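(* Let $n\ge2$, $0<s<1$ and $\lambda\in\mathbb{R}$. Let $\Omega$ be a bounded narrow region in $\Sigma_\lambda$, which is contained in $\{x\mid \lambda-l<x_1<\lambda\}$ with small $l$. Assume that $u\in\mathcal{L}_s(\mathbb{H}^n)\cap C^{1,1}_{loc}(\Omega)$ is lower semi-continuous on $\bar\Omega$ and satisfies $$\begin{cases}(-\Delta_{\mathbb{H}^n})^su+c(x)u\ge0 & \text{in }\Omega,\\ u\ge0 & \text{in }\Sigma_\lambda\setminus\Omega,\\ u(x^\lambda)=-u(x) & \text{in }\Sigma_\lambda.\end{cases}$$ If $c(x)$ is bounded from below in $\Omega$, then $u\ge0$ in $\Omega$. Furthermore, if $u=0$ at some point in $\Omega$, then $u(x)=0$ almost everywhere in $\mathbb{H}^n$.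
   Context: $\mathbb{H}^n$ is the $n$-dimensional hyperbolic space of constant sectional curvature $-1$, with geodesic distance $d$, volume element $d\xi$ and a fixed base point $o$. Use the hyperboloid model $\mathbb{H}^n=\{x=(x_0,x_1,\dots,x_n)\in\mathbb{R}^{n+1}: x_0^2-x_1^2-\dots-x_n^2=1,\ x_0>0\}$, and write $x'=(x_2,\dots,x_n)$. For $t\in\mathbb{R}$ let $A_t$ be the boost $(x_0,x_1,x')\mapsto(x_0\cosh t+x_1\sinh t,\ x_0\sinh t+x_1\cosh t,\ x')$. Set $U=\mathbb{H}^n\cap\{x_1=0\}$, $U_t=A_t(U)$ (these hypersurfaces foliate $\mathbb{H}^n$), and $\Sigma_\lambda=\bigcup_{t<\lambda}U_t$. With $I(x_0,x_1,x')=(x_0,-x_1,x')$, the reflection in $U_\lambda$ is $I_\lambda=A_\lambda\circ I\circ A_{-\lambda}$, and $x^\lambda=I_\lambda(x)$. The fractional Laplacian is defined pointwise by $$(-\Delta_{\mathbb{H}^n})^su(x)=C_{n,s}\,\mathrm{P.V.}\int_{\mathbb{H}^n}(u(x)-u(\xi))\,\mathcal{K}_{n,s}(d(x,\xi))\,d\xi ,$$ where $C_{n,s}>0$ is a normalization constant and the positive kernel $\mathcal{K}_{n,s}$ is, up to a positive multiplicative constant, $$\mathcal{K}_{n,s}(\rho)=\left(-\frac{\partial_\rho}{\sinh\rho}\right)^{\frac{n-1}{2}}\left(\rho^{-\frac{1+2s}{2}}K_{\frac{1+2s}{2}}\left(\tfrac{n-1}{2}\rho\right)\right)\quad(n\ge3\text{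 odd}),$$ $$\mathcal{K}_{n,s}(\rho)=\int_\rho^\infty\frac{\sinh r}{\sqrt{\cosh r-\cosh\rho}}\left(-\frac{\partial_r}{\sinh r}\right)^{\frac n2}\left(r^{-\frac{1+2s}{2}}K_{\frac{1+2s}{2}}\left(\tfrac{n-1}{2}r\right)\right)dr\quad(n\ge2\text{ even}),$$ with $K_\nu$ the modified Bessel function of the second kind. $\mathcal{L}_s(\mathbb{H}^n)$ denotes the set of measurable $u:\mathbb{H}^n\to\mathbb{R}$ with $\int_{\mathbb{H}^n}|u(\xi)|\,\mathcal{K}_{n,s}(1+d(\xi,o))\,d\xi<\infty$. *)

theory Defs
  imports "HOL-Analysis.Analysis"
begin

text \<open>
  A point of \<open>\<real>\<^sup>n\<^sup>+\<^sup>1\<close> is a triple \<open>(x\<^sub>0, x\<^sub>1, x')\<close> with \<open>x' \<in> \<real>\<^sup>n\<^sup>-\<^sup>1\<close> indexed by the finite type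
  \<open>'m\<close>. Thus \<open>n = CARD('m) + 1\<close>, and the condition \<open>n \<ge> 2\<close> holds automatically. Functions on
  hyperbolic space are functions on the ambient type; only their values on \<open>hyperboloid\<close> matter.
  The usual \<open>\<Sigma>\<^sub>\<mu>\<close> is \<open>half_space \<mu>\<close>, and \<open>U\<^sub>t\<close> is \<open>leaf t\<close>.
\<close>

type_synonym 'm pt = "real \<times> real \<times> (real, 'm) vec"

definition hyperboloid :: "'m::finite pt set" where
  "hyperboloid = {(x0, x1, x'). x0\<^sup>2 - x1\<^sup>2 - (norm x')\<^sup>2 = 1 \<and> x0 > 0}"

definition hdist :: "'m::finite pt \<Rightarrow> 'm pt \<Rightarrow> real" where
  "hdist x y = arcosh (fst x * fst y - snd x \<bullet> snd y)"

definition lift :: "real \<times> (real, 'm::finite) vec \<Rightarrow> 'm pt" where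
  "lift y = (sqrt (1 + (norm y)\<^sup>2), y)"

text \<open>
  \<open>lift\<close> is the inverse of the global chart \<open>snd\<close> of the hyperboloid. In this chart the metric
  tensor is \<open>I - y y\<^sup>T / (1 + |y|\<^sup>2)\<close>, whose determinant is \<open>1 / (1 + |y|\<^sup>2)\<close>. The completion makes
  measurability mean Lebesgue measurability.
\<close>

definition hvol :: "'m::finite pt measure" where
  "hvol = completion
     (distr (density lborel (\<lambda>y. ennreal (1 / sqrt (1 + (norm y)\<^sup>2))))
            (restrict_space borel hyperboloid) lift)"

definition boost :: "real \<Rightarrow> 'm::finite pt \<Rightarrow> 'm pt" where
  "boost t = (\<lambda>(x0, x1, x'). (x0 * cosh t + x1 * sinh t, x0 * sinh t + x1 * cosh t, x'))"

definition leaf :: "real \<Rightarrow> 'm::finite pt set" where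
  "leaf t = boost t ` (hyperboloid \<inter> {(x0, x1, x'). x1 = 0})"

definition half_space :: "real \<Rightarrow> 'm::finite pt set" where
  "half_space \<mu> = (\<Union>t\<in>{..<\<mu>}. leaf t)"

definition flip :: "'m::finite pt \<Rightarrow> 'm pt" where
  "flip = (\<lambda>(x0, x1, x'). (x0, - x1, x'))"

definition leaf_refl :: "real \<Rightarrow> 'm::finite pt \<Rightarrow> 'm pt" where
  "leaf_refl \<mu> = boost \<mu> \<circ> flip \<circ> boost (- \<mu>)"

text \<open>Modified Bessel function of the second kind, for \<open>x > 0\<close>, by its classical integral formula.\<close>

definition besselK :: "real \<Rightarrow> real \<Rightarrow> real" where
  "besselK \<nu> x = (LINT t:{0<..}|lborel. exp (- x * cosh t) * cosh (\<nu> * t))"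

definition radial_deriv :: "(real \<Rightarrow> real) \<Rightarrow> real \<Rightarrow> real" where
  "radial_deriv f = (\<lambda>\<rho>. - deriv f \<rho> / sinh \<rho>)"

definition kernel_base :: "nat \<Rightarrow> real \<Rightarrow> real \<Rightarrow> real" where
  "kernel_base n s = (\<lambda>\<rho>. \<rho> powr (- ((1 + 2 * s) / 2))
     * besselK ((1 + 2 * s) / 2) ((real n - 1) / 2 * \<rho>))"

definition hkernel :: "nat \<Rightarrow> real \<Rightarrow> real \<Rightarrow> real" where
  "hkernel n s \<rho> =
    (if odd n then (radial_deriv ^^ ((n - 1) div 2)) (kernel_base n s) \<rho>
     else (LINT r:{\<rho><..}|lborel. sinh r / sqrt (cosh r - cosh \<rho>)
             * (radial_deriv ^^ (n div 2)) (kernel_base n s) r))"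

text \<open>
  The constant \<open>C\<close> is the normalization constant \<open>C\<^sub>n\<^sub>,\<^sub>s\<close> times the positive constant up to which
  the kernel is given. The principal value is the limit of the integrals over the complements of
  geodesic balls around \<open>x\<close>.
\<close>

definition frac_laplacian :: "real \<Rightarrow> real \<Rightarrow> ('m::finite pt \<Rightarrow> real) \<Rightarrow> 'm pt \<Rightarrow> real" where
  "frac_laplacian C s u x = C * Lim (at_right 0)
     (\<lambda>\<epsilon>. LINT \<xi>:{\<xi>\<in>hyperboloid. \<epsilon> \<le> hdist x \<xi>}|hvol.
            (u x - u \<xi>) * hkernel (CARD('m) + 1) s (hdist x \<xi>))"

definition L_space :: "real \<Rightarrow> 'm::finite pt \<Rightarrow> ('m pt \<Rightarrow> real) set" where
  "L_space s p = {u \<in> borel_measurable hvol.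
     integrable hvol (\<lambda>\<xi>. \<bar>u \<xi>\<bar> * hkernel (CARD('m) + 1) s (1 + hdist \<xi> p))}"

definition C11_loc :: "'a::euclidean_space set \<Rightarrow> ('a \<Rightarrow> real) \<Rightarrow> bool" where
  "C11_loc W f \<longleftrightarrow> (\<exists>g. (\<forall>y\<in>W. (f has_derivative (\<lambda>h. g y \<bullet> h)) (at y)) \<and>
     (\<forall>y\<in>W. \<exists>r>0. \<exists>L. L-lipschitz_on (cball y r \<inter> W) g))"

definition hyp_C11_loc :: "'m::finite pt set \<Rightarrow> ('m pt \<Rightarrow> real) \<Rightarrow> bool" where
  "hyp_C11_loc \<Omega> u \<longleftrightarrow> C11_loc (snd ` \<Omega>) (u \<circ> lift)"

definition lsc_on :: "'a::topological_space set \<Rightarrow> ('a \<Rightarrow> real) \<Rightarrow> bool" where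
  "lsc_on S f \<longleftrightarrow> (\<forall>x\<in>S. \<forall>a<f x. \<forall>\<^sub>F y in at x within S. a < f y)"

text \<open>
  The narrowness condition \<open>\<mu> - l < x\<^sub>1 < \<mu>\<close> admits two readings: \<open>x\<^sub>1\<close> may be the ambient
  coordinate, or the parameter \<open>t\<close> of the foliation by the leaves \<open>U\<^sub>t\<close>. They differ, since
  \<open>U\<^sub>\<mu>\<close> is \<open>{x\<^sub>1 = x\<^sub>0 tanh \<mu>}\<close> and not \<open>{x\<^sub>1 = \<mu>}\<close>. A leaf strip becomes arbitrarily thick far
  from the axis of the boosts, so there the smallness of \<open>l\<close> has to depend on the size of the
  region; for a coordinate strip it does not.
\<close>

definition coord_strip :: "real \<Rightarrow> real \<Rightarrow> 'm::finite pt set" where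
  "coord_strip \<mu> l = {(x0, x1, x') \<in> hyperboloid. \<mu> - l < x1 \<and> x1 < \<mu>}"

definition leaf_strip :: "real \<Rightarrow> real \<Rightarrow> 'm::finite pt set" where
  "leaf_strip \<mu> l = (\<Union>t\<in>{\<mu> - l<..<\<mu>}. leaf t)"

end

theory Submission
  imports Defs
begin

text \<open>
  Everything is expressed through the Minkowski product \<open>\<langle>x, \<xi>\<rangle> = cosh d(x, \<xi>)\<close>. As a function of \<open>z = cosh d\<close>
  the kernel \<open>\<kappa>\<close> is positive and strictly decreasing, is comparable to its dilates in \<open>z - 1\<close>, and has order
  \<open>(z - 1) powr - (n / 2 + s)\<close> near \<open>1\<close>; it inherits this from the complete monotonicity of the kernel base
  in \<open>z\<close>. If \<open>\<tau>\<close> is the product with the unit normal of \<open>U\<^sub>\<mu>\<close>, then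
  \<open>\<langle>x, \<xi>\<^sup>\<mu>\<rangle> = \<langle>x, \<xi>\<rangle> + 2 \<tau>(x) \<tau>(\<xi>)\<close>, so \<open>\<kappa>\<close> decreases under reflection and the principal value,
  folded onto \<open>\<Sigma>\<^sub>\<mu>\<close> by antisymmetry, has a nonpositive integrand at a minimum point.

  Let \<open>- m < 0\<close> be the infimum of \<open>u\<close>. If it is attained in \<open>\<Omega>\<close>, the complement of the strip, where
  \<open>u \<ge> 0\<close> up to reflection, pushes the fractional Laplacian below \<open>- m\<close> times a multiple of \<open>l powr - (2 * s)\<close>,
  which contradicts the inequality for small \<open>l\<close>. But \<open>u\<close> is only lower semicontinuous and is unconstrained on
  \<open>U\<^sub>\<mu>\<close>, so the infimum may merely be approached near \<open>U\<^sub>\<mu>\<close>. Then one subtracts a small bump centred at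
  an almost minimal point \<open>y\<close>, of squared radius comparable to \<open>\<tau>(y)\<^sup>2\<close>: the result has a minimum point inside the
  bump, and there the half space beyond \<open>U\<^sub>\<mu>\<close>, of kernel mass at least a multiple of \<open>\<tau>(y) powr - (2 * s)\<close>,
  gives the contradiction. If \<open>u \<ge> 0\<close> vanishes at a point of \<open>\<Omega>\<close>, the folded integrand has a sign and
  a nonnegative integral, hence vanishes almost everywhere.
\<close>

section \<open>Completely monotone functions\<close>

text \<open>Both readings of narrowness become one slab condition: a unit spacelike vector
  \<open>\<omega>\<close> whose product \<open>mink \<omega>\<close> oscillates by less than a fixed
  width on the region. A coordinate vector serves for the coordinate strip. The leaf normal serves
  for the leaf strip, at the price of a bound on \<open>fst x\<close>, and hence of the dependence
  of \<open>l2\<close> on \<open>R\<close>. An isometry that takes the minimum point to the base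
  point turns \<open>mink \<omega>\<close> into an explicit affine function, so that a single
  Euclidean ball bounds the exterior kernel mass from below.

  The bump is no smooth cutoff but the affine function \<open>1 - (mink y \<xi> - 1) / b\<close>. It
  is nonpositive outside its ball, where the lower bound of \<open>u\<close> takes over. Up to an
  additive constant, such a function splits at \<open>x\<close> into a part that is odd under the
  point reflection in \<open>x\<close>, whose truncated integrals vanish, and a multiple of
  \<open>mink x \<xi> - 1\<close>; thus no second derivatives have to be estimated. The same
  splitting shows that the principal value converges at every point of the region.\<close>

fun cmon :: "nat \<Rightarrow> (real \<Rightarrow> real) \<Rightarrow> bool" where
  "cmon 0 f \<longleftrightarrow> (\<forall>z>1. 0 \<le> f z)"
| "cmon (Suc n) f \<longleftrightarrow> (\<forall>z>1. 0 \<le> f z) \<and>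
     (\<exists>g. (\<forall>z>1. (f has_real_derivative - g z) (at z)) \<and> cmon n g)"

lemma cmon_nonneg: "cmon n f \<Longrightarrow> 1 < z \<Longrightarrow> 0 \<le> f z"
  by (cases n) auto

text \<open>The product rule needs it: there an undifferentiated factor of order
  \<open>Suc n\<close> is multiplied by a derivative of order \<open>n\<close>.\<close>

lemma cmon_SucD: "cmon (Suc n) f \<Longrightarrow> cmon n f"
proof (induction n arbitrary: f)
  case (Suc n)
  then obtain g where "\<forall>z>1. (f has_real_derivative - g z) (at z)" "cmon (Suc n) g"
    "\<forall>z>1. 0 \<le> f z" by auto
  with Suc.IH show ?case by auto
qed simp

lemma DERIV_cong_gt1:
  assumes "\<And>z. z > 1 \<Longrightarrow> f z = g z" "z > 1" "(f has_real_derivative d) (at z)"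
  shows "(g has_real_derivative d) (at z)"
  by (rule has_field_derivative_transform_within_open[OF assms(3), of "{1<..}"]) (use assms in auto)

lemma cmon_cong:
  assumes "\<And>z. z > 1 \<Longrightarrow> f z = g z" "cmon n f"
  shows "cmon n g"
proof (cases n)
  case (Suc m)
  then obtain h where h: "\<forall>z>1. (f has_real_derivative - h z) (at z)" "cmon m h"
    using assms(2) by auto
  moreover have "\<forall>z>1. (g has_real_derivative - h z) (at z)"
    using h assms(1) DERIV_cong_gt1 by blast
  ultimately show ?thesis using Suc assms cmon_nonneg[OF assms(2)] by auto
qed (use assms cmon_nonneg[OF assms(2)] in auto)

lemma cmon_const: "0 \<le> c \<Longrightarrow> cmon n (\<lambda>_. c)"
proof (induction n arbitrary: c)
  case (Suc n)
  have "\<forall>z>1. ((\<lambda>_. c) has_real_derivative - (0::real)) (at z)" by auto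
  moreover have "cmon n (\<lambda>_. 0)" by (rule Suc.IH) simp
  ultimately show ?case using Suc.prems by (auto intro!: exI[of _ "\<lambda>_. 0"])
qed simp

lemma cmon_add: "cmon n f \<Longrightarrow> cmon n g \<Longrightarrow> cmon n (\<lambda>z. f z + g z)"
proof (induction n arbitrary: f g)
  case (Suc n)
  then obtain f' g' where *: "\<forall>z>1. (f has_real_derivative - f' z) (at z)" "cmon n f'"
    "\<forall>z>1. (g has_real_derivative - g' z) (at z)" "cmon n g'" by auto
  have "((\<lambda>z. f z + g z) has_real_derivative - (f' z + g' z)) (at z)" if "z > 1" for z
    using * that by (auto intro!: derivative_eq_intros)
  moreover have "cmon n (\<lambda>z. f' z + g' z)" using Suc.IH * by blast
  ultimately show ?case using Suc.prems by (auto intro!: exI[of _ "\<lambda>z. f' z + g' z"])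
qed simp

lemma cmon_mult: "cmon n f \<Longrightarrow> cmon n g \<Longrightarrow> cmon n (\<lambda>z. f z * g z)"
proof (induction n arbitrary: f g)
  case (Suc n)
  then obtain f' g' where *: "\<forall>z>1. (f has_real_derivative - f' z) (at z)" "cmon n f'"
    "\<forall>z>1. (g has_real_derivative - g' z) (at z)" "cmon n g'" by auto
  let ?h = "\<lambda>z. f' z * g z + f z * g' z"
  have "((\<lambda>z. f z * g z) has_real_derivative - ?h z) (at z)" if "z > 1" for z
    using * that by (auto intro!: derivative_eq_intros)
  moreover have "cmon n ?h"
    using Suc.IH * cmon_SucD Suc.prems by (intro cmon_add) blast+
  ultimately show ?case using Suc.prems by (auto intro!: exI[of _ ?h])
qed simp

lemma cmon_cmult: "0 \<le> c \<Longrightarrow> cmon n f \<Longrightarrow> cmon n (\<lambda>z. c * f z)"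
  using cmon_mult[OF cmon_const] .

lemma cmon_powr_shift:
  assumes "b \<le> 1"
  shows "0 \<le> a \<Longrightarrow> cmon n (\<lambda>z. (z - b) powr - a)"
proof (induction n arbitrary: a)
  case (Suc n)
  have "((\<lambda>z. (z - b) powr - a) has_real_derivative - (a * (z - b) powr - (a + 1))) (at z)"
    if "z > 1" for z
    using that assms by (auto intro!: derivative_eq_intros simp: minus_diff_commute)
  moreover have "cmon n (\<lambda>z. a * (z - b) powr - (a + 1))"
    by (intro cmon_cmult Suc) (use Suc.prems in auto)
  ultimately show ?case by (auto intro!: exI[of _ "\<lambda>z. a * (z - b) powr - (a + 1)"])
qed simp

text \<open>\<open>z\<^sup>2 - 1\<close> factors into \<open>z - 1\<close> and \<open>z + 1\<close>,
  and each inverse square root is completely monotone. Being the derivative of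
  \<open>arcosh\<close>, this factor appears with every differentiation in the variable
  \<open>z\<close>.\<close>

lemma cmon_arcosh_deriv: "cmon n (\<lambda>z. 1 / sqrt (z\<^sup>2 - 1))"
proof (rule cmon_cong)
  show "cmon n (\<lambda>z. (z - 1) powr - (1/2) * (z - (-1)) powr - (1/2))"
    by (intro cmon_mult cmon_powr_shift) auto
  fix z :: real assume z: "z > 1"
  have "z\<^sup>2 - 1 = (z - 1) * (z - (-1))" by (simp add: algebra_simps power2_eq_square)
  then show "(z - 1) powr - (1/2) * (z - (-1)) powr - (1/2) = 1 / sqrt (z\<^sup>2 - 1)"
    using z by (simp add: powr_minus powr_half_sqrt real_sqrt_mult divide_simps)
qed

lemma DERIV_arcosh': "1 < z \<Longrightarrow> (arcosh has_real_derivative 1 / sqrt (z\<^sup>2 - 1)) (at z)"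
  by (auto intro!: derivative_eq_intros)

lemma cmon_arcosh_powr: "0 \<le> a \<Longrightarrow> cmon n (\<lambda>z. arcosh z powr - a)"
proof (induction n arbitrary: a)
  case (Suc n)
  let ?g = "\<lambda>z. a * (arcosh z powr - (a + 1) * (1 / sqrt (z\<^sup>2 - 1)))"
  have "((\<lambda>z. arcosh z powr - a) has_real_derivative - ?g z) (at z)" if "z > 1" for z
    using that by (auto intro!: derivative_eq_intros DERIV_arcosh' simp: minus_diff_commute)
  moreover have "cmon n ?g"
    by (intro cmon_cmult cmon_mult cmon_arcosh_deriv Suc) (use Suc.prems in auto)
  ultimately show ?case by (auto intro!: exI[of _ ?g])
qed simp

text \<open>The sign keeps the iterates on a completely monotone function nonnegative, and
  \<open>deriv\<close> selects the witness that \<open>cmon\<close> only asserts to exist.\<close>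

definition nderiv :: "(real \<Rightarrow> real) \<Rightarrow> real \<Rightarrow> real" where
  "nderiv f = (\<lambda>z. - deriv f z)"

lemma cmon_DERIV: "cmon (Suc n) f \<Longrightarrow> 1 < z \<Longrightarrow> (f has_real_derivative - nderiv f z) (at z)"
  unfolding nderiv_def cmon.simps using DERIV_imp_deriv by fastforce

lemma cmon_nderiv:
  assumes "cmon (Suc n) f"
  shows "cmon n (nderiv f)"
proof -
  obtain g where g: "\<forall>z>1. (f has_real_derivative - g z) (at z)" "cmon n g"
    using assms by auto
  have "g z = nderiv f z" if "z > 1" for z
    unfolding nderiv_def using DERIV_imp_deriv[OF g(1)[rule_format, OF that]] by simp
  from cmon_cong[OF this g(2)] show ?thesis .
qed

lemma cmon_antimono:
  assumes "cmon (Suc n) f" "1 < y" "y \<le> z"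
  shows "f z \<le> f y"
proof (rule DERIV_nonpos_imp_nonincreasing[OF assms(3)])
  fix x assume "y \<le> x" "x \<le> z"
  then have "x > 1" using assms by simp
  then show "\<exists>d. (f has_real_derivative d) (at x) \<and> d \<le> 0"
    using cmon_DERIV[OF assms(1)] cmon_nonneg[OF cmon_nderiv[OF assms(1)]]
    by (meson neg_le_0_iff_le)
qed

text \<open>By the mean value theorem the difference is the length times \<open>nderiv f\<close> at
  an intermediate point, and \<open>nderiv f\<close> is itself decreasing.\<close>

lemma cmon_diff_bounds:
  assumes "cmon (Suc (Suc n)) f" "1 < y" "y < z"
  shows "(z - y) * nderiv f z \<le> f y - f z" "f y - f z \<le> (z - y) * nderiv f y"
proof -
  obtain x where x: "y < x" "x < z" "f z - f y = (z - y) * (- nderiv f x)"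
    using MVT2[OF assms(3), of f "\<lambda>x. - nderiv f x"] cmon_DERIV[OF assms(1)] assms by force
  have "nderiv f z \<le> nderiv f x" "nderiv f x \<le> nderiv f y"
    using x assms cmon_antimono[OF cmon_nderiv[OF assms(1)]] by auto
  moreover have "f y - f z = (z - y) * nderiv f x" using x(3) by (simp add: algebra_simps)
  ultimately show "(z - y) * nderiv f z \<le> f y - f z" "f y - f z \<le> (z - y) * nderiv f y"
    using assms by (auto intro!: mult_left_mono)
qed

text \<open>Both scaling conditions are uniform in \<open>w \<in> (0, \<infinity>)\<close>, so they govern the behaviour at
  \<open>1\<close> and at \<open>\<infinity>\<close> at the same time.\<close>

definition scaling_regular :: "(real \<Rightarrow> real) \<Rightarrow> bool" where
  "scaling_regular f \<longleftrightarrow> (\<forall>n. cmon n f) \<and> (\<forall>z>1. 0 < f z) \<and>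
     (\<exists>N>1. \<forall>w>0. f (1 + N * w) \<le> f (1 + w) / 2) \<and>
     (\<exists>C>0. \<forall>w>0. f (1 + w) \<le> C * f (1 + 2 * w))"

text \<open>Since \<open>f\<close> is convex, losing half of its value over a length
  \<open>(N - 1) * w\<close> forces a slope of that order at the left end. Conversely, doubling
  limits the loss between \<open>1 + w / 2\<close> and \<open>1 + w\<close>, and with it the slope
  at the right end.\<close>

lemma nderiv_comparable:
  assumes "scaling_regular f"
  obtains c C where "0 < c" "0 < C"
    "\<And>w. 0 < w \<Longrightarrow> c * (f (1 + w) / w) \<le> nderiv f (1 + w)"
    "\<And>w. 0 < w \<Longrightarrow> nderiv f (1 + w) \<le> C * (f (1 + w) / w)"
proof -
  obtain N C where cm: "\<And>n. cmon n f" and N: "N > 1" "\<And>w. w > 0 \<Longrightarrow> f (1 + N * w) \<le> f (1 + w) / 2"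
    and C: "C > 0" "\<And>w. w > 0 \<Longrightarrow> f (1 + w) \<le> C * f (1 + 2 * w)"
    using assms unfolding scaling_regular_def by blast
  have "1 / (2 * (N - 1)) * (f (1 + w) / w) \<le> nderiv f (1 + w)" if "w > 0" for w
  proof -
    have "w < N * w" using N that by simp
    then have "f (1 + w) - f (1 + N * w) \<le> (N * w - w) * nderiv f (1 + w)"
      using cmon_diff_bounds(2)[OF cm, of "1 + w" "1 + N * w"] that by simp
    with N(2)[OF that] have "f (1 + w) / 2 \<le> ((N - 1) * w) * nderiv f (1 + w)"
      by (simp add: algebra_simps)
    moreover have "(N - 1) * w > 0" using N that by simp
    ultimately have "f (1 + w) / 2 / ((N - 1) * w) \<le> nderiv f (1 + w)"
      by (subst pos_divide_le_eq) (auto simp: mult.commute)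
    then show ?thesis by (simp add: field_simps)
  qed
  moreover have "nderiv f (1 + w) \<le> 2 * C * (f (1 + w) / w)" if "w > 0" for w
  proof -
    have "(w / 2) * nderiv f (1 + w) \<le> f (1 + w / 2) - f (1 + w)"
      using cmon_diff_bounds(1)[OF cm, of "1 + w / 2" "1 + w"] that by simp
    also have "\<dots> \<le> C * f (1 + w)"
      using C(2)[of "w / 2"] that cmon_nonneg[OF cm, of "1 + w"] by simp
    finally show ?thesis using that by (simp add: field_simps)
  qed
  ultimately show ?thesis using N C that[of "1 / (2 * (N - 1))" "2 * C"] by simp
qed

lemma scaling_regular_nderiv:
  assumes "scaling_regular f"
  shows "scaling_regular (nderiv f)"
proof -
  obtain N0 C0 where cm: "\<And>n. cmon n f" and pos: "\<And>z. z > 1 \<Longrightarrow> 0 < f z"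
    and N0: "N0 > 1" "\<And>w. w > 0 \<Longrightarrow> f (1 + N0 * w) \<le> f (1 + w) / 2"
    and C0: "C0 > 0" "\<And>w. w > 0 \<Longrightarrow> f (1 + w) \<le> C0 * f (1 + 2 * w)"
    using assms unfolding scaling_regular_def by blast
  obtain c C where c: "0 < c" "\<And>w. 0 < w \<Longrightarrow> c * (f (1 + w) / w) \<le> nderiv f (1 + w)"
    and C: "0 < C" "\<And>w. 0 < w \<Longrightarrow> nderiv f (1 + w) \<le> C * (f (1 + w) / w)"
    using nderiv_comparable[OF assms] by metis
  \<comment> \<open>The decay comes from the denominator \<open>w\<close> alone, and of
    \<open>f\<close> only monotonicity is used: \<open>C / N\<close> has to fall below
    \<open>c / 2\<close>.\<close>
  define N where "N = max 2 (2 * C / c)"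
  have "nderiv f (1 + N * w) \<le> nderiv f (1 + w) / 2" if "w > 0" for w
  proof -
    have Nw: "N * w > 0" "N * w \<ge> w" "N > 0" using that unfolding N_def by (auto simp: mult_le_cancel_right1)
    have "nderiv f (1 + N * w) \<le> C * (f (1 + N * w) / (N * w))" using C Nw by blast
    also have "\<dots> \<le> C * (f (1 + w) / (N * w))"
      using cmon_antimono[OF cm, of "1 + w" "1 + N * w"] Nw that C
      by (intro mult_left_mono divide_right_mono) auto
    also have "\<dots> = C / N * (f (1 + w) / w)" by simp
    also have "\<dots> \<le> (c / 2) * (f (1 + w) / w)"
    proof (rule mult_right_mono)
      have "2 * C / c \<le> N" unfolding N_def by simp
      then show "C / N \<le> c / 2" using Nw c by (simp add: field_simps)
    qed (use pos[of "1 + w"] that in auto)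
    also have "\<dots> \<le> nderiv f (1 + w) / 2" using c(2)[OF that] by simp
    finally show ?thesis .
  qed
  moreover have "nderiv f (1 + w) \<le> (2 * C * C0 / c) * nderiv f (1 + 2 * w)" if "w > 0" for w
  proof -
    have "nderiv f (1 + w) \<le> C * (f (1 + w) / w)" using C that by blast
    also have "\<dots> \<le> C * (C0 * f (1 + 2 * w) / w)"
      using C C0 that by (intro mult_left_mono divide_right_mono) auto
    also have "\<dots> = (2 * C * C0 / c) * (c * (f (1 + 2 * w) / (2 * w)))" using c that by (simp add: field_simps)
    also have "\<dots> \<le> (2 * C * C0 / c) * nderiv f (1 + 2 * w)"
      using c(2)[of "2 * w"] that C C0 c by (intro mult_left_mono) auto
    finally show ?thesis .
  qed
  moreover have "0 < nderiv f z" if "z > 1" for z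
    using c(2)[of "z - 1"] c(1) pos[OF that] that
    by (smt (verit, best) divide_pos_pos mult_pos_pos)
  moreover have "cmon n (nderiv f)" for n using cmon_nderiv[OF cm] .
  moreover have "N > 1" "2 * C * C0 / c > 0" unfolding N_def using c C C0 by auto
  ultimately show ?thesis unfolding scaling_regular_def by blast
qed

lemma nderiv_iterate_comparable:
  assumes "scaling_regular f"
  shows "scaling_regular ((nderiv ^^ k) f) \<and> (\<exists>c>0. \<exists>C>0. \<forall>w>0.
    c * (f (1 + w) / w ^ k) \<le> (nderiv ^^ k) f (1 + w) \<and>
    (nderiv ^^ k) f (1 + w) \<le> C * (f (1 + w) / w ^ k))"
proof (induction k)
  case 0
  show ?case using assms by (auto intro!: exI[of _ 1])
next
  case (Suc k)
  let ?g = "(nderiv ^^ k) f"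
  obtain c C where g: "scaling_regular ?g" "c > 0" "C > 0"
    "\<And>w. w > 0 \<Longrightarrow> c * (f (1 + w) / w ^ k) \<le> ?g (1 + w)"
    "\<And>w. w > 0 \<Longrightarrow> ?g (1 + w) \<le> C * (f (1 + w) / w ^ k)" using Suc by blast
  obtain c' C' where c': "0 < c'" "\<And>w. 0 < w \<Longrightarrow> c' * (?g (1 + w) / w) \<le> nderiv ?g (1 + w)"
    and C': "0 < C'" "\<And>w. 0 < w \<Longrightarrow> nderiv ?g (1 + w) \<le> C' * (?g (1 + w) / w)"
    using nderiv_comparable[OF g(1)] by metis
  have "c' * c * (f (1 + w) / w ^ Suc k) \<le> nderiv ?g (1 + w)" if "w > 0" for w
  proof -
    have "c' * c * (f (1 + w) / w ^ Suc k) = c' * (c * (f (1 + w) / w ^ k) / w)" using that by (simp add: field_simps)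
    also have "\<dots> \<le> c' * (?g (1 + w) / w)"
      using g that c' by (intro mult_left_mono divide_right_mono) auto
    finally show ?thesis using c'(2)[OF that] by simp
  qed
  moreover have "nderiv ?g (1 + w) \<le> C' * C * (f (1 + w) / w ^ Suc k)" if "w > 0" for w
  proof -
    have "C' * (?g (1 + w) / w) \<le> C' * (C * (f (1 + w) / w ^ k) / w)"
      using g that C' by (intro mult_left_mono divide_right_mono) auto
    also have "\<dots> = C' * C * (f (1 + w) / w ^ Suc k)" using that by (simp add: field_simps)
    finally show ?thesis using C'(2)[OF that] by linarith
  qed
  moreover have "c' * c > 0" "C' * C > 0" using g c' C' by auto
  ultimately show ?case using scaling_regular_nderiv[OF g(1)] unfolding funpow.simps o_def by blast
qed

section \<open>Modified Bessel functions\<close>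

lemma set_integrable_exp_minus:
  fixes a :: real
  assumes "a > 0"
  shows "set_integrable lborel {0..} (\<lambda>t. exp (- a * t))"
    and "(LINT t:{0..}|lborel. exp (- a * t)) = 1 / a"
proof -
  have "((\<lambda>t. exp (- a * t)) has_integral 1 / a) {0..}"
    using has_integral_exp_minus_to_infinity[OF assms, of 0] by simp
  then have "(\<integral>\<^sup>+ t. ennreal (indicator {0..} t * exp (- a * t)) \<partial>lborel) = ennreal (1 / a)"
    by (intro nn_integral_has_integral_lebesgue) auto
  then have "has_bochner_integral lborel (\<lambda>t. indicator {0..} t * exp (- a * t)) (1 / a)"
    by (intro has_bochner_integral_nn_integral) (use assms in auto)
  then show "set_integrable lborel {0..} (\<lambda>t. exp (- a * t))"
    "(LINT t:{0..}|lborel. exp (- a * t)) = 1 / a"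
    by (auto simp: set_integrable_def set_lebesgue_integral_def has_bochner_integral_iff)
qed

lemma power_le_fact_exp: "0 \<le> y \<Longrightarrow> y ^ N \<le> fact N * exp (y::real)"
proof -
  assume y: "0 \<le> y"
  obtain t where t: "exp y = (\<Sum>m<Suc N. y ^ m / fact m) + exp t / fact (Suc N) * y ^ Suc N"
    using Maclaurin_exp_le by blast
  have "y ^ N / fact N \<le> (\<Sum>m<Suc N. y ^ m / fact m)"
    using y by (simp add: sum_nonneg)
  also have "\<dots> \<le> exp y" unfolding t using y by simp
  finally show ?thesis by (simp add: field_simps)
qed

lemma exp_second_order: "\<bar>exp y - 1 - y\<bar> \<le> y\<^sup>2 * exp \<bar>y::real\<bar>"
proof -
  obtain t where t: "\<bar>t\<bar> \<le> \<bar>y\<bar>" "exp y = (\<Sum>m<2. y ^ m / fact m) + exp t / fact 2 * y ^ 2"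
    using Maclaurin_exp_le by blast
  have "\<bar>exp y - 1 - y\<bar> = y\<^sup>2 * (exp t / 2)"
    using t(2) by (simp add: numeral_2_eq_2)
  also have "\<dots> \<le> y\<^sup>2 * exp \<bar>y\<bar>"
  proof (rule mult_left_mono)
    have "exp t \<le> exp \<bar>y\<bar>" using t(1) by simp
    then show "exp t / 2 \<le> exp \<bar>y\<bar>" using exp_ge_zero[of t] by linarith
  qed simp
  finally show ?thesis .
qed

lemma cosh_le_exp_abs: "cosh (y::real) \<le> exp \<bar>y\<bar>"
  by (simp add: cosh_def abs_if)

lemma exp_half_le_cosh: "exp y / 2 \<le> cosh (y::real)"
  by (simp add: cosh_def)

lemma exp_exp_decay:
  fixes x c :: real
  assumes "x > 0"
  obtains C where "C > 0" "\<And>t. t \<ge> 0 \<Longrightarrow> exp (- x * exp t) * exp (c * t) \<le> C * exp (- t)"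
proof
  \<comment> \<open>\<open>N\<close> exceeds \<open>c\<close> by at least one, so the
    \<open>N\<close>-th power of \<open>exp t\<close> dominates both \<open>exp (c * t)\<close> and
    the additional \<open>exp t\<close> that produces the decay on the right. The double exponential
    absorbs this power at the cost of \<open>fact N\<close>.\<close>
  define N where "N = nat \<lceil>c + 1\<rceil>"
  show "fact N / x ^ N > 0" using assms by simp
  fix t :: real assume t: "t \<ge> 0"
  have N: "c + 1 \<le> real N" unfolding N_def by (rule real_nat_ceiling_ge)
  have "exp (c * t) * exp t = exp ((c + 1) * t)" by (simp add: exp_add[symmetric] algebra_simps)
  also have "\<dots> \<le> exp (real N * t)"
    using t N by (simp add: mult_right_mono)
  also have "\<dots> = (x * exp t) ^ N / x ^ N"
    using assms by (simp add: power_mult_distrib exp_of_nat_mult)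
  also have "\<dots> \<le> fact N * exp (x * exp t) / x ^ N"
    using assms by (intro divide_right_mono power_le_fact_exp) auto
  finally have *: "exp (c * t) * exp t \<le> fact N / x ^ N * exp (x * exp t)" by simp
  have "exp (- x * exp t) * exp (c * t) = exp (- x * exp t) * exp (- t) * (exp (c * t) * exp t)"
    by (simp add: exp_minus field_simps)
  also have "\<dots> \<le> exp (- x * exp t) * exp (- t) * (fact N / x ^ N * exp (x * exp t))"
    using * by (intro mult_left_mono) auto
  also have "\<dots> = fact N / x ^ N * exp (- t)" by (simp add: exp_minus field_simps)
  finally show "exp (- x * exp t) * exp (c * t) \<le> fact N / x ^ N * exp (- t)" .
qed

text \<open>The exponent \<open>j\<close> counts differentiations in \<open>x\<close>: each brings
  down a factor \<open>- cosh t\<close>, so for \<open>x > 0\<close> the function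
  \<open>bessel_moment \<nu> j\<close> is the \<open>j\<close>-th derivative of
  \<open>besselK \<nu>\<close> up to the sign \<open>(-1)^j\<close>.\<close>

definition bessel_kern :: "real \<Rightarrow> nat \<Rightarrow> real \<Rightarrow> real \<Rightarrow> real" where
  "bessel_kern \<nu> j x t = cosh t ^ j * (exp (- x * cosh t) * cosh (\<nu> * t))"

definition bessel_moment :: "real \<Rightarrow> nat \<Rightarrow> real \<Rightarrow> real" where
  "bessel_moment \<nu> j x = (LINT t:{0<..}|lborel. bessel_kern \<nu> j x t)"

lemma besselK_eq_moment: "besselK \<nu> = bessel_moment \<nu> 0"
  by (simp add: besselK_def bessel_moment_def bessel_kern_def fun_eq_iff)

lemma bessel_kern_measurable [measurable]: "bessel_kern \<nu> j x \<in> borel_measurable borel"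
  unfolding bessel_kern_def by (intro borel_measurable_continuous_onI continuous_intros)

lemma bessel_kern_nonneg: "0 \<le> bessel_kern \<nu> j x t"
  by (simp add: bessel_kern_def)

lemma bessel_kern_bound:
  assumes "x > 0"
  obtains C where "C > 0" "\<And>t. t \<ge> 0 \<Longrightarrow> bessel_kern \<nu> j x t \<le> C * exp (- t)"
proof -
  obtain C where C: "C > 0"
    "\<And>t. t \<ge> 0 \<Longrightarrow> exp (- (x/2) * exp t) * exp ((real j + \<bar>\<nu>\<bar>) * t) \<le> C * exp (- t)"
    using exp_exp_decay[of "x / 2"] assms by (metis half_gt_zero)
  have "bessel_kern \<nu> j x t \<le> C * exp (- t)" if "t \<ge> 0" for t
  proof -
    have "bessel_kern \<nu> j x t \<le> exp t ^ j * (exp (- x * (exp t / 2)) * exp \<bar>\<nu> * t\<bar>)"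
      unfolding bessel_kern_def
      using cosh_le_exp_abs[of t] that assms exp_half_le_cosh[of t]
      by (intro mult_mono power_mono cosh_le_exp_abs) auto
    also have "\<dots> = exp (- (x/2) * exp t) * exp ((real j + \<bar>\<nu>\<bar>) * t)"
      using that by (simp add: exp_of_nat_mult[symmetric] exp_add[symmetric] abs_mult algebra_simps)
    finally show ?thesis using C(2)[OF that] by simp
  qed
  with C(1) show ?thesis using that by blast
qed

lemma set_integrable_bessel_kern:
  assumes "x > 0"
  shows "set_integrable lborel {0<..} (bessel_kern \<nu> j x)"
proof -
  obtain C where C: "C > 0" "\<And>t. t \<ge> 0 \<Longrightarrow> bessel_kern \<nu> j x t \<le> C * exp (- t)"
    using bessel_kern_bound[OF assms] by metis
  have "set_integrable lborel {0<..} (\<lambda>t::real. C * exp (- 1 * t))"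
    by (intro set_integrable_mult_right set_integrable_subset[OF set_integrable_exp_minus(1)]) auto
  then show ?thesis
    by (rule set_integrable_bound)
       (use C bessel_kern_nonneg[of \<nu> j x] in \<open>auto simp: set_borel_measurable_def\<close>)
qed

lemma bessel_moment_nonneg: "0 \<le> bessel_moment \<nu> j x"
  unfolding bessel_moment_def set_lebesgue_integral_def
  by (intro integral_nonneg_AE) (auto simp: bessel_kern_nonneg)

lemma set_integral_subset_le:
  fixes f :: "'a \<Rightarrow> real"
  assumes "set_integrable M B f" "A \<in> sets M" "A \<subseteq> B" "\<And>x. x \<in> B \<Longrightarrow> 0 \<le> f x"
  shows "(LINT x:A|M. f x) \<le> (LINT x:B|M. f x)"
  unfolding set_lebesgue_integral_def
proof (rule integral_mono)
  show "integrable M (\<lambda>x. indicator A x *\<^sub>R f x)"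
    using set_integrable_subset[OF assms(1-3)] by (simp add: set_integrable_def)
  show "integrable M (\<lambda>x. indicator B x *\<^sub>R f x)"
    using assms(1) by (simp add: set_integrable_def)
  show "indicator A x *\<^sub>R f x \<le> indicator B x *\<^sub>R f x" for x
    using assms(3,4) by (auto simp: indicator_def)
qed

lemma bessel_moment_subset:
  assumes "x > 0" "A \<subseteq> {0<..}" "A \<in> sets borel"
  shows "(LINT t:A|lborel. bessel_kern \<nu> j x t) \<le> bessel_moment \<nu> j x"
  unfolding bessel_moment_def
  by (rule set_integral_subset_le[OF set_integrable_bessel_kern[OF assms(1)]])
     (use assms in \<open>auto simp: bessel_kern_nonneg\<close>)

text \<open>Differentiation under the integral sign with an explicit remainder. The Taylor remainder
  of the exponential carries \<open>exp (\<bar>h\<bar> * cosh t)\<close>, and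
  \<open>\<bar>h\<bar> \<le> x / 2\<close> leaves half of the decay of
  \<open>exp (- x * cosh t)\<close>.\<close>

lemma bessel_moment_quadratic:
  assumes x: "x > 0" and h: "\<bar>h\<bar> \<le> x / 2"
  shows "\<bar>bessel_moment \<nu> j (x + h) - bessel_moment \<nu> j x + h * bessel_moment \<nu> (Suc j) x\<bar>
    \<le> h\<^sup>2 * bessel_moment \<nu> (j + 2) (x / 2)"
proof -
  note I = set_integrable_bessel_kern
  have xh: "x + h > 0" "x / 2 > 0" using assms by (auto simp: abs_if split: if_splits)
  let ?d = "\<lambda>t. bessel_kern \<nu> j (x + h) t - bessel_kern \<nu> j x t + h * bessel_kern \<nu> (Suc j) x t"
  have "bessel_moment \<nu> j (x + h) - bessel_moment \<nu> j x + h * bessel_moment \<nu> (Suc j) x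
      = (LINT t:{0<..}|lborel. ?d t)"
    unfolding bessel_moment_def
    by (simp add: I x xh set_integral_add set_integral_diff)
  moreover have "\<bar>LINT t:{0<..}|lborel. ?d t\<bar> \<le> (LINT t:{0<..}|lborel. \<bar>?d t\<bar>)"
    using set_integral_norm_bound[of lborel "{0<..}" ?d] I x xh
    by (auto intro!: set_integral_add set_integral_diff)
  moreover have "(LINT t:{0<..}|lborel. \<bar>?d t\<bar>) \<le> (LINT t:{0<..}|lborel. h\<^sup>2 * bessel_kern \<nu> (j + 2) (x / 2) t)"
  proof (rule set_integral_mono)
    fix t :: real
    let ?c = "cosh t"
    have "?d t = (?c ^ j * cosh (\<nu> * t) * exp (- x * ?c)) * (exp (- h * ?c) - 1 - (- h * ?c))"
      by (simp add: bessel_kern_def exp_add[symmetric] algebra_simps)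
    then have "\<bar>?d t\<bar> = (?c ^ j * cosh (\<nu> * t) * exp (- x * ?c)) * \<bar>exp (- h * ?c) - 1 - (- h * ?c)\<bar>"
      by (simp add: abs_mult)
    also have "\<dots> \<le> (?c ^ j * cosh (\<nu> * t) * exp (- x * ?c)) * ((- h * ?c)\<^sup>2 * exp \<bar>- h * ?c\<bar>)"
      by (intro mult_left_mono exp_second_order) auto
    also have "\<dots> \<le> (?c ^ j * cosh (\<nu> * t) * exp (- x * ?c)) * ((- h * ?c)\<^sup>2 * exp (x / 2 * ?c))"
      using h by (intro mult_left_mono) (auto simp: abs_mult intro!: mult_right_mono)
    also have "\<dots> = h\<^sup>2 * (?c ^ (j + 2) * cosh (\<nu> * t) * (exp (- x * ?c) * exp (x / 2 * ?c)))"
      by (simp add: power2_eq_square algebra_simps)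
    also have "exp (- x * ?c) * exp (x / 2 * ?c) = exp (- (x/2) * ?c)"
      by (simp add: exp_add[symmetric] algebra_simps)
    finally show "\<bar>?d t\<bar> \<le> h\<^sup>2 * bessel_kern \<nu> (j + 2) (x / 2) t"
      by (simp add: bessel_kern_def mult_ac)
  qed (use I x xh in \<open>auto intro!: set_integrable_abs set_integral_add set_integral_diff\<close>)
  moreover have "(LINT t:{0<..}|lborel. h\<^sup>2 * bessel_kern \<nu> (j + 2) (x / 2) t) = h\<^sup>2 * bessel_moment \<nu> (j + 2) (x / 2)"
    by (simp add: bessel_moment_def)
  ultimately show ?thesis by linarith
qed

lemma DERIV_bessel_moment:
  assumes "x > 0"
  shows "(bessel_moment \<nu> j has_real_derivative - bessel_moment \<nu> (Suc j) x) (at x)"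
proof -
  let ?f = "bessel_moment \<nu> j" and ?M = "bessel_moment \<nu> (j + 2) (x / 2)"
    and ?D = "- bessel_moment \<nu> (Suc j) x"
  have "eventually (\<lambda>h. norm ((?f (x + h) - ?f x) / h - ?D) \<le> \<bar>h\<bar> * ?M) (at 0)"
    unfolding eventually_at
  proof (intro exI[of _ "x / 2"] conjI ballI impI)
    fix h :: real assume h: "h \<noteq> 0 \<and> dist h 0 < x / 2"
    have "\<bar>(?f (x + h) - ?f x) - h * ?D\<bar> \<le> h\<^sup>2 * ?M"
      using bessel_moment_quadratic[OF assms, of h \<nu> j] h by simp
    moreover have "(?f (x + h) - ?f x) / h - ?D = ((?f (x + h) - ?f x) - h * ?D) / h"
      using h by (simp add: field_simps)
    ultimately show "norm ((?f (x + h) - ?f x) / h - ?D) \<le> \<bar>h\<bar> * ?M"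
      using h by (simp add: divide_le_eq power2_eq_square abs_mult mult_ac)
  qed (use assms in auto)
  moreover have "((\<lambda>h. \<bar>h\<bar> * ?M) \<longlongrightarrow> 0) (at (0::real))"
    by (auto intro!: tendsto_eq_intros)
  ultimately have "((\<lambda>h. (?f (x + h) - ?f x) / h - ?D) \<longlongrightarrow> 0) (at 0)"
    by (rule Lim_null_comparison)
  then show ?thesis unfolding DERIV_def by (rule LIM_zero_cancel)
qed

text \<open>As \<open>cosh t \<ge> 1\<close>, an increase of the argument gains a full exponential
  factor. This supplies the decay of the kernel base at large distance, where powers of the distance
  vary too slowly.\<close>

lemma bessel_moment_antimono_exp:
  assumes "0 < x" "x \<le> y"
  shows "bessel_moment \<nu> j y \<le> exp (- (y - x)) * bessel_moment \<nu> j x"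
proof -
  have "bessel_moment \<nu> j y \<le> (LINT t:{0<..}|lborel. exp (- (y - x)) * bessel_kern \<nu> j x t)"
    unfolding bessel_moment_def
  proof (rule set_integral_mono)
    fix t :: real
    have "(y - x) * 1 \<le> (y - x) * cosh t" using assms by (intro mult_left_mono cosh_real_ge_1) auto
    then have "exp (- y * cosh t) \<le> exp (- (y - x)) * exp (- x * cosh t)"
      by (simp add: exp_add[symmetric] algebra_simps)
    then have "cosh t ^ j * (exp (- y * cosh t) * cosh (\<nu> * t))
      \<le> cosh t ^ j * ((exp (- (y - x)) * exp (- x * cosh t)) * cosh (\<nu> * t))"
      by (intro mult_left_mono mult_right_mono) auto
    then show "bessel_kern \<nu> j y t \<le> exp (- (y - x)) * bessel_kern \<nu> j x t"
      by (simp add: bessel_kern_def mult_ac)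
  qed (use assms in \<open>auto intro!: set_integrable_bessel_kern\<close>)
  then show ?thesis by (simp add: bessel_moment_def)
qed

lemma bessel_moment_antimono:
  assumes "0 < x" "x \<le> y"
  shows "bessel_moment \<nu> j y \<le> bessel_moment \<nu> j x"
proof -
  have "exp (- (y - x)) * bessel_moment \<nu> j x \<le> 1 * bessel_moment \<nu> j x"
    using assms by (intro mult_right_mono bessel_moment_nonneg) auto
  then show ?thesis using bessel_moment_antimono_exp[OF assms, of \<nu> j] by linarith
qed

lemma bessel_moment_unit_lower:
  assumes "0 < x"
  shows "exp (- x * cosh 1) \<le> (LINT t:{0<..1}|lborel. bessel_kern \<nu> 0 x t)"
proof -
  have "(LINT t:{0<..1::real}|lborel. exp (- x * cosh 1)) \<le> (LINT t:{0<..1}|lborel. bessel_kern \<nu> 0 x t)"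
  proof (rule set_integral_mono)
    fix t :: real assume t: "t \<in> {0<..1}"
    have "cosh t \<le> cosh 1" using t by (simp add: cosh_real_nonneg_le_iff)
    then have "exp (- x * cosh 1) * 1 \<le> exp (- x * cosh t) * cosh (\<nu> * t)"
      using assms by (intro mult_mono) (auto simp: cosh_real_ge_1)
    then show "exp (- x * cosh 1) \<le> bessel_kern \<nu> 0 x t" by (simp add: bessel_kern_def)
  next
    show "set_integrable lborel {0<..1} (bessel_kern \<nu> 0 x)"
      by (rule set_integrable_subset[OF set_integrable_bessel_kern[OF assms]]) auto
  qed (simp add: set_integrable_def)
  then show ?thesis by (simp add: set_lebesgue_integral_def)
qed

lemma besselK_pos: "0 < x \<Longrightarrow> 0 < besselK \<nu> x"
proof -
  assume x: "0 < x"
  have "0 < exp (- x * cosh 1)" by simp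
  also have "\<dots> \<le> (LINT t:{0<..1}|lborel. bessel_kern \<nu> 0 x t)" by (rule bessel_moment_unit_lower[OF x])
  also have "\<dots> \<le> besselK \<nu> x"
    unfolding besselK_eq_moment by (rule bessel_moment_subset[OF x]) auto
  finally show ?thesis .
qed

text \<open>The shift changes the integrand by \<open>exp (b * cosh t)\<close>, which is unbounded
  in \<open>t\<close>; hence the split at \<open>t = 1\<close>. The part beyond is at most
  \<open>M * exp (- x * cosh 1)\<close>, thus at most \<open>M\<close> times the part up to
  \<open>1\<close>, where the shift costs no more than \<open>exp (b * cosh 1)\<close>.\<close>

lemma besselK_shift:
  assumes "x0 > 0" "b \<ge> 0"
  obtains C where "C > 0" "\<And>x. x \<ge> x0 \<Longrightarrow> besselK \<nu> x \<le> C * besselK \<nu> (x + b)"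
proof -
  let ?c = "cosh (1::real)"
  define M where "M = besselK \<nu> x0 * exp (x0 * ?c)"
  have M: "M > 0" unfolding M_def using besselK_pos[OF assms(1)] by simp
  have "besselK \<nu> x \<le> (1 + M) * exp (b * ?c) * besselK \<nu> (x + b)" if x: "x \<ge> x0" for x
  proof -
  have x': "x > 0" using x assms by simp
  note I = set_integrable_bessel_kern[OF x', of \<nu> 0]
  let ?U = "LINT t:{0<..1}|lborel. bessel_kern \<nu> 0 x t"
  have split: "{0<..} = {0<..1} \<union> {1::real<..}" by auto
  have "besselK \<nu> x = ?U + (LINT t:{1<..}|lborel. bessel_kern \<nu> 0 x t)"
    unfolding besselK_eq_moment bessel_moment_def split
    by (rule set_integral_Un) (auto intro!: set_integrable_subset[OF I])
  moreover have "(LINT t:{1<..}|lborel. bessel_kern \<nu> 0 x t)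
      \<le> (LINT t:{1<..}|lborel. exp (- (x - x0) * ?c) * bessel_kern \<nu> 0 x0 t)"
  proof (rule set_integral_mono)
    fix t :: real assume "t \<in> {1<..}"
    then have "?c \<le> cosh t" by (simp add: cosh_real_nonneg_le_iff)
    then have "(x - x0) * ?c \<le> (x - x0) * cosh t" using x by (intro mult_left_mono) auto
    then have "exp (- x * cosh t) \<le> exp (- (x - x0) * ?c) * exp (- x0 * cosh t)"
      by (simp add: exp_add[symmetric] algebra_simps)
    then have "exp (- x * cosh t) * cosh (\<nu> * t) \<le> (exp (- (x - x0) * ?c) * exp (- x0 * cosh t)) * cosh (\<nu> * t)"
      by (intro mult_right_mono) auto
    then show "bessel_kern \<nu> 0 x t \<le> exp (- (x - x0) * ?c) * bessel_kern \<nu> 0 x0 t"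
      by (simp add: bessel_kern_def mult_ac)
  next
    show "set_integrable lborel {1<..} (bessel_kern \<nu> 0 x)"
      by (rule set_integrable_subset[OF I]) auto
    show "set_integrable lborel {1<..} (\<lambda>t. exp (- (x - x0) * ?c) * bessel_kern \<nu> 0 x0 t)"
      by (rule set_integrable_mult_right, rule set_integrable_subset[OF set_integrable_bessel_kern[OF assms(1)]]) auto
  qed
  moreover have "(LINT t:{1<..}|lborel. exp (- (x - x0) * ?c) * bessel_kern \<nu> 0 x0 t)
      \<le> exp (- (x - x0) * ?c) * besselK \<nu> x0"
  proof -
    have "(LINT t:{1<..}|lborel. bessel_kern \<nu> 0 x0 t) \<le> besselK \<nu> x0"
      unfolding besselK_eq_moment using assms by (intro bessel_moment_subset) auto
    then show ?thesis by simp
  qed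
  moreover have "exp (- (x - x0) * ?c) * besselK \<nu> x0 = M * exp (- x * ?c)"
    unfolding M_def by (simp add: exp_add[symmetric] algebra_simps)
  moreover have "M * exp (- x * ?c) \<le> M * ?U"
    using bessel_moment_unit_lower[OF x'] M by (intro mult_left_mono) auto
  ultimately have 1: "besselK \<nu> x \<le> (1 + M) * ?U" unfolding distrib_right by linarith
  have "?U \<le> (LINT t:{0<..1}|lborel. exp (b * ?c) * bessel_kern \<nu> 0 (x + b) t)"
  proof (rule set_integral_mono)
    fix t :: real assume "t \<in> {0<..1}"
    then have "cosh t \<le> ?c" by (simp add: cosh_real_nonneg_le_iff)
    then have "b * cosh t \<le> b * ?c" using assms by (intro mult_left_mono) auto
    then have "exp (- x * cosh t) \<le> exp (b * ?c) * exp (- (x + b) * cosh t)"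
      by (simp add: exp_add[symmetric] algebra_simps)
    then have "exp (- x * cosh t) * cosh (\<nu> * t) \<le> (exp (b * ?c) * exp (- (x + b) * cosh t)) * cosh (\<nu> * t)"
      by (intro mult_right_mono) auto
    then show "bessel_kern \<nu> 0 x t \<le> exp (b * ?c) * bessel_kern \<nu> 0 (x + b) t"
      by (simp add: bessel_kern_def mult_ac)
  next
    show "set_integrable lborel {0<..1} (bessel_kern \<nu> 0 x)"
      by (rule set_integrable_subset[OF I]) auto
    have "x + b > 0" using x' assms by simp
    then show "set_integrable lborel {0<..1} (\<lambda>t. exp (b * ?c) * bessel_kern \<nu> 0 (x + b) t)"
      by (intro set_integrable_mult_right set_integrable_subset[OF set_integrable_bessel_kern]) auto
  qed
  also have "\<dots> \<le> exp (b * ?c) * besselK \<nu> (x + b)"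
  proof -
    have "(LINT t:{0<..1}|lborel. bessel_kern \<nu> 0 (x + b) t) \<le> besselK \<nu> (x + b)"
      unfolding besselK_eq_moment using x' assms by (intro bessel_moment_subset) auto
    then show ?thesis by simp
  qed
  finally have "?U \<le> exp (b * ?c) * besselK \<nu> (x + b)" .
  then have "(1 + M) * ?U \<le> (1 + M) * (exp (b * ?c) * besselK \<nu> (x + b))"
    by (rule mult_left_mono) (use M in simp)
  from order_trans[OF 1 this] show ?thesis unfolding mult.assoc .
  qed
  moreover have "(1 + M) * exp (b * ?c) > 0" using M by simp
  ultimately show ?thesis using that by blast
qed

text \<open>After \<open>cosh t \<ge> exp t / 2\<close>, the translation of \<open>t\<close> by
  \<open>ln x\<close> extracts \<open>x powr - \<nu>\<close> and leaves a fixed function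
  \<open>h\<close>. It is integrable over the whole line: the double exponential controls
  \<open>t \<ge> 0\<close>, and \<open>exp (\<nu> * t)\<close> controls
  \<open>t \<le> 0\<close>.\<close>

lemma besselK_upper_powr:
  assumes "\<nu> > 0"
  obtains C where "C > 0" "\<And>x. x > 0 \<Longrightarrow> besselK \<nu> x \<le> C * x powr - \<nu>"
proof -
  define h where "h s = exp (- (1/2) * exp s) * exp (\<nu> * s)" for s :: real
  obtain C where C: "C > 0" "\<And>t. t \<ge> 0 \<Longrightarrow> h t \<le> C * exp (- t)"
    unfolding h_def by (rule exp_exp_decay[of "1/2" \<nu>]) auto
  have i1: "integrable lborel (\<lambda>t::real. C * (indicator {0..} t * exp (- 1 * t)))"
    using set_integrable_exp_minus(1)[of 1] by (intro integrable_mult_right) (simp add: set_integrable_def)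
  have "integrable lborel (\<lambda>t::real. indicator {0..} t * exp (- \<nu> * t))"
    using set_integrable_exp_minus(1)[OF assms] by (simp add: set_integrable_def)
  from lborel_integrable_real_affine[OF this, of "-1" 0]
  have i2: "integrable lborel (\<lambda>t::real. indicator {0..} (- t) * exp (\<nu> * t))" by simp
  have h: "integrable lborel h"
  proof (rule Bochner_Integration.integrable_bound[OF Bochner_Integration.integrable_add[OF i1 i2]])
    show "h \<in> borel_measurable lborel" unfolding h_def by simp
    have "\<bar>h t\<bar> \<le> C * (indicator {0..} t * exp (- 1 * t)) + indicator {0..} (- t) * exp (\<nu> * t)" for t
    proof -
      have "h t \<ge> 0" "h t \<le> exp (\<nu> * t)" unfolding h_def by auto
      then show ?thesis using C(1) C(2)[of t] by (cases "t \<ge> 0") (auto simp: indicator_def)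
    qed
    then show "AE t in lborel. norm (h t)
      \<le> norm (C * (indicator {0..} t * exp (- 1 * t)) + indicator {0..} (- t) * exp (\<nu> * t))"
      unfolding real_norm_def by (intro AE_I2 order_trans[OF _ abs_ge_self])
  qed
  have h0: "0 \<le> (LINT t|lborel. h t)" unfolding h_def by simp
  have "besselK \<nu> x \<le> ((LINT t|lborel. h t) + 1) * x powr - \<nu>" if x: "x > 0" for x
  proof -
    have "besselK \<nu> x \<le> (LINT t|lborel. x powr - \<nu> * h (ln x + 1 * t))"
      unfolding besselK_eq_moment bessel_moment_def set_lebesgue_integral_def
    proof (rule integral_mono)
      show "integrable lborel (\<lambda>t. indicator {0<..} t *\<^sub>R bessel_kern \<nu> 0 x t)"
        using set_integrable_bessel_kern[OF x] by (simp add: set_integrable_def)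
      show "integrable lborel (\<lambda>t. x powr - \<nu> * h (ln x + 1 * t))"
        using lborel_integrable_real_affine[OF h, of 1 "ln x"] by simp
      fix t :: real
      have "bessel_kern \<nu> 0 x t \<le> x powr - \<nu> * h (ln x + 1 * t)" if t: "t > 0"
      proof -
        have "bessel_kern \<nu> 0 x t \<le> exp (- x * (exp t / 2)) * exp \<bar>\<nu> * t\<bar>"
          unfolding bessel_kern_def using x exp_half_le_cosh[of t] cosh_le_exp_abs[of "\<nu> * t"]
          by (simp add: mult_mono)
        also have "\<dots> = exp (- (1/2) * exp (ln x + t)) * (exp (\<nu> * t) * (x powr \<nu> * x powr - \<nu>))"
        proof -
          have "x powr \<nu> * x powr - \<nu> = 1" using x by (simp add: powr_minus)
          moreover have "\<bar>\<nu> * t\<bar> = \<nu> * t" using t assms by simp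
          moreover have "- x * (exp t / 2) = - (1/2) * exp (ln x + t)" using x by (simp add: exp_add)
          ultimately show ?thesis by simp
        qed
        also have "x powr \<nu> = exp (\<nu> * ln x)" using x by (simp add: powr_def)
        also have "exp (- (1/2) * exp (ln x + t)) * (exp (\<nu> * t) * (exp (\<nu> * ln x) * x powr - \<nu>))
          = x powr - \<nu> * (exp (- (1/2) * exp (ln x + t)) * (exp (\<nu> * ln x) * exp (\<nu> * t)))"
          by (simp only: mult_ac)
        finally show ?thesis unfolding h_def by (simp add: distrib_left exp_add[of "\<nu> * ln x"])
      qed
      moreover have "0 \<le> x powr - \<nu> * h (ln x + 1 * t)" unfolding h_def by simp
      ultimately show "indicator {0<..} t *\<^sub>R bessel_kern \<nu> 0 x t \<le> x powr - \<nu> * h (ln x + 1 * t)"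
        by (simp add: indicator_def)
    qed
    also have "\<dots> = x powr - \<nu> * (LINT t|lborel. h t)"
      using lborel_integral_real_affine[of 1 h "ln x"] by simp
    also have "\<dots> \<le> ((LINT t|lborel. h t) + 1) * x powr - \<nu>" by (simp add: algebra_simps)
    finally show ?thesis .
  qed
  with h0 that[of "(LINT t|lborel. h t) + 1"] show ?thesis by simp
qed

text \<open>For \<open>x \<le> 1\<close> the mass sits near \<open>t = - ln x\<close>: on the unit
  interval starting there \<open>x * cosh t\<close> stays bounded while
  \<open>cosh (\<nu> * t)\<close> is at least \<open>x powr - \<nu> / 2\<close>. Between
  \<open>1\<close> and \<open>X\<close> monotonicity suffices.\<close>

lemma besselK_lower_powr:
  assumes "\<nu> > 0" "X \<ge> 1"
  obtains c where "c > 0" "\<And>x. 0 < x \<Longrightarrow> x \<le> X \<Longrightarrow> c * x powr - \<nu> \<le> besselK \<nu> x"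
proof -
  define c where "c = exp (- exp 1) / (2::real)"
  have small: "c * x powr - \<nu> \<le> besselK \<nu> x" if x: "0 < x" "x \<le> 1" for x
  proof -
    define L where "L = - ln x"
    have L: "L \<ge> 0" "exp L = 1 / x" unfolding L_def using x by (auto simp: exp_minus field_simps)
    have "(LINT t:{L<..L + 1}|lborel. c * x powr - \<nu>) \<le> (LINT t:{L<..L + 1}|lborel. bessel_kern \<nu> 0 x t)"
    proof (rule set_integral_mono)
      fix t assume t: "t \<in> {L<..L + 1}"
      have "cosh t \<le> exp \<bar>t\<bar>" by (rule cosh_le_exp_abs)
      also have "\<dots> \<le> exp (L + 1)" using t L by simp
      also have "\<dots> = exp 1 / x" using L by (simp add: exp_add)
      finally have "x * cosh t \<le> exp 1" using x by (simp add: field_simps)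
      moreover have "exp (\<nu> * L) / 2 \<le> cosh (\<nu> * t)"
        using t assms by (intro order_trans[OF _ exp_half_le_cosh]) auto
      ultimately have "exp (- exp 1) * (exp (\<nu> * L) / 2) \<le> exp (- x * cosh t) * cosh (\<nu> * t)"
        by (intro mult_mono) auto
      moreover have "exp (\<nu> * L) = x powr - \<nu>" using x unfolding L_def by (simp add: powr_def)
      ultimately show "c * x powr - \<nu> \<le> bessel_kern \<nu> 0 x t"
        unfolding c_def bessel_kern_def by simp
    qed (use L in \<open>auto intro!: set_integrable_subset[OF set_integrable_bessel_kern[OF x(1)]], simp add: set_integrable_def\<close>)
    then have "c * x powr - \<nu> \<le> (LINT t:{L<..L + 1}|lborel. bessel_kern \<nu> 0 x t)"
      by (simp add: set_lebesgue_integral_def)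
    also have "\<dots> \<le> besselK \<nu> x" unfolding besselK_eq_moment
      using L by (intro bessel_moment_subset x) auto
    finally show ?thesis .
  qed
  define d where "d = min c (besselK \<nu> X)"
  have X: "besselK \<nu> X > 0" using besselK_pos assms by simp
  have "d * x powr - \<nu> \<le> besselK \<nu> x" if x: "0 < x" "x \<le> X" for x
  proof (cases "x \<le> 1")
    case True
    have "d * x powr - \<nu> \<le> c * x powr - \<nu>" unfolding d_def by (intro mult_right_mono) auto
    then show ?thesis using small[OF x(1) True] by simp
  next
    case False
    have "x powr - \<nu> \<le> 1"
      using powr_mono[of "- \<nu>" 0 x] False assms by simp
    then have "d * x powr - \<nu> \<le> d * 1" using X unfolding d_def c_def by (intro mult_left_mono) auto
    also have "\<dots> \<le> besselK \<nu> x"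
      using bessel_moment_antimono[OF x, of \<nu> 0] unfolding d_def besselK_eq_moment by simp
    finally show ?thesis .
  qed
  moreover have "d > 0" using X unfolding d_def c_def by simp
  ultimately show ?thesis using that by blast
qed

lemma half_square_le_cosh: "x\<^sup>2 / 2 \<le> cosh (x::real) - 1"
proof -
  have "\<bar>x / 2\<bar> \<le> \<bar>sinh (x / 2)\<bar>"
    using real_le_abs_sinh[of "x / 2"] by (simp add: sinh_field_def exp_minus)
  then have "(x / 2)\<^sup>2 \<le> (sinh (x / 2))\<^sup>2" by (simp only: abs_le_square_iff)
  moreover have "cosh x = 2 * (sinh (x / 2))\<^sup>2 + 1"
    using cosh_double[of "x / 2"] by (simp add: cosh_square_eq)
  ultimately show ?thesis by (simp add: power_divide)
qed

text \<open>Half of \<open>x * (cosh t - 1)\<close> is at least \<open>x * t\<^sup>2 / 4\<close>,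
  hence at least \<open>sqrt x * t - 1\<close>, and integrating \<open>exp (- sqrt x * t)\<close>
  yields the power \<open>x powr - (1/2)\<close>. The other half, lowered to \<open>x0\<close>,
  controls \<open>cosh (\<nu> * t)\<close>. The power is essential for the far kernel mass: without
  it the dyadic terms would be of order \<open>k powr - \<nu>\<close>, and \<open>\<nu>\<close> may
  be below \<open>1\<close>.\<close>

lemma besselK_upper_exp:
  assumes "x0 > 0"
  obtains C where "C > 0" "\<And>x. x \<ge> x0 \<Longrightarrow> besselK \<nu> x \<le> C * x powr - (1/2) * exp (- x)"
proof -
  obtain C where C: "C > 0" "\<And>t. t \<ge> 0 \<Longrightarrow> bessel_kern \<nu> 0 (x0 / 2) t \<le> C * exp (- t)"
    using bessel_kern_bound[of "x0 / 2" \<nu> 0] assms by (metis half_gt_zero)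
  define M where "M = C * exp (x0 / 2) * exp 1"
  have "besselK \<nu> x \<le> M * x powr - (1/2) * exp (- x)" if x: "x \<ge> x0" for x
  proof -
    have x': "x > 0" using x assms by simp
    have "besselK \<nu> x \<le> (LINT t:{0..}|lborel. M * exp (- x) * exp (- sqrt x * t))"
    proof -
      have "besselK \<nu> x \<le> (LINT t:{0<..}|lborel. M * exp (- x) * exp (- sqrt x * t))"
        unfolding besselK_eq_moment bessel_moment_def
      proof (rule set_integral_mono)
        fix t :: real assume t: "t \<in> {0<..}"
        have "sqrt x * t - 1 \<le> (sqrt x * t)\<^sup>2 / 4"
          using zero_le_power2[of "sqrt x * t / 2 - 1"] by (simp add: power2_eq_square algebra_simps)
        also have "\<dots> = x / 2 * (t\<^sup>2 / 2)" using x' by (simp add: power_mult_distrib)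
        also have "\<dots> \<le> x / 2 * (cosh t - 1)"
          using half_square_le_cosh x' by (intro mult_left_mono) auto
        finally have 1: "sqrt x * t - 1 \<le> x / 2 * (cosh t - 1)" .
        have "(x / 2) * (cosh t - 1) \<ge> (x0 / 2) * (cosh t - 1)"
          using x cosh_real_ge_1[of t] by (intro mult_right_mono) auto
        moreover have "x / 2 * (cosh t - 1) = (x * cosh t) / 2 - x / 2"
          "x0 / 2 * (cosh t - 1) = (x0 * cosh t) / 2 - x0 / 2" by algebra+
        ultimately have "- x * cosh t \<le> - x0 / 2 * cosh t + (x0 / 2 + 1 - x - sqrt x * t)"
          using 1 by simp
        then have "exp (- x * cosh t) \<le> exp (- (x0 / 2) * cosh t) * (exp (x0 / 2) * exp 1 * exp (- x) * exp (- sqrt x * t))"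
          by (simp add: exp_add[symmetric] algebra_simps)
        then have "bessel_kern \<nu> 0 x t \<le> (exp (- (x0 / 2) * cosh t) * (exp (x0 / 2) * exp 1 * exp (- x) * exp (- sqrt x * t))) * cosh (\<nu> * t)"
          unfolding bessel_kern_def by (auto intro!: mult_right_mono)
        also have "\<dots> = bessel_kern \<nu> 0 (x0 / 2) t * (exp (x0 / 2) * exp 1 * exp (- x) * exp (- sqrt x * t))"
          by (simp add: bessel_kern_def mult_ac)
        also have "\<dots> \<le> C * (exp (x0 / 2) * exp 1 * exp (- x) * exp (- sqrt x * t))"
        proof (rule mult_right_mono)
          have "C * exp (- t) \<le> C" using C t by simp
          then show "bessel_kern \<nu> 0 (x0 / 2) t \<le> C" using C(2)[of t] t by simp
        qed simp
        finally show "bessel_kern \<nu> 0 x t \<le> M * exp (- x) * exp (- sqrt x * t)"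
          by (simp add: M_def mult_ac)
      qed (rule set_integrable_bessel_kern[OF x'], rule set_integrable_mult_right,
           rule set_integrable_subset[OF set_integrable_exp_minus(1)], use x' in auto)
      also have "\<dots> \<le> (LINT t:{0..}|lborel. M * exp (- x) * exp (- sqrt x * t))"
        using x' C by (intro set_integral_subset_le set_integrable_mult_right set_integrable_exp_minus)
          (auto simp: M_def)
      finally show ?thesis .
    qed
    also have "\<dots> = M * exp (- x) * (1 / sqrt x)"
      using set_integrable_exp_minus(2)[of "sqrt x"] x' by simp
    also have "\<dots> = M * x powr - (1/2) * exp (- x)"
      using x' by (simp add: powr_minus powr_half_sqrt field_simps)
    finally show ?thesis .
  qed
  moreover have "M > 0" unfolding M_def using C by simp
  ultimately show ?thesis using that by blast
qed

lemma cmon_bessel_arcosh: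
  assumes "a > 0"
  shows "cmon n (\<lambda>z. bessel_moment \<nu> j (a * arcosh z))"
proof (induction n arbitrary: j)
  case 0
  then show ?case by (simp add: bessel_moment_nonneg)
next
  case (Suc n)
  let ?g = "\<lambda>z. a * (bessel_moment \<nu> (Suc j) (a * arcosh z) * (1 / sqrt (z\<^sup>2 - 1)))"
  have "((\<lambda>z. bessel_moment \<nu> j (a * arcosh z)) has_real_derivative - ?g z) (at z)" if "z > 1" for z
  proof -
    have "((\<lambda>z. bessel_moment \<nu> j (a * arcosh z)) has_real_derivative
      - bessel_moment \<nu> (Suc j) (a * arcosh z) * (a * (1 / sqrt (z\<^sup>2 - 1)))) (at z)"
      by (rule DERIV_chain2[OF DERIV_bessel_moment DERIV_cmult[OF DERIV_arcosh']]) (use assms that in auto)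
    then show ?thesis by (simp add: mult_ac)
  qed
  moreover have "cmon n ?g"
    by (intro cmon_cmult cmon_mult cmon_arcosh_deriv Suc) (use assms in auto)
  ultimately show ?case by (auto simp: bessel_moment_nonneg intro!: exI[of _ ?g])
qed

text \<open>The kernel base in the variable \<open>z = cosh \<rho>\<close>, in which \<open>radial_deriv\<close> becomes \<open>nderiv\<close>.\<close>

definition base_profile :: "real \<Rightarrow> real \<Rightarrow> real \<Rightarrow> real" where
  "base_profile a \<nu> z = arcosh z powr - \<nu> * besselK \<nu> (a * arcosh z)"

lemma cosh_minus_1: "cosh (r::real) - 1 = 2 * (sinh (r / 2))\<^sup>2"
  using cosh_double[of "r / 2"] by (simp add: cosh_square_eq)

text \<open>If \<open>cosh r' - 1 = 4 (cosh r - 1)\<close> then \<open>sinh (r' / 2) = 2 sinh (r / 2)\<close>.\<close>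

context
  fixes w r r' :: real
  assumes w: "w > 0" and r_def: "r = arcosh (1 + w)" and r'_def: "r' = arcosh (1 + 4 * w)"
begin

lemma arcosh_scale_pos: "0 < r" "r < r'"
  using w unfolding r_def r'_def by auto

lemma arcosh_scale_sinh: "sinh (r' / 2) = 2 * sinh (r / 2)"
proof -
  have "2 * (sinh (r' / 2))\<^sup>2 = 4 * (2 * (sinh (r / 2))\<^sup>2)"
    unfolding cosh_minus_1[symmetric] r_def r'_def using w by simp
  then have "(sinh (r' / 2))\<^sup>2 = (2 * sinh (r / 2))\<^sup>2" by (simp add: power_mult_distrib)
  then show ?thesis using arcosh_scale_pos
    by (subst (asm) power2_eq_iff_nonneg) auto
qed

text \<open>The first bound is efficient for small \<open>r\<close>, the second for large
  \<open>r\<close>, where doubling the argument of the Bessel function would cost an exponential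
  factor.\<close>

lemma arcosh_scale_upper: "r' \<le> 2 * r" "r' \<le> r + 2 * ln 2"
proof -
  have "sinh (r' / 2) \<le> sinh r"
    using arcosh_scale_sinh sinh_double[of "r / 2"] arcosh_scale_pos cosh_real_ge_1[of "r/2"]
    by (simp add: mult_le_cancel_left1)
  then show "r' \<le> 2 * r" by simp
  have e: "exp (ln 2 + r / 2) = 2 * exp (r / 2)" "exp (- (ln 2 + r / 2)) = exp (- (r / 2)) / 2"
    by (simp_all only: exp_add exp_minus) (simp_all add: field_simps)
  have "sinh (r' / 2) \<le> sinh (ln 2 + r / 2)"
    unfolding arcosh_scale_sinh sinh_field_def[of "ln 2 + r / 2"] e sinh_field_def[of "r / 2"]
    using exp_gt_zero[of "- (r / 2)"] by (simp add: field_simps)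
  then show "r' \<le> r + 2 * ln 2" by simp
qed

text \<open>The mean value theorem for \<open>sinh\<close> on \<open>[r / 2, r' / 2]\<close>, whose
  increment equals \<open>sinh (r / 2)\<close>. The gain \<open>tanh (r / 2)\<close> is proportional
  to \<open>r\<close> for small \<open>r\<close> and bounded below for large
  \<open>r\<close>.\<close>

lemma arcosh_scale_lower: "r + tanh (r / 2) \<le> r'"
proof -
  obtain x where x: "r / 2 < x" "x < r' / 2" "sinh (r' / 2) - sinh (r / 2) = (r' / 2 - r / 2) * cosh x"
    using MVT2[of "r / 2" "r' / 2" sinh cosh] arcosh_scale_pos by (force intro: derivative_eq_intros)
  have "sinh (r / 2) = (r' / 2 - r / 2) * cosh x" using x(3) arcosh_scale_sinh by simp
  also have "\<dots> \<le> (r' / 2 - r / 2) * cosh (r' / 2)"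
    using x arcosh_scale_pos by (intro mult_left_mono) (auto simp: cosh_real_nonneg_le_iff)
  finally have "2 * sinh (r / 2) \<le> (r' - r) * cosh (r' / 2)" by (simp add: algebra_simps)
  then have "tanh (r' / 2) \<le> r' - r"
    using arcosh_scale_sinh by (simp add: tanh_def pos_divide_le_eq)
  moreover have "tanh (r / 2) \<le> tanh (r' / 2)"
    using arcosh_scale_pos by simp
  ultimately show ?thesis by linarith
qed

end

lemma besselK_antimono: "0 < x \<Longrightarrow> x \<le> y \<Longrightarrow> besselK \<nu> y \<le> besselK \<nu> x"
  unfolding besselK_eq_moment by (rule bessel_moment_antimono)

section \<open>Scaling regularity and asymptotics of the kernel base\<close>

context
  fixes a \<nu> :: real
  assumes a: "a > 0" and nu: "\<nu> > 0"
begin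

lemma cmon_base_profile: "cmon n (base_profile a \<nu>)"
  using cmon_mult[OF cmon_arcosh_powr[of \<nu> n] cmon_bessel_arcosh[OF a, of n \<nu> 0]] nu
  unfolding base_profile_def[abs_def] besselK_eq_moment by simp

lemma base_profile_pos: "z > 1 \<Longrightarrow> 0 < base_profile a \<nu> z"
  unfolding base_profile_def using besselK_pos a by simp

text \<open>Replacing \<open>w\<close> by \<open>4 * w\<close> gains a fixed factor
  \<open>\<theta> < 1\<close>. For \<open>r \<ge> 1\<close> the additive gain in \<open>r\<close>
  acts through the exponential decay of \<open>besselK\<close>, for \<open>r < 1\<close> the
  multiplicative gain acts through \<open>r powr - \<nu>\<close>. Iteration brings the factor below
  \<open>1/2\<close>.\<close>

lemma base_profile_decay: "\<exists>N>1. \<forall>w>0. base_profile a \<nu> (1 + N * w) \<le> base_profile a \<nu> (1 + w) / 2"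
proof -
  \<comment> \<open>For \<open>r < 1\<close> one has
    \<open>tanh (r / 2) \<ge> (r / 2) / cosh (1/2)\<close>, so \<open>r'\<close> is at least
    \<open>r\<close> times the base of this power. For \<open>r \<ge> 1\<close> the increment is at
    least \<open>tanh (1/2)\<close>, which gives \<open>p\<close>.\<close>
  define q where "q = (1 + 1 / (2 * cosh (1/2))) powr - \<nu>"
  define p where "p = exp (- a * tanh (1/2 :: real))"
  define \<theta> where "\<theta> = max p q"
  have "1 + 1 / (2 * cosh (1/2)) > (1::real)" by simp
  then have q: "q < 1" unfolding q_def using nu by (metis neg_less_0_iff_less powr_less_one)
  have p: "0 < p" "p < 1" unfolding p_def using a by auto
  have th: "0 < \<theta>" "\<theta> < 1" using p q unfolding \<theta>_def by auto
  have step: "base_profile a \<nu> (1 + 4 * w) \<le> \<theta> * base_profile a \<nu> (1 + w)" if w: "w > 0" for w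
  proof -
    define r r' where "r = arcosh (1 + w)" and "r' = arcosh (1 + 4 * w)"
    note A = arcosh_scale_pos[OF w r_def r'_def] arcosh_scale_lower[OF w r_def r'_def]
    have pos: "0 < besselK \<nu> (a * r)" "0 < besselK \<nu> (a * r')" using A a besselK_pos by auto
    have mono: "r' powr - \<nu> \<le> r powr - \<nu>" using A nu by (intro powr_mono2') auto
    show ?thesis
    proof (cases "r \<ge> 1")
      case True
      have "tanh (1/2) \<le> tanh (r / 2)" using True by simp
      then have "r' - r \<ge> tanh (1/2)" using A by linarith
      then have "exp (- (a * r' - a * r)) \<le> p" unfolding p_def using a by (simp add: right_diff_distrib[symmetric])
      then have "besselK \<nu> (a * r') \<le> p * besselK \<nu> (a * r)"
        using bessel_moment_antimono_exp[of "a * r" "a * r'" \<nu> 0] A a pos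
        unfolding besselK_eq_moment by (meson mult_mono' less_eq_real_def mult_right_mono order_trans mult_pos_pos mult_le_cancel_left_pos)
      also have "\<dots> \<le> \<theta> * besselK \<nu> (a * r)" using pos unfolding \<theta>_def by simp
      finally have "r' powr - \<nu> * besselK \<nu> (a * r') \<le> r powr - \<nu> * (\<theta> * besselK \<nu> (a * r))"
        using mono pos by (intro mult_mono) auto
      then show ?thesis unfolding base_profile_def r_def r'_def by (simp add: mult_ac)
    next
      case False
      have "cosh (r / 2) \<le> cosh (1/2)" using False A by (subst cosh_real_nonneg_le_iff) auto
      moreover have "r / 2 \<le> sinh (r / 2)"
        using real_le_x_sinh[of "r / 2"] A by (simp add: sinh_field_def exp_minus)
      ultimately have "(r / 2) / cosh (1/2) \<le> sinh (r / 2) / cosh (r / 2)"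
        using A by (intro frac_le) auto
      then have "r * (1 + 1 / (2 * cosh (1/2))) \<le> r'" using A(3) by (simp add: tanh_def algebra_simps)
      moreover have "r * (1 + 1 / (2 * cosh (1/2))) > 0"
        using A by (intro mult_pos_pos) (auto intro: add_pos_pos)
      ultimately have "r' powr - \<nu> \<le> (r * (1 + 1 / (2 * cosh (1/2)))) powr - \<nu>"
        using nu by (intro powr_mono2') auto
      also have "\<dots> = q * r powr - \<nu>" unfolding q_def using A by (simp add: powr_mult mult.commute)
      also have "\<dots> \<le> \<theta> * r powr - \<nu>" unfolding \<theta>_def by (intro mult_right_mono) auto
      finally have "r' powr - \<nu> * besselK \<nu> (a * r') \<le> (\<theta> * r powr - \<nu>) * besselK \<nu> (a * r)"
        using A a pos th by (intro mult_mono besselK_antimono) auto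
      then show ?thesis unfolding base_profile_def r_def r'_def by (simp add: mult_ac)
    qed
  qed
  have iter: "base_profile a \<nu> (1 + 4 ^ k * w) \<le> \<theta> ^ k * base_profile a \<nu> (1 + w)" if "w > 0" for k w
  proof (induction k)
    case (Suc k)
    have "base_profile a \<nu> (1 + 4 ^ Suc k * w) \<le> \<theta> * base_profile a \<nu> (1 + 4 ^ k * w)"
      using step[of "4 ^ k * w"] that by (simp add: mult_ac)
    also have "\<dots> \<le> \<theta> * (\<theta> ^ k * base_profile a \<nu> (1 + w))" using Suc th by (intro mult_left_mono) auto
    finally show ?case by (simp add: mult_ac)
  qed simp
  obtain k where k: "\<theta> ^ k < 1/2" using real_arch_pow_inv[of "1/2" \<theta>] th by auto
  have "k \<noteq> 0" using k by (metis less_divide_eq_1_pos not_less_iff_gr_or_eq one_less_numeral_iff power_0 semiring_norm(76) zero_less_numeral less_asym)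
  then have "(4::real) ^ k > 1" by (simp add: one_less_power)
  moreover have "base_profile a \<nu> (1 + 4 ^ k * w) \<le> base_profile a \<nu> (1 + w) / 2" if "w > 0" for w
  proof -
    have "\<theta> ^ k * base_profile a \<nu> (1 + w) \<le> 1/2 * base_profile a \<nu> (1 + w)"
      using k base_profile_pos[of "1 + w"] that by (intro mult_right_mono) auto
    then show ?thesis using iter[OF that, of k] by simp
  qed
  ultimately show ?thesis by blast
qed

text \<open>The factor \<open>4\<close> is treated, which is stronger because the profile decreases.
  If \<open>a * r \<ge> 1/2\<close>, the argument of \<open>besselK\<close> grows by at most
  \<open>2 * a * ln 2\<close> and the shift estimate applies. Otherwise
  \<open>a * r' \<le> 1\<close>, and the two-sided power bounds apply.\<close>

lemma base_profile_doubling: "\<exists>C>0. \<forall>w>0. base_profile a \<nu> (1 + w) \<le> C * base_profile a \<nu> (1 + 2 * w)"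
proof -
  obtain C1 where C1: "C1 > 0" "\<And>x. x > 0 \<Longrightarrow> besselK \<nu> x \<le> C1 * x powr - \<nu>"
    using besselK_upper_powr[OF nu] by metis
  obtain c1 where c1: "c1 > 0" "\<And>x. 0 < x \<Longrightarrow> x \<le> 1 \<Longrightarrow> c1 * x powr - \<nu> \<le> besselK \<nu> x"
    using besselK_lower_powr[OF nu, of 1] by auto
  obtain C2 where C2: "C2 > 0" "\<And>x. x \<ge> 1/2 \<Longrightarrow> besselK \<nu> x \<le> C2 * besselK \<nu> (x + 2 * a * ln 2)"
    using besselK_shift[of "1/2" "2 * a * ln 2" \<nu>] a by auto
  define C3 where "C3 = max C2 (C1 * 2 powr \<nu> / c1)"
  have C3: "C3 > 0" using C2 unfolding C3_def by simp
  have "base_profile a \<nu> (1 + w) \<le> (2 powr \<nu> * C3) * base_profile a \<nu> (1 + 2 * w)" if w: "w > 0" for w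
  proof -
    define r r' where "r = arcosh (1 + w)" and "r' = arcosh (1 + 4 * w)"
    note A = arcosh_scale_pos[OF w r_def r'_def] arcosh_scale_upper[OF w r_def r'_def]
    have pos: "0 < besselK \<nu> (a * r)" "0 < besselK \<nu> (a * r')" using A a besselK_pos by auto
    have B: "besselK \<nu> (a * r) \<le> C3 * besselK \<nu> (a * r')"
    proof (cases "a * r \<ge> 1/2")
      case True
      have "a * r' \<le> a * (r + 2 * ln 2)" using A a by (intro mult_left_mono) auto
      then have "besselK \<nu> (a * r + 2 * a * ln 2) \<le> besselK \<nu> (a * r')"
        using A a by (intro besselK_antimono) (auto simp: algebra_simps)
      then have "besselK \<nu> (a * r) \<le> C2 * besselK \<nu> (a * r')"
        using C2(2)[OF True] C2(1) by (meson mult_left_mono less_imp_le order_trans)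
      also have "\<dots> \<le> C3 * besselK \<nu> (a * r')" using pos unfolding C3_def by simp
      finally show ?thesis .
    next
      case False
      have "a * r' \<le> 2 * (a * r)" using A a by simp
      then have le: "a * r' \<le> 1" "0 < a * r'" using False A a mult_pos_pos[of a r'] by linarith+
      have "(a * r) powr - \<nu> \<le> (a * r' / 2) powr - \<nu>"
        using \<open>a * r' \<le> 2 * (a * r)\<close> le nu by (intro powr_mono2') auto
      also have "\<dots> = 2 powr \<nu> * (a * r') powr - \<nu>"
        using le by (simp add: powr_divide powr_minus field_simps)
      finally have "C1 * (a * r) powr - \<nu> \<le> C1 * (2 powr \<nu> * (a * r') powr - \<nu>)"
        using C1 by (intro mult_left_mono) auto
      moreover have "besselK \<nu> (a * r) \<le> C1 * (a * r) powr - \<nu>" using C1 a A by simp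
      ultimately have "besselK \<nu> (a * r) \<le> (C1 * 2 powr \<nu> / c1) * (c1 * (a * r') powr - \<nu>)" using c1(1) by simp
      also have "\<dots> \<le> (C1 * 2 powr \<nu> / c1) * besselK \<nu> (a * r')"
        using c1 le C1 by (intro mult_left_mono) auto
      also have "\<dots> \<le> C3 * besselK \<nu> (a * r')"
        using pos unfolding C3_def by (intro mult_right_mono) auto
      finally show ?thesis .
    qed
    have "r powr - \<nu> \<le> (r' / 2) powr - \<nu>" using A nu by (intro powr_mono2') auto
    also have "\<dots> = 2 powr \<nu> * r' powr - \<nu>" using A by (simp add: powr_divide powr_minus field_simps)
    finally have "r powr - \<nu> * besselK \<nu> (a * r) \<le> (2 powr \<nu> * r' powr - \<nu>) * (C3 * besselK \<nu> (a * r'))"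
      using B pos by (intro mult_mono) auto
    then have "base_profile a \<nu> (1 + w) \<le> (2 powr \<nu> * C3) * base_profile a \<nu> (1 + 4 * w)"
      unfolding base_profile_def r_def r'_def by (simp add: mult_ac)
    also have "\<dots> \<le> (2 powr \<nu> * C3) * base_profile a \<nu> (1 + 2 * w)"
      using w C3 by (intro mult_left_mono cmon_antimono[OF cmon_base_profile]) auto
    finally show ?thesis .
  qed
  moreover have "2 powr \<nu> * C3 > 0" using C3 by simp
  ultimately show ?thesis by blast
qed

lemma scaling_regular_base_profile: "scaling_regular (base_profile a \<nu>)"
  unfolding scaling_regular_def
  using cmon_base_profile base_profile_pos base_profile_decay base_profile_doubling by blast

text \<open>For \<open>w \<le> 1\<close> the square of \<open>r = arcosh (1 + w)\<close> lies
  between \<open>w\<close> and \<open>2 * w\<close>, and the profile has order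
  \<open>r powr - (2 * \<nu>)\<close>: one factor is explicit, the other comes from
  \<open>besselK\<close>.\<close>

lemma base_profile_near_1:
  obtains c C where "0 < c" "0 < C"
    "\<And>w. 0 < w \<Longrightarrow> w \<le> 1 \<Longrightarrow> c * w powr - \<nu> \<le> base_profile a \<nu> (1 + w)"
    "\<And>w. 0 < w \<Longrightarrow> w \<le> 1 \<Longrightarrow> base_profile a \<nu> (1 + w) \<le> C * w powr - \<nu>"
proof -
  define X where "X = max 1 (a * arcosh 2)"
  obtain C1 where C1: "C1 > 0" "\<And>x. x > 0 \<Longrightarrow> besselK \<nu> x \<le> C1 * x powr - \<nu>"
    using besselK_upper_powr[OF nu] by metis
  obtain c1 where c1: "c1 > 0" "\<And>x. 0 < x \<Longrightarrow> x \<le> X \<Longrightarrow> c1 * x powr - \<nu> \<le> besselK \<nu> x"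
    using besselK_lower_powr[OF nu, of X] unfolding X_def by auto
  have *: "c1 * a powr - \<nu> * 2 powr - \<nu> * w powr - \<nu> \<le> base_profile a \<nu> (1 + w) \<and>
     base_profile a \<nu> (1 + w) \<le> C1 * a powr - \<nu> * w powr - \<nu>" if w: "0 < w" "w \<le> 1" for w
  proof -
    define r where "r = arcosh (1 + w)"
    have r: "r > 0" "cosh r = 1 + w" "r \<le> arcosh 2" using w unfolding r_def
      by (auto simp: arcosh_less_iff_real not_less[symmetric])
    have w1: "r\<^sup>2 \<le> 2 * w" using half_square_le_cosh[of r] r by simp
    \<comment> \<open>From \<open>sinh x \<le> x * cosh x\<close> at \<open>x = r / 2\<close>; the
      restriction \<open>w \<le> 1\<close> keeps the resulting factor \<open>(2 + w) / 4\<close>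
      below \<open>1\<close>.\<close>
    have w2: "w \<le> r\<^sup>2"
    proof -
      obtain x where x: "0 < x" "x < r / 2" "sinh (r / 2) - sinh 0 = (r / 2 - 0) * cosh x"
        using MVT2[of 0 "r / 2" sinh cosh] r by (force intro: derivative_eq_intros)
      have "sinh (r / 2) \<le> r / 2 * cosh (r / 2)" using x r by (simp add: cosh_real_nonneg_le_iff)
      then have "(sinh (r / 2))\<^sup>2 \<le> (r / 2 * cosh (r / 2))\<^sup>2" using r by (intro power_mono) auto
      moreover have "(cosh (r / 2))\<^sup>2 = (cosh r + 1) / 2"
        using cosh_double[of "r / 2"] by (simp add: sinh_square_eq)
      ultimately have "w \<le> 2 * (r\<^sup>2 / 4 * ((cosh r + 1) / 2))"
        using cosh_minus_1[of r] r by (simp add: power_mult_distrib power_divide)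
      also have "\<dots> = r\<^sup>2 * ((2 + w) / 4)" using r by simp
      also have "\<dots> \<le> r\<^sup>2 * 1" using w by (intro mult_left_mono) auto
      finally show ?thesis by simp
    qed
    have pw: "r powr - \<nu> * r powr - \<nu> = (r\<^sup>2) powr - \<nu>"
      using r by (simp add: powr_mult power2_eq_square)
    have ar: "a * r \<le> X" using r a unfolding X_def by (intro order_trans[OF mult_left_mono max.cobounded2]) auto
    have "c1 * a powr - \<nu> * 2 powr - \<nu> * w powr - \<nu> = c1 * a powr - \<nu> * (2 * w) powr - \<nu>"
      using w by (simp add: powr_mult)
    also have "\<dots> \<le> c1 * a powr - \<nu> * (r\<^sup>2) powr - \<nu>"
      using w1 r nu c1 by (intro mult_left_mono powr_mono2') auto
    also have "\<dots> = r powr - \<nu> * (c1 * (a * r) powr - \<nu>)"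
      using r a pw by (simp add: powr_mult mult_ac)
    also have "\<dots> \<le> r powr - \<nu> * besselK \<nu> (a * r)"
      using c1 ar r a by (intro mult_left_mono) auto
    finally have L: "c1 * a powr - \<nu> * 2 powr - \<nu> * w powr - \<nu> \<le> base_profile a \<nu> (1 + w)"
      unfolding base_profile_def r_def .
    have "r powr - \<nu> * besselK \<nu> (a * r) \<le> r powr - \<nu> * (C1 * (a * r) powr - \<nu>)"
      using C1 r a by (intro mult_left_mono) auto
    also have "\<dots> = C1 * a powr - \<nu> * (r\<^sup>2) powr - \<nu>"
      using r a pw by (simp add: powr_mult mult_ac)
    also have "\<dots> \<le> C1 * a powr - \<nu> * w powr - \<nu>"
      using w2 w nu C1 by (intro mult_left_mono powr_mono2') auto
    finally show ?thesis using L unfolding base_profile_def r_def by simp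
  qed
  show ?thesis
    by (rule that[of "c1 * a powr - \<nu> * 2 powr - \<nu>" "C1 * a powr - \<nu>"])
       (use * c1 C1 a in auto)
qed

text \<open>At \<open>1 + 2 ^ k\<close> the distance is at least \<open>k * ln 2\<close>, so the
  exponential decay exactly compensates \<open>2 powr (a * k)\<close>. What remains is
  \<open>k powr - (\<nu> + 1/2)\<close>, and the exponent exceeds \<open>1\<close> by the assumption
  on \<open>\<nu>\<close>.\<close>

lemma base_profile_dyadic_summable:
  assumes "\<nu> > 1/2"
  shows "summable (\<lambda>k. 2 powr (a * real k) * base_profile a \<nu> (1 + 2 ^ k))"
proof -
  obtain C where C: "C > 0" "\<And>x. x \<ge> a * ln 2 \<Longrightarrow> besselK \<nu> x \<le> C * x powr - (1/2) * exp (- x)"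
    using besselK_upper_exp[of "a * ln 2" \<nu>] a by auto
  define M where "M = C * a powr - (1/2) * ln 2 powr - (\<nu> + 1/2)"
  have bound: "2 powr (a * real k) * base_profile a \<nu> (1 + 2 ^ k) \<le> M * real k powr - (\<nu> + 1/2)" if k: "k \<ge> 1" for k
  proof -
    define r where "r = arcosh (1 + 2 ^ k :: real)"
    have r0: "r > 0" unfolding r_def by simp
    have "(2::real) ^ k \<le> cosh r" unfolding r_def by simp
    also have "\<dots> \<le> exp r" using cosh_le_exp_abs[of r] r0 by simp
    finally have "ln (2 ^ k) \<le> r" using ln_le_cancel_iff[of "2 ^ k" "exp r"] by simp
    then have rk: "real k * ln 2 \<le> r" by (simp add: ln_realpow)
    have "ln 2 \<le> real k * ln 2" using k by simp
    then have "ln 2 \<le> r" using rk by linarith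
    then have "a * ln 2 \<le> a * r" using a by simp
    from C(2)[OF this] have "r powr - \<nu> * besselK \<nu> (a * r) \<le> r powr - \<nu> * (C * (a * r) powr - (1/2) * exp (- (a * r)))"
      by (intro mult_left_mono) auto
    also have "\<dots> = C * a powr - (1/2) * (r powr - (\<nu> + 1/2) * exp (- (a * r)))"
      using r0 a by (simp add: powr_mult powr_add[symmetric] mult_ac)
    also have "\<dots> \<le> C * a powr - (1/2) * ((real k * ln 2) powr - (\<nu> + 1/2) * exp (- (a * (real k * ln 2))))"
      using rk r0 a nu C k by (intro mult_left_mono mult_mono powr_mono2') auto
    also have "exp (- (a * (real k * ln 2))) = 2 powr (- a * real k)" by (simp add: powr_def mult_ac)
    also have "C * a powr - (1/2) * ((real k * ln 2) powr - (\<nu> + 1/2) * 2 powr (- a * real k))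
      = M * real k powr - (\<nu> + 1/2) * 2 powr (- a * real k)"
      unfolding M_def using k by (simp add: powr_mult)
    finally have "base_profile a \<nu> (1 + 2 ^ k) \<le> M * real k powr - (\<nu> + 1/2) * 2 powr (- a * real k)"
      unfolding base_profile_def r_def .
    then have "2 powr (a * real k) * base_profile a \<nu> (1 + 2 ^ k)
      \<le> 2 powr (a * real k) * (M * real k powr - (\<nu> + 1/2) * 2 powr (- a * real k))"
      by (intro mult_left_mono) auto
    also have "\<dots> = M * real k powr - (\<nu> + 1/2)"
      by (simp add: powr_minus)
    finally show ?thesis .
  qed
  have "summable (\<lambda>k. M * real k powr - (\<nu> + 1/2))"
    using assms by (intro summable_mult) (subst summable_real_powr_iff, simp)
  then show ?thesis
  proof (rule summable_comparison_test'[where N = 1])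
    fix k :: nat assume "k \<ge> 1"
    then show "norm (2 powr (a * real k) * base_profile a \<nu> (1 + 2 ^ k)) \<le> M * real k powr - (\<nu> + 1/2)"
      using bound base_profile_pos[of "1 + 2 ^ k"] by simp
  qed
qed

end

section \<open>The radial kernel\<close>

text \<open>An antiderivative is \<open>2 / sqrt w * arctan (sqrt v / sqrt w)\<close>. This is the
  model integral that dominates the half integrals below.\<close>

lemma inverse_sqrt_weight_integral:
  assumes "w > 0"
  shows "set_integrable lborel {0<..} (\<lambda>v::real. 1 / (sqrt v * (w + v)))"
    and "(LINT v:{0<..}|lborel. 1 / (sqrt v * (w + v))) = pi / sqrt w"
proof -
  let ?F = "\<lambda>v. 2 / sqrt w * arctan (sqrt v / sqrt w)" and ?f = "\<lambda>v. 1 / (sqrt v * (w + v))"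
  have D: "DERIV ?F v :> ?f v" if "0 < v" for v
  proof -
    have "DERIV ?F v :> 2 / sqrt w * (inverse (1 + (sqrt v / sqrt w)\<^sup>2) * ((inverse (sqrt v) / 2) / sqrt w))"
      using that assms by (intro DERIV_cmult DERIV_chain2[OF DERIV_arctan] DERIV_cdivide DERIV_real_sqrt)
    also have "2 / sqrt w * (inverse (1 + (sqrt v / sqrt w)\<^sup>2) * ((inverse (sqrt v) / 2) / sqrt w)) = ?f v"
    proof -
      have "1 + v / w = (w + v) / w" using assms by (simp add: add_divide_distrib)
      then show ?thesis using that assms by (simp add: power_divide) (simp add: divide_simps)
    qed
    finally show ?thesis .
  qed
  have "filterlim (\<lambda>v::real. v * (1 / w)) at_top at_top"
    using assms by (intro filterlim_at_top_mult_tendsto_pos[OF tendsto_const]) (auto simp: filterlim_ident)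
  then have "filterlim (\<lambda>v. sqrt (v * (1 / w))) at_top at_top"
    by (rule filterlim_compose[OF sqrt_at_top])
  then have "filterlim (\<lambda>v. sqrt v / sqrt w) at_top at_top"
    by (simp add: real_sqrt_divide)
  then have top: "(?F \<longlongrightarrow> 2 / sqrt w * (pi / 2)) at_top"
    by (intro tendsto_mult_left filterlim_compose[OF tendsto_arctan_at_top])
  have "(?F \<longlongrightarrow> 2 / sqrt w * arctan (sqrt 0 / sqrt w)) (at_right 0)"
    using assms by (intro tendsto_intros) auto
  then have bot: "(?F \<longlongrightarrow> 0) (at_right 0)" by simp
  note FTC = interval_integral_FTC_nonneg[of 0 \<infinity> ?F ?f 0 "pi / sqrt w"]
  have cont: "isCont ?f v" if "0 < v" for v
    using that assms by (intro continuous_intros) auto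
  have 1: "set_integrable lborel (einterval 0 \<infinity>) ?f"
    and 2: "(LBINT x=0..\<infinity>. ?f x) = pi / sqrt w - 0"
    using top bot by (intro FTC; use D cont assms in \<open>auto simp: ereal_tendsto_simps zero_ereal_def\<close>)+
  show "set_integrable lborel {0<..} ?f" using 1 by (simp add: zero_ereal_def)
  show "(LINT v:{0<..}|lborel. ?f v) = pi / sqrt w"
    using 2 by (simp add: zero_ereal_def interval_integral_to_infinity_eq)
qed

text \<open>The Weyl fractional integral of order \<open>1/2\<close> without its normalization; the
  kernel takes this form in even dimensions.\<close>

definition half_integral :: "(real \<Rightarrow> real) \<Rightarrow> real \<Rightarrow> real" where
  "half_integral F z = (LINT v:{0<..}|lborel. F (z + v) / sqrt v)"

context
  fixes n :: nat and s a \<nu> :: real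
  assumes n: "2 \<le> n" and s: "0 < s" "s < 1"
    and a_def: "a = (real n - 1) / 2" and nu_def: "\<nu> = (1 + 2 * s) / 2"
begin

abbreviation (input) base_D :: "nat \<Rightarrow> real \<Rightarrow> real" where
  "base_D k \<equiv> (nderiv ^^ k) (base_profile a \<nu>)"

lemma a_pos: "a > 0" and nu_pos: "\<nu> > 0" "\<nu> > 1/2"
  using n s by (auto simp: a_def nu_def)

lemmas base_regular = scaling_regular_base_profile[OF a_pos nu_pos(1)]

lemma base_D_regular: "scaling_regular (base_D k)"
  using nderiv_iterate_comparable[OF base_regular] by blast

lemma base_D_cmon: "cmon j (base_D k)" and base_D_pos: "z > 1 \<Longrightarrow> 0 < base_D k z"
  using base_D_regular[of k] by (auto simp: scaling_regular_def)

lemma base_D_DERIV: "z > 1 \<Longrightarrow> (base_D k has_real_derivative - base_D (Suc k) z) (at z)"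
  using cmon_DERIV[OF base_D_cmon] by simp

lemma base_D_antimono: "1 < y \<Longrightarrow> y \<le> z \<Longrightarrow> base_D k z \<le> base_D k y"
  using cmon_antimono[OF base_D_cmon] by blast

lemma base_D_measurable: "set_borel_measurable borel {1<..} (base_D k)"
  unfolding set_borel_measurable_def
proof (rule borel_measurable_continuous_on_indicator)
  show "continuous_on {1<..} (base_D k)"
    by (intro continuous_at_imp_continuous_on ballI DERIV_isCont[OF base_D_DERIV]) auto
qed simp

lemma radial_deriv_iterate:
  "0 < \<rho> \<Longrightarrow> (radial_deriv ^^ k) (kernel_base n s) \<rho> = base_D k (cosh \<rho>)"
proof (induction k arbitrary: \<rho>)
  case 0
  then show ?case by (simp add: kernel_base_def base_profile_def a_def nu_def arcosh_cosh_real)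
next
  case (Suc k)
  have c: "cosh \<rho> > 1" using Suc.prems cosh_real_strict_mono[of 0 \<rho>] by simp
  have "((\<lambda>\<rho>. base_D k (cosh \<rho>)) has_real_derivative - base_D (Suc k) (cosh \<rho>) * sinh \<rho>) (at \<rho>)"
    by (rule DERIV_chain2[where f = "base_D k" and g = cosh, OF base_D_DERIV[OF c]]) (auto intro!: derivative_eq_intros)
  then have "((radial_deriv ^^ k) (kernel_base n s) has_real_derivative - base_D (Suc k) (cosh \<rho>) * sinh \<rho>) (at \<rho>)"
    by (rule has_field_derivative_transform_within_open[of _ _ _ "{0<..}"]) (use Suc in auto)
  then have "deriv ((radial_deriv ^^ k) (kernel_base n s)) \<rho> = - base_D (Suc k) (cosh \<rho>) * sinh \<rho>"
    by (rule DERIV_imp_deriv)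
  then show ?case using Suc.prems by (simp add: radial_deriv_def[of "(radial_deriv ^^ k) (kernel_base n s)"])
qed

text \<open>Of the decay \<open>(w + v) ^ k\<close> one factor \<open>w + v\<close> is kept to make
  the integral converge, and the others are lowered to \<open>w\<close>; this is where
  \<open>k \<ge> 1\<close> enters. The remaining integral is \<open>pi / sqrt w\<close>, so half
  integration multiplies by a factor of order \<open>sqrt w\<close>.\<close>

lemma base_D_half_integrable:
  assumes "k \<ge> 1"
  obtains C where "C > 0" "\<And>z. z > 1 \<Longrightarrow> set_integrable lborel {0<..} (\<lambda>v. base_D k (z + v) / sqrt v)"
    "\<And>w. w > 0 \<Longrightarrow> half_integral (base_D k) (1 + w) \<le> C * (base_profile a \<nu> (1 + w) * (sqrt w / w ^ k))"
proof -
  obtain C where C: "C > 0" "\<And>w. w > 0 \<Longrightarrow> base_D k (1 + w) \<le> C * (base_profile a \<nu> (1 + w) / w ^ k)"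
    using nderiv_iterate_comparable[OF base_regular, of k] by blast
  define M where "M w = C * (base_profile a \<nu> (1 + w) * (w / w ^ k))" for w
  have le: "base_D k (1 + w + v) / sqrt v \<le> M w * (1 / (sqrt v * (w + v)))" if "w > 0" "v > 0" for w v
  proof -
    have p: "base_profile a \<nu> (1 + w) > 0" using base_profile_pos[OF a_pos nu_pos(1)] that by simp
    have "w ^ (k - 1) * (w + v) \<le> (w + v) ^ (k - 1) * (w + v)"
      using that by (intro mult_right_mono power_mono) auto
    also have "\<dots> = (w + v) ^ k" using assms by (metis power_minus_mult zero_less_iff_neq_zero not_one_le_zero)
    finally have pw: "w ^ (k - 1) * (w + v) \<le> (w + v) ^ k" .
    have "base_D k (1 + w + v) \<le> C * (base_profile a \<nu> (1 + (w + v)) / (w + v) ^ k)"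
      using C(2)[of "w + v"] that by (simp add: add.assoc)
    also have "\<dots> \<le> C * (base_profile a \<nu> (1 + w) / (w ^ (k - 1) * (w + v)))"
      using C(1) pw p that cmon_antimono[OF cmon_base_profile[OF a_pos nu_pos(1)], of "1 + w" "1 + (w + v)"]
      by (intro mult_left_mono frac_le) auto
    also have "\<dots> = M w * (1 / (w + v))"
    proof -
      have "w ^ k = w * w ^ (k - 1)" using assms by (metis power_eq_if not_one_le_zero)
      then show ?thesis unfolding M_def using that by (simp add: field_simps)
    qed
    finally have "base_D k (1 + w + v) / sqrt v \<le> M w * (1 / (w + v)) / sqrt v"
      using that by (intro divide_right_mono) auto
    then show ?thesis by (simp add: mult.commute)
  qed
  have int: "set_integrable lborel {0<..} (\<lambda>v. base_D k (z + v) / sqrt v)" if z: "z > 1" for z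
  proof (rule set_integrable_bound)
    show "set_integrable lborel {0<..} (\<lambda>v. M (z - 1) * (1 / (sqrt v * (z - 1 + v))))"
      using z by (intro set_integrable_mult_right inverse_sqrt_weight_integral) auto
    have "(\<lambda>v. indicator {1<..} (z + v) *\<^sub>R base_D k (z + v)) \<in> borel_measurable borel"
      using base_D_measurable[of k] unfolding set_borel_measurable_def by measurable
    then have "(\<lambda>v. indicator {0<..} v *\<^sub>R ((indicator {1<..} (z + v) *\<^sub>R base_D k (z + v)) / sqrt v)) \<in> borel_measurable borel"
      by measurable
    also have "(\<lambda>v. indicator {0<..} v *\<^sub>R ((indicator {1<..} (z + v) *\<^sub>R base_D k (z + v)) / sqrt v))
      = (\<lambda>v. indicator {0<..} v *\<^sub>R (base_D k (z + v) / sqrt v))"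
      using z by (auto simp: fun_eq_iff indicator_def)
    finally show "set_borel_measurable lborel {0<..} (\<lambda>v. base_D k (z + v) / sqrt v)"
      by (simp add: set_borel_measurable_def)
    show "AE v in lborel. v \<in> {0<..} \<longrightarrow> norm (base_D k (z + v) / sqrt v) \<le> norm (M (z - 1) * (1 / (sqrt v * (z - 1 + v))))"
    proof (intro AE_I2 impI)
      fix v :: real assume v: "v \<in> {0<..}"
      have "base_D k (z + v) > 0" using base_D_pos z v by simp
      then have "norm (base_D k (z + v) / sqrt v) \<le> M (z - 1) * (1 / (sqrt v * (z - 1 + v)))"
        using le[of "z - 1" v] z v by simp
      then show "norm (base_D k (z + v) / sqrt v) \<le> norm (M (z - 1) * (1 / (sqrt v * (z - 1 + v))))"
        unfolding real_norm_def[of "M (z - 1) * _"] by (rule order_trans[OF _ abs_ge_self])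
    qed
  qed
  have "half_integral (base_D k) (1 + w) \<le> C * pi * (base_profile a \<nu> (1 + w) * (sqrt w / w ^ k))" if w: "w > 0" for w
  proof -
    have "half_integral (base_D k) (1 + w) \<le> (LINT v:{0<..}|lborel. M w * (1 / (sqrt v * (w + v))))"
      unfolding half_integral_def using w le int
      by (intro set_integral_mono set_integrable_mult_right inverse_sqrt_weight_integral) auto
    also have "\<dots> = M w * (pi / sqrt w)"
      unfolding inverse_sqrt_weight_integral(2)[OF w, symmetric] by (rule set_integral_mult_right)
    also have "\<dots> = C * pi * (base_profile a \<nu> (1 + w) * (sqrt w / w ^ k))"
    proof -
      have "w / sqrt w = sqrt w" using w by (simp add: real_div_sqrt)
      then have "w / w ^ k / sqrt w = sqrt w / w ^ k" by (metis divide_divide_eq_left mult.commute)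
      then show ?thesis unfolding M_def by (metis (no_types, opaque_lifting) mult.assoc mult.commute times_divide_eq_right)
    qed
    finally show ?thesis .
  qed
  then show ?thesis using that[of "C * pi"] C int by simp
qed

text \<open>On \<open>0 < v \<le> w\<close> both the function and the weight are at least their
  values at \<open>v = w\<close>.\<close>

lemma half_integral_lower:
  assumes "k \<ge> 1" "w > 0"
  shows "sqrt w * base_D k (1 + 2 * w) \<le> half_integral (base_D k) (1 + w)"
proof -
  have int: "set_integrable lborel {0<..} (\<lambda>v. base_D k (1 + w + v) / sqrt v)"
    using base_D_half_integrable[OF assms(1)] assms(2) by (metis less_add_same_cancel1)
  have pos: "base_D k (1 + w + v) > 0" if "v > 0" for v using that assms base_D_pos by simp
  have "sqrt w * base_D k (1 + 2 * w) = (LINT v:{0<..w}|lborel. base_D k (1 + 2 * w) / sqrt w)"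
  proof -
    have "w / sqrt w = sqrt w" using assms by (simp add: real_div_sqrt)
    then show ?thesis using assms by (simp add: set_lebesgue_integral_def) (metis mult.commute times_divide_eq_left)
  qed
  also have "\<dots> \<le> (LINT v:{0<..w}|lborel. base_D k (1 + w + v) / sqrt v)"
  proof (rule set_integral_mono)
    show "set_integrable lborel {0<..w} (\<lambda>v. base_D k (1 + w + v) / sqrt v)"
      by (rule set_integrable_subset[OF int]) auto
    fix v assume v: "v \<in> {0<..w}"
    have "base_D k (1 + 2 * w) \<le> base_D k (1 + w + v)" using v assms by (intro base_D_antimono) auto
    then show "base_D k (1 + 2 * w) / sqrt w \<le> base_D k (1 + w + v) / sqrt v"
      by (rule frac_le[rotated]) (use v pos[of v] in auto)
  next
    have "set_integrable lborel {0<..w} (\<lambda>v. base_D k (1 + 2 * w) / sqrt w * 1)"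
      by (rule set_integrable_mult_right)
         (use assms in \<open>auto simp: set_integrable_def intro!: integrable_real_indicator\<close>)
    then show "set_integrable lborel {0<..w} (\<lambda>v. base_D k (1 + 2 * w) / sqrt w)" by simp
  qed
  also have "\<dots> \<le> half_integral (base_D k) (1 + w)"
    unfolding half_integral_def by (rule set_integral_subset_le[OF int]) (use pos in \<open>auto intro: less_imp_le\<close>)
  finally show ?thesis .
qed

text \<open>The decrement is at least \<open>z - y\<close> times the half integral of the next
  derivative, which is positive; this yields strictness under the integral sign.\<close>

lemma half_integral_strict_antimono:
  assumes "k \<ge> 1" "1 < y" "y < z"
  shows "half_integral (base_D k) z < half_integral (base_D k) y"
proof -
  have int: "set_integrable lborel {0<..} (\<lambda>v. base_D j (x + v) / sqrt v)" if "j \<ge> 1" "x > 1" for j x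
    using base_D_half_integrable[OF that(1)] that(2) by metis
  have "(z - y) * half_integral (base_D (Suc k)) z = (LINT v:{0<..}|lborel. (z - y) * (base_D (Suc k) (z + v) / sqrt v))"
    unfolding half_integral_def by (rule set_integral_mult_right[symmetric])
  also have "\<dots> \<le> (LINT v:{0<..}|lborel. base_D k (y + v) / sqrt v - base_D k (z + v) / sqrt v)"
  proof (rule set_integral_mono)
    fix v :: real assume v: "v \<in> {0<..}"
    have "(z + v - (y + v)) * nderiv (base_D k) (z + v) \<le> base_D k (y + v) - base_D k (z + v)"
      by (rule cmon_diff_bounds(1)[OF base_D_cmon]) (use assms v in auto)
    then have "(z - y) * base_D (Suc k) (z + v) / sqrt v \<le> (base_D k (y + v) - base_D k (z + v)) / sqrt v"
      using v by (intro divide_right_mono) auto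
    then show "(z - y) * (base_D (Suc k) (z + v) / sqrt v) \<le> base_D k (y + v) / sqrt v - base_D k (z + v) / sqrt v"
      by (simp add: diff_divide_distrib)
  next
    show "set_integrable lborel {0<..} (\<lambda>v. (z - y) * (base_D (Suc k) (z + v) / sqrt v))"
      by (rule set_integrable_mult_right, rule int) (use assms in auto)
    show "set_integrable lborel {0<..} (\<lambda>v. base_D k (y + v) / sqrt v - base_D k (z + v) / sqrt v)"
      by (rule set_integral_diff, rule int, use assms in auto, rule int, use assms in auto)
  qed
  also have "\<dots> = half_integral (base_D k) y - half_integral (base_D k) z"
    unfolding half_integral_def using assms int by (intro set_integral_diff) auto
  finally have "(z - y) * half_integral (base_D (Suc k)) z \<le> half_integral (base_D k) y - half_integral (base_D k) z" .
  moreover have "0 < half_integral (base_D (Suc k)) z"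
  proof -
    have "0 < sqrt (z - 1) * base_D (Suc k) (1 + 2 * (z - 1))"
      by (rule mult_pos_pos, use assms in simp, rule base_D_pos, use assms in simp)
    also have "\<dots> \<le> half_integral (base_D (Suc k)) (1 + (z - 1))"
      by (rule half_integral_lower) (use assms in auto)
    finally show ?thesis by simp
  qed
  ultimately show ?thesis using assms by (smt (verit) mult_pos_pos)
qed

lemma hkernel_odd:
  assumes "odd n" "z > 1"
  shows "hkernel n s (arcosh z) = base_D ((n - 1) div 2) z"
  using assms radial_deriv_iterate[of "arcosh z"] by (simp add: hkernel_def)

text \<open>The substitution \<open>cosh r = z + v\<close> absorbs \<open>sinh r dr\<close> into
  \<open>dv\<close> and turns the square root into \<open>sqrt v\<close>.\<close>

lemma hkernel_even:
  assumes "even n" "z > 1"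
  shows "hkernel n s (arcosh z) = half_integral (base_D (n div 2)) z"
proof -
  let ?k = "n div 2" and ?\<rho> = "arcosh z"
  define f where "f r = sinh r / sqrt (cosh r - z) * base_D ?k (cosh r)" for r
  have k: "?k \<ge> 1" using n by linarith
  have int: "set_integrable lborel {0<..} (\<lambda>v. base_D ?k (z + v) / sqrt v)"
    using base_D_half_integrable[OF k] assms(2) by metis
  define g where "g v = arcosh (z + v)" for v
  define g' where "g' v = 1 / sqrt ((z + v)\<^sup>2 - 1)" for v
  have sq: "(z + v)\<^sup>2 - 1 > 0" if "v \<ge> 0" for v
  proof -
    have "1 < z + v" using that assms by simp
    then have "1 < (z + v)\<^sup>2" by (simp add: one_less_power)
    then show ?thesis by simp
  qed
  have fg: "f (g v) * g' v = base_D ?k (z + v) / sqrt v" if "v > 0" for v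
    using that assms sq[of v] less_imp_neq[OF sq[of v]] by (auto simp: f_def g_def g'_def sinh_arcosh_real)
  have "(LBINT r=ereal ?\<rho>..\<infinity>. f r) = (LBINT v=ereal 0..\<infinity>. f (g v) * g' v)"
  proof (rule interval_integral_substitution_nonneg(2))
    show "DERIV g v :> g' v" if "ereal 0 < ereal v" for v
    proof -
      have "DERIV (\<lambda>v. z + v) v :> 1" by (auto intro!: derivative_eq_intros)
      moreover have "1 < z + v" using that assms by simp
      ultimately have "DERIV (\<lambda>v. arcosh (z + v)) v :> 1 / sqrt ((z + v)\<^sup>2 - 1) * 1"
        by (intro DERIV_chain2[where f = arcosh and g = "\<lambda>v. z + v"] DERIV_arcosh')
      then show ?thesis unfolding g_def g'_def by simp
    qed
    show "isCont f (g v)" if "ereal 0 < ereal v" for v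
    proof -
      have gt: "cosh (g v) > z" using that assms by (simp add: g_def)
      have "isCont (\<lambda>r. base_D ?k (cosh r)) (g v)"
        by (rule continuous_at_compose[where f = cosh and g = "base_D ?k", unfolded o_def])
           (use gt assms in \<open>auto intro!: continuous_intros DERIV_isCont[OF base_D_DERIV]\<close>)
      then show ?thesis unfolding f_def using gt by (intro continuous_intros) auto
    qed
    show "isCont g' v" if "ereal 0 < ereal v" for v
      unfolding g'_def using that sq[of v] by (intro continuous_intros) auto
    show "0 \<le> f (g v)" if "ereal 0 < ereal v" for v
      unfolding f_def g_def using that assms base_D_pos[of "z + v" ?k] by (simp add: sinh_arcosh_real)
    show "0 \<le> g' v" if "ereal 0 \<le> ereal v" for v
      unfolding g'_def using that sq[of v] by simp
    have "(g \<longlongrightarrow> arcosh (z + 0)) (at_right 0)"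
      unfolding g_def using assms
      by (intro tendsto_arcosh tendsto_add tendsto_const tendsto_ident_at) auto
    then show "((ereal \<circ> g \<circ> real_of_ereal) \<longlongrightarrow> ereal ?\<rho>) (at_right (ereal 0))"
      by (simp add: ereal_tendsto_simps)
    have "filterlim (\<lambda>v. z + v) at_top at_top"
      by (intro filterlim_tendsto_add_at_top[OF tendsto_const filterlim_ident])
    then have "filterlim g at_top at_top"
      unfolding g_def by (rule filterlim_compose[OF arcosh_real_at_top])
    then show "((ereal \<circ> g \<circ> real_of_ereal) \<longlongrightarrow> \<infinity>) (at_left \<infinity>)"
      by (simp add: ereal_tendsto_simps)
    have "set_integrable lborel {0<..} (\<lambda>v. f (g v) * g' v)"
      using int by (rule set_integrable_cong[THEN iffD1, rotated -1]) (auto simp: fg)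
    then show "set_integrable lborel (einterval (ereal 0) \<infinity>) (\<lambda>v. f (g v) * g' v)" by simp
  qed auto
  then have "(LINT r:{?\<rho><..}|lborel. f r) = (LINT v:{0<..}|lborel. f (g v) * g' v)"
    by (simp add: interval_integral_to_infinity_eq)
  also have "\<dots> = half_integral (base_D ?k) z"
    unfolding half_integral_def by (rule set_lebesgue_integral_cong) (auto simp: fg)
  also have "(LINT r:{?\<rho><..}|lborel. f r) = hkernel n s ?\<rho>"
    unfolding hkernel_def using assms
  proof (simp, intro set_lebesgue_integral_cong allI impI)
    fix r assume r: "r \<in> {?\<rho><..}"
    moreover have "0 \<le> arcosh z" using assms by (intro arcosh_nonneg_real) simp
    ultimately have "r > 0" by simp
    then show "f r = sinh r * (radial_deriv ^^ ?k) (kernel_base n s) r / sqrt (cosh r - z)"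
      by (simp add: f_def radial_deriv_iterate)
  qed simp
  finally show ?thesis .
qed

lemma hkernel_strict_antimono:
  assumes "1 < y" "y < z"
  shows "hkernel n s (arcosh z) < hkernel n s (arcosh y)"
proof (cases "odd n")
  case True
  let ?k = "(n - 1) div 2"
  have "(z - y) * base_D (Suc ?k) z \<le> base_D ?k y - base_D ?k z"
    using cmon_diff_bounds(1)[OF base_D_cmon assms] by simp
  moreover have "(z - y) * base_D (Suc ?k) z > 0" using base_D_pos[of z "Suc ?k"] assms by simp
  ultimately show ?thesis using hkernel_odd[OF True] assms by simp
next
  case False
  then show ?thesis using half_integral_strict_antimono[of "n div 2" y z] hkernel_even assms n by simp
qed

text \<open>Each derivative contributes one factor \<open>1 / w\<close>. In odd dimensions their
  number is \<open>a\<close>; in even dimensions it is \<open>a + 1/2\<close>, and the half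
  integration gives back \<open>sqrt w\<close>. Both parities end with
  \<open>w powr - a\<close>.\<close>

lemma hkernel_comparable:
  obtains c C where "0 < c" "0 < C"
    "\<And>w. 0 < w \<Longrightarrow> c * (w powr - a * base_profile a \<nu> (1 + w)) \<le> hkernel n s (arcosh (1 + w))"
    "\<And>w. 0 < w \<Longrightarrow> hkernel n s (arcosh (1 + w)) \<le> C * (w powr - a * base_profile a \<nu> (1 + w))"
proof (cases "odd n")
  case True
  let ?k = "(n - 1) div 2"
  obtain c C where *: "0 < c" "0 < C" "\<And>w. w > 0 \<Longrightarrow> c * (base_profile a \<nu> (1 + w) / w ^ ?k) \<le> base_D ?k (1 + w)"
    "\<And>w. w > 0 \<Longrightarrow> base_D ?k (1 + w) \<le> C * (base_profile a \<nu> (1 + w) / w ^ ?k)"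
    using nderiv_iterate_comparable[OF base_regular, of ?k] by blast
  have "real ?k = a" using True by (auto simp: a_def elim!: oddE)
  then have "w powr - a = 1 / w ^ ?k" if "w > 0" for w
    using that by (metis powr_minus_divide powr_realpow)
  then show ?thesis using that[of c C] * hkernel_odd[OF True] by simp
next
  case False
  let ?k = "n div 2"
  have k: "?k \<ge> 1" using n by linarith
  obtain C where C: "C > 0"
    "\<And>w. w > 0 \<Longrightarrow> half_integral (base_D ?k) (1 + w) \<le> C * (base_profile a \<nu> (1 + w) * (sqrt w / w ^ ?k))"
    using base_D_half_integrable[OF k] by metis
  obtain c where c: "c > 0" "\<And>w. w > 0 \<Longrightarrow> c * (base_profile a \<nu> (1 + w) / w ^ ?k) \<le> base_D ?k (1 + w)"
    using nderiv_iterate_comparable[OF base_regular, of ?k] by blast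
  obtain D where D: "D > 0" "\<And>w. w > 0 \<Longrightarrow> base_profile a \<nu> (1 + w) \<le> D * base_profile a \<nu> (1 + 2 * w)"
    using base_regular unfolding scaling_regular_def by blast
  have "a = real ?k - 1/2" using False by (auto simp: a_def elim!: evenE)
  then have pw: "sqrt w / w ^ ?k = w powr - a" if "w > 0" for w
    using that by (simp add: powr_realpow[symmetric] powr_half_sqrt[symmetric] powr_diff[symmetric])
  have "c / (2 ^ ?k * D) * (w powr - a * base_profile a \<nu> (1 + w)) \<le> half_integral (base_D ?k) (1 + w)" if w: "w > 0" for w
  proof -
    have "c / (2 ^ ?k * D) * (w powr - a * base_profile a \<nu> (1 + w))
      \<le> c / (2 ^ ?k * D) * (w powr - a * (D * base_profile a \<nu> (1 + 2 * w)))"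
      using c D w by (intro mult_left_mono) auto
    also have "\<dots> = sqrt w * (c * (base_profile a \<nu> (1 + 2 * w) / (2 * w) ^ ?k))"
      using D w by (simp add: pw[symmetric] power_mult_distrib)
    also have "\<dots> \<le> sqrt w * base_D ?k (1 + 2 * w)"
      using c(2)[of "2 * w"] w by (intro mult_left_mono) auto
    also have "\<dots> \<le> half_integral (base_D ?k) (1 + w)" by (rule half_integral_lower[OF k w])
    finally show ?thesis .
  qed
  moreover have "half_integral (base_D ?k) (1 + w) \<le> C * (w powr - a * base_profile a \<nu> (1 + w))" if "w > 0" for w
    using C(2)[OF that] pw[OF that] by (simp add: mult.commute)
  ultimately show ?thesis
    using that[of "c / (2 ^ ?k * D)" C] c C D hkernel_even False by simp
qed

lemma hkernel_pos: "z > 1 \<Longrightarrow> 0 < hkernel n s (arcosh z)"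
proof -
  assume z: "z > 1"
  obtain c where c: "0 < c"
    "\<And>w. 0 < w \<Longrightarrow> c * (w powr - a * base_profile a \<nu> (1 + w)) \<le> hkernel n s (arcosh (1 + w))"
    using hkernel_comparable by metis
  have "0 < c * ((z - 1) powr - a * base_profile a \<nu> (1 + (z - 1)))"
    using c z base_profile_pos[OF a_pos nu_pos(1), of z] by simp
  also have "\<dots> \<le> hkernel n s (arcosh (1 + (z - 1)))" using c(2)[of "z - 1"] z by simp
  finally show ?thesis by simp
qed

lemma hkernel_doubling:
  obtains C where "C > 0"
    "\<And>w. 0 < w \<Longrightarrow> hkernel n s (arcosh (1 + w)) \<le> C * hkernel n s (arcosh (1 + 2 * w))"
proof -
  obtain c C where *: "0 < c" "0 < C"
    "\<And>w. 0 < w \<Longrightarrow> c * (w powr - a * base_profile a \<nu> (1 + w)) \<le> hkernel n s (arcosh (1 + w))"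
    "\<And>w. 0 < w \<Longrightarrow> hkernel n s (arcosh (1 + w)) \<le> C * (w powr - a * base_profile a \<nu> (1 + w))"
    using hkernel_comparable by metis
  obtain D where D: "D > 0" "\<And>w. w > 0 \<Longrightarrow> base_profile a \<nu> (1 + w) \<le> D * base_profile a \<nu> (1 + 2 * w)"
    using base_regular unfolding scaling_regular_def by blast
  have "hkernel n s (arcosh (1 + w)) \<le> (C * D * 2 powr a / c) * hkernel n s (arcosh (1 + 2 * w))" if w: "w > 0" for w
  proof -
    have "hkernel n s (arcosh (1 + w)) \<le> C * (w powr - a * (D * base_profile a \<nu> (1 + 2 * w)))"
      using *(4)[OF w] D w * by (meson mult_left_mono less_imp_le order_trans powr_ge_zero)
    also have "\<dots> = (C * D * 2 powr a / c) * (c * ((2 * w) powr - a * base_profile a \<nu> (1 + 2 * w)))"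
      using w * by (simp add: powr_mult powr_minus field_simps)
    also have "\<dots> \<le> (C * D * 2 powr a / c) * hkernel n s (arcosh (1 + 2 * w))"
      using *(3)[of "2 * w"] w * D by (intro mult_left_mono) auto
    finally show ?thesis .
  qed
  moreover have "C * D * 2 powr a / c > 0" using * D by simp
  ultimately show ?thesis using that by blast
qed

lemma hkernel_near_1:
  obtains c C where "0 < c" "0 < C"
    "\<And>w. 0 < w \<Longrightarrow> w \<le> 1 \<Longrightarrow> c * w powr - (real n / 2 + s) \<le> hkernel n s (arcosh (1 + w))"
    "\<And>w. 0 < w \<Longrightarrow> w \<le> 1 \<Longrightarrow> hkernel n s (arcosh (1 + w)) \<le> C * w powr - (real n / 2 + s)"
proof -
  obtain c C where *: "0 < c" "0 < C"
    "\<And>w. 0 < w \<Longrightarrow> c * (w powr - a * base_profile a \<nu> (1 + w)) \<le> hkernel n s (arcosh (1 + w))"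
    "\<And>w. 0 < w \<Longrightarrow> hkernel n s (arcosh (1 + w)) \<le> C * (w powr - a * base_profile a \<nu> (1 + w))"
    using hkernel_comparable by metis
  obtain d D where B: "0 < d" "0 < D"
    "\<And>w. 0 < w \<Longrightarrow> w \<le> 1 \<Longrightarrow> d * w powr - \<nu> \<le> base_profile a \<nu> (1 + w)"
    "\<And>w. 0 < w \<Longrightarrow> w \<le> 1 \<Longrightarrow> base_profile a \<nu> (1 + w) \<le> D * w powr - \<nu>"
    using base_profile_near_1[OF a_pos nu_pos(1)] by metis
  have e: "w powr - (real n / 2 + s) = w powr - a * w powr - \<nu>" for w
    unfolding powr_add[symmetric] by (rule arg_cong[where f = "(powr) w"]) (simp add: a_def nu_def field_simps)
  have "(c * d) * w powr - (real n / 2 + s) \<le> hkernel n s (arcosh (1 + w))" if w: "0 < w" "w \<le> 1" for w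
  proof -
    have "c * (w powr - a * (d * w powr - \<nu>)) \<le> c * (w powr - a * base_profile a \<nu> (1 + w))"
      using B w * by (intro mult_left_mono) auto
    with *(3)[OF w(1)] show ?thesis unfolding e by (simp add: mult_ac)
  qed
  moreover have "hkernel n s (arcosh (1 + w)) \<le> (C * D) * w powr - (real n / 2 + s)" if w: "0 < w" "w \<le> 1" for w
  proof -
    have "C * (w powr - a * base_profile a \<nu> (1 + w)) \<le> C * (w powr - a * (D * w powr - \<nu>))"
      using B w * by (intro mult_left_mono) auto
    with *(4)[OF w(1)] show ?thesis unfolding e by (simp add: mult_ac)
  qed
  ultimately show ?thesis using that[of "c * d" "C * D"] * B by simp
qed

text \<open>The weight is the order of the volume of a shell at scale \<open>2 ^ k\<close>. Since
  \<open>n - 1 = 2 * a\<close>, one half of it cancels \<open>w powr - a\<close> in the kernel and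
  the other half is left to the decay of the kernel base.\<close>

lemma hkernel_dyadic_summable: "summable (\<lambda>k. (2 ^ k) ^ (n - 1) * hkernel n s (arcosh (1 + 2 ^ k)))"
proof -
  obtain C where C: "0 < C"
    "\<And>w. 0 < w \<Longrightarrow> hkernel n s (arcosh (1 + w)) \<le> C * (w powr - a * base_profile a \<nu> (1 + w))"
    using hkernel_comparable by metis
  have "summable (\<lambda>k. C * (2 powr (a * real k) * base_profile a \<nu> (1 + 2 ^ k)))"
    by (intro summable_mult base_profile_dyadic_summable a_pos nu_pos)
  then show ?thesis
  proof (rule summable_comparison_test'[where N = 0])
    fix k :: nat
    have p: "(2 ^ k) powr - a = 2 powr (- (a * real k))"
      by (simp add: powr_realpow[symmetric] powr_powr mult.commute)
    have q: "(2 ^ k) ^ (n - 1) = (2::real) powr (a * real k + a * real k)"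
    proof -
      have "(2 ^ k) ^ (n - 1) = (2::real) ^ (k * (n - 1))" by (simp add: power_mult)
      also have "\<dots> = 2 powr (real k * (real n - 1))" using n by (subst powr_realpow[symmetric]) (auto simp: of_nat_diff)
      also have "real k * (real n - 1) = a * real k + a * real k" by (simp add: a_def field_simps)
      finally show ?thesis .
    qed
    have "norm ((2 ^ k) ^ (n - 1) * hkernel n s (arcosh (1 + 2 ^ k))) = (2 ^ k) ^ (n - 1) * hkernel n s (arcosh (1 + 2 ^ k))"
      using hkernel_pos[of "1 + 2 ^ k"] by (simp add: abs_mult)
    also have "\<dots> \<le> (2 ^ k) ^ (n - 1) * (C * ((2 ^ k) powr - a * base_profile a \<nu> (1 + 2 ^ k)))"
      using C(2)[of "2 ^ k"] by (intro mult_left_mono) auto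
    also have "\<dots> = C * (2 powr (a * real k) * base_profile a \<nu> (1 + 2 ^ k))"
      unfolding p q powr_add by (simp add: powr_minus)
    finally show "norm ((2 ^ k) ^ (n - 1) * hkernel n s (arcosh (1 + 2 ^ k)))
      \<le> C * (2 powr (a * real k) * base_profile a \<nu> (1 + 2 ^ k))" .
  qed
qed

end

section \<open>The hyperboloid and its volume\<close>

definition mink :: "'m::finite pt \<Rightarrow> 'm pt \<Rightarrow> real" where
  "mink x y = fst x * fst y - snd x \<bullet> snd y"

lemma hdist_eq_mink: "hdist x y = arcosh (mink x y)"
  by (simp add: hdist_def mink_def)

lemma mink_commute: "mink x y = mink y x"
  by (simp add: mink_def inner_commute mult.commute)

lemma mink_triple:
  "mink (x0, x1, x') (y0, y1, y') = x0 * y0 - x1 * y1 - x' \<bullet> y'"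
  by (simp add: mink_def)

lemma hyperboloid_iff: "x \<in> hyperboloid \<longleftrightarrow> mink x x = 1 \<and> fst x > 0"
  by (cases x) (auto simp: hyperboloid_def mink_def power2_norm_eq_inner[symmetric] power2_eq_square[symmetric] norm_Pair algebra_simps)

lemma hyperboloid_fst_sq: "x \<in> hyperboloid \<Longrightarrow> (fst x)\<^sup>2 = 1 + (norm (snd x))\<^sup>2"
  unfolding hyperboloid_iff mink_def power2_norm_eq_inner by (simp add: power2_eq_square)

lemma hyperboloid_fst: "x \<in> hyperboloid \<Longrightarrow> fst x = sqrt (1 + (norm (snd x))\<^sup>2)"
  using hyperboloid_fst_sq[of x] by (auto simp: hyperboloid_iff intro!: real_sqrt_unique[symmetric])

lemma lift_snd: "x \<in> hyperboloid \<Longrightarrow> lift (snd x) = x"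
  unfolding lift_def using hyperboloid_fst[of x] by (simp add: prod_eq_iff)

lemma snd_lift: "snd (lift y) = y"
  by (simp add: lift_def)

lemma lift_in: "lift y \<in> hyperboloid"
  unfolding hyperboloid_iff mink_def lift_def
  by (auto simp: power2_norm_eq_inner add_pos_nonneg power2_eq_square[symmetric])

lemma fst_ge_1: "x \<in> hyperboloid \<Longrightarrow> 1 \<le> fst x"
  using hyperboloid_fst[of x] by simp

lemma norm_snd_less_fst: "x \<in> hyperboloid \<Longrightarrow> norm (snd x) < fst x"
  using hyperboloid_fst_sq[of x] by (auto simp: hyperboloid_iff intro: power2_less_imp_less)

text \<open>The Cauchy-Schwarz inequality loses the factor \<open>fst x - norm (snd x)\<close>,
  whose inverse is \<open>fst x + norm (snd x)\<close> on the hyperboloid. Sets on which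
  \<open>mink x\<close> is bounded are therefore bounded in the ambient space.\<close>

lemma mink_ge_fst:
  assumes "x \<in> hyperboloid" "y \<in> hyperboloid"
  shows "fst y \<le> (fst x + norm (snd x)) * mink x y"
proof -
  let ?a = "fst x" and ?b = "norm (snd x)"
  have "snd x \<bullet> snd y \<le> ?b * norm (snd y)" by (rule norm_cauchy_schwarz)
  also have "\<dots> \<le> ?b * fst y" using norm_snd_less_fst[OF assms(2)] by (intro mult_left_mono) auto
  finally have "(?a - ?b) * fst y \<le> mink x y" by (simp add: mink_def algebra_simps)
  then have "(?a + ?b) * ((?a - ?b) * fst y) \<le> (?a + ?b) * mink x y"
    using assms(1) by (intro mult_left_mono) (auto simp: hyperboloid_iff)
  moreover have "(?a + ?b) * (?a - ?b) = 1"
    using hyperboloid_fst_sq[OF assms(1)] by (simp add: power2_eq_square algebra_simps)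
  ultimately show ?thesis by (simp add: mult.assoc[symmetric])
qed

text \<open>\<open>2 * (mink x y - 1)\<close> is \<open>norm (snd y - snd x)\<close> squared minus
  the squared difference of the first coordinates. On the ball of radius \<open>R\<close> the first
  coordinate has slope at most \<open>sqrt q\<close> with \<open>q < 1\<close>, so a fixed part of
  the spatial square survives.\<close>

lemma mink_lower:
  assumes "x \<in> hyperboloid" "y \<in> hyperboloid" "norm (snd x) \<le> R" "norm (snd y) \<le> R"
  shows "(norm (snd y - snd x))\<^sup>2 \<le> 2 * (1 + R\<^sup>2) * (mink x y - 1)"
proof -
  let ?a = "norm (snd x)" and ?b = "norm (snd y)"
  have R: "0 \<le> R" using assms(3) norm_ge_zero order_trans by blast
  define q where "q = R\<^sup>2 / (1 + R\<^sup>2)"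
  have pos: "fst x > 0" "fst y > 0" using assms by (auto simp: hyperboloid_iff)
  have sq: "c\<^sup>2 \<le> q * d\<^sup>2" if "d\<^sup>2 = 1 + c\<^sup>2" "0 \<le> c" "c \<le> R" for c d :: real
  proof -
    have "c\<^sup>2 \<le> R\<^sup>2" using that by (intro power_mono) auto
    then have "c\<^sup>2 * (1 + R\<^sup>2) \<le> R\<^sup>2 * (1 + c\<^sup>2)" by (simp add: algebra_simps)
    then show ?thesis unfolding q_def that(1) by (simp add: pos_le_divide_eq add_pos_nonneg)
  qed
  have "?a\<^sup>2 \<le> q * (fst x)\<^sup>2" "?b\<^sup>2 \<le> q * (fst y)\<^sup>2"
    using assms sq[OF hyperboloid_fst_sq[OF assms(1)]] sq[OF hyperboloid_fst_sq[OF assms(2)]] by simp_all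
  then have "sqrt (?a\<^sup>2) \<le> sqrt (q * (fst x)\<^sup>2)" "sqrt (?b\<^sup>2) \<le> sqrt (q * (fst y)\<^sup>2)"
    by (meson real_sqrt_le_mono)+
  then have ab: "?a + ?b \<le> sqrt q * (fst x + fst y)"
    using pos by (simp add: real_sqrt_mult algebra_simps)
  have "\<bar>?b - ?a\<bar> \<le> norm (snd y - snd x)" by (rule norm_triangle_ineq3)
  then have "\<bar>?b - ?a\<bar> * (?a + ?b) \<le> norm (snd y - snd x) * (sqrt q * (fst x + fst y))"
    using ab by (intro mult_mono) auto
  moreover have "(fst y - fst x) * (fst x + fst y) = (?b - ?a) * (?a + ?b)"
    using hyperboloid_fst_sq[OF assms(1)] hyperboloid_fst_sq[OF assms(2)]
    by (simp add: power2_eq_square algebra_simps)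
  then have "\<bar>fst y - fst x\<bar> * \<bar>fst x + fst y\<bar> = \<bar>?b - ?a\<bar> * \<bar>?a + ?b\<bar>"
    by (simp only: abs_mult[symmetric])
  then have "\<bar>fst y - fst x\<bar> * (fst x + fst y) = \<bar>?b - ?a\<bar> * (?a + ?b)"
    using pos by simp
  ultimately have "\<bar>fst y - fst x\<bar> * (fst x + fst y) \<le> (norm (snd y - snd x) * sqrt q) * (fst x + fst y)"
    by (simp add: mult.assoc)
  then have "\<bar>fst y - fst x\<bar> \<le> norm (snd y - snd x) * sqrt q" using pos by simp
  then have "\<bar>fst y - fst x\<bar>\<^sup>2 \<le> (norm (snd y - snd x) * sqrt q)\<^sup>2" by (rule power_mono) simp
  moreover have q0: "q \<ge> 0" unfolding q_def by simp
  ultimately have "(fst y - fst x)\<^sup>2 \<le> (norm (snd y - snd x))\<^sup>2 * q" by (simp add: power_mult_distrib)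
  moreover have "2 * (mink x y - 1) = (norm (snd y - snd x))\<^sup>2 - (fst y - fst x)\<^sup>2"
    using hyperboloid_fst_sq[OF assms(1)] hyperboloid_fst_sq[OF assms(2)]
    unfolding power2_norm_eq_inner mink_def
    by (simp add: power2_eq_square algebra_simps inner_commute)
  ultimately have "(norm (snd y - snd x))\<^sup>2 * (1 - q) \<le> 2 * (mink x y - 1)" by (simp add: algebra_simps)
  moreover have "(1 - q) * (1 + R\<^sup>2) = 1"
    unfolding q_def using add_pos_nonneg[of 1 "R\<^sup>2"] by (simp add: field_simps)
  ultimately have "(norm (snd y - snd x))\<^sup>2 * (1 - q) * (1 + R\<^sup>2) \<le> 2 * (mink x y - 1) * (1 + R\<^sup>2)"
    by (intro mult_right_mono) auto
  with \<open>(1 - q) * (1 + R\<^sup>2) = 1\<close> have "(norm (snd y - snd x))\<^sup>2 \<le> 2 * (mink x y - 1) * (1 + R\<^sup>2)"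
    by (simp only: mult.assoc mult_1_right)
  then show ?thesis by (simp only: mult_ac)
qed

lemma mink_ge_1:
  assumes "x \<in> hyperboloid" "y \<in> hyperboloid"
  shows "1 \<le> mink x y"
proof -
  let ?R = "max (norm (snd x)) (norm (snd y))"
  have "0 \<le> 2 * (1 + ?R\<^sup>2) * (mink x y - 1)"
    by (rule order_trans[OF zero_le_power2 mink_lower[OF assms]]) auto
  moreover have "0 < 2 * (1 + ?R\<^sup>2)" by (simp add: add_pos_nonneg)
  ultimately show ?thesis by (simp add: zero_le_mult_iff)
qed

lemma mink_gt_1:
  assumes "x \<in> hyperboloid" "y \<in> hyperboloid" "x \<noteq> y"
  shows "1 < mink x y"
proof (rule ccontr)
  assume "\<not> 1 < mink x y"
  then have "mink x y = 1" using mink_ge_1[OF assms(1,2)] by simp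
  then have "snd y = snd x"
    using mink_lower[OF assms(1,2), of "max (norm (snd x)) (norm (snd y))"] by simp
  then show False using assms lift_snd by metis
qed

lemma mink_self: "x \<in> hyperboloid \<Longrightarrow> mink x x = 1"
  by (simp add: hyperboloid_iff)

lemma continuous_mink [continuous_intros]:
  "continuous_on S f \<Longrightarrow> continuous_on S g \<Longrightarrow> continuous_on S (\<lambda>z. mink (f z) (g z))"
  unfolding mink_def by (intro continuous_intros)

lemma mink_measurable [measurable]: "mink x \<in> borel_measurable borel"
  by (intro borel_measurable_continuous_onI continuous_intros)

text \<open>The volume before completion: isometries are shown to preserve this Borel measure, and
  the completion inherits it.\<close>

definition hyp_meas :: "'m::finite pt measure" where
  "hyp_meas = distr (density lborel (\<lambda>y. ennreal (1 / sqrt (1 + (norm y)\<^sup>2))))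
            (restrict_space borel hyperboloid) lift"

lemma hvol_eq: "hvol = completion hyp_meas"
  by (simp add: hvol_def hyp_meas_def)

lemma space_hyp_meas [simp]: "space hyp_meas = hyperboloid"
  and sets_hyp_meas [measurable_cong]: "sets hyp_meas = sets (restrict_space borel hyperboloid)"
  by (auto simp: hyp_meas_def space_restrict_space)

lemma space_hvol [simp]: "space hvol = hyperboloid"
  by (simp add: hvol_eq)

lemma measurable_into_hyp:
  "f \<in> borel_measurable M \<Longrightarrow> (\<And>x. x \<in> space M \<Longrightarrow> f x \<in> hyperboloid) \<Longrightarrow>
    f \<in> M \<rightarrow>\<^sub>M restrict_space borel hyperboloid"
  by (intro measurable_restrict_space2) auto

lemma lift_measurable [measurable]: "lift \<in> borel_measurable borel"
  unfolding lift_def by (intro borel_measurable_continuous_onI continuous_intros)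

text \<open>Horospherical coordinates: \<open>x\<^sub>0 - x\<^sub>1 = e\<^sup>-\<^sup>r\<close> and \<open>x' = v\<close>. The volume becomes \<open>dr dv\<close>.\<close>

definition horo :: "real \<times> (real, 'm::finite) vec \<Rightarrow> 'm pt" where
  "horo = (\<lambda>(r, v). (cosh r + exp r * (norm v)\<^sup>2 / 2, sinh r + exp r * (norm v)\<^sup>2 / 2, v))"

lemma horo_identity:
  "(cosh r + exp r * b / 2)\<^sup>2 = 1 + (sinh r + exp r * b / 2)\<^sup>2 + (b::real)"
proof -
  have "(cosh r + exp r * b / 2)\<^sup>2 - (sinh r + exp r * b / 2)\<^sup>2
    = (cosh r ^ 2 - sinh r ^ 2) + exp r * (cosh r - sinh r) * b"
    by (simp add: power2_eq_square algebra_simps)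
  also have "\<dots> = 1 + b"
    by (simp add: hyperbolic_pythagoras cosh_minus_sinh exp_minus)
  finally show ?thesis by simp
qed

lemma horo_pos: "0 \<le> b \<Longrightarrow> 0 < cosh r + exp r * b / (2::real)"
  by (intro add_pos_nonneg cosh_real_pos) auto

lemma horo_in: "horo p \<in> hyperboloid"
proof (cases p)
  case (Pair r v)
  show ?thesis using horo_identity[of r "(norm v)\<^sup>2"] horo_pos[of "(norm v)\<^sup>2" r]
    by (simp add: Pair horo_def hyperboloid_def algebra_simps)
qed

lemma horo_measurable [measurable]: "horo \<in> borel_measurable borel"
  unfolding horo_def case_prod_beta
  by (intro borel_measurable_continuous_onI continuous_intros) simp_all

text \<open>Exhaustion by the intervals between \<open>- k (Suc i)\<close> and
  \<open>k (Suc i)\<close> with monotone convergence on both sides; \<open>Suc\<close> keeps these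
  intervals nondegenerate, as the substitution rule on intervals requires.\<close>

lemma nn_integral_substitution_line:
  fixes g g' :: "real \<Rightarrow> real" and f :: "real \<Rightarrow> ennreal"
  assumes f: "f \<in> borel_measurable borel"
    and g: "\<And>x. (g has_real_derivative g' x) (at x)" and g': "continuous_on UNIV g'" "\<And>x. 0 \<le> g' x"
    and top: "filterlim g at_top at_top" and bot: "filterlim g at_bot at_bot"
  shows "(\<integral>\<^sup>+t. f t \<partial>lborel) = (\<integral>\<^sup>+r. f (g r) * ennreal (g' r) \<partial>lborel)"
proof -
  have mono: "g x \<le> g y" if "x \<le> y" for x y
    using that by (rule DERIV_nonneg_imp_nondecreasing) (use g g' in blast)
  have gm: "g \<in> borel_measurable borel" "g' \<in> borel_measurable borel"
    using g g' by (auto intro!: borel_measurable_continuous_onI continuous_at_imp_continuous_on DERIV_isCont)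
  define k where "k i = real i" for i
  have ends: "\<exists>i. g (- k i) \<le> t \<and> t \<le> g (k i)" for t
  proof -
    have "\<forall>\<^sub>F x in at_top. t \<le> g x" using top by (simp add: filterlim_at_top)
    then obtain N where N: "\<And>x. x \<ge> N \<Longrightarrow> t \<le> g x" unfolding eventually_at_top_linorder by blast
    have "\<forall>\<^sub>F x in at_bot. g x \<le> t" using bot by (simp add: filterlim_at_bot)
    then obtain M where M: "\<And>x. x \<le> M \<Longrightarrow> g x \<le> t" unfolding eventually_at_bot_linorder by blast
    obtain i :: nat where "real i \<ge> max N (- M)" using real_arch_simple by blast
    then show ?thesis using N[of "k i"] M[of "- k i"] by (intro exI[of _ i]) (auto simp: k_def)
  qed
  have sup1: "(SUP i. f t * indicator {g (- k (Suc i))..g (k (Suc i))} t) = f t" for t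
  proof (rule antisym)
    obtain i where i: "g (- k i) \<le> t" "t \<le> g (k i)" using ends by blast
    have "g (- k (Suc i)) \<le> g (- k i)" "g (k i) \<le> g (k (Suc i))" by (rule mono; simp add: k_def)+
    with i have "f t = f t * indicator {g (- k (Suc i))..g (k (Suc i))} t" by (simp add: indicator_def)
    then show "f t \<le> (SUP i. f t * indicator {g (- k (Suc i))..g (k (Suc i))} t)"
      by (metis (no_types, lifting) SUP_upper UNIV_I)
  qed (auto intro!: SUP_least simp: indicator_def)
  have sup2: "(SUP i. f (g r) * ennreal (g' r) * indicator {- k (Suc i)..k (Suc i)} r) = f (g r) * ennreal (g' r)" for r
  proof (rule antisym)
    obtain i :: nat where "real i \<ge> \<bar>r\<bar>" using real_arch_simple by blast
    then have "f (g r) * ennreal (g' r) = f (g r) * ennreal (g' r) * indicator {- k (Suc i)..k (Suc i)} r"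
      by (auto simp: indicator_def k_def)
    then show "f (g r) * ennreal (g' r) \<le> (SUP i. f (g r) * ennreal (g' r) * indicator {- k (Suc i)..k (Suc i)} r)"
      by (metis (no_types, lifting) SUP_upper UNIV_I)
  qed (auto intro!: SUP_least simp: indicator_def)
  have "(\<integral>\<^sup>+t. f t \<partial>lborel) = (\<integral>\<^sup>+t. (SUP i. f t * indicator {g (- k (Suc i))..g (k (Suc i))} t) \<partial>lborel)"
    by (simp only: sup1)
  also have "\<dots> = (SUP i. \<integral>\<^sup>+t. f t * indicator {g (- k (Suc i))..g (k (Suc i))} t \<partial>lborel)"
  proof (rule nn_integral_monotone_convergence_SUP)
    show "incseq (\<lambda>i t. f t * indicator {g (- k (Suc i))..g (k (Suc i))} t)"
    proof (intro incseq_SucI le_funI mult_left_mono indicator_leI)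
      fix i t
      have "g (- k (Suc (Suc i))) \<le> g (- k (Suc i))" "g (k (Suc i)) \<le> g (k (Suc (Suc i)))"
        by (rule mono; simp add: k_def)+
      then show "t \<in> {g (- k (Suc i))..g (k (Suc i))} \<Longrightarrow> t \<in> {g (- k (Suc (Suc i)))..g (k (Suc (Suc i)))}" by simp
    qed auto
  qed (use f in measurable)
  also have "\<dots> = (SUP i. \<integral>\<^sup>+r. f (g r) * ennreal (g' r) * indicator {- k (Suc i)..k (Suc i)} r \<partial>lborel)"
    by (intro SUP_cong refl nn_integral_substitution_aux f g continuous_on_subset[OF g'(1)] g'(2))
       (auto simp: k_def)
  also have "\<dots> = (\<integral>\<^sup>+r. (SUP i. f (g r) * ennreal (g' r) * indicator {- k (Suc i)..k (Suc i)} r) \<partial>lborel)"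
  proof (rule nn_integral_monotone_convergence_SUP[symmetric])
    show "incseq (\<lambda>i r. f (g r) * ennreal (g' r) * indicator {- k (Suc i)..k (Suc i)} r)"
      by (intro incseq_SucI le_funI mult_left_mono indicator_leI) (auto simp: k_def)
  qed (use f gm in measurable)
  also have "\<dots> = (\<integral>\<^sup>+r. f (g r) * ennreal (g' r) \<partial>lborel)" by (simp only: sup2)
  finally show ?thesis .
qed

text \<open>By \<open>horo_identity\<close> the square root in the density equals the derivative of
  the substitution, so the two cancel and leave Lebesgue measure.\<close>

lemma nn_integral_horo_line:
  fixes f :: "real \<Rightarrow> ennreal"
  assumes f: "f \<in> borel_measurable borel" and b: "0 \<le> b"
  shows "(\<integral>\<^sup>+t. f t * ennreal (1 / sqrt (1 + t\<^sup>2 + b)) \<partial>lborel)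
    = (\<integral>\<^sup>+r. f (sinh r + exp r * b / 2) \<partial>lborel)"
proof -
  let ?g = "\<lambda>r. sinh r + exp r * b / 2" and ?g' = "\<lambda>r. cosh r + exp r * b / 2"
  have sq: "sqrt (1 + (?g r)\<^sup>2 + b) = ?g' r" for r
    unfolding horo_identity[symmetric] using horo_pos[OF b] by (simp add: less_imp_le)
  have "(\<integral>\<^sup>+t. f t * ennreal (1 / sqrt (1 + t\<^sup>2 + b)) \<partial>lborel)
    = (\<integral>\<^sup>+r. f (?g r) * ennreal (1 / sqrt (1 + (?g r)\<^sup>2 + b)) * ennreal (?g' r) \<partial>lborel)"
  proof (rule nn_integral_substitution_line)
    show "(\<lambda>t. f t * ennreal (1 / sqrt (1 + t\<^sup>2 + b))) \<in> borel_measurable borel" using f by measurable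
    show "(?g has_real_derivative ?g' r) (at r)" for r by (auto intro!: derivative_eq_intros)
    show "continuous_on UNIV ?g'" by (intro continuous_intros) simp
    show "0 \<le> ?g' r" for r using horo_pos[OF b] by (rule less_imp_le)
    show "filterlim ?g at_top at_top"
      by (rule filterlim_at_top_mono[OF sinh_real_at_top]) (use b in simp)
    show "filterlim ?g at_bot at_bot"
      unfolding filterlim_at_bot
    proof
      fix Z :: real
      have "\<forall>\<^sub>F r::real in at_bot. sinh r \<le> Z - b / 2"
        using sinh_real_at_bot by (simp add: filterlim_at_bot)
      moreover have "\<forall>\<^sub>F r::real in at_bot. r \<le> 0" by (rule eventually_le_at_bot)
      ultimately show "\<forall>\<^sub>F r in at_bot. ?g r \<le> Z"
      proof eventually_elim
        case (elim r)
        have "exp r * b \<le> 1 * b" using elim b by (intro mult_right_mono) auto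
        then show ?case using elim by simp
      qed
    qed
  qed
  also have "\<dots> = (\<integral>\<^sup>+r. f (?g r) \<partial>lborel)"
  proof (rule nn_integral_cong)
    fix r
    have "ennreal (1 / ?g' r) * ennreal (?g' r) = 1"
      using horo_pos[OF b, of r] by (simp add: ennreal_mult[symmetric])
    then show "f (?g r) * ennreal (1 / sqrt (1 + (?g r)\<^sup>2 + b)) * ennreal (?g' r) = f (?g r)"
      unfolding sq by (simp add: mult.assoc)
  qed
  finally show ?thesis .
qed

lemma norm_pair_sq: "(norm (t, v))\<^sup>2 = t\<^sup>2 + (norm v)\<^sup>2" for t :: real
  by (simp add: norm_Pair)

lemma horo_eq_lift: "horo (r, v) = lift (sinh r + exp r * (norm v)\<^sup>2 / 2, v)"
proof -
  have "horo (r, v) = lift (snd (horo (r, v)))" by (rule lift_snd[OF horo_in, symmetric])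
  then show ?thesis by (simp add: horo_def)
qed

lemma closed_hyperboloid: "closed (hyperboloid :: 'm::finite pt set)"
proof -
  have "{x. mink x x = 1} \<inter> {x. 0 \<le> fst x} = (hyperboloid :: 'm pt set)"
  proof (auto simp: hyperboloid_iff)
    fix a b c assume "mink (a, b, c :: (real, 'm) vec) (a, b, c) = 1" "0 \<le> a"
    then have "a * a = 1 + (b * b + c \<bullet> c)" by (simp add: mink_triple)
    moreover have "0 \<le> b * b" "0 \<le> c \<bullet> c" by auto
    ultimately show "0 < a" using \<open>0 \<le> a\<close> by (cases "a = 0") auto
  qed
  moreover have "closed ({x :: 'm pt. mink x x = 1} \<inter> {x. 0 \<le> fst x})"
    by (intro closed_Int closed_Collect_eq closed_Collect_le continuous_intros)
  ultimately show ?thesis by simp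
qed

lemma hyperboloid_borel [measurable]: "hyperboloid \<in> sets borel"
  using closed_hyperboloid by (rule borel_closed)

lemma sets_hyp_meas_iff: "A \<in> sets hyp_meas \<longleftrightarrow> A \<in> sets borel \<and> A \<subseteq> hyperboloid"
  unfolding sets_hyp_meas using hyperboloid_borel by (subst sets_restrict_space_iff) auto

lemma nn_integral_lborel_pair:
  fixes f :: "real \<times> 'a::euclidean_space \<Rightarrow> ennreal"
  assumes "f \<in> borel_measurable borel"
  shows "(\<integral>\<^sup>+p. f p \<partial>lborel) = (\<integral>\<^sup>+v. \<integral>\<^sup>+t. f (t, v) \<partial>lborel \<partial>lborel)"
    "(\<integral>\<^sup>+p. f p \<partial>lborel) = (\<integral>\<^sup>+t. \<integral>\<^sup>+v. f (t, v) \<partial>lborel \<partial>lborel)"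
proof -
  have f: "f \<in> borel_measurable (lborel \<Otimes>\<^sub>M lborel)" using assms by (simp add: lborel_prod)
  have f': "(\<lambda>(t, v). f (t, v)) \<in> borel_measurable (lborel \<Otimes>\<^sub>M lborel)" using f by simp
  show "(\<integral>\<^sup>+p. f p \<partial>lborel) = (\<integral>\<^sup>+v. \<integral>\<^sup>+t. f (t, v) \<partial>lborel \<partial>lborel)"
    using lborel_pair.nn_integral_snd[OF f'] by (simp add: lborel_prod)
  show "(\<integral>\<^sup>+p. f p \<partial>lborel) = (\<integral>\<^sup>+t. \<integral>\<^sup>+v. f (t, v) \<partial>lborel \<partial>lborel)"
    using lborel.nn_integral_fst[OF f] by (simp add: lborel_prod)
qed

lemma nn_integral_hyp_meas:
  assumes "f \<in> borel_measurable hyp_meas"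
  shows "(\<integral>\<^sup>+x. f x \<partial>hyp_meas) = (\<integral>\<^sup>+y. ennreal (1 / sqrt (1 + (norm y)\<^sup>2)) * f (lift y) \<partial>lborel)"
proof -
  have l: "lift \<in> borel \<rightarrow>\<^sub>M restrict_space borel hyperboloid"
    by (intro measurable_into_hyp lift_measurable lift_in)
  have f: "f \<in> borel_measurable (restrict_space borel hyperboloid)"
    using assms by (simp cong: measurable_cong_sets add: sets_hyp_meas)
  have fl: "(\<lambda>y. f (lift y)) \<in> borel_measurable borel" using measurable_compose[OF l f] .
  show ?thesis unfolding hyp_meas_def
    using l f fl by (subst nn_integral_distr) (auto simp: nn_integral_density)
qed

lemma hyp_meas_horo: "hyp_meas = distr lborel (restrict_space borel hyperboloid) (horo :: _ \<Rightarrow> 'm::finite pt)"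
proof (rule measure_eqI)
  fix A :: "'m pt set" assume A: "A \<in> sets hyp_meas"
  then have Ab [measurable]: "A \<in> sets borel" by (simp add: sets_hyp_meas_iff)
  have h: "horo \<in> borel \<rightarrow>\<^sub>M restrict_space borel (hyperboloid :: 'm pt set)"
    by (intro measurable_into_hyp horo_measurable horo_in)
  have "emeasure hyp_meas A = (\<integral>\<^sup>+x. indicator A x \<partial>hyp_meas)" using A by simp
  also have "\<dots> = (\<integral>\<^sup>+y. ennreal (1 / sqrt (1 + (norm y)\<^sup>2)) * indicator A (lift y) \<partial>lborel)"
    using A by (intro nn_integral_hyp_meas) simp
  also have "\<dots> = (\<integral>\<^sup>+v. \<integral>\<^sup>+t. ennreal (1 / sqrt (1 + (norm (t, v))\<^sup>2)) * indicator A (lift (t, v)) \<partial>lborel \<partial>lborel)"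
    by (rule nn_integral_lborel_pair) measurable
  also have "\<dots> = (\<integral>\<^sup>+v. \<integral>\<^sup>+r. indicator A (horo (r, v)) \<partial>lborel \<partial>lborel)"
  proof (rule nn_integral_cong)
    fix v :: "(real, 'm) vec"
    have "(\<lambda>t. indicator A (lift (t, v)) :: ennreal) \<in> borel_measurable borel" by measurable
    from nn_integral_horo_line[OF this, of "(norm v)\<^sup>2"]
    show "(\<integral>\<^sup>+t. ennreal (1 / sqrt (1 + (norm (t, v))\<^sup>2)) * indicator A (lift (t, v)) \<partial>lborel)
      = (\<integral>\<^sup>+r. indicator A (horo (r, v)) \<partial>lborel)"
      by (simp add: norm_pair_sq horo_eq_lift mult.commute add.assoc)
  qed
  also have "\<dots> = (\<integral>\<^sup>+p. indicator A (horo p) \<partial>lborel)"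
    by (rule nn_integral_lborel_pair(1)[symmetric]) measurable
  also have "\<dots> = (\<integral>\<^sup>+x. indicator A x \<partial>distr lborel (restrict_space borel hyperboloid) horo)"
    using h A by (subst nn_integral_distr) (auto simp: sets_hyp_meas)
  also have "\<dots> = emeasure (distr lborel (restrict_space borel hyperboloid) horo) A"
    using A by (simp add: sets_hyp_meas)
  finally show "emeasure hyp_meas A = emeasure (distr lborel (restrict_space borel hyperboloid) horo) A" .
qed (simp add: sets_hyp_meas)

section \<open>Isometries\<close>

lemma horo_surj:
  assumes "x \<in> hyperboloid"
  obtains p where "x = horo p"
proof -
  obtain a b v where x: "x = (a, b, v)" by (cases x)
  have e: "a\<^sup>2 - b\<^sup>2 - (norm v)\<^sup>2 = 1" "a > 0" using assms by (auto simp: x hyperboloid_def)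
  have "\<bar>b\<bar>\<^sup>2 < a\<^sup>2" using e(1) zero_le_power2[of "norm v"] unfolding power2_abs by linarith
  then have "\<bar>b\<bar> < a" using e(2) by (intro power2_less_imp_less[of "\<bar>b\<bar>" a]) simp_all
  then have k: "a - b > 0" by simp
  define r where "r = - ln (a - b)"
  have r: "exp (- r) = a - b" "exp r = 1 / (a - b)" using k by (auto simp: r_def exp_minus inverse_eq_divide)
  have s: "(a - b) * (a + b) = 1 + (norm v)\<^sup>2" using e by (simp add: power2_eq_square algebra_simps)
  then have "a + b = (1 + (norm v)\<^sup>2) / (a - b)" using k by (simp add: field_simps)
  then have e3: "exp r + exp r * (norm v)\<^sup>2 = a + b" unfolding r by (simp add: add_divide_distrib)
  have "cosh r + exp r * (norm v)\<^sup>2 / 2 = ((exp r + exp r * (norm v)\<^sup>2) + exp (- r)) / 2"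
    "sinh r + exp r * (norm v)\<^sup>2 / 2 = ((exp r + exp r * (norm v)\<^sup>2) - exp (- r)) / 2"
    by (simp_all add: cosh_field_def sinh_field_def add_divide_distrib diff_divide_distrib)
  then have "horo (r, v) = x" unfolding horo_def x e3 r(1) by simp
  then show ?thesis using that by metis
qed

text \<open>The product is to be preserved on the whole ambient space, so that spacelike vectors
  such as leaf normals can be moved along with the points.\<close>

definition hyp_iso :: "('m::finite pt \<Rightarrow> 'm pt) \<Rightarrow> bool" where
  "hyp_iso g \<longleftrightarrow> (\<forall>x y. mink (g x) (g y) = mink x y) \<and> (\<forall>x\<in>hyperboloid. g x \<in> hyperboloid) \<and>
    g \<in> hyp_meas \<rightarrow>\<^sub>M hyp_meas \<and> distr hyp_meas hyp_meas g = hyp_meas"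

lemma hyp_iso_mink: "hyp_iso g \<Longrightarrow> mink (g x) (g y) = mink x y"
  and hyp_iso_in: "hyp_iso g \<Longrightarrow> x \<in> hyperboloid \<Longrightarrow> g x \<in> hyperboloid"
  unfolding hyp_iso_def by blast+

lemma hyp_iso_comp: "hyp_iso g \<Longrightarrow> hyp_iso h \<Longrightarrow> hyp_iso (\<lambda>x. g (h x))"
proof -
  assume g: "hyp_iso g" and h: "hyp_iso h"
  have "distr hyp_meas hyp_meas (g \<circ> h) = distr (distr hyp_meas hyp_meas h) hyp_meas g"
    using g h by (intro distr_distr[symmetric]) (auto simp: hyp_iso_def)
  also have "\<dots> = hyp_meas" using g h by (simp add: hyp_iso_def)
  finally have "distr hyp_meas hyp_meas (\<lambda>x. g (h x)) = hyp_meas" by (simp add: o_def)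
  moreover have "(\<lambda>x. g (h x)) \<in> hyp_meas \<rightarrow>\<^sub>M hyp_meas"
    by (rule measurable_compose[of h _ hyp_meas]) (use g h in \<open>simp_all add: hyp_iso_def\<close>)
  ultimately show ?thesis
    unfolding hyp_iso_def[of "\<lambda>x. g (h x)"]
    by (intro conjI allI ballI)
       (simp_all only: hyp_iso_mink[OF g] hyp_iso_mink[OF h] hyp_iso_in[OF g] hyp_iso_in[OF h])
qed

lemma measurable_hyp_meas: "g \<in> M \<rightarrow>\<^sub>M hyp_meas \<longleftrightarrow> g \<in> M \<rightarrow>\<^sub>M restrict_space borel hyperboloid"
  by (intro arg_cong2[where f = "(\<in>)"] refl measurable_cong_sets sets_hyp_meas)

text \<open>In horospherical coordinates the volume is Lebesgue measure, so it suffices that the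
  coordinate expression \<open>T\<close> of the map preserves Lebesgue measure. For the generators
  below \<open>T\<close> is a translation or reflection on each fibre.\<close>

lemma hyp_isoI_horo:
  fixes g :: "'m::finite pt \<Rightarrow> 'm pt"
  assumes mink: "\<And>x y. mink (g x) (g y) = mink x y" and g: "g \<in> borel_measurable borel"
    and T: "T \<in> borel_measurable borel" "distr lborel borel T = lborel"
    and gh: "\<And>p. g (horo p) = horo (T p)"
  shows "hyp_iso g"
proof -
  have "g x \<in> hyperboloid" if x: "x \<in> hyperboloid" for x
    using horo_surj[OF x] gh horo_in by metis
  then have gm: "g \<in> hyp_meas \<rightarrow>\<^sub>M hyp_meas"
    unfolding measurable_hyp_meas
    by (intro measurable_into_hyp) (use g in \<open>auto simp: measurable_restrict_space1 cong: measurable_cong_sets[OF sets_hyp_meas refl]\<close>)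
  have hm: "horo \<in> lborel \<rightarrow>\<^sub>M (hyp_meas :: 'm pt measure)"
    unfolding measurable_hyp_meas by (intro measurable_into_hyp horo_in) simp
  have hd: "distr lborel hyp_meas horo = (hyp_meas :: 'm pt measure)"
    by (subst (2) hyp_meas_horo) (rule distr_cong, auto simp: sets_hyp_meas)
  have Tm: "T \<in> lborel \<rightarrow>\<^sub>M lborel" "distr lborel lborel T = lborel"
    using T by (simp_all cong: distr_cong)
  have "distr hyp_meas hyp_meas g = distr (distr lborel hyp_meas horo) hyp_meas g" by (simp add: hd)
  also have "\<dots> = distr lborel hyp_meas (g \<circ> horo)" by (rule distr_distr[OF gm hm])
  also have "g \<circ> horo = horo \<circ> T" by (auto simp: gh)
  also have "distr lborel hyp_meas (horo \<circ> T) = distr (distr lborel lborel T) hyp_meas horo"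
    by (rule distr_distr[symmetric, OF hm Tm(1)])
  also have "\<dots> = hyp_meas" by (simp add: Tm(2) hd)
  finally show ?thesis using mink gm measurable_space[OF gm] by (simp add: hyp_iso_def)
qed

lemma nn_integral_preserved:
  fixes h :: "'a::euclidean_space \<Rightarrow> 'a" and f :: "'a \<Rightarrow> ennreal"
  assumes "h \<in> borel_measurable borel" "distr lborel borel h = lborel" "f \<in> borel_measurable borel"
  shows "(\<integral>\<^sup>+x. f (h x) \<partial>lborel) = (\<integral>\<^sup>+x. f x \<partial>lborel)"
proof -
  have "(\<integral>\<^sup>+x. f x \<partial>distr lborel borel h) = (\<integral>\<^sup>+x. f (h x) \<partial>lborel)"
    by (rule nn_integral_distr) (use assms in auto)
  then show ?thesis unfolding assms(2) by (rule sym)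
qed

lemma lborel_fiber_snd:
  fixes h :: "real \<Rightarrow> 'a::euclidean_space \<Rightarrow> 'a"
  assumes T: "(\<lambda>(r, v). (r, h r v)) \<in> borel_measurable borel"
    and h: "\<And>r. h r \<in> borel_measurable borel" "\<And>r. distr lborel borel (h r) = lborel"
  shows "distr lborel borel (\<lambda>(r, v). (r, h r v)) = lborel"
proof (rule measure_eqI)
  let ?T = "\<lambda>(r, v). (r, h r v)"
  fix A assume "A \<in> sets (distr lborel borel ?T)"
  then have A [measurable]: "A \<in> sets borel" by simp
  have fT: "(\<lambda>p. indicator A (?T p) :: ennreal) \<in> borel_measurable borel"
    by (rule measurable_compose[OF T]) measurable
  have "emeasure (distr lborel borel ?T) A = (\<integral>\<^sup>+x. indicator A x \<partial>distr lborel borel ?T)" by simp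
  also have "\<dots> = (\<integral>\<^sup>+p. indicator A (?T p) \<partial>lborel)" using T by (intro nn_integral_distr) auto
  also have "\<dots> = (\<integral>\<^sup>+r. \<integral>\<^sup>+v. indicator A (?T (r, v)) \<partial>lborel \<partial>lborel)"
    by (rule nn_integral_lborel_pair(2)[OF fT])
  also have "\<dots> = (\<integral>\<^sup>+r. \<integral>\<^sup>+v. indicator A (r, v) \<partial>lborel \<partial>lborel)"
  proof (rule nn_integral_cong)
    fix r
    have "(\<lambda>v. indicator A (r, v) :: ennreal) \<in> borel_measurable borel" by measurable
    from nn_integral_preserved[OF h this, of r]
    show "(\<integral>\<^sup>+v. indicator A (?T (r, v)) \<partial>lborel) = (\<integral>\<^sup>+v. indicator A (r, v) \<partial>lborel)" by simp
  qed
  also have "\<dots> = (\<integral>\<^sup>+p. indicator A p \<partial>lborel)"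
    by (rule nn_integral_lborel_pair(2)[of "indicator A", symmetric]) measurable
  finally show "emeasure (distr lborel borel ?T) A = emeasure lborel A" by simp
qed simp

lemma lborel_fiber_fst:
  fixes h :: "'a::euclidean_space \<Rightarrow> real \<Rightarrow> real"
  assumes T: "(\<lambda>(r, v). (h v r, v)) \<in> borel_measurable borel"
    and h: "\<And>v. h v \<in> borel_measurable borel" "\<And>v. distr lborel borel (h v) = lborel"
  shows "distr lborel borel (\<lambda>(r, v). (h v r, v)) = lborel"
proof (rule measure_eqI)
  let ?T = "\<lambda>(r, v). (h v r, v)"
  fix A assume "A \<in> sets (distr lborel borel ?T)"
  then have A [measurable]: "A \<in> sets borel" by simp
  have fT: "(\<lambda>p. indicator A (?T p) :: ennreal) \<in> borel_measurable borel"
    by (rule measurable_compose[OF T]) measurable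
  have "emeasure (distr lborel borel ?T) A = (\<integral>\<^sup>+x. indicator A x \<partial>distr lborel borel ?T)" by simp
  also have "\<dots> = (\<integral>\<^sup>+p. indicator A (?T p) \<partial>lborel)" using T by (intro nn_integral_distr) auto
  also have "\<dots> = (\<integral>\<^sup>+v. \<integral>\<^sup>+r. indicator A (?T (r, v)) \<partial>lborel \<partial>lborel)"
    by (rule nn_integral_lborel_pair(1)[OF fT])
  also have "\<dots> = (\<integral>\<^sup>+v. \<integral>\<^sup>+r. indicator A (r, v) \<partial>lborel \<partial>lborel)"
  proof (rule nn_integral_cong)
    fix v
    have "(\<lambda>r. indicator A (r, v) :: ennreal) \<in> borel_measurable borel" by measurable
    from nn_integral_preserved[OF h this, of v]
    show "(\<integral>\<^sup>+r. indicator A (?T (r, v)) \<partial>lborel) = (\<integral>\<^sup>+r. indicator A (r, v) \<partial>lborel)" by simp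
  qed
  also have "\<dots> = (\<integral>\<^sup>+p. indicator A p \<partial>lborel)"
    by (rule nn_integral_lborel_pair(1)[of "indicator A", symmetric]) measurable
  finally show "emeasure (distr lborel borel ?T) A = emeasure lborel A" by simp
qed simp

lemma lborel_distr_unit_affine:
  fixes t :: "'a::euclidean_space"
  assumes "\<bar>c\<bar> = 1"
  shows "distr lborel borel (\<lambda>x. t + c *\<^sub>R x) = lborel"
proof -
  have "c \<noteq> 0" using assms by auto
  then have "lborel = density (distr lborel borel (\<lambda>x. t + c *\<^sub>R x)) (\<lambda>_. ennreal (\<bar>c\<bar> ^ DIM('a)))"
    using lborel_affine[of c t] by (simp only: not_False_eq_True)
  also have "\<dots> = distr lborel borel (\<lambda>x. t + c *\<^sub>R x)"
    by (simp add: assms density_1)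
  finally show ?thesis by (rule sym)
qed

lemma boost_eq: "boost t x = (fst x * cosh t + fst (snd x) * sinh t, fst x * sinh t + fst (snd x) * cosh t, snd (snd x))"
  by (simp add: boost_def case_prod_beta)

lemma flip_eq: "flip x = (fst x, - fst (snd x), snd (snd x))"
  by (simp add: flip_def case_prod_beta)

lemma cosh_sq: "cosh t * cosh t = 1 + sinh t * sinh (t::real)"
  using cosh_square_eq[of t] by (simp add: power2_eq_square)

lemma mink_boost: "mink (boost t x) (boost t y) = mink x y"
proof -
  have "(a * cosh t + b * sinh t) * (c * cosh t + d * sinh t) - (a * sinh t + b * cosh t) * (c * sinh t + d * cosh t)
    = a * c - b * d" for a b c d
    using cosh_sq[of t] by algebra
  then show ?thesis by (cases x; cases y) (simp add: boost_eq mink_triple)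
qed

text \<open>A boost multiplies \<open>x0 - x1 = exp (- r)\<close> by \<open>exp (- t)\<close>, hence
  it translates \<open>r\<close> by \<open>t\<close> and fixes \<open>v\<close>.\<close>

lemma hyp_iso_boost: "hyp_iso (boost t)"
proof (rule hyp_isoI_horo[OF mink_boost])
  show "boost t \<in> borel_measurable borel"
    unfolding boost_eq[abs_def] by (intro borel_measurable_continuous_onI continuous_intros)
  show "(\<lambda>(r :: real, v :: (real, 'a) vec). (t + 1 *\<^sub>R r, v)) \<in> borel_measurable borel"
    unfolding case_prod_beta by (intro borel_measurable_continuous_onI continuous_intros)
  then show "distr lborel borel (\<lambda>(r :: real, v :: (real, 'a) vec). (t + 1 *\<^sub>R r, v)) = lborel"
    by (rule lborel_fiber_fst[where h = "\<lambda>v r. t + 1 *\<^sub>R r"]) (use lborel_distr_unit_affine[of 1 t] in auto)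
  show "boost t (horo p) = horo ((\<lambda>(r, v). (t + 1 *\<^sub>R r, v)) p)" for p :: "real \<times> (real, 'a) vec"
  proof (cases p)
    case (Pair r v)
    have e: "exp (t + r) = exp r * (cosh t + sinh t)"
      by (simp only: cosh_plus_sinh exp_add mult.commute)
    have "exp r * (norm v)\<^sup>2 / 2 * cosh t + exp r * (norm v)\<^sup>2 / 2 * sinh t = exp (t + r) * (norm v)\<^sup>2 / 2"
      unfolding e by algebra
    then show ?thesis unfolding Pair horo_def boost_def
      by (simp add: cosh_add sinh_add algebra_simps)
  qed
qed

text \<open>The flip exchanges \<open>x0 - x1\<close> and \<open>x0 + x1\<close>, whose product is
  \<open>1 + (norm v)\<^sup>2\<close>. This gives the coordinate map
  \<open>r \<mapsto> - ln (1 + (norm v)\<^sup>2) - r\<close>.\<close>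

lemma hyp_iso_flip: "hyp_iso flip"
proof (rule hyp_isoI_horo)
  show "mink (flip x) (flip y) = mink x y" for x y :: "'a pt"
    by (cases x; cases y) (simp add: flip_def mink_triple)
  show "(flip :: 'a pt \<Rightarrow> _) \<in> borel_measurable borel"
    unfolding flip_eq[abs_def] by (intro borel_measurable_continuous_onI continuous_intros)
  let ?T = "\<lambda>(r :: real, v :: (real, 'a) vec). (- ln (1 + (norm v)\<^sup>2) + (-1) *\<^sub>R r, v)"
  have p: "1 + (norm v)\<^sup>2 > 0" for v :: "(real, 'a) vec" by (simp add: add_pos_nonneg)
  show "?T \<in> borel_measurable borel"
    unfolding case_prod_beta
    by (intro borel_measurable_continuous_onI continuous_intros ballI) (use p in \<open>auto simp: less_imp_neq[symmetric]\<close>)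
  then show "distr lborel borel ?T = lborel"
    by (rule lborel_fiber_fst[where h = "\<lambda>v r. - ln (1 + (norm v)\<^sup>2) + (-1) *\<^sub>R r"])
       (use lborel_distr_unit_affine[of "-1"] in auto)
  show "flip (horo q) = horo (?T q)" for q :: "real \<times> (real, 'a) vec"
  proof (cases q)
    case (Pair r v)
    define b where "b = (norm v)\<^sup>2"
    have b: "1 + b > 0" using p[of v] by (simp add: b_def)
    define \<rho> where "\<rho> = - ln (1 + b) + (-1) *\<^sub>R r"
    have e1: "exp \<rho> = inverse (1 + b) * exp (- r)"
      using b by (simp only: \<rho>_def exp_add exp_minus exp_ln) (simp add: exp_minus)
    have "- \<rho> = ln (1 + b) + r" by (simp add: \<rho>_def)
    then have e2: "exp (- \<rho>) = exp r + exp r * b"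
      using b by (simp only: exp_add exp_ln) (simp add: algebra_simps)
    have e3: "exp \<rho> + exp \<rho> * b = exp (- r)"
    proof -
      have "exp \<rho> + exp \<rho> * b = exp \<rho> * (1 + b)" by (simp add: distrib_left)
      then show ?thesis unfolding e1 using b by simp
    qed
    have "cosh \<rho> + exp \<rho> * b / 2 = cosh r + exp r * b / 2"
    proof -
      have "(exp \<rho> + exp (- \<rho>)) / 2 + exp \<rho> * b / 2 = ((exp \<rho> + exp \<rho> * b) + exp (- \<rho>)) / 2"
        by (simp add: add_divide_distrib)
      then show ?thesis unfolding cosh_field_def e2 e3 by (simp add: add_divide_distrib)
    qed
    moreover have "sinh \<rho> + exp \<rho> * b / 2 = - (sinh r + exp r * b / 2)"
    proof -
      have "(exp \<rho> - exp (- \<rho>)) / 2 + exp \<rho> * b / 2 = ((exp \<rho> + exp \<rho> * b) - exp (- \<rho>)) / 2"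
        by (simp add: add_divide_distrib diff_divide_distrib)
      then show ?thesis unfolding sinh_field_def e2 e3 by (simp add: add_divide_distrib diff_divide_distrib)
    qed
    ultimately show ?thesis unfolding Pair by (simp add: horo_def flip_def b_def \<rho>_def)
  qed
qed

text \<open>The parabolic isometries fixing the null vector \<open>(1, 1, 0)\<close>. In
  horospherical coordinates they translate \<open>v\<close> by
  \<open>exp (- r) *\<^sub>R w\<close>.\<close>

definition shear :: "(real, 'm::finite) vec \<Rightarrow> 'm pt \<Rightarrow> 'm pt" where
  "shear w = (\<lambda>(x0, x1, x'). (x0 + (w \<bullet> x' + (x0 - x1) * (w \<bullet> w) / 2),
     x1 + (w \<bullet> x' + (x0 - x1) * (w \<bullet> w) / 2), x' + (x0 - x1) *\<^sub>R w))"

lemma hyp_iso_shear: "hyp_iso (shear w)"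
proof (rule hyp_isoI_horo)
  have alg: "(a + (p + (a - b) * W / 2)) * (c + (q + (c - d) * W / 2))
     - (b + (p + (a - b) * W / 2)) * (d + (q + (c - d) * W / 2))
     - (k + (c - d) * p + (a - b) * q + (a - b) * (c - d) * W) = a * c - b * d - k" for a b c d p q k W :: real
  proof -
    have "(a + P) * (c + Q) - (b + P) * (d + Q) = a * c - b * d + (a - b) * Q + (c - d) * P" for P Q :: real
      by (simp add: algebra_simps)
    moreover define V where "V = W / 2"
    have "(a - b) * W / 2 = (a - b) * V" "(c - d) * W / 2 = (c - d) * V" "W = 2 * V" by (simp_all add: V_def)
    ultimately show ?thesis by (simp only:) (simp add: algebra_simps)
  qed
  show "mink (shear w x) (shear w y) = mink x y" for x y
  proof (cases x; cases y)
    fix a b v c d u assume "x = (a, b, v)" "y = (c, d, u)"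
    moreover have "(v + (a - b) *\<^sub>R w) \<bullet> (u + (c - d) *\<^sub>R w)
      = v \<bullet> u + (c - d) * (w \<bullet> v) + (a - b) * (w \<bullet> u) + (a - b) * (c - d) * (w \<bullet> w)"
      by (simp add: inner_add_left inner_add_right inner_commute)
    ultimately show ?thesis by (simp only: shear_def mink_triple prod.case alg)
  qed
  show "shear w \<in> borel_measurable borel"
    unfolding shear_def case_prod_beta by (intro borel_measurable_continuous_onI continuous_intros) auto
  let ?T = "\<lambda>(r :: real, v). (r, exp (- r) *\<^sub>R w + 1 *\<^sub>R v)"
  show "?T \<in> borel_measurable borel"
    unfolding case_prod_beta by (intro borel_measurable_continuous_onI continuous_intros)
  then show "distr lborel borel ?T = lborel"
    by (rule lborel_fiber_snd[where h = "\<lambda>r v. exp (- r) *\<^sub>R w + 1 *\<^sub>R v"])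
       (use lborel_distr_unit_affine[of 1 "exp (- r) *\<^sub>R w" for r] in auto)
  show "shear w (horo q) = horo (?T q)" for q
  proof (cases q)
    case (Pair r v)
    have "(norm (exp (- r) *\<^sub>R w + v))\<^sup>2 = exp (- r) * exp (- r) * (w \<bullet> w) + 2 * exp (- r) * (w \<bullet> v) + (norm v)\<^sup>2"
      unfolding power2_norm_eq_inner by (simp add: inner_add_left inner_add_right inner_commute algebra_simps)
    moreover have "exp r * exp (- r) = 1" by (simp add: exp_minus)
    ultimately have "exp r * (norm (exp (- r) *\<^sub>R w + v))\<^sup>2 = exp (- r) * (w \<bullet> w) + 2 * (w \<bullet> v) + exp r * (norm v)\<^sup>2"
      by (simp add: distrib_left mult.assoc[symmetric])
    then have "exp r * (norm (exp (- r) *\<^sub>R w + v))\<^sup>2 / 2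
        = exp r * (norm v)\<^sup>2 / 2 + (w \<bullet> v + exp (- r) * (w \<bullet> w) / 2)"
      by (simp add: add_divide_distrib)
    moreover have "cosh r + exp r * (norm v)\<^sup>2 / 2 - (sinh r + exp r * (norm v)\<^sup>2 / 2) = exp (- r)"
      by (simp add: cosh_minus_sinh)
    ultimately show ?thesis unfolding Pair horo_def shear_def prod.case by (simp add: add.commute)
  qed
qed

section \<open>Transitivity, the completed measure, and point and leaf reflections\<close>

definition base_pt :: "'m::finite pt" where "base_pt = (1, 0, 0)"

lemma mink_base_pt: "mink base_pt x = fst x" "mink x base_pt = fst x"
  by (simp_all add: base_pt_def mink_def zero_prod_def[symmetric])

text \<open>The shear by \<open>v\<close> takes the base point to \<open>horo (0, v)\<close> and the
  boost by \<open>r\<close> then to \<open>horo (r, v)\<close>; rotations are not involved. The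
  inverse is supplied as an isometry of its own because vectors off the hyperboloid are pulled back
  by it.\<close>

lemma hyp_transitive:
  assumes "x \<in> hyperboloid"
  obtains g h where "hyp_iso g" "hyp_iso h" "\<And>z. g (h z) = z" "\<And>z. h (g z) = z" "g base_pt = x"
proof -
  obtain r v where x: "x = horo (r, v)" using horo_surj[OF assms] by (metis surj_pair)
  have bb: "boost s (boost t z) = z" if "s = - t" for s t and z :: "'a pt"
  proof -
    have "(a * cosh t + b * sinh t) * cosh t - (a * sinh t + b * cosh t) * sinh t = a"
      "(a * sinh t + b * cosh t) * cosh t - (a * cosh t + b * sinh t) * sinh t = b" for a b
      using cosh_sq[of t] by algebra+
    then show ?thesis by (simp add: boost_eq that prod_eq_iff)
  qed
  have ss: "shear a (shear b z) = z" if "a = - b" for a b and z :: "'a pt"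
    by (cases z) (simp add: shear_def that algebra_simps)
  show ?thesis
  proof (rule that[of "\<lambda>z. boost r (shear v z)" "\<lambda>z. shear (- v) (boost (- r) z)"])
    show "boost r (shear v base_pt) = x"
    proof -
      have "exp r = cosh r + sinh r" by (rule cosh_plus_sinh[symmetric])
      then show ?thesis
        by (simp add: x base_pt_def shear_def boost_def horo_def power2_norm_eq_inner algebra_simps add_divide_distrib)
    qed
    show "hyp_iso (\<lambda>z. boost r (shear v z))" by (rule hyp_iso_comp[OF hyp_iso_boost hyp_iso_shear])
    show "hyp_iso (\<lambda>z. shear (- v) (boost (- r) z))" by (rule hyp_iso_comp[OF hyp_iso_shear hyp_iso_boost])
  qed (simp_all add: bb ss)
qed

lemma completion_measure_preserving:
  assumes g: "g \<in> M \<rightarrow>\<^sub>M M" "distr M M g = M"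
  shows "g \<in> completion M \<rightarrow>\<^sub>M completion M" "distr (completion M) (completion M) g = completion M"
proof -
  have g': "g \<in> completion M \<rightarrow>\<^sub>M M" by (rule measurable_completion[OF g(1)])
  have d: "distr (completion M) M g = M" using g by (simp add: distr_completion)
  show "g \<in> completion M \<rightarrow>\<^sub>M completion M"
    by (rule completion.measurable_completion2[OF g']) (simp add: d)
  have "completion (distr (completion M) M g) = distr (completion M) (completion M) g"
    by (rule completion.completion_distr_eq[OF g']) (simp add: d)
  then show "distr (completion M) (completion M) g = completion M" by (simp add: d)
qed

lemma hyp_iso_hvol:
  assumes "hyp_iso g"
  shows "g \<in> hvol \<rightarrow>\<^sub>M hvol" "distr hvol hvol g = hvol"
  using completion_measure_preserving[of g hyp_meas] assms by (auto simp: hvol_eq hyp_iso_def)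

lemma hyp_iso_integral:
  fixes f :: "'m::finite pt \<Rightarrow> real"
  assumes "hyp_iso g" "f \<in> borel_measurable hvol"
  shows "(LINT x|hvol. f (g x)) = (LINT x|hvol. f x)"
  using integral_distr[OF hyp_iso_hvol(1)[OF assms(1)] assms(2)] hyp_iso_hvol(2)[OF assms(1)] by simp

lemma hyp_iso_integrable:
  fixes f :: "'m::finite pt \<Rightarrow> real"
  assumes "hyp_iso g" "f \<in> borel_measurable hvol"
  shows "integrable hvol (\<lambda>x. f (g x)) \<longleftrightarrow> integrable hvol f"
  using integrable_distr_eq[OF hyp_iso_hvol(1)[OF assms(1)] assms(2)] hyp_iso_hvol(2)[OF assms(1)] by simp

lemma hyp_iso_nn_integral:
  assumes "hyp_iso g" "f \<in> borel_measurable hvol"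
  shows "(\<integral>\<^sup>+x. f (g x) \<partial>hvol) = (\<integral>\<^sup>+x. f x \<partial>hvol)"
  using nn_integral_distr[OF hyp_iso_hvol(1)[OF assms(1)], of f] hyp_iso_hvol(2)[OF assms(1)] assms(2) by simp

lemma hyp_iso_AE:
  assumes "hyp_iso g" "AE x in hvol. P x"
  shows "AE x in hvol. P (g x)"
proof -
  have "AE x in distr hvol hvol g. P x" by (simp only: hyp_iso_hvol(2)[OF assms(1)] assms(2))
  from AE_distrD[OF hyp_iso_hvol(1)[OF assms(1)] this] show ?thesis .
qed

text \<open>The geodesic symmetry at \<open>x\<close>, formally
  \<open>\<xi> \<mapsto> 2 * mink x \<xi> * x - \<xi>\<close>, is described by its products only. It
  is the spatial inversion at the base point, conjugated to \<open>x\<close>.\<close>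

lemma point_reflection:
  assumes "x \<in> hyperboloid"
  obtains \<sigma> where "hyp_iso \<sigma>" "\<And>y \<xi>. mink y (\<sigma> \<xi>) = 2 * mink y x * mink x \<xi> - mink y \<xi>"
proof -
  define S :: "'a pt \<Rightarrow> 'a pt" where "S = (\<lambda>z. (fst z, - fst (snd z), - snd (snd z)))"
  have "hyp_iso (\<lambda>(x0, x1, x'). (x0, x1, - x') :: 'a pt)" (is "hyp_iso ?N")
  proof (rule hyp_isoI_horo)
    show "mink (?N x) (?N y) = mink x y" for x y :: "'a pt"
      by (cases x; cases y) (simp add: mink_triple)
    show "?N \<in> borel_measurable borel"
      unfolding case_prod_beta by (intro borel_measurable_continuous_onI continuous_intros)
    let ?T = "\<lambda>(r :: real, v :: (real, 'a) vec). (r, 0 + (-1) *\<^sub>R v)"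
    show "?T \<in> borel_measurable borel"
      unfolding case_prod_beta by (intro borel_measurable_continuous_onI continuous_intros)
    then show "distr lborel borel ?T = lborel"
      by (rule lborel_fiber_snd[where h = "\<lambda>r v. 0 + (-1) *\<^sub>R v"])
         (use lborel_distr_unit_affine[of "-1" 0] in auto)
    show "?N (horo q) = horo (?T q)" for q by (cases q) (simp add: horo_def)
  qed
  from hyp_iso_comp[OF this hyp_iso_flip] have S: "hyp_iso S"
    by (simp add: S_def flip_def case_prod_beta)
  have Sm: "mink a (S b) = 2 * fst a * fst b - mink a b" for a b
    by (cases a; cases b) (simp add: S_def mink_triple algebra_simps)
  obtain g h where gh: "hyp_iso g" "hyp_iso h" "\<And>z. g (h z) = z" "\<And>z. h (g z) = z" "g base_pt = x"
    using hyp_transitive[OF assms] by metis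
  have fst_h: "fst (h z) = mink x z" for z
    using hyp_iso_mink[OF gh(1), of base_pt "h z"] by (simp add: gh mink_base_pt)
  show ?thesis
  proof (rule that)
    show "hyp_iso (\<lambda>z. g (S (h z)))" by (rule hyp_iso_comp[OF gh(1) hyp_iso_comp[OF S gh(2)]])
    show "mink y (g (S (h \<xi>))) = 2 * mink y x * mink x \<xi> - mink y \<xi>" for y \<xi>
    proof -
      have "mink y (g (S (h \<xi>))) = mink (h y) (S (h \<xi>))"
        using hyp_iso_mink[OF gh(2), of y "g (S (h \<xi>))"] gh by simp
      also have "\<dots> = 2 * mink x y * mink x \<xi> - mink (h y) (h \<xi>)" by (simp add: Sm fst_h)
      finally show ?thesis by (simp add: hyp_iso_mink[OF gh(2)] mink_commute)
    qed
  qed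
qed

text \<open>The spacelike unit normal of the leaf \<open>U\<^sub>\<mu>\<close>: the leaf is \<open>{x. mink (leaf_normal \<mu>) x = 0}\<close>.\<close>

definition leaf_normal :: "real \<Rightarrow> 'm::finite pt" where
  "leaf_normal \<mu> = (sinh \<mu>, cosh \<mu>, 0)"

lemma mink_leaf_normal: "mink (leaf_normal \<mu>) x = fst x * sinh \<mu> - fst (snd x) * cosh \<mu>"
  by (cases x) (simp add: leaf_normal_def mink_triple mult.commute)

lemma mink_leaf_normal_self: "mink (leaf_normal \<mu>) (leaf_normal \<mu>) = -1"
  using hyperbolic_pythagoras[of \<mu>]
  by (simp add: leaf_normal_def mink_triple power2_eq_square)

lemma hyp_iso_leaf_refl: "hyp_iso (leaf_refl \<mu>)"
  unfolding leaf_refl_def o_def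
  by (rule hyp_iso_comp[OF hyp_iso_comp[OF hyp_iso_boost hyp_iso_flip] hyp_iso_boost])

text \<open>The conjugated flip is the linear reflection \<open>x + 2 * mink n x * n\<close> along
  the leaf normal \<open>n\<close>; the sign is positive because
  \<open>mink n n = -1\<close>.\<close>

lemma mink_leaf_refl: "mink y (leaf_refl \<mu> x) = mink y x + 2 * mink (leaf_normal \<mu>) y * mink (leaf_normal \<mu>) x"
proof (cases x; cases y)
  fix x0 x1 x' y0 y1 y' assume x: "x = (x0, x1, x')" and y: "y = (y0, y1, y')"
  have h: "cosh \<mu> * cosh \<mu> = 1 + sinh \<mu> * sinh \<mu>"
    using hyperbolic_pythagoras[of \<mu>] by (simp add: power2_eq_square)
  have 1: "leaf_refl \<mu> x = ((x0 * cosh \<mu> - x1 * sinh \<mu>) * cosh \<mu> + (x0 * sinh \<mu> - x1 * cosh \<mu>) * sinh \<mu>,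
     (x0 * cosh \<mu> - x1 * sinh \<mu>) * sinh \<mu> + (x0 * sinh \<mu> - x1 * cosh \<mu>) * cosh \<mu>, x')"
    by (simp add: x leaf_refl_def boost_def flip_def algebra_simps)
  have "(x0 * cosh \<mu> - x1 * sinh \<mu>) * cosh \<mu> + (x0 * sinh \<mu> - x1 * cosh \<mu>) * sinh \<mu>
    = x0 + 2 * (x0 * sinh \<mu> - x1 * cosh \<mu>) * sinh \<mu>"
    using h by algebra
  moreover have "(x0 * cosh \<mu> - x1 * sinh \<mu>) * sinh \<mu> + (x0 * sinh \<mu> - x1 * cosh \<mu>) * cosh \<mu>
    = x1 + 2 * (x0 * sinh \<mu> - x1 * cosh \<mu>) * cosh \<mu>"
    using h by algebra
  ultimately have "leaf_refl \<mu> x = (x0 + 2 * (x0 * sinh \<mu> - x1 * cosh \<mu>) * sinh \<mu>,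
     x1 + 2 * (x0 * sinh \<mu> - x1 * cosh \<mu>) * cosh \<mu>, x')" using 1 by simp
  then show ?thesis unfolding mink_leaf_normal by (simp add: x y mink_triple algebra_simps)
qed

lemma leaf_normal_refl: "mink (leaf_normal \<mu>) (leaf_refl \<mu> x) = - mink (leaf_normal \<mu>) x"
  by (simp add: mink_leaf_refl mink_leaf_normal_self)

text \<open>The double reflection has product \<open>1\<close> with \<open>x\<close>, and on the
  hyperboloid only \<open>x\<close> itself has that product.\<close>

lemma leaf_refl_involution:
  assumes "x \<in> hyperboloid" shows "leaf_refl \<mu> (leaf_refl \<mu> x) = x"
proof -
  let ?y = "leaf_refl \<mu> (leaf_refl \<mu> x)"
  have "mink x ?y = 1" 
    by (subst mink_leaf_refl, subst leaf_normal_refl, subst mink_leaf_refl) (simp add: mink_self[OF assms])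
  moreover have "?y \<in> hyperboloid" by (intro hyp_iso_in[OF hyp_iso_leaf_refl] assms)
  ultimately show ?thesis using mink_gt_1[OF assms] by fastforce
qed

section \<open>Integrals of the kernel\<close>

lemma measurable_hvol: "f \<in> borel_measurable borel \<Longrightarrow> f \<in> borel_measurable hvol"
  unfolding hvol_eq
  by (intro measurable_completion) (auto cong: measurable_cong_sets[OF sets_hyp_meas refl] intro: measurable_restrict_space1)

lemma sets_hvol_I: "A \<in> sets borel \<Longrightarrow> A \<subseteq> hyperboloid \<Longrightarrow> A \<in> sets hvol"
  unfolding hvol_eq by (rule sets_completionI_sets) (simp add: sets_hyp_meas_iff)

lemma nn_integral_hvol_chart:
  assumes "f \<in> borel_measurable borel"
  shows "(\<integral>\<^sup>+x. f x \<partial>hvol) = (\<integral>\<^sup>+y. ennreal (1 / sqrt (1 + (norm y)\<^sup>2)) * f (lift y) \<partial>lborel)"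
proof -
  have "f \<in> borel_measurable hyp_meas"
    using assms by (auto cong: measurable_cong_sets[OF sets_hyp_meas refl] intro: measurable_restrict_space1)
  then show ?thesis unfolding hvol_eq nn_integral_completion by (rule nn_integral_hyp_meas)
qed

lemma nn_integral_radial:
  fixes x :: "'m::finite pt" and F :: "real \<Rightarrow> ennreal"
  assumes x: "x \<in> hyperboloid" and F: "F \<in> borel_measurable borel"
  shows "(\<integral>\<^sup>+\<xi>. F (mink x \<xi>) \<partial>hvol) = (\<integral>\<^sup>+\<zeta>. F (fst \<zeta>) \<partial>(hvol :: 'm pt measure))"
proof -
  obtain g where g: "hyp_iso g" "g base_pt = x" using hyp_transitive[OF x] by metis
  have "(\<lambda>\<xi>. F (mink x \<xi>)) \<in> borel_measurable hvol"
    by (intro measurable_hvol measurable_compose[OF mink_measurable F])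
  from hyp_iso_nn_integral[OF g(1) this]
  have "(\<integral>\<^sup>+\<xi>. F (mink x \<xi>) \<partial>hvol) = (\<integral>\<^sup>+\<zeta>. F (mink (g base_pt) (g \<zeta>)) \<partial>hvol)" by (simp add: g(2))
  then show ?thesis by (simp add: hyp_iso_mink[OF g(1)] mink_base_pt)
qed

text \<open>In the chart the shell lies in the ball of squared radius \<open>4 * w * (1 + w)\<close>
  and meets a density of at most \<open>1 / (1 + w)\<close>. For small \<open>w\<close> the radius
  has order \<open>sqrt w\<close>; for large \<open>w\<close> it has order \<open>w\<close>, and the
  density removes one of the \<open>CARD('m) + 1\<close> powers.\<close>

lemma hyp_shell_volume:
  obtains C where "C > 0" "\<And>w. 0 < w \<Longrightarrow> w \<le> 1 \<Longrightarrow>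
      emeasure hvol {\<zeta> \<in> (hyperboloid :: 'm::finite pt set). 1 + w \<le> fst \<zeta> \<and> fst \<zeta> < 1 + 2 * w} \<le> ennreal (C * w powr ((CARD('m) + 1) / 2))"
    "\<And>w. 1 \<le> w \<Longrightarrow>
      emeasure hvol {\<zeta> \<in> (hyperboloid :: 'm::finite pt set). 1 + w \<le> fst \<zeta> \<and> fst \<zeta> < 1 + 2 * w} \<le> ennreal (C * w ^ CARD('m))"
proof -
  let ?d = "CARD('m) + 1"
  define V where "V = unit_ball_vol (real ?d)"
  have V: "V > 0" unfolding V_def by simp
  let ?S = "\<lambda>w. {\<zeta> \<in> (hyperboloid :: 'm pt set). 1 + w \<le> fst \<zeta> \<and> fst \<zeta> < 1 + 2 * w}"
  have shell: "emeasure hvol (?S w) \<le> ennreal (1 / (1 + w) * (V * (2 * sqrt (w * (1 + w))) ^ ?d))" if w: "w > 0" for w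
  proof -
    let ?r = "2 * sqrt (w * (1 + w))"
    have S[measurable]: "?S w \<in> sets borel"
    proof -
      have "?S w = hyperboloid \<inter> {\<zeta>. 1 + w \<le> fst \<zeta>} \<inter> {\<zeta>. fst \<zeta> < 1 + 2 * w}" by auto
      also have "\<dots> \<in> sets borel"
        by (intro sets.Int hyperboloid_borel borel_closed[OF closed_Collect_le] borel_open[OF open_Collect_less] continuous_intros)
      finally show ?thesis .
    qed
    have "emeasure hvol (?S w) = (\<integral>\<^sup>+x. indicator (?S w) x \<partial>hvol)"
      using sets_hvol_I[OF S] by simp
    also have "\<dots> = (\<integral>\<^sup>+y. ennreal (1 / sqrt (1 + (norm y)\<^sup>2)) * indicator (?S w) (lift y) \<partial>lborel)"
      by (rule nn_integral_hvol_chart) measurable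
    also have "\<dots> \<le> (\<integral>\<^sup>+y. ennreal (1 / (1 + w)) * indicator (cball 0 ?r) (y :: real \<times> (real, 'm) vec) \<partial>lborel)"
    proof (rule nn_integral_mono)
      fix y :: "real \<times> (real, 'm) vec"
      show "ennreal (1 / sqrt (1 + (norm y)\<^sup>2)) * indicator (?S w) (lift y) \<le> ennreal (1 / (1 + w)) * indicator (cball 0 ?r) y"
      proof (cases "lift y \<in> ?S w")
        case True
        then have y: "1 + w \<le> sqrt (1 + (norm y)\<^sup>2)" "sqrt (1 + (norm y)\<^sup>2) < 1 + 2 * w"
          by (auto simp: lift_def)
        have "(sqrt (1 + (norm y)\<^sup>2))\<^sup>2 < (1 + 2 * w)\<^sup>2"
          using y(2) by (rule power_strict_mono) auto
        then have "1 + (norm y)\<^sup>2 < (1 + 2 * w)\<^sup>2" by simp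
        then have "(norm y)\<^sup>2 \<le> ?r\<^sup>2" using w by (simp add: power_mult_distrib power2_eq_square algebra_simps)
        then have "norm y \<le> ?r" by (rule power2_le_imp_le) (use w in simp)
        moreover have "1 / sqrt (1 + (norm y)\<^sup>2) \<le> 1 / (1 + w)"
          using y w by (intro divide_left_mono mult_pos_pos) linarith+
        ultimately show ?thesis using True by (simp add: ennreal_leI)
      qed simp
    qed
    also have "\<dots> = ennreal (1 / (1 + w)) * emeasure lborel (cball (0 :: real \<times> (real, 'm) vec) ?r)"
      by (subst nn_integral_cmult_indicator) auto
    also have "\<dots> = ennreal (1 / (1 + w)) * ennreal (V * ?r ^ ?d)"
      using w by (subst emeasure_cball) (auto simp: V_def)
    also have "\<dots> = ennreal (1 / (1 + w) * (V * ?r ^ ?d))"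
      using w V by (intro ennreal_mult[symmetric]) auto
    finally show ?thesis .
  qed
  define C where "C = V * 4 ^ ?d"
  have "emeasure hvol (?S w) \<le> ennreal (C * w powr (?d / 2))" if w: "0 < w" "w \<le> 1" for w
  proof (rule order_trans[OF shell[OF w(1)] ennreal_leI])
    have "w * (1 + w) \<le> 4 * w" using w by simp
    then have "sqrt (w * (1 + w)) \<le> sqrt (4 * w)" by (rule real_sqrt_le_mono)
    then have "(2 * sqrt (w * (1 + w))) ^ ?d \<le> (4 * sqrt w) ^ ?d"
      using w by (intro power_mono) (auto simp: real_sqrt_mult)
    also have "\<dots> = 4 ^ ?d * w powr (?d / 2)"
    proof -
      have "sqrt w ^ ?d = w powr (?d / 2)"
        using w by (simp only: powr_half_sqrt[symmetric] powr_realpow[symmetric] powr_gt_zero powr_powr) (simp add: powr_powr powr_gt_zero powr_realpow[symmetric])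
      then show ?thesis by (simp only: power_mult_distrib)
    qed
    finally have "1 / (1 + w) * (V * (2 * sqrt (w * (1 + w))) ^ ?d) \<le> 1 * (V * (4 ^ ?d * w powr (?d / 2)))"
      using w V by (intro mult_mono) auto
    then show "1 / (1 + w) * (V * (2 * sqrt (w * (1 + w))) ^ ?d) \<le> C * w powr (?d / 2)" by (simp add: C_def)
  qed
  moreover have "emeasure hvol (?S w) \<le> ennreal (C * w ^ CARD('m))" if w: "1 \<le> w" for w
  proof (rule order_trans[OF shell ennreal_leI])
    have "w * (1 + w) \<le> (1 + w)\<^sup>2" using w by (simp add: power2_eq_square)
    then have "sqrt (w * (1 + w)) \<le> 1 + w" using w by (intro real_le_lsqrt) auto
    then have "(2 * sqrt (w * (1 + w))) ^ ?d \<le> (2 * (1 + w)) ^ ?d" using w by (intro power_mono) auto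
    then have "1 / (1 + w) * (V * (2 * sqrt (w * (1 + w))) ^ ?d) \<le> 1 / (1 + w) * (V * (2 * (1 + w)) ^ ?d)"
      using w V by (intro mult_left_mono) auto
    also have "\<dots> = V * 2 ^ ?d * (1 + w) ^ CARD('m)"
    proof -
      have "(2 * (1 + w)) ^ ?d = 2 ^ ?d * ((1 + w) ^ CARD('m) * (1 + w))"
        by (simp only: power_mult_distrib power_add power_one_right)
      then show ?thesis using w by simp
    qed
    also have "\<dots> \<le> V * 2 ^ ?d * (2 * w) ^ CARD('m)" using w V by (intro mult_left_mono power_mono) auto
    also have "\<dots> \<le> C * w ^ CARD('m)"
    proof -
      have "(2::real) ^ ?d * 2 ^ CARD('m) \<le> 2 ^ ?d * 2 ^ ?d" by (intro mult_left_mono power_increasing) auto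
      also have "\<dots> = 4 ^ ?d" by (simp only: power_mult_distrib[symmetric]) simp
      finally have "V * (2 ^ ?d * 2 ^ CARD('m)) * w ^ CARD('m) \<le> V * 4 ^ ?d * w ^ CARD('m)"
        using V w by (intro mult_right_mono mult_left_mono) auto
      then show ?thesis by (simp add: C_def power_mult_distrib mult_ac)
    qed
    finally show "1 / (1 + w) * (V * (2 * sqrt (w * (1 + w))) ^ ?d) \<le> C * w ^ CARD('m)" .
  qed (use w in simp)
  moreover have "C > 0" unfolding C_def using V by simp
  ultimately show ?thesis using that by blast
qed

text \<open>\<open>\<kappa>\<close> is a kernel as a function of \<open>cosh d\<close>. Since \<open>cosh \<rho> - 1\<close> has order \<open>\<rho>\<^sup>2\<close>, the exponent
  \<open>n / 2 + s\<close> is half the usual \<open>n + 2 s\<close>.\<close>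

locale hyp_kernel =
  fixes \<kappa> :: "real \<Rightarrow> real" and s :: real and dim_type :: "'m::finite itself"
  assumes s: "0 < s" "s < 1"
    and \<kappa>_pos: "1 < z \<Longrightarrow> 0 < \<kappa> z"
    and \<kappa>_strict: "1 < y \<Longrightarrow> y < z \<Longrightarrow> \<kappa> z < \<kappa> y"
    and \<kappa>_doubling: "\<exists>C>0. \<forall>w>0. \<kappa> (1 + w) \<le> C * \<kappa> (1 + 2 * w)"
    and \<kappa>_near: "\<exists>c>0. \<exists>C>0. \<forall>w. 0 < w \<and> w \<le> 1 \<longrightarrow>
      c * w powr - ((CARD('m) + 1) / 2 + s) \<le> \<kappa> (1 + w) \<and>
      \<kappa> (1 + w) \<le> C * w powr - ((CARD('m) + 1) / 2 + s)"
    and \<kappa>_summable: "summable (\<lambda>k. (2 ^ k) ^ CARD('m) * \<kappa> (1 + 2 ^ k))"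
begin

lemma \<kappa>_antimono: "1 < y \<Longrightarrow> y \<le> z \<Longrightarrow> \<kappa> z \<le> \<kappa> y"
  using \<kappa>_strict[of y z] by (cases "y = z") auto

text \<open>The locale says nothing about \<open>\<kappa>\<close> at \<open>1\<close>, the value of
  the product on the diagonal. The extension by \<open>0\<close> is nonnegative and measurable on
  the whole line.\<close>

definition kap :: "real \<Rightarrow> real" where "kap z = (if 1 < z then \<kappa> z else 0)"

lemma kap_measurable [measurable]: "kap \<in> borel_measurable borel"
proof -
  have "mono_on {1<..} (\<lambda>z. - \<kappa> z)" using \<kappa>_antimono by (auto simp: mono_on_def)
  then have "(\<lambda>z. - \<kappa> z) \<in> borel_measurable (restrict_space borel {1<..})"
    by (rule borel_measurable_mono_on_fnc)
  then have "(\<lambda>z. indicator {1<..} z *\<^sub>R - \<kappa> z) \<in> borel_measurable borel"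
    by (subst (asm) borel_measurable_restrict_space_iff) auto
  then have "(\<lambda>z. - (indicator {1<..} z *\<^sub>R - \<kappa> z)) \<in> borel_measurable borel" by measurable
  also have "(\<lambda>z. - (indicator {1<..} z *\<^sub>R - \<kappa> z)) = kap" by (auto simp: kap_def indicator_def)
  finally show ?thesis .
qed

lemma kap_nonneg: "0 \<le> kap z"
  using \<kappa>_pos[of z] by (auto simp: kap_def less_imp_le)

text \<open>The common scheme of the kernel estimates: a sum over dyadic shells of a bound times a
  volume. The volume bound is demanded only where \<open>b j\<close> does not vanish, so that shells
  outside the support of \<open>F\<close> can be switched off.\<close>

lemma ennreal_shell_sum:
  fixes F :: "real \<Rightarrow> real" and a :: "nat \<Rightarrow> real"
  assumes F: "\<And>z. 0 \<le> F z" "F \<in> borel_measurable borel"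
    and cover: "\<And>z. 1 \<le> z \<Longrightarrow> F z \<noteq> 0 \<Longrightarrow> \<exists>j. 1 + a j \<le> z \<and> z < 1 + 2 * a j"
    and a: "\<And>j. 0 < a j"
    and b: "\<And>j z. 1 + a j \<le> z \<Longrightarrow> z < 1 + 2 * a j \<Longrightarrow> F z \<le> b j"
    and x: "x \<in> (hyperboloid :: 'm pt set)"
    and c: "\<And>j. 0 \<le> c j" "\<And>j. 0 \<le> b j" "summable (\<lambda>j. b j * c j)"
    and vol: "\<And>j. b j \<noteq> 0 \<Longrightarrow> emeasure hvol {\<zeta> \<in> (hyperboloid :: 'm pt set). 1 + a j \<le> fst \<zeta> \<and> fst \<zeta> < 1 + 2 * a j} \<le> ennreal (c j)"
  shows "integrable hvol (\<lambda>\<xi>. F (mink x \<xi>)) \<and> (LINT \<xi>|hvol. F (mink x \<xi>)) \<le> (\<Sum>j. b j * c j)"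
proof -
  let ?S = "\<lambda>j. {\<zeta> \<in> (hyperboloid :: 'm pt set). 1 + a j \<le> fst \<zeta> \<and> fst \<zeta> < 1 + 2 * a j}"
  have S[measurable]: "?S j \<in> sets borel" for j
  proof -
    have "?S j = hyperboloid \<inter> {\<zeta>. 1 + a j \<le> fst \<zeta>} \<inter> {\<zeta>. fst \<zeta> < 1 + 2 * a j}" by auto
    also have "\<dots> \<in> sets borel"
      by (intro sets.Int hyperboloid_borel borel_closed[OF closed_Collect_le] borel_open[OF open_Collect_less] continuous_intros)
    finally show ?thesis .
  qed
  have "(\<integral>\<^sup>+\<xi>. ennreal (F (mink x \<xi>)) \<partial>hvol) = (\<integral>\<^sup>+\<zeta>. ennreal (F (fst \<zeta>)) \<partial>(hvol :: 'm pt measure))"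
    by (rule nn_integral_radial[OF x]) (use F in measurable)
  also have "\<dots> \<le> (\<integral>\<^sup>+\<zeta>. (\<Sum>j. ennreal (b j) * indicator (?S j) \<zeta>) \<partial>hvol)"
  proof (rule nn_integral_mono)
    fix \<zeta> :: "'m pt" assume "\<zeta> \<in> space hvol"
    then have z: "\<zeta> \<in> hyperboloid" "1 \<le> fst \<zeta>" using fst_ge_1[of \<zeta>] by simp_all
    show "ennreal (F (fst \<zeta>)) \<le> (\<Sum>j. ennreal (b j) * indicator (?S j) \<zeta>)"
    proof (cases "F (fst \<zeta>) = 0")
      case False
      then obtain j where j: "1 + a j \<le> fst \<zeta>" "fst \<zeta> < 1 + 2 * a j" using cover z by blast
      have "ennreal (F (fst \<zeta>)) \<le> ennreal (b j) * indicator (?S j) \<zeta>"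
        using b[OF j] j z by (simp add: ennreal_leI)
      also have "\<dots> \<le> (\<Sum>j. ennreal (b j) * indicator (?S j) \<zeta>)"
      proof -
        define f where "f i = ennreal (b i) * indicator (?S i) \<zeta>" for i
        have "sum f {j} \<le> suminf f" by (rule sum_le_suminf) auto
        then have "f j \<le> suminf f" by simp
        then show ?thesis unfolding f_def .
      qed
      finally show ?thesis .
    qed simp
  qed
  also have "\<dots> = (\<Sum>j. \<integral>\<^sup>+\<zeta>. ennreal (b j) * indicator (?S j) \<zeta> \<partial>hvol)"
    using sets_hvol_I[OF S] by (intro nn_integral_suminf) auto
  also have "\<dots> = (\<Sum>j. ennreal (b j) * emeasure hvol (?S j))"
    using sets_hvol_I[OF S] by (intro suminf_cong nn_integral_cmult_indicator) auto
  also have "\<dots> \<le> (\<Sum>j. ennreal (b j * c j))"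
  proof (rule suminf_le)
    fix j
    show "ennreal (b j) * emeasure hvol (?S j) \<le> ennreal (b j * c j)"
    proof (cases "b j = 0")
      case False
      then have "ennreal (b j) * emeasure hvol (?S j) \<le> ennreal (b j) * ennreal (c j)"
        by (intro mult_left_mono vol) auto
      then show ?thesis using c by (simp add: ennreal_mult)
    qed simp
  qed auto
  also have "\<dots> = ennreal (\<Sum>j. b j * c j)" using c by (intro suminf_ennreal2) auto
  finally have le: "(\<integral>\<^sup>+\<xi>. ennreal (F (mink x \<xi>)) \<partial>hvol) \<le> ennreal (\<Sum>j. b j * c j)" .
  have m: "(\<lambda>\<xi>. F (mink x \<xi>)) \<in> borel_measurable hvol"
    by (intro measurable_hvol measurable_compose[OF mink_measurable F(2)])
  have "integrable hvol (\<lambda>\<xi>. F (mink x \<xi>))"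
    by (rule integrableI_nonneg[OF m]) (use F le in \<open>auto intro: le_less_trans\<close>)
  have "(LINT \<xi>|hvol. F (mink x \<xi>)) = enn2real (\<integral>\<^sup>+\<xi>. ennreal (F (mink x \<xi>)) \<partial>hvol)"
    using F m by (intro integral_eq_nn_integral) auto
  also have "\<dots> \<le> enn2real (ennreal (\<Sum>j. b j * c j))" by (intro enn2real_mono le) simp
  also have "\<dots> = (\<Sum>j. b j * c j)" using c by (intro enn2real_ennreal suminf_nonneg) auto
  finally show ?thesis using \<open>integrable hvol (\<lambda>\<xi>. F (mink x \<xi>))\<close> by blast
qed

lemma power_powr_swap: "0 < b \<Longrightarrow> (b ^ k) powr y = (b powr y) ^ k" for b y :: real
  by (induction k) (simp_all add: powr_mult)

lemma dyadic_scale: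
  fixes t :: real
  assumes "1 \<le> t"
  obtains j :: nat where "2 ^ j \<le> t" "t < 2 ^ Suc j"
proof -
  have "\<exists>j::nat. t < 2 ^ j" using real_arch_pow[of 2 t] by auto
  define k where "k = (LEAST j::nat. t < 2 ^ j)"
  have k: "t < 2 ^ k" unfolding k_def using \<open>\<exists>j::nat. t < 2 ^ j\<close> by (rule LeastI_ex)
  have "k \<noteq> 0" using k assms by (metis not_less power_0)
  then obtain j where j: "k = Suc j" by (cases k) auto
  have "j < k" using j by simp
  then have "\<not> t < 2 ^ j" unfolding k_def by (rule not_less_Least)
  then show ?thesis using that[of j] k unfolding j by simp
qed

text \<open>On the shell at scale \<open>a j\<close> the factor \<open>mink x \<xi> - 1\<close>, the
  kernel and the volume multiply to the order \<open>a j powr (1 - s)\<close>. This is a geometric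
  series because \<open>s < 1\<close>.\<close>

lemma kernel_inner_bound:
  "\<exists>C>0. \<forall>x\<in>(hyperboloid :: 'm pt set). \<forall>w. 0 < w \<and> w \<le> 1 \<longrightarrow>
    integrable hvol (\<lambda>\<xi>. indicator {..<1 + w} (mink x \<xi>) * ((mink x \<xi> - 1) * kap (mink x \<xi>))) \<and>
    (LINT \<xi>|hvol. indicator {..<1 + w} (mink x \<xi>) * ((mink x \<xi> - 1) * kap (mink x \<xi>))) \<le> C * w powr (1 - s)"
proof -
  let ?e = "(CARD('m) + 1) / 2"
  obtain V where V: "V > 0" "\<And>w. 0 < w \<Longrightarrow> w \<le> 1 \<Longrightarrow>
      emeasure hvol {\<zeta> \<in> (hyperboloid :: 'm::finite pt set). 1 + w \<le> fst \<zeta> \<and> fst \<zeta> < 1 + 2 * w} \<le> ennreal (V * w powr ?e)"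
    "\<And>w. 1 \<le> w \<Longrightarrow>
      emeasure hvol {\<zeta> \<in> (hyperboloid :: 'm::finite pt set). 1 + w \<le> fst \<zeta> \<and> fst \<zeta> < 1 + 2 * w} \<le> ennreal (V * w ^ CARD('m))"
    by (rule hyp_shell_volume[where ?'m = 'm]) blast
  obtain D where D: "D > 0" "\<And>w. 0 < w \<Longrightarrow> w \<le> 1 \<Longrightarrow> \<kappa> (1 + w) \<le> D * w powr - (?e + s)"
    using \<kappa>_near by blast
  define q where "q = (1/2) powr (1 - s)"
  have "q = 1 / 2 powr (1 - s)" unfolding q_def by (simp add: powr_divide)
  moreover have "2 powr (1 - s) > 1" using s by simp
  ultimately have q: "0 < q" "q < 1" by simp_all
  have main: "integrable hvol (\<lambda>\<xi>. indicator {..<1 + w} (mink x \<xi>) * ((mink x \<xi> - 1) * kap (mink x \<xi>))) \<and>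
    (LINT \<xi>|hvol. indicator {..<1 + w} (mink x \<xi>) * ((mink x \<xi> - 1) * kap (mink x \<xi>))) \<le> (2 * D * V * q * (1 / (1 - q))) * w powr (1 - s)"
    if x: "x \<in> (hyperboloid :: 'm pt set)" and w: "0 < w" "w \<le> 1" for x w
  proof -
    define a where "a j = w * (1/2) ^ Suc j" for j
    define F where "F z = indicator {..<1 + w} z * ((max z 1 - 1) * kap z)" for z
    have a: "0 < a j" "a j \<le> 1" for j
    proof -
      show "0 < a j" unfolding a_def using w by simp
      have "w * (1/2) ^ Suc j \<le> 1 * 1" using w by (intro mult_mono power_le_one) auto
      then show "a j \<le> 1" unfolding a_def by simp
    qed
    have F0: "0 \<le> F z" for z unfolding F_def using kap_nonneg by simp
    have Fm: "F \<in> borel_measurable borel" unfolding F_def by measurable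
    have tm: "2 * a j * (D * a j powr - (?e + s)) * (V * a j powr ?e) = 2 * D * V * q * w powr (1 - s) * q ^ j" for j
    proof -
      have "a j * a j powr - (?e + s) * a j powr ?e = a j powr 1 * a j powr - (?e + s) * a j powr ?e"
        using a(1)[of j] by simp
      also have "\<dots> = a j powr (1 - s)" unfolding powr_add[symmetric] by (rule arg_cong[where f = "(powr) (a j)"]) simp
      also have "\<dots> = w powr (1 - s) * q ^ Suc j"
        unfolding a_def q_def using w by (simp only: powr_mult power_powr_swap half_gt_zero_iff zero_less_one)
      finally have "2 * D * V * (a j * a j powr - (?e + s) * a j powr ?e) = 2 * D * V * (w powr (1 - s) * q ^ Suc j)" by simp
      then show ?thesis by (simp only: mult_ac power_Suc)
    qed
    have sums: "(\<lambda>j. 2 * D * V * q * w powr (1 - s) * q ^ j) sums (2 * D * V * q * w powr (1 - s) * (1 / (1 - q)))"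
      using q by (intro sums_mult geometric_sums) simp
    have "integrable hvol (\<lambda>\<xi>. F (mink x \<xi>)) \<and> (LINT \<xi>|hvol. F (mink x \<xi>))
      \<le> (\<Sum>j. 2 * a j * (D * a j powr - (?e + s)) * (V * a j powr ?e))"
    proof (rule ennreal_shell_sum[OF F0 Fm _ _ _ x, where a = a])
      fix z :: real assume z: "1 \<le> z" "F z \<noteq> 0"
      then have z': "1 < z" "z < 1 + w" unfolding F_def kap_def by (auto split: if_splits simp: indicator_def)
      then have "1 \<le> w / (z - 1)" by simp
      then obtain j where j: "2 ^ j \<le> w / (z - 1)" "w / (z - 1) < 2 ^ Suc j" using dyadic_scale by blast
      have "1 + a j \<le> z" using j(2) z' unfolding a_def by (simp add: field_simps power_one_over)
      show "\<exists>j. 1 + a j \<le> z \<and> z < 1 + 2 * a j"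
      \<comment> \<open>Shells are closed on the left and open on the right, whereas halving from
        above gives the opposite inclusion. In the boundary case \<open>z - 1 = 2 * a j\<close> the
        point belongs to the preceding shell, and for \<open>j = 0\<close> it is excluded by
        \<open>z < 1 + w\<close>.\<close>
      proof (cases "z - 1 < 2 * a j")
        case True
        then show ?thesis using \<open>1 + a j \<le> z\<close> by auto
      next
        case False
        have "z - 1 \<le> 2 * a j" using j(1) z' unfolding a_def by (simp add: field_simps power_one_over)
        with False have eq: "z - 1 = 2 * a j" by simp
        show ?thesis
        proof (cases j)
          case 0
          then show ?thesis using eq z' unfolding a_def by simp
        next
          case (Suc i)
          then have "a i = 2 * a j" unfolding a_def by simp
          then show ?thesis using eq a(1)[of i] by (intro exI[of _ i]) simp
        qed
      qed
    next
      fix j z assume z: "1 + a j \<le> z" "z < 1 + 2 * a j"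
      have "kap z \<le> \<kappa> (1 + a j)" using z a(1)[of j] by (auto simp: kap_def intro!: \<kappa>_antimono)
      also have "\<dots> \<le> D * a j powr - (?e + s)" using D a by blast
      finally have "(max z 1 - 1) * kap z \<le> 2 * a j * (D * a j powr - (?e + s))"
        using z a(1)[of j] kap_nonneg by (intro mult_mono) auto
      moreover have "0 \<le> 2 * a j * (D * a j powr - (?e + s))"
        using a(1)[of j] D(1) by simp
      ultimately show "F z \<le> 2 * a j * (D * a j powr - (?e + s))"
        unfolding F_def indicator_def by (cases "z \<in> {..<1 + w}") simp_all
    next
      show "summable (\<lambda>j. 2 * a j * (D * a j powr - (?e + s)) * (V * a j powr ?e))"
        unfolding tm using sums by (rule sums_summable)
    next
      fix j
      show "0 < a j" by (rule a)
      show "0 \<le> V * a j powr ?e" using V(1) by simp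
      show "0 \<le> 2 * a j * (D * a j powr - (?e + s))" using a(1)[of j] D(1) by simp
      show "emeasure hvol {\<zeta> \<in> (hyperboloid :: 'm pt set). 1 + a j \<le> fst \<zeta> \<and> fst \<zeta> < 1 + 2 * a j} \<le> ennreal (V * a j powr ?e)"
        by (rule V(2)[OF a])
    qed
    moreover have "(\<Sum>j. 2 * a j * (D * a j powr - (?e + s)) * (V * a j powr ?e)) = 2 * D * V * q * w powr (1 - s) * (1 / (1 - q))"
      unfolding tm using sums by (rule sums_unique[symmetric])
    moreover have Fx: "F (mink x \<xi>) = indicator {..<1 + w} (mink x \<xi>) * ((mink x \<xi> - 1) * kap (mink x \<xi>))"
      if "\<xi> \<in> space hvol" for \<xi>
      using mink_ge_1[OF x, of \<xi>] that by (simp add: F_def max.absorb1)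
    moreover have "integrable hvol (\<lambda>\<xi>. F (mink x \<xi>)) \<longleftrightarrow> integrable hvol (\<lambda>\<xi>. indicator {..<1 + w} (mink x \<xi>) * ((mink x \<xi> - 1) * kap (mink x \<xi>)))"
      by (rule Bochner_Integration.integrable_cong[OF refl Fx])
    moreover have "(LINT \<xi>|hvol. F (mink x \<xi>)) = (LINT \<xi>|hvol. indicator {..<1 + w} (mink x \<xi>) * ((mink x \<xi> - 1) * kap (mink x \<xi>)))"
      by (rule Bochner_Integration.integral_cong[OF refl Fx])
    ultimately show ?thesis by (simp only: mult_ac)
  qed
  have "2 * D * V * q * (1 / (1 - q)) > 0" using D V q by simp
  then show ?thesis using main by blast
qed

text \<open>The shells between scales \<open>w\<close> and \<open>1\<close> form a geometric series
  of ratio \<open>2 powr - s\<close>, governed by its first term. The part at product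
  \<open>2\<close> and beyond is bounded by a constant, which is absorbed because
  \<open>w \<le> 1\<close>.\<close>

lemma kernel_outer_bound:
  "\<exists>C>0. \<forall>x\<in>(hyperboloid :: 'm pt set). \<forall>w. 0 < w \<and> w \<le> 1 \<longrightarrow>
    integrable hvol (\<lambda>\<xi>. indicator {1 + w..} (mink x \<xi>) * kap (mink x \<xi>)) \<and>
    (LINT \<xi>|hvol. indicator {1 + w..} (mink x \<xi>) * kap (mink x \<xi>)) \<le> C * w powr - s"
proof -
  let ?e = "(CARD('m) + 1) / 2"
  obtain V where V: "V > 0" "\<And>w. 0 < w \<Longrightarrow> w \<le> 1 \<Longrightarrow>
      emeasure hvol {\<zeta> \<in> (hyperboloid :: 'm::finite pt set). 1 + w \<le> fst \<zeta> \<and> fst \<zeta> < 1 + 2 * w} \<le> ennreal (V * w powr ?e)"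
    "\<And>w. 1 \<le> w \<Longrightarrow>
      emeasure hvol {\<zeta> \<in> (hyperboloid :: 'm::finite pt set). 1 + w \<le> fst \<zeta> \<and> fst \<zeta> < 1 + 2 * w} \<le> ennreal (V * w ^ CARD('m))"
    by (rule hyp_shell_volume[where ?'m = 'm]) blast
  obtain D where D: "D > 0" "\<And>w. 0 < w \<Longrightarrow> w \<le> 1 \<Longrightarrow> \<kappa> (1 + w) \<le> D * w powr - (?e + s)"
    using \<kappa>_near by blast
  define q where "q = 2 powr - s"
  have q: "0 < q" "q < 1" unfolding q_def using s by (auto simp: powr_minus_divide)
  define F1 where "F1 w z = indicator {1 + w..<2} z * kap z" for w z
  define F2 where "F2 z = indicator {2..} z * kap z" for z
  define M where "M = (\<Sum>k. \<kappa> (1 + 2 ^ k) * (V * (2 ^ k) ^ CARD('m)))"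
  have far: "integrable hvol (\<lambda>\<xi>. F2 (mink x \<xi>)) \<and> (LINT \<xi>|hvol. F2 (mink x \<xi>)) \<le> M"
    if x: "x \<in> (hyperboloid :: 'm pt set)" for x
    unfolding M_def
  proof (rule ennreal_shell_sum[OF _ _ _ _ _ x, where a = "\<lambda>k. 2 ^ k"])
    fix z assume z: "1 \<le> z" "F2 z \<noteq> 0"
    then have "1 \<le> z - 1" unfolding F2_def by (auto simp: indicator_def)
    then obtain j where "2 ^ j \<le> z - 1" "z - 1 < 2 ^ Suc j" using dyadic_scale by blast
    then show "\<exists>j. 1 + 2 ^ j \<le> z \<and> z < 1 + 2 * 2 ^ j" by (intro exI[of _ j]) auto
  next
    fix j and z :: real assume z: "1 + 2 ^ j \<le> z" "z < 1 + 2 * 2 ^ j"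
    have "(1::real) < 1 + 2 ^ j" by simp
    then have "kap z \<le> \<kappa> (1 + 2 ^ j)" unfolding kap_def using z \<kappa>_antimono[of "1 + 2 ^ j" z] by auto
    then show "F2 z \<le> \<kappa> (1 + 2 ^ j)" unfolding F2_def using \<kappa>_pos[of "1 + 2 ^ j"]
      by (simp add: indicator_def less_imp_le)
  next
    show "summable (\<lambda>j. \<kappa> (1 + 2 ^ j) * (V * (2 ^ j) ^ CARD('m)))"
      using summable_mult[OF \<kappa>_summable, of V] by (simp add: mult_ac)
  qed (use V kap_nonneg \<kappa>_pos in \<open>auto simp: F2_def intro!: V(3) less_imp_le[OF \<kappa>_pos]\<close>)
  have near: "integrable hvol (\<lambda>\<xi>. F1 w (mink x \<xi>)) \<and> (LINT \<xi>|hvol. F1 w (mink x \<xi>)) \<le> (D * V / (1 - q)) * w powr - s"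
    if x: "x \<in> (hyperboloid :: 'm pt set)" and w: "0 < w" "w \<le> 1" for x w
  proof -
    define a where "a j = w * 2 ^ j" for j :: nat
    \<comment> \<open>\<open>F1 w\<close> vanishes from \<open>z = 2\<close> on, so shells with
      \<open>a j > 1\<close> contribute nothing and only the small-scale bounds for kernel and
      volume are invoked.\<close>
    define b where "b j = (if a j \<le> 1 then D * a j powr - (?e + s) else 0)" for j
    define c where "c j = V * a j powr ?e" for j
    have a: "0 < a j" for j unfolding a_def using w by simp
    have bc: "b j * c j \<le> D * V * w powr - s * q ^ j" for j
    proof -
      have "a j powr - (?e + s) * a j powr ?e = a j powr - s"
        unfolding powr_add[symmetric] by (rule arg_cong[where f = "(powr) (a j)"]) simp
      also have "\<dots> = w powr - s * q ^ j"
        unfolding a_def q_def using w by (simp only: powr_mult power_powr_swap zero_less_numeral)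
      finally have "D * a j powr - (?e + s) * (V * a j powr ?e) = D * V * w powr - s * q ^ j" by (metis mult.assoc mult.left_commute)
      then show ?thesis unfolding b_def c_def using D V q w by simp
    qed
    have bc0: "0 \<le> b j" "0 \<le> c j" for j unfolding b_def c_def using D V by auto
    have sums: "(\<lambda>j. D * V * w powr - s * q ^ j) sums (D * V * w powr - s * (1 / (1 - q)))"
      using q by (intro sums_mult geometric_sums) simp
    have summ: "summable (\<lambda>j. b j * c j)"
      by (rule summable_comparison_test'[OF sums_summable[OF sums], of 0]) (use bc bc0 in simp)
    have "integrable hvol (\<lambda>\<xi>. F1 w (mink x \<xi>)) \<and> (LINT \<xi>|hvol. F1 w (mink x \<xi>)) \<le> (\<Sum>j. b j * c j)"
    proof (rule ennreal_shell_sum[OF _ _ _ a _ x _ _ summ])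
      fix z assume z: "1 \<le> z" "F1 w z \<noteq> 0"
      then have "1 \<le> (z - 1) / w" using w unfolding F1_def by (auto simp: indicator_def split: if_splits)
      then obtain j where "2 ^ j \<le> (z - 1) / w" "(z - 1) / w < 2 ^ Suc j" using dyadic_scale by blast
      then have "1 + a j \<le> z" "z < 1 + 2 * a j" unfolding a_def using w by (auto simp: field_simps)
      then show "\<exists>j. 1 + a j \<le> z \<and> z < 1 + 2 * a j" by blast
    next
      fix j z assume z: "1 + a j \<le> z" "z < 1 + 2 * a j"
      show "F1 w z \<le> b j"
      proof (cases "a j \<le> 1")
        case True
        have "kap z \<le> \<kappa> (1 + a j)" unfolding kap_def using z a[of j] by (auto intro!: \<kappa>_antimono)
        also have "\<dots> \<le> b j" unfolding b_def using D(2)[OF a True] True by simp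
        finally show ?thesis unfolding F1_def using bc0 by (simp add: indicator_def)
      next
        case False
        then show ?thesis using z unfolding F1_def b_def by (simp add: indicator_def)
      qed
    next
      fix j assume "b j \<noteq> 0"
      then have "a j \<le> 1" unfolding b_def by (auto split: if_splits)
      then show "emeasure hvol {\<zeta> \<in> (hyperboloid :: 'm pt set). 1 + a j \<le> fst \<zeta> \<and> fst \<zeta> < 1 + 2 * a j} \<le> ennreal (c j)"
        unfolding c_def by (rule V(2)[OF a])
    qed (use bc0 kap_nonneg in \<open>auto simp: F1_def\<close>)
    moreover have "(\<Sum>j. b j * c j) \<le> (\<Sum>j. D * V * w powr - s * q ^ j)"
      by (rule suminf_le[OF bc summ sums_summable[OF sums]])
    moreover have "\<dots> = D * V * w powr - s * (1 / (1 - q))" using sums by (rule sums_unique[symmetric])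
    ultimately show ?thesis by (simp add: mult_ac)
  qed
  have M: "0 \<le> M" unfolding M_def
    using V \<kappa>_pos summable_mult[OF \<kappa>_summable, of V] by (intro suminf_nonneg) (auto simp: mult_ac less_imp_le)
  have "integrable hvol (\<lambda>\<xi>. indicator {1 + w..} (mink x \<xi>) * kap (mink x \<xi>)) \<and>
    (LINT \<xi>|hvol. indicator {1 + w..} (mink x \<xi>) * kap (mink x \<xi>)) \<le> (D * V / (1 - q) + M) * w powr - s"
    if x: "x \<in> (hyperboloid :: 'm pt set)" and w: "0 < w" "w \<le> 1" for x w
  proof -
    have eq: "indicator {1 + w..} z * kap z = F1 w z + F2 z" for z
      unfolding F1_def F2_def using w by (auto simp: indicator_def)
    have "M * 1 \<le> M * w powr - s"
    proof (intro mult_left_mono M)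
      have "w powr 0 \<le> w powr - s" by (intro powr_mono') (use s w in auto)
      then show "1 \<le> w powr - s" using w by simp
    qed
    then show ?thesis unfolding eq using near[OF x w] far[OF x] by (auto simp: algebra_simps)
  qed
  moreover have "D * V / (1 - q) + M > 0" using D V q M by (simp add: add_pos_nonneg)
  ultimately show ?thesis by blast
qed

text \<open>Points of the ball have norm between \<open>l\<close> and \<open>3 * l\<close>, so their
  product with the base point is above \<open>1\<close> and at most
  \<open>1 + 9 * l\<^sup>2\<close>; \<open>l \<le> 1/3\<close> keeps this in the range of the power
  bound. Volume times kernel then has order \<open>l powr - (2 * s)\<close>, and the density is at
  least \<open>1/2\<close>.\<close>

lemma kernel_ball_lower:
  "\<exists>c>0. \<forall>l e. 0 < l \<and> l \<le> 1/3 \<and> norm (e :: real \<times> (real, 'm) vec) = 1 \<longrightarrow>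
    ennreal (c * l powr - (2 * s)) \<le> (\<integral>\<^sup>+\<zeta>. indicator {\<zeta>. snd \<zeta> \<in> cball ((2 * l) *\<^sub>R e) l} \<zeta> * ennreal (kap (fst \<zeta>)) \<partial>hvol)"
proof -
  let ?d = "CARD('m) + 1"
  define V where "V = unit_ball_vol (real ?d)"
  have V: "V > 0" unfolding V_def by simp
  obtain c where c: "c > 0" "\<And>w. 0 < w \<Longrightarrow> w \<le> 1 \<Longrightarrow> c * w powr - (?d / 2 + s) \<le> \<kappa> (1 + w)"
    using \<kappa>_near by blast
  define c' where "c' = c * 9 powr - (?d / 2 + s) * V / 2"
  have main: "ennreal (c' * l powr - (2 * s)) \<le> (\<integral>\<^sup>+\<zeta>. indicator {\<zeta>. snd \<zeta> \<in> cball ((2 * l) *\<^sub>R e) l} \<zeta> * ennreal (kap (fst \<zeta>)) \<partial>hvol)"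
    if l: "0 < l" "l \<le> 1/3" and e: "norm (e :: real \<times> (real, 'm) vec) = 1" for l e
  proof -
    let ?B = "cball ((2 * l) *\<^sub>R e) l"
    let ?A = "{\<zeta> :: 'm pt. snd \<zeta> \<in> ?B}"
    have B[measurable]: "?B \<in> sets borel" by simp
    have A[measurable]: "?A \<in> sets borel"
    proof -
      have "?A = snd -` ?B \<inter> space borel" by auto
      also have "\<dots> \<in> sets borel" by (rule measurable_sets) (auto intro!: borel_measurable_continuous_onI continuous_intros)
      finally show ?thesis .
    qed
    have fm: "(\<lambda>\<zeta> :: 'm pt. kap (fst \<zeta>)) \<in> borel_measurable borel"
      by (rule measurable_compose[OF _ kap_measurable]) (auto intro!: borel_measurable_continuous_onI continuous_intros)
    have "ennreal (c' * l powr - (2 * s)) = ennreal (1 / 2 * (c * (9 * l\<^sup>2) powr - (?d / 2 + s))) * ennreal (V * l ^ ?d)"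
    proof -
      have l2: "(l\<^sup>2) powr - (?d / 2 + s) = l powr - (?d + 2 * s)"
      proof -
        have "l\<^sup>2 = l powr 2" using l(1) by simp
        then have "(l\<^sup>2) powr - (?d / 2 + s) = l powr (2 * - (?d / 2 + s))" by (simp only: powr_powr)
        also have "2 * - (?d / 2 + s) = - (?d + 2 * s)" by (simp add: field_simps)
        finally show ?thesis .
      qed
      have ld: "l ^ ?d = l powr (real ?d)" by (rule powr_realpow[OF l(1), symmetric])
      have "(9 * l\<^sup>2) powr - (?d / 2 + s) * l ^ ?d = 9 powr - (?d / 2 + s) * (l powr - (?d + 2 * s) * l powr ?d)"
        unfolding ld l2[symmetric] powr_mult by (simp only: mult.assoc)
      also have "l powr - (?d + 2 * s) * l powr ?d = l powr - (2 * s)"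
        unfolding powr_add[symmetric] by (rule arg_cong[where f = "(powr) l"]) simp
      finally have "c * V / 2 * ((9 * l\<^sup>2) powr - (?d / 2 + s) * l ^ ?d) = c * V / 2 * (9 powr - (?d / 2 + s) * l powr - (2 * s))" by simp
      then have "c' * l powr - (2 * s) = 1 / 2 * (c * (9 * l\<^sup>2) powr - (?d / 2 + s)) * (V * l ^ ?d)"
        unfolding c'_def by (simp only: mult_ac times_divide_eq_right times_divide_eq_left mult_1_left)
      moreover have "0 \<le> 1 / 2 * (c * (9 * l\<^sup>2) powr - (?d / 2 + s))" "0 \<le> V * l ^ ?d"
        using c(1) V l(1) by simp_all
      ultimately show ?thesis by (simp only: ennreal_mult)
    qed
    also have "\<dots> = ennreal (1 / 2 * (c * (9 * l\<^sup>2) powr - (?d / 2 + s))) * emeasure lborel ?B"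
      using l by (subst emeasure_cball) (auto simp: V_def)
    also have "\<dots> = (\<integral>\<^sup>+y. ennreal (1 / 2 * (c * (9 * l\<^sup>2) powr - (?d / 2 + s))) * indicator ?B y \<partial>lborel)"
      by (rule nn_integral_cmult_indicator[symmetric]) simp
    also have "\<dots> \<le> (\<integral>\<^sup>+y. ennreal (1 / sqrt (1 + (norm y)\<^sup>2)) * (indicator ?A (lift y) * ennreal (kap (fst (lift y)))) \<partial>lborel)"
    proof (rule nn_integral_mono)
      fix y :: "real \<times> (real, 'm) vec"
      show "ennreal (1 / 2 * (c * (9 * l\<^sup>2) powr - (?d / 2 + s))) * indicator ?B y
        \<le> ennreal (1 / sqrt (1 + (norm y)\<^sup>2)) * (indicator ?A (lift y) * ennreal (kap (fst (lift y))))"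
      proof (cases "y \<in> ?B")
        case True
        have "norm (y - (2 * l) *\<^sub>R e) \<le> l" using True by (simp add: dist_norm norm_minus_commute)
        moreover have "norm ((2 * l) *\<^sub>R e) = 2 * l" using e l by simp
        ultimately have y: "l \<le> norm y" "norm y \<le> 3 * l"
          using norm_triangle_ineq2[of "(2 * l) *\<^sub>R e" y] norm_triangle_ineq2[of y "(2 * l) *\<^sub>R e"]
          by (auto simp: norm_minus_commute)
        have y2: "(norm y)\<^sup>2 \<le> 9 * l\<^sup>2" using power_mono[OF y(2), of 2] by (simp add: power_mult_distrib)
        have l2: "9 * l\<^sup>2 \<le> 1" using power_mono[OF l(2), of 2] l by (simp add: power_divide)
        have "0 < norm y" using y(1) l(1) by linarith
        then have gt: "sqrt (1 + (norm y)\<^sup>2) > 1" by simp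
        have le: "sqrt (1 + (norm y)\<^sup>2) \<le> 1 + 9 * l\<^sup>2"
        proof (rule real_le_lsqrt)
          have "1 + (norm y)\<^sup>2 \<le> 1 + 2 * (9 * l\<^sup>2) + (9 * l\<^sup>2)\<^sup>2"
            using y2 zero_le_power2[of "9 * l\<^sup>2"] zero_le_power2[of l] by linarith
          also have "\<dots> = (1 + 9 * l\<^sup>2)\<^sup>2" by (simp add: power2_sum)
          finally show "1 + (norm y)\<^sup>2 \<le> (1 + 9 * l\<^sup>2)\<^sup>2" .
        qed simp
        have "c * (9 * l\<^sup>2) powr - (?d / 2 + s) \<le> \<kappa> (1 + 9 * l\<^sup>2)" using c(2)[of "9 * l\<^sup>2"] l l2 by simp
        also have "\<dots> \<le> kap (sqrt (1 + (norm y)\<^sup>2))" using \<kappa>_antimono[OF gt le] gt by (simp add: kap_def)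
        finally have k: "c * (9 * l\<^sup>2) powr - (?d / 2 + s) \<le> kap (sqrt (1 + (norm y)\<^sup>2))" .
        have "sqrt (1 + (norm y)\<^sup>2) \<le> 2" using le l2 by simp
        then have "1 / 2 \<le> 1 / sqrt (1 + (norm y)\<^sup>2)"
          using gt by (intro divide_left_mono mult_pos_pos) linarith+
        then have "1 / 2 * (c * (9 * l\<^sup>2) powr - (?d / 2 + s)) \<le> 1 / sqrt (1 + (norm y)\<^sup>2) * kap (sqrt (1 + (norm y)\<^sup>2))"
          using k c by (intro mult_mono) auto
        then show ?thesis using True kap_nonneg gt
          by (simp add: snd_lift lift_def ennreal_mult[symmetric] ennreal_leI)
      qed simp
    qed
    also have "\<dots> = (\<integral>\<^sup>+\<zeta>. indicator ?A \<zeta> * ennreal (kap (fst \<zeta>)) \<partial>hvol)"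
      by (rule nn_integral_hvol_chart[symmetric]) (use fm in measurable)
    finally show ?thesis .
  qed
  have "c' > 0" unfolding c'_def using c V by simp
  then show ?thesis using main by blast
qed

text \<open>The weight of \<open>L_space\<close> sits at distance \<open>1 + hdist \<xi> p\<close>,
  whose \<open>cosh\<close> is at most a constant times \<open>mink x \<xi>\<close>. Away from
  \<open>x\<close> that is at most \<open>2 ^ k * (mink x \<xi> - 1)\<close> for a fixed
  \<open>k\<close>, and \<open>k\<close>-fold doubling compares the two kernels.\<close>

lemma kernel_weight_bound:
  assumes x: "x \<in> (hyperboloid :: 'm pt set)" and p: "p \<in> hyperboloid" and e: "0 < e"
  obtains C where "C > 0"
    "\<And>\<xi>. \<xi> \<in> hyperboloid \<Longrightarrow> 1 + e \<le> mink x \<xi> \<Longrightarrow> \<kappa> (mink x \<xi>) \<le> C * \<kappa> (cosh (1 + hdist \<xi> p))"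
proof -
  obtain D where D: "D > 0" "\<And>w. w > 0 \<Longrightarrow> \<kappa> (1 + w) \<le> D * \<kappa> (1 + 2 * w)" using \<kappa>_doubling by blast
  define M where "M = exp 1 * ((fst p + norm (snd p)) * (fst x + norm (snd x)))"
  obtain k :: nat where k: "M * (1 + 1 / e) < 2 ^ k" using real_arch_pow[of 2] by auto
  have iter: "\<kappa> (1 + w) \<le> D ^ j * \<kappa> (1 + 2 ^ j * w)" if "w > 0" for w and j :: nat
  proof (induction j)
    case (Suc j)
    have "\<kappa> (1 + 2 ^ j * w) \<le> D * \<kappa> (1 + 2 * (2 ^ j * w))" using D(2)[of "2 ^ j * w"] that by simp
    then have "D ^ j * \<kappa> (1 + 2 ^ j * w) \<le> D ^ j * (D * \<kappa> (1 + 2 * (2 ^ j * w)))" using D by (intro mult_left_mono) auto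
    with Suc show ?case by (simp add: mult_ac)
  qed simp
  have "\<kappa> (mink x \<xi>) \<le> D ^ k * \<kappa> (cosh (1 + hdist \<xi> p))" if xi: "\<xi> \<in> hyperboloid" "1 + e \<le> mink x \<xi>" for \<xi>
  proof -
    let ?z = "mink x \<xi>"
    have h: "0 \<le> hdist \<xi> p" "cosh (hdist \<xi> p) = mink p \<xi>"
      using mink_ge_1[OF xi(1) p] by (auto simp: hdist_eq_mink mink_commute)
    have c1: "cosh (1 + hdist \<xi> p) \<le> exp 1 * mink p \<xi>"
      unfolding h(2)[symmetric]
    proof -
      have "exp (- (1 + hdist \<xi> p)) \<le> exp 1 * exp (- hdist \<xi> p)" by (simp add: exp_add[symmetric])
      then show "cosh (1 + hdist \<xi> p) \<le> exp 1 * cosh (hdist \<xi> p)"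
        by (simp add: cosh_field_def exp_add algebra_simps)
    qed
    have "mink p \<xi> \<le> (fst p + norm (snd p)) * fst \<xi>"
    proof -
      have "- (snd p \<bullet> snd \<xi>) \<le> norm (snd p) * norm (snd \<xi>)" using Cauchy_Schwarz_ineq2[of "snd p" "snd \<xi>"] by linarith
      also have "\<dots> \<le> norm (snd p) * fst \<xi>" using norm_snd_less_fst[OF xi(1)] by (intro mult_left_mono) auto
      finally show ?thesis by (simp add: mink_def algebra_simps)
    qed
    also have "(fst p + norm (snd p)) * fst \<xi> \<le> (fst p + norm (snd p)) * ((fst x + norm (snd x)) * ?z)"
      using mink_ge_fst[OF x xi(1)] p by (intro mult_left_mono) (auto simp: hyperboloid_iff)
    finally have "exp 1 * mink p \<xi> \<le> exp 1 * ((fst p + norm (snd p)) * ((fst x + norm (snd x)) * ?z))" by simp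
    then have "cosh (1 + hdist \<xi> p) \<le> M * ?z" using c1 unfolding M_def mult.assoc by linarith
    also have "M * ?z \<le> 2 ^ k * (?z - 1)"
    proof -
      have "M \<ge> 0" unfolding M_def using x p by (auto simp: hyperboloid_iff intro!: mult_nonneg_nonneg)
      moreover have "?z \<le> (1 + 1 / e) * (?z - 1)" using xi e by (simp add: field_simps)
      ultimately have "M * ?z \<le> M * ((1 + 1 / e) * (?z - 1))" by (intro mult_left_mono)
      also have "\<dots> = (M * (1 + 1 / e)) * (?z - 1)" by simp
      also have "\<dots> \<le> 2 ^ k * (?z - 1)" using k xi e by (intro mult_right_mono) auto
      finally show ?thesis .
    qed
    finally have le: "cosh (1 + hdist \<xi> p) \<le> 1 + 2 ^ k * (?z - 1)" by simp
    have "cosh 0 < cosh (1 + hdist \<xi> p)" using h by (subst cosh_real_nonneg_less_iff) auto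
    then have "\<kappa> (1 + 2 ^ k * (?z - 1)) \<le> \<kappa> (cosh (1 + hdist \<xi> p))" using le by (intro \<kappa>_antimono) auto
    then have "D ^ k * \<kappa> (1 + 2 ^ k * (?z - 1)) \<le> D ^ k * \<kappa> (cosh (1 + hdist \<xi> p))"
      using D by (intro mult_left_mono) auto
    then show ?thesis using iter[of "?z - 1" k] xi e by simp
  qed
  moreover have "D ^ k > 0" using D by simp
  ultimately show ?thesis using that by blast
qed

end

section \<open>Null leaves, normal frames and the distance to a hyperplane\<close>

lemma mink_hvol [measurable]: "mink x \<in> borel_measurable hvol"
  by (rule measurable_hvol[OF mink_measurable])

lemma fst_snd_null: "AE \<xi> in (hvol :: 'm::finite pt measure). fst (snd \<xi>) \<noteq> 0"
proof -
  let ?A = "{\<xi> :: 'm pt. fst (snd \<xi>) = 0}"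
  have A: "?A \<in> sets borel"
    by (intro borel_closed closed_Collect_eq continuous_intros)
  have im: "(indicator ?A :: 'm pt \<Rightarrow> ennreal) \<in> borel_measurable borel" using A by measurable
  have gm: "(\<lambda>y :: real \<times> (real, 'm) vec. ennreal (1 / sqrt (1 + (norm y)\<^sup>2)) * indicator ?A (lift y)) \<in> borel_measurable borel"
    using measurable_compose[OF lift_measurable im] by measurable
  have "(\<integral>\<^sup>+\<xi>. indicator ?A \<xi> \<partial>hvol) = (\<integral>\<^sup>+y. ennreal (1 / sqrt (1 + (norm y)\<^sup>2)) * indicator ?A (lift y) \<partial>lborel)"
    by (rule nn_integral_hvol_chart[OF im])
  also have "\<dots> = (\<integral>\<^sup>+v. \<integral>\<^sup>+t. ennreal (1 / sqrt (1 + (norm (t, v))\<^sup>2)) * indicator ?A (lift (t, v)) \<partial>lborel \<partial>lborel)"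
    by (rule nn_integral_lborel_pair(1)[OF gm])
  also have "\<dots> = nn_integral lborel (\<lambda>v :: (real, 'm) vec. 0)"
  proof (rule nn_integral_cong)
    fix v :: "(real, 'm) vec"
    have "AE t :: real in lborel. t \<noteq> 0" by (rule AE_lborel_singleton)
    then have "AE t in lborel. ennreal (1 / sqrt (1 + (norm (t, v))\<^sup>2)) * indicator ?A (lift (t, v)) = 0"
      by eventually_elim (simp add: lift_def)
    then show "(\<integral>\<^sup>+t. ennreal (1 / sqrt (1 + (norm (t, v))\<^sup>2)) * indicator ?A (lift (t, v)) \<partial>lborel) = 0"
      by (subst nn_integral_cong_AE[where v = "\<lambda>_. 0"]) auto
  qed
  finally have "(\<integral>\<^sup>+\<xi>. indicator ?A \<xi> \<partial>hvol) = 0" by simp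
  moreover have "(indicator ?A :: 'm pt \<Rightarrow> ennreal) \<in> borel_measurable hvol" by (rule measurable_hvol[OF im])
  ultimately have "AE \<xi> in hvol. (indicator ?A \<xi> :: ennreal) = 0"
    by (subst (asm) nn_integral_0_iff_AE)
  then show ?thesis by eventually_elim (auto simp: indicator_def split: if_splits)
qed

lemma leaf_null: "AE \<xi> in hvol. mink (leaf_normal \<mu>) \<xi> \<noteq> 0"
proof -
  have "AE \<xi> in hvol. fst (snd (boost (- \<mu>) \<xi>)) \<noteq> 0"
    by (rule hyp_iso_AE[OF hyp_iso_boost fst_snd_null])
  then show ?thesis by eventually_elim (simp add: boost_eq mink_leaf_normal)
qed

text \<open>The isometry \<open>g\<close> carries the base point to \<open>x\<close>, so that \<open>mink \<omega>\<close> becomes an explicit affine function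
  in the coordinates \<open>\<zeta>\<close>, with linear part \<open>W\<close>.\<close>

definition normal_frame :: "'m::finite pt \<Rightarrow> 'm pt \<Rightarrow> ('m pt \<Rightarrow> 'm pt) \<Rightarrow> real \<times> (real, 'm) vec \<Rightarrow> bool" where
  "normal_frame x \<omega> g W \<longleftrightarrow> hyp_iso g \<and> (\<forall>\<zeta>. mink x (g \<zeta>) = fst \<zeta>) \<and>
    (\<forall>\<zeta>. mink \<omega> (g \<zeta>) = mink \<omega> x * fst \<zeta> - W \<bullet> snd \<zeta>) \<and> norm W = sqrt (1 + (mink \<omega> x)\<^sup>2) \<and>
    (\<forall>\<xi>\<in>hyperboloid. \<exists>\<zeta>\<in>hyperboloid. \<xi> = g \<zeta>)"

lemma normal_frameD:
  assumes "normal_frame x \<omega> g W"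
  shows "hyp_iso g" "mink x (g \<zeta>) = fst \<zeta>" "mink \<omega> (g \<zeta>) = mink \<omega> x * fst \<zeta> - W \<bullet> snd \<zeta>"
    "norm W = sqrt (1 + (mink \<omega> x)\<^sup>2)" "\<xi> \<in> hyperboloid \<Longrightarrow> \<exists>\<zeta>\<in>hyperboloid. \<xi> = g \<zeta>"
  using assms unfolding normal_frame_def by blast+

lemma normal_frame_exists:
  assumes x: "x \<in> hyperboloid" and om: "mink \<omega> \<omega> = -1"
  shows "\<exists>g W. normal_frame x \<omega> g W"
proof -
  obtain g h where gh: "hyp_iso g" "hyp_iso h" "\<And>z. g (h z) = z" "\<And>z. h (g z) = z" "g base_pt = x"
    using hyp_transitive[OF x] by metis
  define w where "w = h \<omega>"
  have m: "mink \<omega> (g \<zeta>) = mink w \<zeta>" for \<zeta>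
    using hyp_iso_mink[OF gh(2), of \<omega> "g \<zeta>"] by (simp add: gh(4) w_def)
  have w0: "fst w = mink \<omega> x" using m[of base_pt] by (simp add: gh(5) mink_base_pt)
  have "mink w w = -1" using hyp_iso_mink[OF gh(2), of \<omega> \<omega>] om by (simp add: w_def)
  then have "(norm (snd w))\<^sup>2 = 1 + (mink \<omega> x)\<^sup>2"
    unfolding mink_def[of w w] w0[symmetric] power2_norm_eq_inner by (simp add: power2_eq_square)
  then have nW: "norm (snd w) = sqrt (1 + (mink \<omega> x)\<^sup>2)"
    by (metis norm_ge_zero real_sqrt_unique)
  have "mink x (g \<zeta>) = fst \<zeta>" for \<zeta>
    using hyp_iso_mink[OF gh(1), of base_pt \<zeta>] by (simp add: gh(5) mink_base_pt)
  moreover have "mink \<omega> (g \<zeta>) = mink \<omega> x * fst \<zeta> - snd w \<bullet> snd \<zeta>" for \<zeta>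
    unfolding m mink_def[of w \<zeta>] w0 by (rule refl)
  moreover have "\<exists>\<zeta>\<in>hyperboloid. \<xi> = g \<zeta>" if "\<xi> \<in> hyperboloid" for \<xi>
    using hyp_iso_in[OF gh(2) that] gh(3)[of \<xi>] by (intro bexI[of _ "h \<xi>"]) simp_all
  ultimately have "normal_frame x \<omega> g (snd w)"
    unfolding normal_frame_def using gh(1) nW by blast
  then show ?thesis by blast
qed

text \<open>\<open>mink \<omega> x\<close> is the hyperbolic sine of the distance from
  \<open>x\<close> to the hyperplane of \<open>\<omega>\<close>, and the right order of magnitude
  for crossing it is the corresponding hyperbolic cosine. In the frame at \<open>x\<close> this is
  the Cauchy-Schwarz inequality.\<close>

lemma mink_cross:
  assumes x: "x \<in> hyperboloid" and xi: "\<xi> \<in> hyperboloid" and om: "mink \<omega> \<omega> = -1"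
    and t: "0 < mink \<omega> x" "mink \<omega> \<xi> \<le> 0"
  shows "sqrt (1 + (mink \<omega> x)\<^sup>2) \<le> mink x \<xi>"
proof -
  obtain g W where nf: "normal_frame x \<omega> g W" using normal_frame_exists[OF x om] by blast
  note g = normal_frameD[OF nf]
  obtain \<zeta> where z: "\<zeta> \<in> hyperboloid" "\<xi> = g \<zeta>" using g(5)[OF xi] by blast
  let ?t = "mink \<omega> x" and ?z = "fst \<zeta>"
  have z0: "?z > 0" using z(1) by (simp add: hyperboloid_iff)
  have "?t * ?z \<le> W \<bullet> snd \<zeta>" using t(2) unfolding z(2) g(3) by simp
  also have "\<dots> \<le> norm W * norm (snd \<zeta>)" by (rule norm_cauchy_schwarz)
  finally have "(?t * ?z)\<^sup>2 \<le> (norm W * norm (snd \<zeta>))\<^sup>2" using t z0 by (intro power_mono) auto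
  also have "\<dots> = (1 + ?t\<^sup>2) * (?z\<^sup>2 - 1)"
    using hyperboloid_fst_sq[OF z(1)] by (simp add: power_mult_distrib g(4) add_nonneg_nonneg)
  finally have "1 + ?t\<^sup>2 \<le> ?z\<^sup>2" by (simp add: power_mult_distrib algebra_simps)
  then have "sqrt (1 + ?t\<^sup>2) \<le> ?z" using z0 by (intro real_le_lsqrt) auto
  then show ?thesis by (simp add: z(2) g(2))
qed

text \<open>It controls how the distance to the leaf changes within a bump. In the frame at
  \<open>y\<close>, \<open>b \<le> 1\<close> gives \<open>(1 + b)\<^sup>2 - 1 \<le> 3 * b\<close>,
  which bounds the spatial coordinates by \<open>sqrt (3 * b)\<close>.\<close>

lemma mink_variation:
  assumes y: "y \<in> hyperboloid" and x: "x \<in> hyperboloid" and om: "mink \<omega> \<omega> = -1"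
    and b: "mink y x \<le> 1 + b" "0 \<le> b" "b \<le> 1"
  shows "\<bar>mink \<omega> x - mink \<omega> y\<bar> \<le> \<bar>mink \<omega> y\<bar> * b + sqrt (1 + (mink \<omega> y)\<^sup>2) * sqrt (3 * b)"
proof -
  obtain g W where nf: "normal_frame y \<omega> g W" using normal_frame_exists[OF y om] by blast
  note g = normal_frameD[OF nf]
  obtain \<zeta> where z: "\<zeta> \<in> hyperboloid" "x = g \<zeta>" using g(5)[OF x] by blast
  have z1: "1 \<le> fst \<zeta>" "fst \<zeta> \<le> 1 + b" using fst_ge_1[OF z(1)] b(1) by (auto simp: z(2) g(2))
  have "(fst \<zeta>)\<^sup>2 \<le> (1 + b)\<^sup>2" using z1 by (intro power_mono) auto
  also have "\<dots> = 1 + 2 * b + b * b" by (simp add: power2_eq_square algebra_simps)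
  also have "b * b \<le> b * 1" using b by (intro mult_left_mono) auto
  finally have "(norm (snd \<zeta>))\<^sup>2 \<le> 3 * b" using hyperboloid_fst_sq[OF z(1)] by simp
  then have n: "norm (snd \<zeta>) \<le> sqrt (3 * b)" by (rule real_le_rsqrt)
  have "mink \<omega> x - mink \<omega> y = mink \<omega> y * (fst \<zeta> - 1) - W \<bullet> snd \<zeta>"
    unfolding z(2) g(3) by (simp add: algebra_simps)
  then have "\<bar>mink \<omega> x - mink \<omega> y\<bar> \<le> \<bar>mink \<omega> y * (fst \<zeta> - 1)\<bar> + \<bar>W \<bullet> snd \<zeta>\<bar>"
    by (simp only: abs_triangle_ineq4)
  also have "\<bar>mink \<omega> y * (fst \<zeta> - 1)\<bar> \<le> \<bar>mink \<omega> y\<bar> * b"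
    using z1 by (simp add: abs_mult mult_left_mono)
  also have "\<bar>W \<bullet> snd \<zeta>\<bar> \<le> norm W * norm (snd \<zeta>)" by (rule Cauchy_Schwarz_ineq2)
  also have "\<dots> \<le> norm W * sqrt (3 * b)" by (intro mult_left_mono n norm_ge_zero)
  finally show ?thesis by (simp add: g(4))
qed

section \<open>Kernel mass of half spaces and convergence of the principal value\<close>

context hyp_kernel
begin

text \<open>In the frame at \<open>x\<close> the expression
  \<open>mink x \<xi> * mink \<omega> x - mink \<omega> \<xi>\<close> is
  \<open>W \<bullet> snd \<zeta>\<close>, so the condition describes a Euclidean half space at
  distance \<open>l\<close> from the origin. With \<open>\<sigma>\<close> selecting the side, it
  contains the ball of radius \<open>l\<close> centred at distance \<open>2 * l\<close> along the
  normal, whatever \<open>x\<close> and \<open>\<omega>\<close> are.\<close>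

lemma kernel_halfspace_lower:
  "\<exists>c>0. \<forall>x \<omega> l \<sigma> E. x \<in> (hyperboloid :: 'm pt set) \<and> mink \<omega> \<omega> = -1 \<and> 0 < l \<and> l \<le> 1/3 \<and> \<bar>\<sigma>\<bar> = (1::real) \<and>
    E \<in> sets hvol \<and>
    (\<forall>\<xi>\<in>hyperboloid. mink x \<xi> \<le> sqrt (1 + 9 * l\<^sup>2) \<and>
       l * sqrt (1 + (mink \<omega> x)\<^sup>2) \<le> \<sigma> * (mink x \<xi> * mink \<omega> x - mink \<omega> \<xi>) \<longrightarrow> \<xi> \<in> E)
    \<longrightarrow> ennreal (c * l powr - (2 * s)) \<le> (\<integral>\<^sup>+\<xi>. indicator E \<xi> * ennreal (kap (mink x \<xi>)) \<partial>hvol)"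
proof -
  obtain c where c: "c > 0" "\<And>l e. 0 < l \<Longrightarrow> l \<le> 1/3 \<Longrightarrow> norm (e :: real \<times> (real, 'm) vec) = 1 \<Longrightarrow>
    ennreal (c * l powr - (2 * s)) \<le> (\<integral>\<^sup>+\<zeta>. indicator {\<zeta>. snd \<zeta> \<in> cball ((2 * l) *\<^sub>R e) l} \<zeta> * ennreal (kap (fst \<zeta>)) \<partial>hvol)"
    using kernel_ball_lower by blast
  have "ennreal (c * l powr - (2 * s)) \<le> (\<integral>\<^sup>+\<xi>. indicator E \<xi> * ennreal (kap (mink x \<xi>)) \<partial>hvol)"
    if x: "x \<in> (hyperboloid :: 'm pt set)" and om: "mink \<omega> \<omega> = -1" and l: "0 < l" "l \<le> 1/3" and sg: "\<bar>\<sigma>\<bar> = (1::real)"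
      and E: "E \<in> sets hvol"
      and sub: "\<And>\<xi>. \<xi> \<in> hyperboloid \<Longrightarrow> mink x \<xi> \<le> sqrt (1 + 9 * l\<^sup>2) \<Longrightarrow>
       l * sqrt (1 + (mink \<omega> x)\<^sup>2) \<le> \<sigma> * (mink x \<xi> * mink \<omega> x - mink \<omega> \<xi>) \<Longrightarrow> \<xi> \<in> E"
    for x \<omega> l \<sigma> E
  proof -
    obtain g W where nf: "normal_frame x \<omega> g W" using normal_frame_exists[OF x om] by blast
  note g = normal_frameD[OF nf]
    have W: "norm W > 0" unfolding g(4) by (simp add: add_pos_nonneg)
    define e where "e = (\<sigma> / norm W) *\<^sub>R W"
    have e: "norm e = 1" "\<sigma> *\<^sub>R W = norm W *\<^sub>R e"
      using W sg unfolding e_def by simp_all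
    have "ennreal (c * l powr - (2 * s)) \<le> (\<integral>\<^sup>+\<zeta>. indicator {\<zeta>. snd \<zeta> \<in> cball ((2 * l) *\<^sub>R e) l} \<zeta> * ennreal (kap (fst \<zeta>)) \<partial>hvol)"
      by (rule c(2)[OF l e(1)])
    also have "\<dots> \<le> (\<integral>\<^sup>+\<zeta>. indicator E (g \<zeta>) * ennreal (kap (mink x (g \<zeta>))) \<partial>hvol)"
    proof (rule nn_integral_mono)
      fix \<zeta> :: "'m pt" assume "\<zeta> \<in> space hvol"
      then have z: "\<zeta> \<in> hyperboloid" by simp
      show "indicator {\<zeta>. snd \<zeta> \<in> cball ((2 * l) *\<^sub>R e) l} \<zeta> * ennreal (kap (fst \<zeta>))
        \<le> indicator E (g \<zeta>) * ennreal (kap (mink x (g \<zeta>)))"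
      proof (cases "snd \<zeta> \<in> cball ((2 * l) *\<^sub>R e) l")
        case True
        then have d: "norm (snd \<zeta> - (2 * l) *\<^sub>R e) \<le> l" by (simp add: dist_norm norm_minus_commute)
        have "norm (snd \<zeta>) \<le> norm (snd \<zeta> - (2 * l) *\<^sub>R e) + norm ((2 * l) *\<^sub>R e)"
          using norm_triangle_ineq[of "snd \<zeta> - (2 * l) *\<^sub>R e" "(2 * l) *\<^sub>R e"] by simp
        then have n: "norm (snd \<zeta>) \<le> 3 * l" using d e(1) l by simp
        have "(norm (snd \<zeta>))\<^sup>2 \<le> 9 * l\<^sup>2" using power_mono[OF n norm_ge_zero, of 2] by (simp add: power_mult_distrib)
        then have f: "fst \<zeta> \<le> sqrt (1 + 9 * l\<^sup>2)" unfolding hyperboloid_fst[OF z] by simp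
        have "- (e \<bullet> (snd \<zeta> - (2 * l) *\<^sub>R e)) \<le> norm e * norm (snd \<zeta> - (2 * l) *\<^sub>R e)"
          using Cauchy_Schwarz_ineq2[of e "snd \<zeta> - (2 * l) *\<^sub>R e"] by linarith
        moreover have "e \<bullet> (snd \<zeta> - (2 * l) *\<^sub>R e) = e \<bullet> snd \<zeta> - 2 * l"
          using e(1) by (simp add: inner_diff_right dot_square_norm)
        ultimately have "l \<le> e \<bullet> snd \<zeta>" using d e(1) by simp
        then have "l * norm W \<le> norm W * (e \<bullet> snd \<zeta>)" using W by (simp add: mult.commute)
        also have "\<dots> = \<sigma> * (W \<bullet> snd \<zeta>)"
          by (metis e(2) inner_scaleR_left)
        finally have "l * sqrt (1 + (mink \<omega> x)\<^sup>2) \<le> \<sigma> * (mink x (g \<zeta>) * mink \<omega> x - mink \<omega> (g \<zeta>))"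
          by (simp add: g(2,3,4) mult.commute)
        then have "g \<zeta> \<in> E" using f by (intro sub hyp_iso_in[OF g(1) z]) (simp_all add: g(2))
        then show ?thesis using True by (simp add: g(2))
      qed simp
    qed
    also have "\<dots> = (\<integral>\<^sup>+\<xi>. indicator E \<xi> * ennreal (kap (mink x \<xi>)) \<partial>hvol)"
      by (rule hyp_iso_nn_integral[OF g(1)]) (use E in measurable)
    finally show ?thesis .
  qed
  then show ?thesis using c(1) by blast
qed

text \<open>The principal value truncated in the variable \<open>cosh d\<close>: the geodesic ball
  of radius \<open>\<epsilon>\<close> corresponds to
  \<open>\<delta> = cosh \<epsilon> - 1\<close>.\<close>

definition trunc :: "('m pt \<Rightarrow> real) \<Rightarrow> 'm pt \<Rightarrow> real \<Rightarrow> real" where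
  "trunc u x \<delta> = (LINT \<xi>|hvol. indicator {1 + \<delta>..} (mink x \<xi>) * ((u x - u \<xi>) * kap (mink x \<xi>)))"

text \<open>Dominated convergence along sequences; \<open>zero\<close> takes care of the points that
  no truncated set contains.\<close>

lemma trunc_tendsto:
  fixes f :: "'m pt \<Rightarrow> real"
  assumes f: "integrable hvol f" and zero: "\<And>\<xi>. \<xi> \<in> hyperboloid \<Longrightarrow> mink x \<xi> \<le> 1 \<Longrightarrow> f \<xi> = 0"
  shows "((\<lambda>\<delta>. LINT \<xi>|hvol. indicator {1 + \<delta>..} (mink x \<xi>) * f \<xi>) \<longlongrightarrow> (LINT \<xi>|hvol. f \<xi>)) (at_right 0)"
  unfolding tendsto_at_iff_sequentially
proof (intro allI impI)
  fix X :: "nat \<Rightarrow> real" assume X: "\<forall>i. X i \<in> {0<..} - {0}" "X \<longlonglongrightarrow> 0"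
  have fm: "f \<in> borel_measurable hvol" using f by (rule borel_measurable_integrable)
  have "(\<lambda>i. LINT \<xi>|hvol. indicator {1 + X i..} (mink x \<xi>) * f \<xi>) \<longlonglongrightarrow> (LINT \<xi>|hvol. f \<xi>)"
  proof (rule integral_dominated_convergence[where w = "\<lambda>\<xi>. norm (f \<xi>)"])
    show "AE \<xi> in hvol. (\<lambda>i. indicator {1 + X i..} (mink x \<xi>) * f \<xi>) \<longlonglongrightarrow> f \<xi>"
    proof (rule AE_I2)
      fix \<xi> :: "'m pt" assume "\<xi> \<in> space hvol"
      then have xi: "\<xi> \<in> hyperboloid" by simp
      show "(\<lambda>i. indicator {1 + X i..} (mink x \<xi>) * f \<xi>) \<longlonglongrightarrow> f \<xi>"
      proof (cases "mink x \<xi> \<le> 1")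
        case True
        then show ?thesis using zero[OF xi] by simp
      next
        case False
        then have "\<forall>\<^sub>F i in sequentially. X i < mink x \<xi> - 1"
          by (intro order_tendstoD(2)[OF X(2)]) simp
        then have "\<forall>\<^sub>F i in sequentially. indicator {1 + X i..} (mink x \<xi>) * f \<xi> = f \<xi>"
          by eventually_elim (simp add: indicator_def)
        then show ?thesis by (rule tendsto_eventually)
      qed
    qed
    show "integrable hvol (\<lambda>\<xi>. norm (f \<xi>))" using f by (rule integrable_norm)
    show "(\<lambda>\<xi>. indicator {1 + X i..} (mink x \<xi>) * f \<xi>) \<in> borel_measurable hvol" for i using fm by measurable
    show "AE \<xi> in hvol. norm (indicator {1 + X i..} (mink x \<xi>) * f \<xi>) \<le> norm (f \<xi>)" for i
      by (intro AE_I2) (simp add: indicator_def)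
  qed (rule fm)
  then show "((\<lambda>\<delta>. LINT \<xi>|hvol. indicator {1 + \<delta>..} (mink x \<xi>) * f \<xi>) \<circ> X) \<longlonglongrightarrow> (LINT \<xi>|hvol. f \<xi>)"
    by (simp add: o_def)
qed

text \<open>The point reflection in \<open>x\<close> preserves \<open>mink x \<xi>\<close> and
  reverses the sign of the linear factor. A Bochner integral that diverges has the value
  \<open>0\<close>, so measurability is enough for the change of variables and the
  conclusion.\<close>

lemma odd_integral_zero:
  assumes x: "x \<in> (hyperboloid :: 'm pt set)" and F: "F \<in> borel_measurable borel"
  shows "(LINT \<xi>|hvol. F (mink x \<xi>) * (mink y \<xi> - mink y x * mink x \<xi>)) = (0::real)"
proof -
  let ?f = "\<lambda>\<xi>. F (mink x \<xi>) * (mink y \<xi> - mink y x * mink x \<xi>)"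
  obtain \<sigma> where g: "hyp_iso \<sigma>" "\<And>y \<xi>. mink y (\<sigma> \<xi>) = 2 * mink y x * mink x \<xi> - mink y \<xi>"
    using point_reflection[OF x] by metis
  have fm: "?f \<in> borel_measurable hvol" using F by measurable
  have "?f (\<sigma> \<xi>) = - ?f \<xi>" for \<xi>
    by (simp add: g(2) mink_self[OF x] algebra_simps)
  then have "(LINT \<xi>|hvol. ?f \<xi>) = (LINT \<xi>|hvol. - ?f \<xi>)"
    using hyp_iso_integral[OF g(1) fm] by simp
  then show ?thesis by simp
qed

text \<open>The two analytic facts retained about \<open>u\<close> at \<open>x\<close>: integrable
  tails against the kernel, and a first-order expansion whose error is measured by
  \<open>mink x \<xi> - 1\<close>, which is of the order of the squared distance and integrable
  against the kernel near \<open>x\<close>.\<close>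

definition admissible :: "('m pt \<Rightarrow> real) \<Rightarrow> 'm pt \<Rightarrow> bool" where
  "admissible u x \<longleftrightarrow> x \<in> hyperboloid \<and> u \<in> borel_measurable hvol \<and>
    (\<forall>e>0. integrable hvol (\<lambda>\<xi>. indicator {1 + e..} (mink x \<xi>) * (\<bar>u \<xi>\<bar> * kap (mink x \<xi>)))) \<and>
    (\<exists>w>0. \<exists>L. \<exists>g. \<forall>\<xi>\<in>hyperboloid. mink x \<xi> < 1 + w \<longrightarrow>
      \<bar>u \<xi> - u x - g \<bullet> (snd \<xi> - snd x)\<bar> \<le> L * (mink x \<xi> - 1))"

lemma outer_integrable:
  assumes "x \<in> (hyperboloid :: 'm pt set)" "0 < e"
  shows "integrable hvol (\<lambda>\<xi>. indicator {1 + e..} (mink x \<xi>) * kap (mink x \<xi>))"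
proof -
  obtain C where C: "\<forall>x\<in>(hyperboloid :: 'm pt set). \<forall>w. 0 < w \<and> w \<le> 1 \<longrightarrow>
    integrable hvol (\<lambda>\<xi>. indicator {1 + w..} (mink x \<xi>) * kap (mink x \<xi>)) \<and>
    (LINT \<xi>|hvol. indicator {1 + w..} (mink x \<xi>) * kap (mink x \<xi>)) \<le> C * w powr - s"
    using kernel_outer_bound by blast
  have "0 < min e 1 \<and> min e 1 \<le> 1" using assms by simp
  with C assms(1) have i: "integrable hvol (\<lambda>\<xi>. indicator {1 + min e 1..} (mink x \<xi>) * kap (mink x \<xi>))"
    by blast
  show ?thesis
  proof (rule Bochner_Integration.integrable_bound[OF i])
    show "AE \<xi> in hvol. norm (indicator {1 + e..} (mink x \<xi>) * kap (mink x \<xi>))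
      \<le> norm (indicator {1 + min e 1..} (mink x \<xi>) * kap (mink x \<xi>))"
      by (intro AE_I2) (auto simp: indicator_def min_def split: if_splits)
  qed measurable
qed

lemma difference_integrable:
  assumes u: "admissible u x" and e: "0 < e"
  shows "integrable hvol (\<lambda>\<xi>. indicator {1 + e..} (mink x \<xi>) * ((u x - u \<xi>) * kap (mink x \<xi>)))"
proof -
  have x: "x \<in> hyperboloid" and um[measurable]: "u \<in> borel_measurable hvol"
    and i: "integrable hvol (\<lambda>\<xi>. indicator {1 + e..} (mink x \<xi>) * (\<bar>u \<xi>\<bar> * kap (mink x \<xi>)))"
    using u e unfolding admissible_def by auto
  have "integrable hvol (\<lambda>\<xi>. \<bar>u x\<bar> * (indicator {1 + e..} (mink x \<xi>) * kap (mink x \<xi>))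
      + indicator {1 + e..} (mink x \<xi>) * (\<bar>u \<xi>\<bar> * kap (mink x \<xi>)))"
    by (intro Bochner_Integration.integrable_add integrable_mult_right outer_integrable[OF x e] i)
  then show ?thesis
  proof (rule Bochner_Integration.integrable_bound)
    show "AE \<xi> in hvol. norm (indicator {1 + e..} (mink x \<xi>) * ((u x - u \<xi>) * kap (mink x \<xi>)))
      \<le> norm (\<bar>u x\<bar> * (indicator {1 + e..} (mink x \<xi>) * kap (mink x \<xi>))
      + indicator {1 + e..} (mink x \<xi>) * (\<bar>u \<xi>\<bar> * kap (mink x \<xi>)))"
    proof (rule AE_I2)
      fix \<xi> :: "'m pt"
      have "\<bar>u x - u \<xi>\<bar> * kap (mink x \<xi>) \<le> (\<bar>u x\<bar> + \<bar>u \<xi>\<bar>) * kap (mink x \<xi>)"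
        by (intro mult_right_mono kap_nonneg abs_triangle_ineq4)
      then show "norm (indicator {1 + e..} (mink x \<xi>) * ((u x - u \<xi>) * kap (mink x \<xi>)))
      \<le> norm (\<bar>u x\<bar> * (indicator {1 + e..} (mink x \<xi>) * kap (mink x \<xi>))
      + indicator {1 + e..} (mink x \<xi>) * (\<bar>u \<xi>\<bar> * kap (mink x \<xi>)))"
        using kap_nonneg[of "mink x \<xi>"] by (simp add: indicator_def abs_mult distrib_right)
    qed
  qed measurable
qed

text \<open>Near \<open>x\<close> the first-order term is replaced by \<open>l\<close>, which is odd
  under the point reflection in \<open>x\<close>; the two differ by a multiple of
  \<open>mink x \<xi> - 1\<close>. Adding \<open>l\<close> leaves the truncated integrals unchanged
  and makes the integrand absolutely integrable.\<close>

lemma trunc_converges: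
  assumes u: "admissible u x"
  obtains P where "(trunc u x \<longlongrightarrow> P) (at_right 0)"
proof -
  have x: "x \<in> hyperboloid" and um[measurable]: "u \<in> borel_measurable hvol"
    using u unfolding admissible_def by auto
  obtain w0 L g where g: "w0 > 0" "\<And>\<xi>. \<xi> \<in> hyperboloid \<Longrightarrow> mink x \<xi> < 1 + w0 \<Longrightarrow>
      \<bar>u \<xi> - u x - g \<bullet> (snd \<xi> - snd x)\<bar> \<le> L * (mink x \<xi> - 1)"
    using u unfolding admissible_def by blast
  define w where "w = min w0 1"
  have w: "0 < w" "w \<le> 1" "w \<le> w0" using g(1) by (auto simp: w_def)
  \<comment> \<open>Not a point of the hyperboloid: products with this vector reproduce the linear
    functional of the expansion.\<close>
  define y :: "'m pt" where "y = (0, - g)"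
  have gy: "g \<bullet> snd z = mink y z" for z by (simp add: y_def mink_def)
  define l where "l \<xi> = mink y \<xi> - mink y x * mink x \<xi>" for \<xi>
  have [measurable]: "l \<in> borel_measurable hvol" unfolding l_def by measurable
  define M where "M = L + \<bar>mink y x\<bar>"
  define q where "q \<xi> = indicator {..<1 + w} (mink x \<xi>) * ((u x - u \<xi> + l \<xi>) * kap (mink x \<xi>))
     + indicator {1 + w..} (mink x \<xi>) * ((u x - u \<xi>) * kap (mink x \<xi>))" for \<xi>
  have near: "\<bar>u x - u \<xi> + l \<xi>\<bar> \<le> M * (mink x \<xi> - 1)" if "\<xi> \<in> hyperboloid" "mink x \<xi> < 1 + w" for \<xi>
  proof -
    have "u x - u \<xi> + l \<xi> = - (u \<xi> - u x - g \<bullet> (snd \<xi> - snd x)) - mink y x * (mink x \<xi> - 1)"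
      unfolding l_def inner_diff_right gy by (simp add: algebra_simps)
    then have "\<bar>u x - u \<xi> + l \<xi>\<bar> \<le> \<bar>u \<xi> - u x - g \<bullet> (snd \<xi> - snd x)\<bar> + \<bar>mink y x * (mink x \<xi> - 1)\<bar>"
      by linarith
    also have "\<bar>mink y x * (mink x \<xi> - 1)\<bar> = \<bar>mink y x\<bar> * (mink x \<xi> - 1)"
      using mink_ge_1[OF x that(1)] by (simp add: abs_mult)
    also have "\<bar>u \<xi> - u x - g \<bullet> (snd \<xi> - snd x)\<bar> \<le> L * (mink x \<xi> - 1)" using g(2)[OF that(1)] that(2) w by simp
    finally show ?thesis by (simp add: M_def distrib_right)
  qed
  have inner: "integrable hvol (\<lambda>\<xi>. indicator {..<1 + w} (mink x \<xi>) * ((mink x \<xi> - 1) * kap (mink x \<xi>)))"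
    using kernel_inner_bound x w(1,2) by blast
  have q1: "integrable hvol (\<lambda>\<xi>. indicator {..<1 + w} (mink x \<xi>) * ((u x - u \<xi> + l \<xi>) * kap (mink x \<xi>)))"
  proof (rule Bochner_Integration.integrable_bound[OF integrable_mult_right[OF inner, of M]])
    show "AE \<xi> in hvol. norm (indicator {..<1 + w} (mink x \<xi>) * ((u x - u \<xi> + l \<xi>) * kap (mink x \<xi>)))
      \<le> norm (M * (indicator {..<1 + w} (mink x \<xi>) * ((mink x \<xi> - 1) * kap (mink x \<xi>))))"
    proof (rule AE_I2)
      fix \<xi> :: "'m pt" assume "\<xi> \<in> space hvol"
      then have xi: "\<xi> \<in> hyperboloid" by simp
      show "norm (indicator {..<1 + w} (mink x \<xi>) * ((u x - u \<xi> + l \<xi>) * kap (mink x \<xi>)))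
        \<le> norm (M * (indicator {..<1 + w} (mink x \<xi>) * ((mink x \<xi> - 1) * kap (mink x \<xi>))))"
      proof (cases "mink x \<xi> < 1 + w")
        case True
        have "\<bar>u x - u \<xi> + l \<xi>\<bar> * kap (mink x \<xi>) \<le> (M * (mink x \<xi> - 1)) * kap (mink x \<xi>)"
          by (intro mult_right_mono near xi True kap_nonneg)
        also have "\<dots> \<le> \<bar>(M * (mink x \<xi> - 1)) * kap (mink x \<xi>)\<bar>" by (rule abs_ge_self)
        finally show ?thesis using True kap_nonneg[of "mink x \<xi>"] by (simp add: abs_mult mult.assoc)
      qed simp
    qed
  qed measurable
  have q2: "integrable hvol (\<lambda>\<xi>. indicator {1 + w..} (mink x \<xi>) * ((u x - u \<xi>) * kap (mink x \<xi>)))"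
    by (rule difference_integrable[OF u w(1)])
  have qi: "integrable hvol q" unfolding q_def by (rule Bochner_Integration.integrable_add[OF q1 q2])
  have lim: "((\<lambda>\<delta>. LINT \<xi>|hvol. indicator {1 + \<delta>..} (mink x \<xi>) * q \<xi>) \<longlongrightarrow> (LINT \<xi>|hvol. q \<xi>)) (at_right 0)"
    by (rule trunc_tendsto[OF qi]) (simp add: q_def kap_def)
  have eq: "(LINT \<xi>|hvol. indicator {1 + \<delta>..} (mink x \<xi>) * q \<xi>) = trunc u x \<delta>" if d: "0 < \<delta>" "\<delta> < w" for \<delta>
  proof -
    define F where "F z = indicator {1 + \<delta>..<1 + w} z * kap z" for z
    have Fm: "F \<in> borel_measurable borel" unfolding F_def by measurable
    have dec: "indicator {1 + \<delta>..} (mink x \<xi>) * q \<xi>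
      = indicator {1 + \<delta>..} (mink x \<xi>) * ((u x - u \<xi>) * kap (mink x \<xi>)) + F (mink x \<xi>) * l \<xi>" for \<xi>
      unfolding q_def F_def using d by (auto simp: indicator_def algebra_simps)
    have i0: "integrable hvol (\<lambda>\<xi>. indicator {1 + \<delta>..} (mink x \<xi>) * ((u x - u \<xi>) * kap (mink x \<xi>)))"
      by (rule difference_integrable[OF u d(1)])
    have iq: "integrable hvol (\<lambda>\<xi>. indicator {1 + \<delta>..} (mink x \<xi>) * q \<xi>)"
      by (rule Bochner_Integration.integrable_bound[OF qi])
         (use borel_measurable_integrable[OF qi] in measurable, auto simp: indicator_def)
    have "integrable hvol (\<lambda>\<xi>. indicator {1 + \<delta>..} (mink x \<xi>) * q \<xi>
       - indicator {1 + \<delta>..} (mink x \<xi>) * ((u x - u \<xi>) * kap (mink x \<xi>)))"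
      by (rule Bochner_Integration.integrable_diff[OF iq i0])
    then have il: "integrable hvol (\<lambda>\<xi>. F (mink x \<xi>) * l \<xi>)" unfolding dec by simp
    have "(LINT \<xi>|hvol. indicator {1 + \<delta>..} (mink x \<xi>) * q \<xi>) = trunc u x \<delta> + (LINT \<xi>|hvol. F (mink x \<xi>) * l \<xi>)"
      unfolding dec trunc_def by (rule Bochner_Integration.integral_add[OF i0 il])
    also have "(LINT \<xi>|hvol. F (mink x \<xi>) * l \<xi>) = 0" unfolding l_def by (rule odd_integral_zero[OF x Fm])
    finally show ?thesis by simp
  qed
  have "\<forall>\<^sub>F \<delta> in at_right 0. (LINT \<xi>|hvol. indicator {1 + \<delta>..} (mink x \<xi>) * q \<xi>) = trunc u x \<delta>"
    unfolding eventually_at_right_field using eq w(1) by (intro exI[of _ w]) auto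
  from that[OF Lim_transform_eventually[OF lim this]] show ?thesis .
qed

section \<open>Estimates at a minimum point\<close>

definition krefl :: "real \<Rightarrow> 'm pt \<Rightarrow> 'm pt \<Rightarrow> real" where
  "krefl \<mu> x \<xi> = kap (mink x (leaf_refl \<mu> \<xi>))"

lemma krefl_eq: "krefl \<mu> x = (\<lambda>\<xi>. kap (mink x \<xi> + 2 * mink (leaf_normal \<mu>) x * mink (leaf_normal \<mu>) \<xi>))"
  by (simp add: krefl_def mink_leaf_refl fun_eq_iff)

lemma krefl_measurable [measurable]: "krefl \<mu> x \<in> borel_measurable hvol"
  unfolding krefl_eq by measurable

lemma krefl_nonneg: "0 \<le> krefl \<mu> x \<xi>"
  unfolding krefl_def by (rule kap_nonneg)

lemma krefl_less:
  assumes "0 < mink (leaf_normal \<mu>) x" "0 < mink (leaf_normal \<mu>) \<xi>" "1 < mink x \<xi>"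
  shows "krefl \<mu> x \<xi> < kap (mink x \<xi>)"
proof -
  have lt: "mink x \<xi> < mink x \<xi> + 2 * mink (leaf_normal \<mu>) x * mink (leaf_normal \<mu>) \<xi>" using assms by simp
  have gt: "1 < mink x \<xi> + 2 * mink (leaf_normal \<mu>) x * mink (leaf_normal \<mu>) \<xi>" using lt assms(3) by linarith
  show ?thesis unfolding krefl_eq kap_def using \<kappa>_strict[OF assms(3) lt] by (simp only: gt assms(3) if_True)
qed

text \<open>The kernel mass, seen from \<open>x\<close>, of the half space beyond the leaf. By
  reflection it is also the mass of \<open>krefl\<close> on the near side, and it blows up as
  \<open>x\<close> approaches the leaf.\<close>

definition Jout :: "real \<Rightarrow> 'm pt \<Rightarrow> real" where
  "Jout \<mu> x = (LINT \<xi>|hvol. indicator {..<0} (mink (leaf_normal \<mu>) \<xi>) * kap (mink x \<xi>))"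

lemma reflection_split:
  fixes f :: "'m pt \<Rightarrow> real"
  assumes f: "integrable hvol f"
  shows "integrable hvol (\<lambda>\<xi>. indicator {0<..} (mink (leaf_normal \<mu>) \<xi>) * f \<xi>)"
    and "integrable hvol (\<lambda>\<xi>. indicator {0<..} (mink (leaf_normal \<mu>) \<xi>) * f (leaf_refl \<mu> \<xi>))"
    and "(LINT \<xi>|hvol. f \<xi>) = (LINT \<xi>|hvol. indicator {0<..} (mink (leaf_normal \<mu>) \<xi>) * f \<xi>)
      + (LINT \<xi>|hvol. indicator {0<..} (mink (leaf_normal \<mu>) \<xi>) * f (leaf_refl \<mu> \<xi>))"
proof -
  let ?t = "mink (leaf_normal \<mu>)" and ?I = "leaf_refl \<mu>"
  have fm[measurable]: "f \<in> borel_measurable hvol" using f by (rule borel_measurable_integrable)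
  have i: "integrable hvol (\<lambda>\<xi>. indicator A (?t \<xi>) * f \<xi>)" if "A \<in> sets borel" for A :: "real set"
    by (rule Bochner_Integration.integrable_bound[OF f])
       (use that in measurable, auto simp: indicator_def)
  show i1: "integrable hvol (\<lambda>\<xi>. indicator {0<..} (?t \<xi>) * f \<xi>)" by (rule i) simp
  have i2: "integrable hvol (\<lambda>\<xi>. indicator {..<0} (?t \<xi>) * f \<xi>)" by (rule i) simp
  have m2: "(\<lambda>\<xi>. indicator {..<0} (?t \<xi>) * f \<xi>) \<in> borel_measurable hvol" by measurable
  have eq: "indicator {..<0} (?t (?I \<xi>)) * f (?I \<xi>) = indicator {0<..} (?t \<xi>) * f (?I \<xi>)" for \<xi>
    unfolding leaf_normal_refl by (simp add: indicator_def)
  show "integrable hvol (\<lambda>\<xi>. indicator {0<..} (?t \<xi>) * f (?I \<xi>))"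
    using hyp_iso_integrable[OF hyp_iso_leaf_refl m2, of \<mu>] i2 unfolding eq by blast
  have "(LINT \<xi>|hvol. f \<xi>) = (LINT \<xi>|hvol. indicator {0<..} (?t \<xi>) * f \<xi> + indicator {..<0} (?t \<xi>) * f \<xi>)"
  proof (rule integral_cong_AE)
    show "AE \<xi> in hvol. f \<xi> = indicator {0<..} (?t \<xi>) * f \<xi> + indicator {..<0} (?t \<xi>) * f \<xi>"
      using leaf_null[of \<mu>] by eventually_elim (auto simp: indicator_def)
  qed measurable
  also have "\<dots> = (LINT \<xi>|hvol. indicator {0<..} (?t \<xi>) * f \<xi>) + (LINT \<xi>|hvol. indicator {..<0} (?t \<xi>) * f \<xi>)"
    by (rule Bochner_Integration.integral_add[OF i1 i2])
  also have "(LINT \<xi>|hvol. indicator {..<0} (?t \<xi>) * f \<xi>) = (LINT \<xi>|hvol. indicator {0<..} (?t \<xi>) * f (?I \<xi>))"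
    using hyp_iso_integral[OF hyp_iso_leaf_refl m2, of \<mu>] unfolding eq by (rule sym)
  finally show "(LINT \<xi>|hvol. f \<xi>) = (LINT \<xi>|hvol. indicator {0<..} (?t \<xi>) * f \<xi>)
      + (LINT \<xi>|hvol. indicator {0<..} (?t \<xi>) * f (?I \<xi>))" .
qed

lemma Jout_integrable:
  assumes x: "x \<in> (hyperboloid :: 'm pt set)" and t: "0 < mink (leaf_normal \<mu>) x"
  shows "integrable hvol (\<lambda>\<xi>. indicator {..<0} (mink (leaf_normal \<mu>) \<xi>) * kap (mink x \<xi>))"
proof -
  let ?t = "mink (leaf_normal \<mu>)"
  define e where "e = sqrt (1 + (?t x)\<^sup>2) - 1"
  have e: "0 < e" using t by (simp add: e_def)
  show ?thesis
  proof (rule Bochner_Integration.integrable_bound[OF outer_integrable[OF x e]])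
    show "AE \<xi> in hvol. norm (indicator {..<0} (?t \<xi>) * kap (mink x \<xi>)) \<le> norm (indicator {1 + e..} (mink x \<xi>) * kap (mink x \<xi>))"
    proof (rule AE_I2)
      fix \<xi> :: "'m pt" assume "\<xi> \<in> space hvol"
      then have xi: "\<xi> \<in> hyperboloid" by simp
      show "norm (indicator {..<0} (?t \<xi>) * kap (mink x \<xi>)) \<le> norm (indicator {1 + e..} (mink x \<xi>) * kap (mink x \<xi>))"
      proof (cases "?t \<xi> < 0")
        case True
        then have "1 + e \<le> mink x \<xi>"
          using mink_cross[OF x xi mink_leaf_normal_self t] by (simp add: e_def)
        then show ?thesis by (simp add: indicator_def)
      qed simp
    qed
  qed measurable
qed

lemma krefl_integral:
  assumes x: "x \<in> (hyperboloid :: 'm pt set)" and t: "0 < mink (leaf_normal \<mu>) x"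
  shows "integrable hvol (\<lambda>\<xi>. indicator {0<..} (mink (leaf_normal \<mu>) \<xi>) * krefl \<mu> x \<xi>)"
    and "(LINT \<xi>|hvol. indicator {0<..} (mink (leaf_normal \<mu>) \<xi>) * krefl \<mu> x \<xi>) = Jout \<mu> x"
proof -
  let ?t = "mink (leaf_normal \<mu>)" and ?I = "leaf_refl \<mu>"
  note J = Jout_integrable[OF x t]
  have m2: "(\<lambda>\<xi>. indicator {..<0} (?t \<xi>) * kap (mink x \<xi>)) \<in> borel_measurable hvol" by measurable
  have eq: "indicator {..<0} (?t (?I \<xi>)) * kap (mink x (?I \<xi>)) = indicator {0<..} (?t \<xi>) * krefl \<mu> x \<xi>" for \<xi>
    unfolding leaf_normal_refl krefl_def by (simp add: indicator_def)
  show "integrable hvol (\<lambda>\<xi>. indicator {0<..} (?t \<xi>) * krefl \<mu> x \<xi>)"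
    using hyp_iso_integrable[OF hyp_iso_leaf_refl m2, of \<mu>] J unfolding eq by blast
  show "(LINT \<xi>|hvol. indicator {0<..} (?t \<xi>) * krefl \<mu> x \<xi>) = Jout \<mu> x"
    using hyp_iso_integral[OF hyp_iso_leaf_refl m2, of \<mu>] unfolding eq Jout_def .
qed

text \<open>Antisymmetry off the leaf only; values on the leaf itself are left free.\<close>

definition odd_refl :: "real \<Rightarrow> ('m pt \<Rightarrow> real) \<Rightarrow> bool" where
  "odd_refl \<mu> u \<longleftrightarrow> (\<forall>\<xi>\<in>hyperboloid. 0 < mink (leaf_normal \<mu>) \<xi> \<longrightarrow> u (leaf_refl \<mu> \<xi>) = - u \<xi>)"

definition sym_integrand :: "real \<Rightarrow> ('m pt \<Rightarrow> real) \<Rightarrow> 'm pt \<Rightarrow> real \<Rightarrow> 'm pt \<Rightarrow> real" where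
  "sym_integrand \<mu> u x \<delta> \<xi> = indicator {0<..} (mink (leaf_normal \<mu>) \<xi>) *
     (indicator {1 + \<delta>..} (mink x \<xi>) * ((u x - u \<xi>) * (kap (mink x \<xi>) - krefl \<mu> x \<xi>)))"

text \<open>Folding the principal value onto the half space: the reflected half contributes
  \<open>(u x + u \<xi>) krefl = 2 u x krefl - (u x - u \<xi>) krefl\<close>.\<close>

lemma trunc_folded:
  assumes u: "admissible u x" and odd: "odd_refl \<mu> u" and t: "0 < mink (leaf_normal \<mu>) x"
  shows "0 < \<delta> \<Longrightarrow> integrable hvol (sym_integrand \<mu> u x \<delta>)"
    and "(trunc u x \<longlongrightarrow> P) (at_right 0) \<Longrightarrow>
      ((\<lambda>\<delta>. (LINT \<xi>|hvol. sym_integrand \<mu> u x \<delta> \<xi>) + 2 * u x * Jout \<mu> x) \<longlongrightarrow> P) (at_right 0)"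
proof -
  let ?t = "mink (leaf_normal \<mu>)" and ?I = "leaf_refl \<mu>"
  have x: "x \<in> hyperboloid" and um[measurable]: "u \<in> borel_measurable hvol"
    using u unfolding admissible_def by auto
  \<comment> \<open>By \<open>mink_cross\<close> all points beyond the leaf have product at least
    \<open>1 + e\<close> with \<open>x\<close>. Hence for \<open>\<delta> \<le> e\<close> the
    truncation is invisible on the reflected half, as \<open>foldf\<close> requires.\<close>
  define e where "e = sqrt (1 + (?t x)\<^sup>2) - 1"
  have e: "0 < e" using t by (simp add: e_def)
  define f where "f \<delta> \<xi> = indicator {1 + \<delta>..} (mink x \<xi>) * ((u x - u \<xi>) * kap (mink x \<xi>))" for \<delta> \<xi>
  have fi: "integrable hvol (f \<delta>)" if "0 < \<delta>" for \<delta>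
    unfolding f_def[abs_def] by (rule difference_integrable[OF u that])
  have foldf: "indicator {0<..} (?t \<xi>) * f \<delta> (?I \<xi>) = indicator {0<..} (?t \<xi>) * ((u x + u \<xi>) * krefl \<mu> x \<xi>)"
    if d: "\<delta> \<le> e" and xi: "\<xi> \<in> hyperboloid" for \<delta> \<xi>
  proof (cases "0 < ?t \<xi>")
    case True
    have "u (?I \<xi>) = - u \<xi>" using odd xi True unfolding odd_refl_def by blast
    moreover have "1 + e \<le> mink x (?I \<xi>)"
      using mink_cross[OF x hyp_iso_in[OF hyp_iso_leaf_refl xi] mink_leaf_normal_self t] True
      by (simp add: leaf_normal_refl e_def)
    ultimately show ?thesis using d by (simp add: f_def krefl_def indicator_def)
  qed simp
  define g where "g \<xi> = indicator {0<..} (?t \<xi>) * ((u x - u \<xi>) * krefl \<mu> x \<xi>)" for \<xi>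
  have pi: "integrable hvol (\<lambda>\<xi>. indicator {0<..} (?t \<xi>) * ((u x + u \<xi>) * krefl \<mu> x \<xi>))"
  proof -
    have "integrable hvol (\<lambda>\<xi>. indicator {0<..} (?t \<xi>) * f e (?I \<xi>))
      \<longleftrightarrow> integrable hvol (\<lambda>\<xi>. indicator {0<..} (?t \<xi>) * ((u x + u \<xi>) * krefl \<mu> x \<xi>))"
      by (rule Bochner_Integration.integrable_cong[OF refl]) (use foldf[of e] in simp)
    then show ?thesis using reflection_split(2)[OF fi[OF e], of \<mu>] by blast
  qed
  note ki = krefl_integral[OF x t]
  have geq: "g \<xi> = 2 * u x * (indicator {0<..} (?t \<xi>) * krefl \<mu> x \<xi>) - indicator {0<..} (?t \<xi>) * ((u x + u \<xi>) * krefl \<mu> x \<xi>)" for \<xi>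
    unfolding g_def by (simp add: algebra_simps)
  have gi: "integrable hvol g"
    unfolding geq[abs_def] by (rule Bochner_Integration.integrable_diff[OF integrable_mult_right[OF ki(1)] pi])
  have gint: "(LINT \<xi>|hvol. g \<xi>) = 2 * u x * Jout \<mu> x - (LINT \<xi>|hvol. indicator {0<..} (?t \<xi>) * ((u x + u \<xi>) * krefl \<mu> x \<xi>))"
    unfolding geq using Bochner_Integration.integral_diff[OF integrable_mult_right[OF ki(1), of "2 * u x"] pi] ki(2) by simp
  have gdi: "integrable hvol (\<lambda>\<xi>. indicator {1 + \<delta>..} (mink x \<xi>) * g \<xi>)" for \<delta>
    by (rule Bochner_Integration.integrable_bound[OF gi])
       (use borel_measurable_integrable[OF gi] in measurable, auto simp: indicator_def)
  have S: "sym_integrand \<mu> u x \<delta> = (\<lambda>\<xi>. indicator {0<..} (?t \<xi>) * f \<delta> \<xi> - indicator {1 + \<delta>..} (mink x \<xi>) * g \<xi>)" for \<delta>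
    unfolding sym_integrand_def f_def g_def by (simp add: fun_eq_iff algebra_simps)
  show "integrable hvol (sym_integrand \<mu> u x \<delta>)" if "0 < \<delta>" for \<delta>
    unfolding S by (rule Bochner_Integration.integrable_diff[OF reflection_split(1)[OF fi[OF that]] gdi])
  assume lim: "(trunc u x \<longlongrightarrow> P) (at_right 0)"
  have eq: "trunc u x \<delta> + ((LINT \<xi>|hvol. g \<xi>) - (LINT \<xi>|hvol. indicator {1 + \<delta>..} (mink x \<xi>) * g \<xi>))
    = (LINT \<xi>|hvol. sym_integrand \<mu> u x \<delta> \<xi>) + 2 * u x * Jout \<mu> x" if d: "0 < \<delta>" "\<delta> < e" for \<delta>
  proof -
    have "trunc u x \<delta> = (LINT \<xi>|hvol. indicator {0<..} (?t \<xi>) * f \<delta> \<xi>) + (LINT \<xi>|hvol. indicator {0<..} (?t \<xi>) * f \<delta> (?I \<xi>))"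
      unfolding trunc_def using reflection_split(3)[OF fi[OF d(1)], of \<mu>] by (simp add: f_def)
    also have "(LINT \<xi>|hvol. indicator {0<..} (?t \<xi>) * f \<delta> (?I \<xi>)) = (LINT \<xi>|hvol. indicator {0<..} (?t \<xi>) * ((u x + u \<xi>) * krefl \<mu> x \<xi>))"
      by (rule Bochner_Integration.integral_cong[OF refl]) (use foldf[of \<delta>] d in simp)
    finally have "trunc u x \<delta> = (LINT \<xi>|hvol. indicator {0<..} (?t \<xi>) * f \<delta> \<xi>) + (2 * u x * Jout \<mu> x - (LINT \<xi>|hvol. g \<xi>))"
      using gint by simp
    moreover have "(LINT \<xi>|hvol. sym_integrand \<mu> u x \<delta> \<xi>) = (LINT \<xi>|hvol. indicator {0<..} (?t \<xi>) * f \<delta> \<xi>)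
       - (LINT \<xi>|hvol. indicator {1 + \<delta>..} (mink x \<xi>) * g \<xi>)"
      unfolding S by (rule Bochner_Integration.integral_diff[OF reflection_split(1)[OF fi[OF d(1)]] gdi])
    ultimately show ?thesis by simp
  qed
  \<comment> \<open>\<open>sym_integrand\<close> also truncates the reflected kernel, which the
    folded integral does not. The discrepancy is the integral of \<open>g\<close> over shrinking
    sets around \<open>x\<close>.\<close>
  have "((\<lambda>\<delta>. LINT \<xi>|hvol. indicator {1 + \<delta>..} (mink x \<xi>) * g \<xi>) \<longlongrightarrow> (LINT \<xi>|hvol. g \<xi>)) (at_right 0)"
  proof (rule trunc_tendsto[OF gi])
    fix \<xi> :: "'m pt" assume "\<xi> \<in> hyperboloid" "mink x \<xi> \<le> 1"
    then have "\<xi> = x" using mink_gt_1[OF x, of \<xi>] by fastforce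
    then show "g \<xi> = 0" by (simp add: g_def)
  qed
  then have "((\<lambda>\<delta>. trunc u x \<delta> + ((LINT \<xi>|hvol. g \<xi>) - (LINT \<xi>|hvol. indicator {1 + \<delta>..} (mink x \<xi>) * g \<xi>)))
    \<longlongrightarrow> P + ((LINT \<xi>|hvol. g \<xi>) - (LINT \<xi>|hvol. g \<xi>))) (at_right 0)"
    by (intro tendsto_add lim tendsto_diff tendsto_const)
  then have lim2: "((\<lambda>\<delta>. trunc u x \<delta> + ((LINT \<xi>|hvol. g \<xi>) - (LINT \<xi>|hvol. indicator {1 + \<delta>..} (mink x \<xi>) * g \<xi>)))
    \<longlongrightarrow> P) (at_right 0)" by simp
  have "\<forall>\<^sub>F \<delta> in at_right 0. trunc u x \<delta> + ((LINT \<xi>|hvol. g \<xi>) - (LINT \<xi>|hvol. indicator {1 + \<delta>..} (mink x \<xi>) * g \<xi>))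
    = (LINT \<xi>|hvol. sym_integrand \<mu> u x \<delta> \<xi>) + 2 * u x * Jout \<mu> x"
    unfolding eventually_at_right_field using eq e by (intro exI[of _ e]) auto
  from Lim_transform_eventually[OF lim2 this]
  show "((\<lambda>\<delta>. (LINT \<xi>|hvol. sym_integrand \<mu> u x \<delta> \<xi>) + 2 * u x * Jout \<mu> x) \<longlongrightarrow> P) (at_right 0)" .
qed

lemma folded_upper:
  assumes u: "admissible u x" and odd: "odd_refl \<mu> u" and t: "0 < mink (leaf_normal \<mu>) x"
    and lim: "(trunc u x \<longlongrightarrow> P) (at_right 0)" and r: "0 < r"
    and B: "\<And>\<delta>. 0 < \<delta> \<Longrightarrow> \<delta> < r \<Longrightarrow> (LINT \<xi>|hvol. sym_integrand \<mu> u x \<delta> \<xi>) \<le> B"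
  shows "P \<le> B + 2 * u x * Jout \<mu> x"
proof (rule tendsto_upperbound[OF trunc_folded(2)[OF u odd t lim]])
  show "\<forall>\<^sub>F \<delta> in at_right 0. (LINT \<xi>|hvol. sym_integrand \<mu> u x \<delta> \<xi>) + 2 * u x * Jout \<mu> x \<le> B + 2 * u x * Jout \<mu> x"
    unfolding eventually_at_right_field using B r by (intro exI[of _ r]) auto
qed simp

text \<open>\<open>N\<close> may lie on both sides of the leaf. On the near side folding yields its
  kernel mass minus its reflected mass; the two copies of \<open>Jout\<close> compensate this loss
  and cover the part of \<open>N\<close> beyond the leaf, each of the two being at most
  \<open>Jout\<close>.\<close>

lemma minimum_estimate:
  assumes u: "admissible u x" and odd: "odd_refl \<mu> u" and t: "0 < mink (leaf_normal \<mu>) x"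
    and lim: "(trunc u x \<longlongrightarrow> P) (at_right 0)" and ux: "u x \<le> 0"
    and min: "\<And>\<xi>. \<xi> \<in> hyperboloid \<Longrightarrow> 0 < mink (leaf_normal \<mu>) \<xi> \<Longrightarrow> u x \<le> u \<xi>"
    and N: "N \<in> sets hvol" "\<And>\<xi>. \<xi> \<in> N \<Longrightarrow> 0 < mink (leaf_normal \<mu>) \<xi> \<Longrightarrow> 0 \<le> u \<xi>"
    and r: "0 < r" "\<And>\<xi>. \<xi> \<in> N \<Longrightarrow> 1 + r \<le> mink x \<xi>"
  shows "integrable hvol (\<lambda>\<xi>. indicator N \<xi> * kap (mink x \<xi>))"
    and "P \<le> u x * (LINT \<xi>|hvol. indicator N \<xi> * kap (mink x \<xi>))"
proof -
  let ?t = "mink (leaf_normal \<mu>)" and ?I = "leaf_refl \<mu>"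
  have x: "x \<in> hyperboloid" using u unfolding admissible_def by auto
  have Nm[measurable]: "(indicator N :: 'm pt \<Rightarrow> real) \<in> borel_measurable hvol" using N(1) by measurable
  let ?k = "\<lambda>\<xi>. indicator N \<xi> * kap (mink x \<xi>)"
  show Ni: "integrable hvol ?k"
  proof (rule Bochner_Integration.integrable_bound[OF outer_integrable[OF x r(1)]])
    show "AE \<xi> in hvol. norm (?k \<xi>) \<le> norm (indicator {1 + r..} (mink x \<xi>) * kap (mink x \<xi>))"
      using r(2) by (intro AE_I2) (simp add: indicator_def)
  qed measurable
  note Ns = reflection_split[OF Ni, of \<mu>]
  note ki = krefl_integral[OF x t]
  have NJ: "(LINT \<xi>|hvol. indicator {0<..} (?t \<xi>) * ?k (?I \<xi>)) \<le> Jout \<mu> x"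
    unfolding ki(2)[symmetric]
  proof (rule integral_mono[OF Ns(2) ki(1)])
    fix \<xi> show "indicator {0<..} (?t \<xi>) * ?k (?I \<xi>) \<le> indicator {0<..} (?t \<xi>) * krefl \<mu> x \<xi>"
      using kap_nonneg by (intro mult_left_mono) (auto simp: krefl_def indicator_def)
  qed
  let ?h = "\<lambda>\<xi>. indicator {0<..} (?t \<xi>) * (indicator N \<xi> * krefl \<mu> x \<xi>)"
  have hi: "integrable hvol ?h"
  proof (rule Bochner_Integration.integrable_bound[OF ki(1)])
    show "AE \<xi> in hvol. norm (?h \<xi>) \<le> norm (indicator {0<..} (?t \<xi>) * krefl \<mu> x \<xi>)"
      by (intro AE_I2) (simp add: indicator_def)
  qed measurable
  have hJ: "(LINT \<xi>|hvol. ?h \<xi>) \<le> Jout \<mu> x"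
    unfolding ki(2)[symmetric]
  proof (rule integral_mono[OF hi ki(1)])
    fix \<xi> show "?h \<xi> \<le> indicator {0<..} (?t \<xi>) * krefl \<mu> x \<xi>"
      using krefl_nonneg[of \<mu> x \<xi>] by (simp add: indicator_def)
  qed
  let ?A = "LINT \<xi>|hvol. indicator {0<..} (?t \<xi>) * ?k \<xi>" and ?A' = "LINT \<xi>|hvol. ?h \<xi>"
  have "P \<le> u x * (?A - ?A') + 2 * u x * Jout \<mu> x"
  proof (rule folded_upper[OF u odd t lim r(1)])
    fix \<delta> assume d: "0 < \<delta>" "\<delta> < r"
    have di: "integrable hvol (\<lambda>\<xi>. u x * (indicator {0<..} (?t \<xi>) * ?k \<xi> - ?h \<xi>))"
      by (intro integrable_mult_right Bochner_Integration.integrable_diff Ns(1) hi)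
    have "(LINT \<xi>|hvol. sym_integrand \<mu> u x \<delta> \<xi>) \<le> (LINT \<xi>|hvol. u x * (indicator {0<..} (?t \<xi>) * ?k \<xi> - ?h \<xi>))"
    proof (rule integral_mono[OF trunc_folded(1)[OF u odd t d(1)] di])
      fix \<xi> :: "'m pt" assume "\<xi> \<in> space hvol"
      then have xi: "\<xi> \<in> hyperboloid" by simp
      show "sym_integrand \<mu> u x \<delta> \<xi> \<le> u x * (indicator {0<..} (?t \<xi>) * ?k \<xi> - ?h \<xi>)"
      proof (cases "0 < ?t \<xi>")
        case True
        note pt = this
        show ?thesis
        proof (cases "1 + \<delta> \<le> mink x \<xi>")
          case True
          then have "krefl \<mu> x \<xi> < kap (mink x \<xi>)" using d by (intro krefl_less[OF t pt]) simp
          then have k: "0 \<le> kap (mink x \<xi>) - krefl \<mu> x \<xi>" by simp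
          show ?thesis
          proof (cases "\<xi> \<in> N")
            case True
            have "(u x - u \<xi>) * (kap (mink x \<xi>) - krefl \<mu> x \<xi>) \<le> u x * (kap (mink x \<xi>) - krefl \<mu> x \<xi>)"
              using N(2)[OF True pt] k by (intro mult_right_mono) auto
            then show ?thesis using True pt \<open>1 + \<delta> \<le> mink x \<xi>\<close> by (simp add: sym_integrand_def)
          next
            case False
            have "(u x - u \<xi>) * (kap (mink x \<xi>) - krefl \<mu> x \<xi>) \<le> 0"
              using min[OF xi pt] k by (intro mult_nonpos_nonneg) auto
            then show ?thesis using False pt \<open>1 + \<delta> \<le> mink x \<xi>\<close> by (simp add: sym_integrand_def)
          qed
        next
          case False
          then have "\<xi> \<notin> N" using r(2)[of \<xi>] d by auto
          then show ?thesis using False by (simp add: sym_integrand_def)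
        qed
      qed (simp add: sym_integrand_def)
    qed
    also have "\<dots> = u x * (?A - ?A')"
      by (simp add: Bochner_Integration.integral_diff[OF Ns(1) hi])
    finally show "(LINT \<xi>|hvol. sym_integrand \<mu> u x \<delta> \<xi>) \<le> u x * (?A - ?A')" .
  qed
  also have "u x * (?A - ?A') + 2 * u x * Jout \<mu> x = u x * (?A - ?A' + 2 * Jout \<mu> x)" by (simp add: algebra_simps)
  also have "\<dots> \<le> u x * (LINT \<xi>|hvol. ?k \<xi>)"
    using NJ hJ ux unfolding Ns(3) by (intro mult_left_mono_neg) auto
  finally show "P \<le> u x * (LINT \<xi>|hvol. ?k \<xi>)" .
qed

text \<open>The folded integrands are nonpositive and decrease as \<open>\<delta>\<close> does, so a
  nonnegative limit forces each integral to vanish, and with it each integrand almost everywhere.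
  The countably many values \<open>1 / (n + 1)\<close> of \<open>\<delta>\<close> exhaust the near
  side, and reflection transfers the result to the other.\<close>

lemma zero_minimum_ae:
  assumes u: "admissible u x" and odd: "odd_refl \<mu> u" and t: "0 < mink (leaf_normal \<mu>) x"
    and lim: "(trunc u x \<longlongrightarrow> P) (at_right 0)" and P: "0 \<le> P" and ux: "u x = 0"
    and min: "\<And>\<xi>. \<xi> \<in> hyperboloid \<Longrightarrow> 0 < mink (leaf_normal \<mu>) \<xi> \<Longrightarrow> 0 \<le> u \<xi>"
  shows "AE \<xi> in hvol. u \<xi> = 0"
proof -
  let ?t = "mink (leaf_normal \<mu>)" and ?I = "leaf_refl \<mu>"
  have x: "x \<in> hyperboloid" using u unfolding admissible_def by auto
  have neg: "sym_integrand \<mu> u x \<delta> \<xi> \<le> 0" if "0 < \<delta>" "\<xi> \<in> hyperboloid" for \<delta> \<xi>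
  proof (cases "0 < ?t \<xi> \<and> 1 + \<delta> \<le> mink x \<xi>")
    case True
    then have "krefl \<mu> x \<xi> < kap (mink x \<xi>)" using that by (intro krefl_less[OF t]) auto
    then have "(u x - u \<xi>) * (kap (mink x \<xi>) - krefl \<mu> x \<xi>) \<le> 0"
      using min[OF that(2)] True ux by (intro mult_nonpos_nonneg) auto
    then show ?thesis using True by (simp add: sym_integrand_def)
  qed (auto simp: sym_integrand_def indicator_def)
  have mono: "sym_integrand \<mu> u x \<delta>' \<xi> \<le> sym_integrand \<mu> u x \<delta> \<xi>" if "0 < \<delta>'" "\<delta>' \<le> \<delta>" "\<xi> \<in> hyperboloid" for \<delta> \<delta>' \<xi>
  proof (cases "1 + \<delta> \<le> mink x \<xi>")
    case True
    then show ?thesis using that by (simp add: sym_integrand_def)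
  next
    case False
    then have "sym_integrand \<mu> u x \<delta> \<xi> = 0" by (simp add: sym_integrand_def)
    then show ?thesis using neg[OF that(1,3)] by simp
  qed
  note Si = trunc_folded(1)[OF u odd t]
  have zero: "AE \<xi> in hvol. sym_integrand \<mu> u x \<delta> \<xi> = 0" if d: "0 < \<delta>" for \<delta>
  proof -
    have "P \<le> (LINT \<xi>|hvol. sym_integrand \<mu> u x \<delta> \<xi>) + 2 * u x * Jout \<mu> x"
    proof (rule folded_upper[OF u odd t lim d])
      fix \<delta>' assume d': "0 < \<delta>'" "\<delta>' < \<delta>"
      show "(LINT \<xi>|hvol. sym_integrand \<mu> u x \<delta>' \<xi>) \<le> (LINT \<xi>|hvol. sym_integrand \<mu> u x \<delta> \<xi>)"
        by (rule integral_mono[OF Si[OF d'(1)] Si[OF d]]) (use mono d' in simp)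
    qed
    then have ge: "0 \<le> (LINT \<xi>|hvol. sym_integrand \<mu> u x \<delta> \<xi>)" using P ux by simp
    have ni: "integrable hvol (\<lambda>\<xi>. - sym_integrand \<mu> u x \<delta> \<xi>)"
      by (rule Bochner_Integration.integrable_minus[OF Si[OF d]])
    have nn: "AE \<xi> in hvol. 0 \<le> - sym_integrand \<mu> u x \<delta> \<xi>" by (rule AE_I2) (use neg[OF d] in simp)
    have "(LINT \<xi>|hvol. - sym_integrand \<mu> u x \<delta> \<xi>) = 0"
      using ge integral_nonneg_AE[OF nn] by simp
    then have "AE \<xi> in hvol. - sym_integrand \<mu> u x \<delta> \<xi> = 0"
      using integral_nonneg_eq_0_iff_AE[OF ni nn] by blast
    then show ?thesis by simp
  qed
  have "AE \<xi> in hvol. \<forall>n::nat. sym_integrand \<mu> u x (1 / real (Suc n)) \<xi> = 0"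
    unfolding AE_all_countable using zero by simp
  then have half: "AE \<xi> in hvol. 0 < ?t \<xi> \<longrightarrow> u \<xi> = 0"
    using AE_space
  proof eventually_elim
    case (elim \<xi>)
    then have xi: "\<xi> \<in> hyperboloid" by simp
    show ?case
    proof
      assume pt: "0 < ?t \<xi>"
      show "u \<xi> = 0"
      proof (cases "\<xi> = x")
        case False
        then have gt: "1 < mink x \<xi>" using mink_gt_1[OF x xi] by simp
        then obtain n :: nat where n: "1 / real (Suc n) < mink x \<xi> - 1"
          using reals_Archimedean[of "mink x \<xi> - 1"] by (auto simp: inverse_eq_divide)
        have "(u x - u \<xi>) * (kap (mink x \<xi>) - krefl \<mu> x \<xi>) = 0"
          using elim(1)[rule_format, of n] n pt by (simp add: sym_integrand_def)
        then show ?thesis using krefl_less[OF t pt gt] ux by simp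
      qed (use ux in simp)
    qed
  qed
  have "AE \<xi> in hvol. 0 < ?t (?I \<xi>) \<longrightarrow> u (?I \<xi>) = 0"
    by (rule hyp_iso_AE[OF hyp_iso_leaf_refl half])
  with half leaf_null[of \<mu>] AE_space show ?thesis
  proof eventually_elim
    case (elim \<xi>)
    then have xi: "\<xi> \<in> hyperboloid" by simp
    show ?case
    proof (cases "0 < ?t \<xi>")
      case False
      then have pt: "0 < ?t (?I \<xi>)" using elim(2) by (simp add: leaf_normal_refl)
      have "u (?I (?I \<xi>)) = - u (?I \<xi>)"
        using odd hyp_iso_in[OF hyp_iso_leaf_refl xi] pt unfolding odd_refl_def by blast
      then show ?thesis using elim(4) pt by (simp add: leaf_refl_involution[OF xi])
    qed (use elim in simp)
  qed
qed

text \<open>The linear function \<open>\<xi> \<mapsto> mink y \<xi>\<close> serves as the perturbation near the leaf: modulo the part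
  that is odd under the point reflection in \<open>x\<close>, it is \<open>mink y x * (mink x \<xi> - 1)\<close>.\<close>

lemma perturbed_minimum_estimate:
  assumes u: "admissible u x" and odd: "odd_refl \<mu> u" and t: "0 < mink (leaf_normal \<mu>) x"
    and lim: "(trunc u x \<longlongrightarrow> P) (at_right 0)"
    and y: "y \<in> hyperboloid" "mink y x \<le> 1 + b" and b: "0 < b" "b \<le> 1"
    and ball: "1 + b \<le> sqrt (1 + (mink (leaf_normal \<mu>) x)\<^sup>2)" and E: "0 \<le> E"
    and u1: "\<And>\<xi>. \<xi> \<in> hyperboloid \<Longrightarrow> 0 < mink (leaf_normal \<mu>) \<xi> \<Longrightarrow> u x - u \<xi> \<le> E / b * (mink y \<xi> - mink y x)"
    and u2: "\<And>\<xi>. \<xi> \<in> hyperboloid \<Longrightarrow> 0 < mink (leaf_normal \<mu>) \<xi> \<Longrightarrow> u x - u \<xi> \<le> E"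
    and C1: "integrable hvol (\<lambda>\<xi>. indicator {..<1 + b} (mink x \<xi>) * ((mink x \<xi> - 1) * kap (mink x \<xi>)))"
      "(LINT \<xi>|hvol. indicator {..<1 + b} (mink x \<xi>) * ((mink x \<xi> - 1) * kap (mink x \<xi>))) \<le> C1 * b"
    and C2: "(LINT \<xi>|hvol. indicator {1 + b..} (mink x \<xi>) * kap (mink x \<xi>)) \<le> C2"
  shows "P \<le> E * (2 * C1 + C2 + Jout \<mu> x) + 2 * u x * Jout \<mu> x"
proof -
  let ?t = "mink (leaf_normal \<mu>)" and ?k = "\<lambda>\<xi>. kap (mink x \<xi>)" and ?A = "E / b"
  have x: "x \<in> hyperboloid" using u unfolding admissible_def by auto
  note ki = krefl_integral[OF x t] and oi = outer_integrable[OF x b(1)]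
  have A: "0 \<le> ?A" using E b by simp
  define h1 where "h1 \<xi> = indicator {..<1 + b} (mink x \<xi>) * ((mink x \<xi> - 1) * ?k \<xi>)" for \<xi>
  define h2 where "h2 \<xi> = indicator {0<..} (?t \<xi>) * krefl \<mu> x \<xi>" for \<xi>
  define h3 where "h3 \<xi> = indicator {1 + b..} (mink x \<xi>) * ?k \<xi>" for \<xi>
  define l where "l \<delta> \<xi> = indicator {1 + \<delta>..<1 + b} (mink x \<xi>) * ?k \<xi> * (mink y \<xi> - mink y x * mink x \<xi>)" for \<delta> \<xi>
  have i: "integrable hvol h1" "integrable hvol h2" "integrable hvol h3"
    unfolding h1_def[abs_def] h2_def[abs_def] h3_def[abs_def] using C1(1) ki(1) oi by blast+
  have "P \<le> (?A * (2 * (C1 * b)) + E * Jout \<mu> x + E * C2) + 2 * u x * Jout \<mu> x"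
  proof (rule folded_upper[OF u odd t lim b(1)])
    fix \<delta> assume d: "0 < \<delta>" "\<delta> < b"
    define G where "G \<xi> = ?A * (2 * h1 \<xi>) + E * h2 \<xi> + E * h3 \<xi>" for \<xi>
    have Gi: "integrable hvol G" unfolding G_def[abs_def]
      by (intro Bochner_Integration.integrable_add integrable_mult_right i)
    have lm: "l \<delta> \<in> borel_measurable hvol" unfolding l_def by measurable
    have pw: "sym_integrand \<mu> u x \<delta> \<xi> \<le> G \<xi> + ?A * l \<delta> \<xi>" if "\<xi> \<in> space hvol" for \<xi>
    proof -
      have xi: "\<xi> \<in> hyperboloid" using that by simp
      have m1: "1 \<le> mink x \<xi>" by (rule mink_ge_1[OF x xi])
      have yx: "1 \<le> mink y x" "1 \<le> mink y \<xi>" using mink_ge_1[OF y(1)] x xi by auto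
      have nn: "0 \<le> h1 \<xi>" "0 \<le> h2 \<xi>" "0 \<le> h3 \<xi>"
        unfolding h1_def h2_def h3_def using m1 kap_nonneg krefl_nonneg by (auto simp: indicator_def)
      have nnA: "0 \<le> ?A * (2 * h1 \<xi>)" "0 \<le> E * h2 \<xi>" "0 \<le> E * h3 \<xi>"
        by (rule mult_nonneg_nonneg, use A E nn in simp_all)+
      have Gnn: "0 \<le> G \<xi>" unfolding G_def using nnA by linarith
      show ?thesis
      proof (cases "1 + b \<le> mink x \<xi>")
        case True
        then have l0: "l \<delta> \<xi> = 0" by (simp add: l_def)
        show ?thesis
        proof (cases "0 < ?t \<xi>")
          case pt: True
          have "krefl \<mu> x \<xi> < ?k \<xi>" using True b by (intro krefl_less[OF t pt]) simp
          then have "(u x - u \<xi>) * (?k \<xi> - krefl \<mu> x \<xi>) \<le> E * (?k \<xi> - krefl \<mu> x \<xi>)"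
            using u2[OF xi pt] by (intro mult_right_mono) auto
          also have "\<dots> \<le> E * ?k \<xi>" using E krefl_nonneg[of \<mu> x \<xi>] by (intro mult_left_mono) auto
          also have "\<dots> = E * h3 \<xi>" using True by (simp add: h3_def)
          also have "\<dots> \<le> G \<xi>" unfolding G_def using nnA by linarith
          finally show ?thesis using pt True d l0 by (simp add: sym_integrand_def)
        qed (use Gnn l0 in \<open>simp add: sym_integrand_def\<close>)
      next
        case False
        \<comment> \<open>The set \<open>mink x \<xi> < 1 + b\<close> does not reach the leaf. The
          odd part can therefore be integrated over full shells around \<open>x\<close>, as its
          cancellation requires.\<close>
        have pt: "0 < ?t \<xi>"
        proof (rule ccontr)
          assume "\<not> 0 < ?t \<xi>"
          then have "sqrt (1 + (?t x)\<^sup>2) \<le> mink x \<xi>" by (intro mink_cross[OF x xi mink_leaf_normal_self t]) simp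
          then show False using False ball by simp
        qed
        show ?thesis
        proof (cases "1 + \<delta> \<le> mink x \<xi>")
          case True
          have kk: "krefl \<mu> x \<xi> < ?k \<xi>" using True d by (intro krefl_less[OF t pt]) simp
          have "(u x - u \<xi>) * (?k \<xi> - krefl \<mu> x \<xi>) \<le> ?A * (mink y \<xi> - mink y x) * (?k \<xi> - krefl \<mu> x \<xi>)"
            using u1[OF xi pt] kk by (intro mult_right_mono) auto
          also have "\<dots> = ?A * ((mink y \<xi> - mink y x) * ?k \<xi>) + ?A * (mink y x - mink y \<xi>) * krefl \<mu> x \<xi>"
            by (simp add: algebra_simps)
          \<comment> \<open>Here \<open>mink y x \<le> 1 + b\<close> and
            \<open>mink y \<xi> \<ge> 1\<close>.\<close>
          also have "?A * (mink y x - mink y \<xi>) * krefl \<mu> x \<xi> \<le> ?A * b * krefl \<mu> x \<xi>"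
            using A yx y(2) krefl_nonneg by (intro mult_right_mono mult_left_mono) auto
          also have "?A * b * krefl \<mu> x \<xi> = E * h2 \<xi>" using b pt by (simp add: h2_def)
          also have "?A * ((mink y \<xi> - mink y x) * ?k \<xi>) = ?A * l \<delta> \<xi> + ?A * (mink y x * h1 \<xi>)"
            using True False by (simp add: l_def h1_def algebra_simps)
          also have "?A * (mink y x * h1 \<xi>) \<le> ?A * (2 * h1 \<xi>)"
            using A nn y(2) b by (intro mult_left_mono mult_right_mono) auto
          finally have "(u x - u \<xi>) * (?k \<xi> - krefl \<mu> x \<xi>) \<le> ?A * l \<delta> \<xi> + ?A * (2 * h1 \<xi>) + E * h2 \<xi>" by simp
          then have "(u x - u \<xi>) * (?k \<xi> - krefl \<mu> x \<xi>) \<le> G \<xi> + ?A * l \<delta> \<xi>"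
            unfolding G_def using nnA(3) by linarith
          then show ?thesis using True pt by (simp add: sym_integrand_def)
        next
          case False
          then have "l \<delta> \<xi> = 0" by (simp add: l_def)
          then show ?thesis using False Gnn by (simp add: sym_integrand_def)
        qed
      qed
    qed
    \<comment> \<open>Applying \<open>mink_ge_fst\<close> bounds \<open>mink y \<xi>\<close> by a
      fixed multiple of \<open>mink x \<xi>\<close>, which is below \<open>1 + b\<close> on the
      support.\<close>
    have li: "integrable hvol (l \<delta>)"
    proof (rule Bochner_Integration.integrable_bound[OF integrable_mult_right[OF outer_integrable[OF x d(1)],
          of "((fst y + norm (snd y)) * (fst x + norm (snd x)) + mink y x) * (1 + b)"]])
      show "AE \<xi> in hvol. norm (l \<delta> \<xi>) \<le> norm (((fst y + norm (snd y)) * (fst x + norm (snd x)) + mink y x) * (1 + b) *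
          (indicator {1 + \<delta>..} (mink x \<xi>) * kap (mink x \<xi>)))"
      proof (rule AE_I2)
        fix \<xi> :: "'m pt" assume "\<xi> \<in> space hvol"
        then have xi: "\<xi> \<in> hyperboloid" by simp
        let ?M = "(fst y + norm (snd y)) * (fst x + norm (snd x))"
        show "norm (l \<delta> \<xi>) \<le> norm ((?M + mink y x) * (1 + b) * (indicator {1 + \<delta>..} (mink x \<xi>) * kap (mink x \<xi>)))"
        proof (cases "mink x \<xi> \<in> {1 + \<delta>..<1 + b}")
          case True
          have "- (snd y \<bullet> snd \<xi>) \<le> norm (snd y) * norm (snd \<xi>)"
            using Cauchy_Schwarz_ineq2[of "snd y" "snd \<xi>"] by linarith
          also have "\<dots> \<le> norm (snd y) * fst \<xi>" using norm_snd_less_fst[OF xi] by (intro mult_left_mono) auto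
          finally have "mink y \<xi> \<le> (fst y + norm (snd y)) * fst \<xi>" by (simp add: mink_def algebra_simps)
          also have "\<dots> \<le> (fst y + norm (snd y)) * ((fst x + norm (snd x)) * mink x \<xi>)"
            using mink_ge_fst[OF x xi] y(1) by (intro mult_left_mono) (auto simp: hyperboloid_iff)
          also have "\<dots> = ?M * mink x \<xi>" by (simp add: mult.assoc)
          finally have "mink y \<xi> + mink y x * mink x \<xi> \<le> (?M + mink y x) * mink x \<xi>" by (simp add: distrib_right)
          also have "\<dots> \<le> (?M + mink y x) * (1 + b)"
          proof (rule mult_left_mono)
            have "0 \<le> ?M" using x y(1) by (auto simp: hyperboloid_iff intro!: mult_nonneg_nonneg add_nonneg_nonneg)
            then show "0 \<le> ?M + mink y x" using mink_ge_1[OF y(1) x] by simp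
          qed (use True in auto)
          finally have "\<bar>mink y \<xi> - mink y x * mink x \<xi>\<bar> \<le> (?M + mink y x) * (1 + b)"
            using mink_ge_1[OF y(1) xi] mink_ge_1[OF y(1) x] mink_ge_1[OF x xi] mult_nonneg_nonneg[of "mink y x" "mink x \<xi>"]
            by linarith
          then have "?k \<xi> * \<bar>mink y \<xi> - mink y x * mink x \<xi>\<bar> \<le> ?k \<xi> * ((?M + mink y x) * (1 + b))"
            by (rule mult_left_mono[OF _ kap_nonneg])
          also have "\<dots> \<le> \<bar>?k \<xi> * ((?M + mink y x) * (1 + b))\<bar>" by (rule abs_ge_self)
          finally show ?thesis using True kap_nonneg[of "mink x \<xi>"]
            by (simp add: l_def abs_mult mult_ac)
        qed (simp add: l_def)
      qed
    qed (use lm in auto)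
    have "(LINT \<xi>|hvol. sym_integrand \<mu> u x \<delta> \<xi>) \<le> (LINT \<xi>|hvol. G \<xi> + ?A * l \<delta> \<xi>)"
      by (rule integral_mono[OF trunc_folded(1)[OF u odd t d(1)] Bochner_Integration.integrable_add[OF Gi integrable_mult_right[OF li]] pw])
    also have "\<dots> = (LINT \<xi>|hvol. G \<xi>) + ?A * (LINT \<xi>|hvol. l \<delta> \<xi>)"
      by (simp only: Bochner_Integration.integral_add[OF Gi integrable_mult_right[OF li]] integral_mult_right_zero)
    also have "(LINT \<xi>|hvol. l \<delta> \<xi>) = 0"
    proof -
      have "(\<lambda>z. indicator {1 + \<delta>..<1 + b} z * kap z) \<in> borel_measurable borel" by measurable
      from odd_integral_zero[OF x this, of y] show ?thesis by (simp only: l_def)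
    qed
    also have "(LINT \<xi>|hvol. G \<xi>) = ?A * (2 * (LINT \<xi>|hvol. h1 \<xi>)) + E * (LINT \<xi>|hvol. h2 \<xi>) + E * (LINT \<xi>|hvol. h3 \<xi>)"
    proof -
      have a: "integrable hvol (\<lambda>\<xi>. ?A * (2 * h1 \<xi>))" "integrable hvol (\<lambda>\<xi>. E * h2 \<xi>)" "integrable hvol (\<lambda>\<xi>. E * h3 \<xi>)"
        by (intro integrable_mult_right i)+
      show ?thesis unfolding G_def
        by (simp only: Bochner_Integration.integral_add[OF Bochner_Integration.integrable_add[OF a(1,2)] a(3)]
            Bochner_Integration.integral_add[OF a(1,2)] integral_mult_right_zero)
    qed
    also have "\<dots> + ?A * 0 \<le> ?A * (2 * (C1 * b)) + E * Jout \<mu> x + E * C2"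
    proof -
      have "(LINT \<xi>|hvol. h1 \<xi>) \<le> C1 * b" "(LINT \<xi>|hvol. h2 \<xi>) = Jout \<mu> x" "(LINT \<xi>|hvol. h3 \<xi>) \<le> C2"
        unfolding h1_def h2_def h3_def using C1(2) ki(2) C2 by blast+
      then have "2 * (LINT \<xi>|hvol. h1 \<xi>) \<le> 2 * (C1 * b)" "(LINT \<xi>|hvol. h2 \<xi>) = Jout \<mu> x"
        "(LINT \<xi>|hvol. h3 \<xi>) \<le> C2" by simp_all
      from mult_left_mono[OF this(1) A] mult_left_mono[OF this(3) E] this(2) show ?thesis by simp
    qed
    finally show "(LINT \<xi>|hvol. sym_integrand \<mu> u x \<delta> \<xi>) \<le> ?A * (2 * (C1 * b)) + E * Jout \<mu> x + E * C2" .
  qed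
  also have "?A * (2 * (C1 * b)) = E * (2 * C1)" using b by simp
  finally show ?thesis unfolding distrib_left by linarith
qed

end

section \<open>Semicontinuity and charts\<close>

lemma lsc_on_subset: "lsc_on S f \<Longrightarrow> T \<subseteq> S \<Longrightarrow> lsc_on T f"
  unfolding lsc_on_def by (meson at_le filter_leD subsetD)

lemma lsc_on_add_continuous:
  assumes f: "lsc_on S f" and g: "continuous_on S g"
  shows "lsc_on S (\<lambda>x. f x + g x)"
  unfolding lsc_on_def
proof (intro ballI allI impI)
  fix x a assume x: "x \<in> S" and a: "a < f x + g x"
  define d where "d = (f x + g x - a) / 2"
  have d: "d > 0" using a by (simp add: d_def)
  have "\<forall>\<^sub>F y in at x within S. f x - d < f y"
    using f x d unfolding lsc_on_def by simp
  moreover have "\<forall>\<^sub>F y in at x within S. g x - d < g y"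
    using g x d unfolding continuous_on_def by (intro order_tendstoD(1)) auto
  ultimately show "\<forall>\<^sub>F y in at x within S. a < f y + g y"
  proof eventually_elim
    case (elim y)
    have "2 * d = f x + g x - a" by (simp add: d_def)
    then show ?case using elim by linarith
  qed
qed

text \<open>Without a minimum the relatively open sets \<open>U y\<close> cover \<open>S\<close>. In
  a finite subcover the index with the least value of \<open>f\<close> is not covered.\<close>

lemma lsc_attains_min:
  assumes S: "compact S" "S \<noteq> {}" and f: "lsc_on S f"
  shows "\<exists>x\<in>S. \<forall>y\<in>S. f x \<le> f y"
proof (rule ccontr)
  assume "\<not> ?thesis"
  then have no: "\<exists>y\<in>S. f y < f x" if "x \<in> S" for x using that by (meson not_le)
  define U where "U y = {z \<in> S. f y < f z}" for y
  have op: "openin (top_of_set S) (U y)" for y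
  proof (subst openin_subopen, intro ballI)
    fix z assume z: "z \<in> U y"
    then have "\<forall>\<^sub>F w in at z within S. f y < f w" using f unfolding lsc_on_def U_def by blast
    then obtain T where T: "open T" "z \<in> T" "\<And>w. w \<in> T \<Longrightarrow> w \<noteq> z \<Longrightarrow> w \<in> S \<Longrightarrow> f y < f w"
      unfolding eventually_at_topological by blast
    have "S \<inter> T \<subseteq> U y" using T(3) z unfolding U_def by auto
    moreover have "openin (top_of_set S) (S \<inter> T)" using T(1) by (rule openin_open_Int)
    moreover have "z \<in> S \<inter> T" using z T(2) unfolding U_def by simp
    ultimately show "\<exists>V. openin (top_of_set S) V \<and> z \<in> V \<and> V \<subseteq> U y" by blast
  qed
  have "S \<subseteq> \<Union> (U ` S)" using no unfolding U_def by blast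
  moreover have "\<forall>c\<in>U ` S. openin (top_of_set S) c" using op by blast
  ultimately obtain D where D: "D \<subseteq> U ` S" "finite D" "S \<subseteq> \<Union> D"
    using S(1) unfolding compact_eq_openin_cover by meson
  obtain T where T: "T \<subseteq> S" "finite T" "D = U ` T" using finite_subset_image[OF D(2,1)] by blast
  have "T \<noteq> {}" using S(2) D(3) T(3) by auto
  then have "Min (f ` T) \<in> f ` T" using T(2) by (intro Min_in) auto
  then obtain j where j: "j \<in> T" "Min (f ` T) = f j" by blast
  obtain k where k: "k \<in> T" "j \<in> U k" using j(1) T D(3) by blast
  have "f j \<le> f k" unfolding j(2)[symmetric] using T(2) k(1) by (intro Min_le) auto
  then show False using k(2) unfolding U_def by simp
qed

section \<open>The chart near a point and quadratic expansions\<close>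

lemma near_chart:
  assumes x: "x \<in> hyperboloid"
  obtains K where "K > 0" "\<And>\<xi>. \<xi> \<in> hyperboloid \<Longrightarrow> mink x \<xi> \<le> 2 \<Longrightarrow> (norm (snd \<xi> - snd x))\<^sup>2 \<le> K * (mink x \<xi> - 1)"
proof
  define R where "R = (fst x + norm (snd x)) * 2"
  show "2 * (1 + R\<^sup>2) > 0" by (simp add: add_pos_nonneg)
  fix \<xi> assume xi: "\<xi> \<in> hyperboloid" "mink x \<xi> \<le> 2"
  have p: "fst x + norm (snd x) \<ge> 0" using fst_ge_1[OF x] by simp
  have "fst \<xi> \<le> (fst x + norm (snd x)) * mink x \<xi>" by (rule mink_ge_fst[OF x xi(1)])
  also have "\<dots> \<le> R" unfolding R_def using xi(2) p by (rule mult_left_mono)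
  finally have "norm (snd \<xi>) \<le> R" using norm_snd_less_fst[OF xi(1)] by simp
  moreover have "norm (snd x) \<le> R" unfolding R_def distrib_right using fst_ge_1[OF x] norm_ge_zero[of "snd x"] by linarith
  ultimately show "(norm (snd \<xi> - snd x))\<^sup>2 \<le> 2 * (1 + R\<^sup>2) * (mink x \<xi> - 1)"
    by (intro mink_lower x xi(1))
qed

lemma lift_continuous: "continuous_on UNIV lift"
  unfolding lift_def by (intro continuous_intros)

lemma open_chart_image:
  assumes "openin (top_of_set hyperboloid) \<Omega>"
  shows "open (snd ` \<Omega>)"
proof -
  obtain O' where O: "open O'" "\<Omega> = hyperboloid \<inter> O'" using assms by (auto simp: openin_open)
  have "snd ` \<Omega> = lift -` O'"
  proof (intro set_eqI iffI)
    fix y assume "y \<in> snd ` \<Omega>"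
    then obtain x where "x \<in> \<Omega>" "y = snd x" by blast
    then show "y \<in> lift -` O'" using O(2) by (simp add: lift_snd)
  next
    fix y assume "y \<in> lift -` O'"
    then have "lift y \<in> \<Omega>" using O(2) lift_in by blast
    then show "y \<in> snd ` \<Omega>" by (metis image_eqI snd_lift)
  qed
  then show ?thesis using open_vimage[OF O(1) lift_continuous] by simp
qed

lemma chart_image_iff:
  assumes "\<Omega> \<subseteq> hyperboloid" "\<xi> \<in> hyperboloid"
  shows "snd \<xi> \<in> snd ` \<Omega> \<longleftrightarrow> \<xi> \<in> \<Omega>"
proof
  assume "snd \<xi> \<in> snd ` \<Omega>"
  then obtain z where z: "z \<in> \<Omega>" "snd \<xi> = snd z" by blast
  then have "\<xi> = z" using lift_snd[OF assms(2)] lift_snd[of z] assms(1) by (metis subsetD)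
  then show "\<xi> \<in> \<Omega>" using z by simp
qed blast

lemma chart_ball:
  assumes x: "x \<in> hyperboloid" and r: "0 < r"
  obtains w where "0 < w" "w \<le> 1" "\<And>\<xi>. \<xi> \<in> hyperboloid \<Longrightarrow> mink x \<xi> < 1 + w \<Longrightarrow> snd \<xi> \<in> ball (snd x) r"
proof -
  obtain K where K: "K > 0" "\<And>\<xi>. \<xi> \<in> hyperboloid \<Longrightarrow> mink x \<xi> \<le> 2 \<Longrightarrow> (norm (snd \<xi> - snd x))\<^sup>2 \<le> K * (mink x \<xi> - 1)"
    using near_chart[OF x] by blast
  define w where "w = min 1 (r\<^sup>2 / K)"
  have w: "0 < w" "w \<le> 1" "K * w \<le> r\<^sup>2" using K(1) r unfolding w_def by (auto simp: min_def field_simps)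
  have "snd \<xi> \<in> ball (snd x) r" if xi: "\<xi> \<in> hyperboloid" "mink x \<xi> < 1 + w" for \<xi>
  proof -
    have "(norm (snd \<xi> - snd x))\<^sup>2 \<le> K * (mink x \<xi> - 1)" using K(2)[OF xi(1)] xi(2) w(2) by simp
    also have "\<dots> < K * w" using K(1) xi(2) by simp
    finally have "(norm (snd \<xi> - snd x))\<^sup>2 < r\<^sup>2" using w(3) by simp
    then have "norm (snd \<xi> - snd x) < r" by (rule power2_less_imp_less) (use r in simp)
    then show ?thesis by (simp add: dist_norm norm_minus_commute)
  qed
  then show ?thesis using that w by blast
qed

lemma open_mink_ball:
  assumes "openin (top_of_set hyperboloid) \<Omega>" "x \<in> \<Omega>"
  obtains r where "0 < r" "\<And>\<xi>. \<xi> \<in> hyperboloid \<Longrightarrow> mink x \<xi> < 1 + r \<Longrightarrow> \<xi> \<in> \<Omega>"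
proof -
  have sub: "\<Omega> \<subseteq> hyperboloid" using openin_imp_subset[OF assms(1)] .
  obtain e where e: "e > 0" "ball (snd x) e \<subseteq> snd ` \<Omega>"
    using open_chart_image[OF assms(1)] assms(2) unfolding open_contains_ball by blast
  have x: "x \<in> hyperboloid" using sub assms(2) by blast
  obtain w where "0 < w" "\<And>\<xi>. \<xi> \<in> hyperboloid \<Longrightarrow> mink x \<xi> < 1 + w \<Longrightarrow> snd \<xi> \<in> ball (snd x) e"
    using chart_ball[OF x e(1)] by metis
  then show ?thesis using that[of w] e(2) chart_image_iff[OF sub] by blast
qed

text \<open>The mean value theorem along a segment in the chart, where the Lipschitz gradient gives
  an error of order \<open>L\<close> times the squared length; \<open>near_chart\<close> converts
  the square into \<open>mink x \<xi> - 1\<close>.\<close>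

lemma C11_expansion:
  assumes om: "openin (top_of_set hyperboloid) \<Omega>" and u: "hyp_C11_loc \<Omega> u" and x: "x \<in> \<Omega>"
  shows "\<exists>w>0. \<exists>L. \<exists>g. \<forall>\<xi>\<in>hyperboloid. mink x \<xi> < 1 + w \<longrightarrow>
      \<bar>u \<xi> - u x - g \<bullet> (snd \<xi> - snd x)\<bar> \<le> L * (mink x \<xi> - 1)"
proof -
  let ?W = "snd ` \<Omega>" and ?U = "u \<circ> lift" and ?y = "snd x"
  have xh: "x \<in> hyperboloid" using openin_imp_subset[OF om] x by blast
  obtain g where G: "(\<forall>y\<in>?W. (?U has_derivative (\<lambda>h. g y \<bullet> h)) (at y)) \<and>
      (\<forall>y\<in>?W. \<exists>r>0. \<exists>L. L-lipschitz_on (cball y r \<inter> ?W) g)"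
    using u unfolding hyp_C11_loc_def C11_loc_def by (rule exE)
  have g: "(?U has_derivative (\<lambda>h. g y \<bullet> h)) (at y)" if "y \<in> ?W" for y
    using bspec[OF conjunct1[OF G] that] .
  have yW: "?y \<in> ?W" using x by (rule imageI)
  obtain r where rL: "r > 0 \<and> (\<exists>L. L-lipschitz_on (cball ?y r \<inter> ?W) g)"
    using bspec[OF conjunct2[OF G] yW] by (rule exE)
  then have r: "r > 0" by (rule conjunct1)
  obtain L where L: "L-lipschitz_on (cball ?y r \<inter> ?W) g" using conjunct2[OF rL] by (rule exE)
  have L0: "0 \<le> L" using L by (rule lipschitz_on_nonneg)
  obtain e where e: "e > 0" "ball ?y e \<subseteq> ?W"
    using open_chart_image[OF om] yW unfolding open_contains_ball by blast
  define d where "d = min r e"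
  have d: "d > 0" "d \<le> r" "d \<le> e" using r e by (auto simp: d_def)
  obtain w where w: "0 < w" "w \<le> 1" "\<And>\<xi>. \<xi> \<in> hyperboloid \<Longrightarrow> mink x \<xi> < 1 + w \<Longrightarrow> snd \<xi> \<in> ball ?y d"
    using chart_ball[OF xh d(1)] by metis
  obtain K where K: "K > 0" "\<And>\<xi>. \<xi> \<in> hyperboloid \<Longrightarrow> mink x \<xi> \<le> 2 \<Longrightarrow> (norm (snd \<xi> - snd x))\<^sup>2 \<le> K * (mink x \<xi> - 1)"
    using near_chart[OF xh] by blast
  have "\<bar>u \<xi> - u x - g ?y \<bullet> (snd \<xi> - ?y)\<bar> \<le> (L * K) * (mink x \<xi> - 1)"
    if xi: "\<xi> \<in> hyperboloid" "mink x \<xi> < 1 + w" for \<xi>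
  proof -
    define h where "h = snd \<xi> - ?y"
    have hd: "norm h < d" using w(3)[OF xi] by (simp add: h_def dist_norm norm_minus_commute)
    have seg: "norm (t *\<^sub>R h) < d" if "0 \<le> t" "t \<le> 1" for t :: real
    proof -
      have "norm (t *\<^sub>R h) \<le> 1 * norm h" using that by (simp add: mult_left_le_one_le)
      then show ?thesis using hd by simp
    qed
    have segW: "?y + t *\<^sub>R h \<in> cball ?y r \<inter> ?W" if "0 \<le> t" "t \<le> 1" for t :: real
    proof -
      have "dist ?y (?y + t *\<^sub>R h) < d" using seg[OF that] by (simp add: dist_norm)
      then have "?y + t *\<^sub>R h \<in> ball ?y e" "?y + t *\<^sub>R h \<in> cball ?y r" using d by auto
      then show ?thesis using e(2) by blast
    qed
    define \<phi> where "\<phi> t = ?U (?y + t *\<^sub>R h)" for t :: real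
    have D: "(\<phi> has_real_derivative g (?y + t *\<^sub>R h) \<bullet> h) (at t)" if "0 \<le> t" "t \<le> 1" for t
    proof -
      have "((\<lambda>t. ?y + t *\<^sub>R h) has_derivative (\<lambda>s. s *\<^sub>R h)) (at t)" by (auto intro!: derivative_eq_intros)
      moreover have "(?U has_derivative (\<lambda>k. g (?y + t *\<^sub>R h) \<bullet> k)) (at (?y + t *\<^sub>R h))"
        using g[of "?y + t *\<^sub>R h"] segW[OF that] by simp
      ultimately have "(\<phi> has_derivative (\<lambda>s. g (?y + t *\<^sub>R h) \<bullet> (s *\<^sub>R h))) (at t)"
        unfolding \<phi>_def by (rule has_derivative_compose)
      moreover have "(\<lambda>s. g (?y + t *\<^sub>R h) \<bullet> (s *\<^sub>R h)) = (*) (g (?y + t *\<^sub>R h) \<bullet> h)"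
        by (rule ext) (simp add: mult.commute)
      ultimately show ?thesis unfolding has_field_derivative_def by simp
    qed
    obtain t where t: "0 < t" "t < 1" "\<phi> 1 - \<phi> 0 = (1 - 0) * (g (?y + t *\<^sub>R h) \<bullet> h)"
      using MVT2[of 0 1 \<phi> "\<lambda>t. g (?y + t *\<^sub>R h) \<bullet> h"] D by auto
    have "\<phi> 1 = u \<xi>" "\<phi> 0 = u x" unfolding \<phi>_def h_def using lift_snd[OF xi(1)] lift_snd[OF xh] by simp_all
    then have eq: "u \<xi> - u x - g ?y \<bullet> h = (g (?y + t *\<^sub>R h) - g ?y) \<bullet> h" using t(3) by (simp add: inner_diff_left)
    have "norm (g (?y + t *\<^sub>R h) - g ?y) \<le> L * norm ((?y + t *\<^sub>R h) - ?y)"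
      using lipschitz_onD[OF L segW[of t] segW[of 0]] t by (simp add: dist_norm)
    also have "norm ((?y + t *\<^sub>R h) - ?y) \<le> 1 * norm h" using t by (simp add: mult_left_le_one_le)
    finally have gl: "norm (g (?y + t *\<^sub>R h) - g ?y) \<le> L * norm h" using L0 by (simp add: mult_left_mono)
    have "\<bar>u \<xi> - u x - g ?y \<bullet> h\<bar> \<le> norm (g (?y + t *\<^sub>R h) - g ?y) * norm h"
      unfolding eq by (rule Cauchy_Schwarz_ineq2)
    also have "\<dots> \<le> L * norm h * norm h" using gl by (rule mult_right_mono) simp
    also have "\<dots> = L * (norm (snd \<xi> - snd x))\<^sup>2" by (simp add: h_def power2_eq_square)
    also have "\<dots> \<le> L * (K * (mink x \<xi> - 1))" using K(2)[OF xi(1)] xi(2) w(2) L0 by (intro mult_left_mono) auto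
    finally show ?thesis by (simp add: h_def mult.assoc)
  qed
  then show ?thesis using w(1) by blast
qed

lemma powr_neg_unbounded:
  fixes a c M :: real
  assumes "0 < a" "0 < c" "0 < M"
  obtains t where "0 < t" "\<And>r. 0 < r \<Longrightarrow> r \<le> t \<Longrightarrow> M \<le> c * r powr - a"
proof
  define t where "t = (M / c) powr (- (1 / a))"
  show t: "0 < t" unfolding t_def using assms by simp
  fix r assume r: "0 < r" "r \<le> t"
  have "M / c = t powr - a" unfolding t_def using assms by (simp add: powr_powr)
  also have "\<dots> \<le> r powr - a" using r assms by (intro powr_mono2') auto
  finally show "M \<le> c * r powr - a" using assms by (simp add: field_simps)
qed

section \<open>Kernel mass beyond the leaf and outside a slab\<close>

context hyp_kernel
begin

text \<open>The half-space bound is used at scale \<open>2 * t\<close>, where \<open>t\<close> is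
  the leaf product of \<open>x\<close>. As \<open>mink x \<xi> < 2\<close> on the relevant set, an
  inward displacement of \<open>2 * t\<close> forces the leaf product of \<open>\<xi>\<close> to be
  negative. The restriction \<open>t \<le> 1/6\<close> makes the scale at most
  \<open>1/3\<close>.\<close>

lemma Jout_lower:
  "\<exists>c>0. \<forall>x\<in>(hyperboloid :: 'm pt set). \<forall>\<mu>. 0 < mink (leaf_normal \<mu>) x \<and> mink (leaf_normal \<mu>) x \<le> 1/6 \<longrightarrow>
     c * (2 * mink (leaf_normal \<mu>) x) powr - (2 * s) \<le> Jout \<mu> x"
proof -
  obtain c where c: "c > 0" "\<And>x \<omega> l \<sigma> E. x \<in> (hyperboloid :: 'm pt set) \<and> mink \<omega> \<omega> = -1 \<and> 0 < l \<and> l \<le> 1/3 \<and> \<bar>\<sigma>\<bar> = (1::real) \<and>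
    E \<in> sets hvol \<and>
    (\<forall>\<xi>\<in>hyperboloid. mink x \<xi> \<le> sqrt (1 + 9 * l\<^sup>2) \<and>
       l * sqrt (1 + (mink \<omega> x)\<^sup>2) \<le> \<sigma> * (mink x \<xi> * mink \<omega> x - mink \<omega> \<xi>) \<longrightarrow> \<xi> \<in> E)
    \<Longrightarrow> ennreal (c * l powr - (2 * s)) \<le> (\<integral>\<^sup>+\<xi>. indicator E \<xi> * ennreal (kap (mink x \<xi>)) \<partial>hvol)"
    using kernel_halfspace_lower by blast
  have "c * (2 * t) powr - (2 * s) \<le> Jout \<mu> x"
    if x: "x \<in> (hyperboloid :: 'm pt set)" and t: "t = mink (leaf_normal \<mu>) x" "0 < t" "t \<le> 1/6" for x \<mu> t
  proof -
    let ?t = "mink (leaf_normal \<mu>)"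
    define E where "E = {\<xi> \<in> (hyperboloid :: 'm pt set). ?t \<xi> < 0}"
    have "{\<xi> \<in> space (hvol :: 'm pt measure). ?t \<xi> < 0} \<in> sets hvol" by measurable
    then have Es: "E \<in> sets hvol" unfolding E_def by simp
    have tx: "0 < ?t x" using t by simp
    have "ennreal (c * (2 * t) powr - (2 * s)) \<le> (\<integral>\<^sup>+\<xi>. indicator E \<xi> * ennreal (kap (mink x \<xi>)) \<partial>hvol)"
    proof (rule c(2)[of x "leaf_normal \<mu>" "2 * t" 1 E], intro conjI ballI impI)
      fix \<xi> :: "'m pt" assume xi: "\<xi> \<in> hyperboloid"
        and h: "mink x \<xi> \<le> sqrt (1 + 9 * (2 * t)\<^sup>2) \<and>
          2 * t * sqrt (1 + (?t x)\<^sup>2) \<le> 1 * (mink x \<xi> * ?t x - ?t \<xi>)"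
      have "t\<^sup>2 \<le> (1/6)\<^sup>2" using t by (intro power_mono) auto
      then have "1 + 9 * (2 * t)\<^sup>2 \<le> 2" by (simp add: power_mult_distrib power2_eq_square)
      then have "1 + 9 * (2 * t)\<^sup>2 < 2\<^sup>2" by simp
      then have "sqrt (1 + 9 * (2 * t)\<^sup>2) < 2" by (intro real_less_lsqrt) auto
      then have "mink x \<xi> < 2" using h by simp
      then have a: "mink x \<xi> * t < 2 * t" using t(2) by simp
      have "1 \<le> sqrt (1 + (?t x)\<^sup>2)" by simp
      then have "2 * t * 1 \<le> 2 * t * sqrt (1 + (?t x)\<^sup>2)" using t(2) by (intro mult_left_mono) auto
      then have "?t \<xi> < 0" using h a t(1) by simp
      then show "\<xi> \<in> E" using xi by (simp add: E_def)
    qed (use x t Es mink_leaf_normal_self in auto)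
    also have "\<dots> = (\<integral>\<^sup>+\<xi>. ennreal (indicator {..<0} (?t \<xi>) * kap (mink x \<xi>)) \<partial>hvol)"
      by (rule nn_integral_cong) (simp add: E_def indicator_def)
    also have "\<dots> = ennreal (Jout \<mu> x)"
      unfolding Jout_def
      by (rule nn_integral_eq_integral[OF Jout_integrable[OF x tx]]) (simp add: kap_nonneg)
    finally have "ennreal (c * (2 * t) powr - (2 * s)) \<le> ennreal (Jout \<mu> x)" .
    moreover have "0 \<le> Jout \<mu> x" unfolding Jout_def
      by (rule integral_nonneg_AE) (simp add: kap_nonneg)
    ultimately show ?thesis by (simp add: ennreal_le_iff)
  qed
  then show ?thesis using c(1) by blast
qed

lemma openin_complement_sets:
  assumes "openin (top_of_set hyperboloid) (\<Omega> :: 'm pt set)"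
  shows "hyperboloid - \<Omega> \<in> sets hvol"
proof -
  obtain O' where "open O'" "\<Omega> = hyperboloid \<inter> O'" using assms by (auto simp: openin_open)
  then have "hyperboloid - \<Omega> = hyperboloid - O'" "O' \<in> sets borel" by auto
  then show ?thesis by (intro sets_hvol_I) auto
qed

lemma slab_complement_lower:
  "\<exists>c>0. \<forall>x \<omega> l \<Omega>. x \<in> \<Omega> \<and> openin (top_of_set hyperboloid) (\<Omega> :: 'm pt set) \<and> mink \<omega> \<omega> = -1 \<and> 0 < l \<and> l \<le> 1/3 \<and>
     (\<forall>\<xi>\<in>\<Omega>. \<bar>mink \<omega> x - mink \<omega> \<xi>\<bar> < l) \<longrightarrow>
     ennreal (c * l powr - (2 * s)) \<le> (\<integral>\<^sup>+\<xi>. indicator (hyperboloid - \<Omega>) \<xi> * ennreal (kap (mink x \<xi>)) \<partial>hvol)"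
proof -
  obtain c where c: "c > 0" "\<And>x \<omega> l \<sigma> E. x \<in> (hyperboloid :: 'm pt set) \<and> mink \<omega> \<omega> = -1 \<and> 0 < l \<and> l \<le> 1/3 \<and> \<bar>\<sigma>\<bar> = (1::real) \<and>
    E \<in> sets hvol \<and>
    (\<forall>\<xi>\<in>hyperboloid. mink x \<xi> \<le> sqrt (1 + 9 * l\<^sup>2) \<and>
       l * sqrt (1 + (mink \<omega> x)\<^sup>2) \<le> \<sigma> * (mink x \<xi> * mink \<omega> x - mink \<omega> \<xi>) \<longrightarrow> \<xi> \<in> E)
    \<Longrightarrow> ennreal (c * l powr - (2 * s)) \<le> (\<integral>\<^sup>+\<xi>. indicator E \<xi> * ennreal (kap (mink x \<xi>)) \<partial>hvol)"
    using kernel_halfspace_lower by blast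
  have "ennreal (c * l powr - (2 * s)) \<le> (\<integral>\<^sup>+\<xi>. indicator (hyperboloid - \<Omega>) \<xi> * ennreal (kap (mink x \<xi>)) \<partial>hvol)"
    if x: "x \<in> \<Omega>" and om: "openin (top_of_set hyperboloid) (\<Omega> :: 'm pt set)" and w: "mink \<omega> \<omega> = -1" and l: "0 < l" "l \<le> 1/3"
      and slab: "\<And>\<xi>. \<xi> \<in> \<Omega> \<Longrightarrow> \<bar>mink \<omega> x - mink \<omega> \<xi>\<bar> < l" for x \<omega> l \<Omega>
  proof -
    have xh: "x \<in> hyperboloid" using openin_imp_subset[OF om] x by blast
    \<comment> \<open>The displacement is taken away from the hyperplane of \<open>\<omega>\<close>:
      since \<open>mink x \<xi> \<ge> 1\<close>, the factor in
      \<open>mink x \<xi> * mink \<omega> x\<close> then only helps, and \<open>\<xi>\<close> leaves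
      the slab.\<close>
    define \<sigma> :: real where "\<sigma> = (if 0 \<le> mink \<omega> x then -1 else 1)"
    show ?thesis
    proof (rule c(2)[of x \<omega> l \<sigma> "hyperboloid - \<Omega>"], intro conjI ballI impI)
      show "hyperboloid - \<Omega> \<in> sets hvol" by (rule openin_complement_sets[OF om])
      fix \<xi> :: "'m pt" assume xi: "\<xi> \<in> hyperboloid"
        and h: "mink x \<xi> \<le> sqrt (1 + 9 * l\<^sup>2) \<and>
          l * sqrt (1 + (mink \<omega> x)\<^sup>2) \<le> \<sigma> * (mink x \<xi> * mink \<omega> x - mink \<omega> \<xi>)"
      have "1 \<le> sqrt (1 + (mink \<omega> x)\<^sup>2)" by simp
      then have "l * 1 \<le> l * sqrt (1 + (mink \<omega> x)\<^sup>2)" using l by (intro mult_left_mono) auto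
      then have ge: "l \<le> \<sigma> * (mink x \<xi> * mink \<omega> x - mink \<omega> \<xi>)" using h by linarith
      have z: "1 \<le> mink x \<xi>" by (rule mink_ge_1[OF xh xi])
      have "\<xi> \<notin> \<Omega>"
      proof
        assume "\<xi> \<in> \<Omega>"
        then have lt: "\<bar>mink \<omega> x - mink \<omega> \<xi>\<bar> < l" by (rule slab)
        show False
        proof (cases "0 \<le> mink \<omega> x")
          case True
          then have "1 * mink \<omega> x \<le> mink x \<xi> * mink \<omega> x" using z by (intro mult_right_mono) auto
          moreover have "l \<le> mink \<omega> \<xi> - mink x \<xi> * mink \<omega> x" using ge True by (simp add: \<sigma>_def)
          ultimately show False using lt by linarith
        next
          case False
          then have "mink x \<xi> * mink \<omega> x \<le> 1 * mink \<omega> x" using z by (intro mult_right_mono_neg) auto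
          moreover have "l \<le> mink x \<xi> * mink \<omega> x - mink \<omega> \<xi>" using ge False by (simp add: \<sigma>_def)
          ultimately show False using lt by linarith
        qed
      qed
      then show "\<xi> \<in> hyperboloid - \<Omega>" using xi by simp
    qed (use xh w l in \<open>auto simp: \<sigma>_def\<close>)
  qed
  then show ?thesis using c(1) by blast
qed

section \<open>The narrow region principle\<close>

text \<open>At a negative minimum, \<open>minimum_estimate\<close> with the complement of
  \<open>\<Omega>\<close> gives \<open>P \<le> u x * M\<close>. The quantity assumed nonnegative is
  then at most \<open>u x * (C * M + c0)\<close>, which is negative.\<close>

lemma attained_minimum_nonneg:
  assumes om: "openin (top_of_set hyperboloid) \<Omega>" and x: "x \<in> \<Omega>" and adm: "admissible u x"
    and odd: "odd_refl \<mu> u" and t: "0 < mink (leaf_normal \<mu>) x" and C: "0 < C"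
    and eq: "\<And>P. (trunc u x \<longlongrightarrow> P) (at_right 0) \<Longrightarrow> 0 \<le> C * P + cx * u x" and cx: "c0 \<le> cx"
    and min: "\<And>\<xi>. \<xi> \<in> hyperboloid \<Longrightarrow> 0 < mink (leaf_normal \<mu>) \<xi> \<Longrightarrow> u x \<le> u \<xi>"
    and nonneg: "\<And>\<xi>. \<xi> \<in> hyperboloid \<Longrightarrow> \<xi> \<notin> \<Omega> \<Longrightarrow> 0 < mink (leaf_normal \<mu>) \<xi> \<Longrightarrow> 0 \<le> u \<xi>"
    and M: "ennreal M \<le> (\<integral>\<^sup>+\<xi>. indicator (hyperboloid - \<Omega>) \<xi> * ennreal (kap (mink x \<xi>)) \<partial>hvol)"
    and pos: "0 < C * M + c0"
  shows "0 \<le> u x"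
proof (rule ccontr)
  assume "\<not> 0 \<le> u x"
  then have ux: "u x < 0" by simp
  obtain P where P: "(trunc u x \<longlongrightarrow> P) (at_right 0)" by (rule trunc_converges[OF adm])
  obtain r where r: "0 < r" "\<And>\<xi>. \<xi> \<in> hyperboloid \<Longrightarrow> mink x \<xi> < 1 + r \<Longrightarrow> \<xi> \<in> \<Omega>"
    using open_mink_ball[OF om x] by blast
  let ?N = "hyperboloid - \<Omega>"
  define I where "I = (LINT \<xi>|hvol. indicator ?N \<xi> * kap (mink x \<xi>))"
  have Nr: "1 + r \<le> mink x \<xi>" if "\<xi> \<in> ?N" for \<xi> using r(2)[of \<xi>] that by (auto simp: not_less[symmetric])
  have Nn: "0 \<le> u \<xi>" if "\<xi> \<in> ?N" "0 < mink (leaf_normal \<mu>) \<xi>" for \<xi> using nonneg that by simp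
  note est = minimum_estimate[OF adm odd t P less_imp_le[OF ux] min openin_complement_sets[OF om] Nn r(1) Nr]
  have Ii: "integrable hvol (\<lambda>\<xi>. indicator ?N \<xi> * kap (mink x \<xi>))" by (rule est(1))
  have nn: "0 \<le> indicator ?N \<xi> * kap (mink x \<xi>)" for \<xi> by (simp add: indicator_def kap_nonneg)
  have "(\<integral>\<^sup>+\<xi>. indicator ?N \<xi> * ennreal (kap (mink x \<xi>)) \<partial>hvol) = (\<integral>\<^sup>+\<xi>. ennreal (indicator ?N \<xi> * kap (mink x \<xi>)) \<partial>hvol)"
    by (rule nn_integral_cong) (simp add: indicator_def)
  also have "\<dots> = ennreal I"
    unfolding I_def by (rule nn_integral_eq_integral[OF Ii]) (intro AE_I2 nn)
  finally have "ennreal M \<le> ennreal I" using M by simp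
  moreover have I0: "0 \<le> I" unfolding I_def by (intro integral_nonneg_AE AE_I2 nn)
  ultimately have MI: "M \<le> I" by (simp add: ennreal_le_iff)
  have "P \<le> u x * I" unfolding I_def by (rule est(2))
  also have "\<dots> \<le> u x * M" using MI ux by (intro mult_left_mono_neg) auto
  finally have "C * P \<le> C * (u x * M)" using C by (intro mult_left_mono) auto
  moreover have "cx * u x \<le> c0 * u x" using cx ux by (intro mult_right_mono_neg) auto
  ultimately have "0 \<le> C * (u x * M) + c0 * u x" using eq[OF P] by linarith
  also have "\<dots> = u x * (C * M + c0)" by (simp add: algebra_simps)
  also have "\<dots> < 0" using ux pos by (rule mult_neg_pos)
  finally show False by simp
qed

text \<open>Almost minimal points keep the distance \<open>\<tau>\<close> from the leaf. Otherwise a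
  bump of height \<open>\<epsilon> * m\<close> at such a point produces a minimum point
  \<open>x\<close> with \<open>P \<le> - (m * J)\<close>, where \<open>J = Jout \<mu> x\<close>
  exceeds \<open>\<bar>c0\<bar> / C\<close>.\<close>

lemma near_leaf_contradiction:
  fixes C c0 :: real
  assumes C: "0 < C"
  shows "\<exists>\<epsilon>>0. \<exists>\<tau>>0. \<forall>\<mu> \<Omega> u c m. \<forall>y\<in>\<Omega>.
    openin (top_of_set hyperboloid) (\<Omega> :: 'm pt set) \<and> compact (closure \<Omega>) \<and>
    (\<forall>x\<in>\<Omega>. admissible u x) \<and> lsc_on (closure \<Omega>) u \<and> odd_refl \<mu> u \<and>
    (\<forall>x\<in>\<Omega>. \<forall>P. (trunc u x \<longlongrightarrow> P) (at_right 0) \<longrightarrow> 0 \<le> C * P + c x * u x) \<and> (\<forall>x\<in>\<Omega>. c0 \<le> c x) \<and>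
    (\<forall>\<xi>\<in>hyperboloid. 0 < mink (leaf_normal \<mu>) \<xi> \<longrightarrow> \<xi> \<notin> \<Omega> \<longrightarrow> 0 \<le> u \<xi>) \<and>
    0 < m \<and> (\<forall>x\<in>\<Omega>. - m \<le> u x) \<and> u y < - m + \<epsilon> * m \<and>
    0 < mink (leaf_normal \<mu>) y \<and> mink (leaf_normal \<mu>) y < \<tau> \<longrightarrow> False"
proof -
  obtain C1 where C1: "C1 > 0" "\<forall>x\<in>(hyperboloid :: 'm pt set). \<forall>w. 0 < w \<and> w \<le> 1 \<longrightarrow>
    integrable hvol (\<lambda>\<xi>. indicator {..<1 + w} (mink x \<xi>) * ((mink x \<xi> - 1) * kap (mink x \<xi>))) \<and>
    (LINT \<xi>|hvol. indicator {..<1 + w} (mink x \<xi>) * ((mink x \<xi> - 1) * kap (mink x \<xi>))) \<le> C1 * w powr (1 - s)"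
    using kernel_inner_bound by (elim exE conjE)
  obtain C2 where C2: "C2 > 0" "\<forall>x\<in>(hyperboloid :: 'm pt set). \<forall>w. 0 < w \<and> w \<le> 1 \<longrightarrow>
    integrable hvol (\<lambda>\<xi>. indicator {1 + w..} (mink x \<xi>) * kap (mink x \<xi>)) \<and>
    (LINT \<xi>|hvol. indicator {1 + w..} (mink x \<xi>) * kap (mink x \<xi>)) \<le> C2 * w powr - s"
    using kernel_outer_bound by (elim exE conjE)
  obtain c3 where c3: "c3 > 0" "\<forall>x\<in>(hyperboloid :: 'm pt set). \<forall>\<mu>. 0 < mink (leaf_normal \<mu>) x \<and> mink (leaf_normal \<mu>) x \<le> 1/6 \<longrightarrow>
     c3 * (2 * mink (leaf_normal \<mu>) x) powr - (2 * s) \<le> Jout \<mu> x"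
    using Jout_lower by (elim exE conjE)
  \<comment> \<open>At the minimum point the doubled leaf product is at most \<open>3 * t\<close>,
    and \<open>(3 * t)\<^sup>2 = 432 * b\<close> for the squared radius
    \<open>b = t\<^sup>2 / 48\<close> chosen below.\<close>
  define c4 where "c4 = c3 * 432 powr - s"
  have c4: "c4 > 0" using c3(1) by (simp add: c4_def)
  define K0 where "K0 = (2 * C1 + C2) / c4"
  have K0: "K0 > 0" using C1(1) C2(1) c4 by (simp add: K0_def)
  \<comment> \<open>The final bound is \<open>m * J * (\<epsilon> * (K0 + 3) - 2)\<close>: the bump
    costs \<open>K0 + 1\<close> and the deviation of \<open>u x\<close> from \<open>- m\<close>
    costs \<open>2\<close>. This choice turns it into \<open>- (m * J)\<close>.\<close>
  define \<epsilon> where "\<epsilon> = 1 / (K0 + 3)"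
  have eps: "0 < \<epsilon>" "\<epsilon> \<le> 1/3" "\<epsilon> * (K0 + 3) = 1" using K0 by (auto simp: \<epsilon>_def field_simps)
  have M: "0 < \<bar>c0\<bar> / C + 1" using C by (simp add: add_nonneg_pos)
  obtain t0 where t0: "0 < t0" "\<And>r. 0 < r \<Longrightarrow> r \<le> t0 \<Longrightarrow> \<bar>c0\<bar> / C + 1 \<le> c4 * r powr - s"
    using powr_neg_unbounded[OF s(1) c4 M] by blast
  \<comment> \<open>The bound \<open>1/9\<close> keeps the leaf product at the minimum point, at
    most \<open>3/2 * t\<close>, below \<open>1/6\<close>; \<open>t0\<close> makes the kernel mass
    beyond the leaf outweigh the lower bound of \<open>c\<close>.\<close>
  define \<tau> where "\<tau> = min (1/9) t0"
  have tau: "\<tau> > 0" "\<tau> \<le> 1/9" "\<tau> \<le> t0" using t0 by (auto simp: \<tau>_def)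
  have False
    if y: "y \<in> \<Omega>" and om: "openin (top_of_set hyperboloid) (\<Omega> :: 'm pt set)" and cpt: "compact (closure \<Omega>)"
      and adm: "\<forall>x\<in>\<Omega>. admissible u x" and lsc: "lsc_on (closure \<Omega>) u" and odd: "odd_refl \<mu> u"
      and eq: "\<forall>x\<in>\<Omega>. \<forall>P. (trunc u x \<longlongrightarrow> P) (at_right 0) \<longrightarrow> 0 \<le> C * P + c x * u x"
      and c: "\<forall>x\<in>\<Omega>. c0 \<le> c x"
      and nonneg: "\<forall>\<xi>\<in>hyperboloid. 0 < mink (leaf_normal \<mu>) \<xi> \<longrightarrow> \<xi> \<notin> \<Omega> \<longrightarrow> 0 \<le> u \<xi>"
      and m: "0 < m" and low: "\<forall>x\<in>\<Omega>. - m \<le> u x" and uy: "u y < - m + \<epsilon> * m"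
      and t: "0 < mink (leaf_normal \<mu>) y" "mink (leaf_normal \<mu>) y < \<tau>"
    for \<mu> \<Omega> u c m y
  proof -
    let ?t = "mink (leaf_normal \<mu> :: 'm pt)"
    define t where "t = ?t y"
    have t0': "0 < t" "t \<le> 1/9" "t \<le> t0" using t tau by (auto simp: t_def)
    \<comment> \<open>Chosen so that \<open>sqrt (3 * b) = t / 4\<close>: with
      \<open>sqrt (1 + t\<^sup>2) \<le> 3/2\<close> the leaf product then changes by at most
      \<open>t / 2\<close> over the bump.\<close>
    define b where "b = t\<^sup>2 / 48"
    have tt: "t\<^sup>2 \<le> t" using t0' by (simp add: power2_eq_square mult_left_le)
    have b: "0 < b" "b \<le> 1" "b \<le> t0" "b \<le> 1/48" using t0' tt by (auto simp: b_def)
    define E where "E = \<epsilon> * m"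
    have E: "0 < E" "E \<le> m" using eps m by (auto simp: E_def mult_le_cancel_right1)
    have sub: "\<Omega> \<subseteq> hyperboloid" using openin_imp_subset[OF om] .
    have csub: "closure \<Omega> \<subseteq> hyperboloid" using sub closed_hyperboloid by (rule closure_minimal)
    have yh: "y \<in> hyperboloid" using sub y by blast
    define \<eta> where "\<eta> \<xi> = 1 - (mink y \<xi> - 1) / b" for \<xi>
    define S where "S = closure \<Omega> \<inter> {\<xi>. mink y \<xi> \<le> 1 + b}"
    have "closed {\<xi>. mink y \<xi> \<le> 1 + b}" by (intro closed_Collect_le continuous_intros)
    then have Sc: "compact S" unfolding S_def using cpt by (rule compact_Int_closed[rotated])
    have yS: "y \<in> S" using closure_subset y b(1) mink_self[OF yh] by (auto simp: S_def)
    have "lsc_on S (\<lambda>\<xi>. u \<xi> + - E * \<eta> \<xi>)"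
    proof (rule lsc_on_add_continuous)
      show "lsc_on S u" using lsc by (rule lsc_on_subset) (simp add: S_def)
      show "continuous_on S (\<lambda>\<xi>. - E * \<eta> \<xi>)" unfolding \<eta>_def using b(1) by (intro continuous_intros) auto
    qed
    from lsc_attains_min[OF Sc _ this] obtain x where xS: "x \<in> S"
      and xmin: "\<forall>\<xi>\<in>S. u x + - E * \<eta> x \<le> u \<xi> + - E * \<eta> \<xi>" using yS by blast
    have xh: "x \<in> hyperboloid" and yx: "mink y x \<le> 1 + b" using xS csub by (auto simp: S_def)
    have eta1: "\<eta> \<xi> \<le> 1" if "\<xi> \<in> hyperboloid" for \<xi>
      using mink_ge_1[OF yh that] b(1) by (simp add: \<eta>_def)
    have "\<eta> y = 1" using mink_self[OF yh] by (simp add: \<eta>_def)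
    \<comment> \<open>At \<open>y\<close> the perturbed function is already below
      \<open>- m\<close>, the lower bound of \<open>u\<close> on the near side. Hence neither points
      outside the bump nor points outside \<open>\<Omega>\<close> can compete with
      \<open>x\<close>.\<close>
    then have wx: "u x - E * \<eta> x < - m" using bspec[OF xmin yS] uy by (simp add: E_def)
    have "E * \<eta> x \<le> E * 1" using eta1[OF xh] E by (intro mult_left_mono) auto
    then have ux: "u x < - m + E" using wx by simp
    have sq: "sqrt (1 + t\<^sup>2) \<le> 3/2"
    proof (rule real_le_lsqrt)
      have "1 + t\<^sup>2 \<le> 9 / 4" using tt t0' by linarith
      then show "1 + t\<^sup>2 \<le> (3/2)\<^sup>2" by (simp add: power_divide)
    qed (use t0' in auto)
    have s3: "sqrt (3 * b) = t / 4" using t0' by (simp add: b_def real_sqrt_divide)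
    have var: "\<bar>?t x - t\<bar> \<le> t / 2"
    proof -
      have "\<bar>?t x - t\<bar> \<le> \<bar>t\<bar> * b + sqrt (1 + t\<^sup>2) * sqrt (3 * b)"
        unfolding t_def by (rule mink_variation[OF yh xh mink_leaf_normal_self yx less_imp_le[OF b(1)] b(2)])
      also have "\<dots> \<le> t * (1/48) + 3/2 * (t / 4)"
        unfolding s3 using sq b(1,4) t0' by (intro add_mono mult_mono) auto
      finally show ?thesis using t0'(1) by linarith
    qed
    have tx: "t / 2 \<le> ?t x" "?t x \<le> 3/2 * t" "0 < ?t x" "?t x \<le> 1/6" using var t0' by linarith+
    have xO: "x \<in> \<Omega>"
    proof (rule ccontr)
      assume "x \<notin> \<Omega>"
      then have "0 \<le> u x" using nonneg xh tx(3) by blast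
      then show False using ux E(2) by linarith
    qed
    have ball: "1 + b \<le> sqrt (1 + (?t x)\<^sup>2)"
    proof (rule real_le_rsqrt)
      have "b * b \<le> b * 1" using b by (intro mult_left_mono) auto
      then have "(1 + b)\<^sup>2 \<le> 1 + 3 * b" by (simp add: power2_eq_square algebra_simps)
      also have "\<dots> \<le> 1 + (t / 2)\<^sup>2" using t0' by (simp add: b_def power_divide)
      also have "\<dots> \<le> 1 + (?t x)\<^sup>2" using tx(1) t0'(1) by (intro add_left_mono power_mono) auto
      finally show "(1 + b)\<^sup>2 \<le> 1 + (?t x)\<^sup>2" .
    qed
    have lowH: "- m \<le> u \<xi>" if "\<xi> \<in> hyperboloid" "0 < ?t \<xi>" for \<xi>
      using low nonneg that m by (cases "\<xi> \<in> \<Omega>") force+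
    have glob: "u x - E * \<eta> x \<le> u \<xi> - E * \<eta> \<xi>" if xi: "\<xi> \<in> hyperboloid" "0 < ?t \<xi>" for \<xi>
    proof (cases "mink y \<xi> \<le> 1 + b")
      case True
      show ?thesis
      proof (cases "\<xi> \<in> \<Omega>")
        case True
        then have "\<xi> \<in> S" using closure_subset \<open>mink y \<xi> \<le> 1 + b\<close> by (auto simp: S_def)
        then show ?thesis using xmin by simp
      next
        case False
        then have "0 \<le> u \<xi>" using nonneg xi by blast
        moreover have "E * \<eta> \<xi> \<le> E * 1" using eta1[OF xi(1)] E by (intro mult_left_mono) auto
        ultimately show ?thesis using wx E(2) by linarith
      qed
    next
      case False
      then have "\<eta> \<xi> \<le> 0" using b(1) by (simp add: \<eta>_def)
      then have "E * \<eta> \<xi> \<le> 0" using E(1) by (simp add: mult_nonneg_nonpos)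
      then show ?thesis using lowH[OF xi] wx by linarith
    qed
    have u1: "u x - u \<xi> \<le> E / b * (mink y \<xi> - mink y x)" if "\<xi> \<in> hyperboloid" "0 < ?t \<xi>" for \<xi>
    proof -
      have "u x - u \<xi> \<le> E * \<eta> x - E * \<eta> \<xi>" using glob[OF that] by linarith
      also have "\<dots> = E / b * (mink y \<xi> - mink y x)" unfolding \<eta>_def using b(1) by (simp add: field_simps)
      finally show ?thesis .
    qed
    have u2: "u x - u \<xi> \<le> E" if "\<xi> \<in> hyperboloid" "0 < ?t \<xi>" for \<xi>
      using lowH[OF that] ux by linarith
    have admx: "admissible u x" using adm xO by blast
    obtain P where P: "(trunc u x \<longlongrightarrow> P) (at_right 0)" by (rule trunc_converges[OF admx])
    note inner = mp[OF spec[OF bspec[OF C1(2) xh]] conjI[OF b(1,2)]]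
    note outer = mp[OF spec[OF bspec[OF C2(2) xh]] conjI[OF b(1,2)]]
    have "b powr (1 - s) = b powr - s * b" using b(1) by (simp add: powr_diff powr_minus field_simps)
    then have inner': "(LINT \<xi>|hvol. indicator {..<1 + b} (mink x \<xi>) * ((mink x \<xi> - 1) * kap (mink x \<xi>))) \<le> (C1 * b powr - s) * b"
      using conjunct2[OF inner] by (simp only: mult.assoc)
    define J where "J = Jout \<mu> x"
    define q where "q = b powr - s"
    have "P \<le> E * (2 * (C1 * b powr - s) + C2 * b powr - s + Jout \<mu> x) + 2 * u x * Jout \<mu> x"
      by (rule perturbed_minimum_estimate[OF admx odd tx(3) P yh yx b(1,2) ball less_imp_le[OF E(1)] u1 u2
            conjunct1[OF inner] inner' conjunct2[OF outer]])
    then have est: "P \<le> E * ((2 * C1 + C2) * q + J) + 2 * u x * J" by (simp add: J_def q_def algebra_simps)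
    have Jq: "c4 * q \<le> J"
    proof -
      have "(2 * ?t x)\<^sup>2 \<le> (3 * t)\<^sup>2" using tx by (intro power_mono) auto
      also have "\<dots> = 432 * b" by (simp add: b_def power_mult_distrib)
      finally have "(432 * b) powr - s \<le> ((2 * ?t x)\<^sup>2) powr - s" using tx s b(1) by (intro powr_mono2') auto
      also have "\<dots> = ((2 * ?t x) powr 2) powr - s" using tx(3) by (subst powr_numeral) auto
      also have "\<dots> = (2 * ?t x) powr - (2 * s)" by (simp add: powr_powr)
      finally have "c3 * (432 * b) powr - s \<le> c3 * (2 * ?t x) powr - (2 * s)" using c3(1) by (intro mult_left_mono) auto
      also have "\<dots> \<le> J" unfolding J_def using c3(2) xh tx by blast
      finally show ?thesis using b(1) by (simp add: c4_def q_def powr_mult mult.assoc)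
    qed
    have Jbig: "\<bar>c0\<bar> / C + 1 \<le> J" using t0(2)[OF b(1,3)] Jq by (simp add: q_def)
    have J: "0 < J" using Jbig M by linarith
    have "(2 * C1 + C2) * q = K0 * (c4 * q)" using c4 by (simp add: K0_def)
    also have "\<dots> \<le> K0 * J" using Jq K0 by (intro mult_left_mono) auto
    finally have "E * ((2 * C1 + C2) * q + J) \<le> E * (K0 * J + J)" using E by (intro mult_left_mono) auto
    moreover have "2 * u x * J \<le> 2 * (- m + E) * J" using ux J by (intro mult_right_mono) auto
    ultimately have "P \<le> E * (K0 * J + J) + 2 * (- m + E) * J" using est by linarith
    also have "\<dots> = m * J * (\<epsilon> * (K0 + 3)) - 2 * m * J" by (simp add: E_def algebra_simps)
    also have "\<dots> = - (m * J)" unfolding eps(3) by simp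
    finally have "C * P \<le> C * (- (m * J))" using C by (intro mult_left_mono) auto
    moreover have "c x * u x \<le> \<bar>c0\<bar> * m"
    proof -
      have u0: "u x < 0" using ux E(2) by linarith
      have "c x * u x \<le> c0 * u x" using c xO u0 by (intro mult_right_mono_neg) auto
      also have "\<dots> \<le> \<bar>c0\<bar> * \<bar>u x\<bar>" by (simp add: abs_mult[symmetric])
      also have "\<dots> \<le> \<bar>c0\<bar> * m" using low xO u0 by (intro mult_left_mono) force+
      finally show ?thesis .
    qed
    moreover have "0 \<le> C * P + c x * u x" using eq xO P by blast
    ultimately have "0 \<le> m * (\<bar>c0\<bar> - C * J)" by (simp add: algebra_simps)
    then have "C * J \<le> \<bar>c0\<bar>" using m by (simp add: zero_le_mult_iff)
    moreover have "\<bar>c0\<bar> + C \<le> C * J"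
    proof -
      have "C * (\<bar>c0\<bar> / C + 1) \<le> C * J" using Jbig C by (intro mult_left_mono) auto
      then show ?thesis using C by (simp add: distrib_left)
    qed
    ultimately show False using C by linarith
  qed
  note F = this
  show ?thesis
    by (rule exI[of _ \<epsilon>], rule conjI[OF eps(1)], rule exI[of _ \<tau>], rule conjI[OF tau(1)])
      (intro allI ballI impI, elim conjE, rule F)
qed

text \<open>Either almost minimal points come within \<open>\<tau>\<close> of the leaf, which
  \<open>near_leaf_contradiction\<close> excludes, or the infimum is attained away from it and the
  slab is narrow enough for \<open>attained_minimum_nonneg\<close>. The slab direction
  \<open>\<omega>\<close> is independent of the leaf normal, and \<open>p\<close> with
  \<open>B\<close> encodes boundedness.\<close>

lemma narrow_principle:
  fixes C c0 :: real
  assumes C: "0 < C"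
  shows "\<exists>l>0. \<forall>\<mu> \<Omega> u c p B \<omega>.
    openin (top_of_set hyperboloid) (\<Omega> :: 'm pt set) \<and> (\<forall>x\<in>\<Omega>. 0 < mink (leaf_normal \<mu>) x) \<and>
    p \<in> hyperboloid \<and> (\<forall>x\<in>\<Omega>. mink p x \<le> B) \<and> mink \<omega> \<omega> = -1 \<and>
    (\<forall>x\<in>\<Omega>. \<forall>\<xi>\<in>\<Omega>. \<bar>mink \<omega> x - mink \<omega> \<xi>\<bar> < l) \<and>
    (\<forall>x\<in>\<Omega>. admissible u x) \<and> lsc_on (closure \<Omega>) u \<and> odd_refl \<mu> u \<and>
    (\<forall>x\<in>\<Omega>. \<forall>P. (trunc u x \<longlongrightarrow> P) (at_right 0) \<longrightarrow> 0 \<le> C * P + c x * u x) \<and> (\<forall>x\<in>\<Omega>. c0 \<le> c x) \<and>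
    (\<forall>\<xi>\<in>hyperboloid. 0 < mink (leaf_normal \<mu>) \<xi> \<longrightarrow> \<xi> \<notin> \<Omega> \<longrightarrow> 0 \<le> u \<xi>)
    \<longrightarrow> (\<forall>x\<in>\<Omega>. 0 \<le> u x) \<and> ((\<exists>x\<in>\<Omega>. u x = 0) \<longrightarrow> (AE \<xi> in hvol. u \<xi> = 0))"
proof -
  obtain cs where cs: "cs > 0" "\<forall>x \<omega> l \<Omega>. x \<in> \<Omega> \<and> openin (top_of_set hyperboloid) (\<Omega> :: 'm pt set) \<and> mink \<omega> \<omega> = -1 \<and> 0 < l \<and> l \<le> 1/3 \<and>
     (\<forall>\<xi>\<in>\<Omega>. \<bar>mink \<omega> x - mink \<omega> \<xi>\<bar> < l) \<longrightarrow>
     ennreal (cs * l powr - (2 * s)) \<le> (\<integral>\<^sup>+\<xi>. indicator (hyperboloid - \<Omega>) \<xi> * ennreal (kap (mink x \<xi>)) \<partial>hvol)"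
    using slab_complement_lower by (elim exE conjE)
  obtain \<epsilon> \<tau> where et: "\<epsilon> > 0" "\<tau> > 0" and near: "\<forall>\<mu> \<Omega> u c m. \<forall>y\<in>\<Omega>.
    openin (top_of_set hyperboloid) (\<Omega> :: 'm pt set) \<and> compact (closure \<Omega>) \<and>
    (\<forall>x\<in>\<Omega>. admissible u x) \<and> lsc_on (closure \<Omega>) u \<and> odd_refl \<mu> u \<and>
    (\<forall>x\<in>\<Omega>. \<forall>P. (trunc u x \<longlongrightarrow> P) (at_right 0) \<longrightarrow> 0 \<le> C * P + c x * u x) \<and> (\<forall>x\<in>\<Omega>. c0 \<le> c x) \<and>
    (\<forall>\<xi>\<in>hyperboloid. 0 < mink (leaf_normal \<mu>) \<xi> \<longrightarrow> \<xi> \<notin> \<Omega> \<longrightarrow> 0 \<le> u \<xi>) \<and>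
    0 < m \<and> (\<forall>x\<in>\<Omega>. - m \<le> u x) \<and> u y < - m + \<epsilon> * m \<and>
    0 < mink (leaf_normal \<mu>) y \<and> mink (leaf_normal \<mu>) y < \<tau> \<longrightarrow> False"
    using near_leaf_contradiction[OF C, of c0] by (elim exE conjE)
  define M where "M = \<bar>c0\<bar> / C + 1"
  have M: "0 < M" "0 < C * M + c0"
  proof -
    show "0 < M" unfolding M_def using C by (simp add: add_nonneg_pos)
    have "C * M = \<bar>c0\<bar> + C" using C by (simp add: M_def distrib_left)
    then show "0 < C * M + c0" using C by linarith
  qed
  have s2: "0 < 2 * s" using s by simp
  obtain t where t: "0 < t" "\<And>r. 0 < r \<Longrightarrow> r \<le> t \<Longrightarrow> M \<le> cs * r powr - (2 * s)"
    using powr_neg_unbounded[OF s2 cs(1) M(1)] by blast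
  define l where "l = min t (1/3)"
  have l: "0 < l" "l \<le> 1/3" "M \<le> cs * l powr - (2 * s)" using t(1) t(2)[of l] by (auto simp: l_def)
  have main: "(\<forall>x\<in>\<Omega>. 0 \<le> u x) \<and> ((\<exists>x\<in>\<Omega>. u x = 0) \<longrightarrow> (AE \<xi> in hvol. u \<xi> = 0))"
    if om: "openin (top_of_set hyperboloid) (\<Omega> :: 'm pt set)" and tpos: "\<forall>x\<in>\<Omega>. 0 < mink (leaf_normal \<mu>) x"
      and p: "p \<in> hyperboloid" and B: "\<forall>x\<in>\<Omega>. mink p x \<le> B" and w: "mink \<omega> \<omega> = -1"
      and slab: "\<forall>x\<in>\<Omega>. \<forall>\<xi>\<in>\<Omega>. \<bar>mink \<omega> x - mink \<omega> \<xi>\<bar> < l"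
      and adm: "\<forall>x\<in>\<Omega>. admissible u x" and lsc: "lsc_on (closure \<Omega>) u" and odd: "odd_refl \<mu> u"
      and eq: "\<forall>x\<in>\<Omega>. \<forall>P. (trunc u x \<longlongrightarrow> P) (at_right 0) \<longrightarrow> 0 \<le> C * P + c x * u x"
      and c: "\<forall>x\<in>\<Omega>. c0 \<le> c x"
      and nonneg: "\<forall>\<xi>\<in>hyperboloid. 0 < mink (leaf_normal \<mu>) \<xi> \<longrightarrow> \<xi> \<notin> \<Omega> \<longrightarrow> 0 \<le> u \<xi>"
    for \<mu> \<Omega> u c p B \<omega>
  proof -
    let ?t = "mink (leaf_normal \<mu> :: 'm pt)"
    have sub: "\<Omega> \<subseteq> hyperboloid" using openin_imp_subset[OF om] .
    have csub: "closure \<Omega> \<subseteq> hyperboloid" using sub closed_hyperboloid by (rule closure_minimal)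
    have "bounded \<Omega>"
    proof (rule boundedI)
      fix x assume x: "x \<in> \<Omega>"
      then have xh: "x \<in> hyperboloid" using sub by blast
      have "fst x \<le> (fst p + norm (snd p)) * mink p x" by (rule mink_ge_fst[OF p xh])
      also have "\<dots> \<le> (fst p + norm (snd p)) * B"
        using B x fst_ge_1[OF p] by (intro mult_left_mono add_nonneg_nonneg) auto
      finally have f: "fst x \<le> (fst p + norm (snd p)) * B" .
      have "norm x \<le> norm (fst x) + norm (snd x)" using norm_Pair_le[of "fst x" "snd x"] by simp
      also have "\<dots> \<le> fst x + fst x" using norm_snd_less_fst[OF xh] fst_ge_1[OF xh] by simp
      finally show "norm x \<le> 2 * ((fst p + norm (snd p)) * B)" using f by linarith
    qed
    then have cpt: "compact (closure \<Omega>)" by simp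
    have nonnegO: "\<forall>x\<in>\<Omega>. 0 \<le> u x"
    proof (rule ccontr)
      assume "\<not> ?thesis"
      then obtain x0 where x0: "x0 \<in> \<Omega>" "u x0 < 0" by (auto simp: not_le)
      have "closure \<Omega> \<noteq> {}" using x0(1) closure_subset by blast
      from lsc_attains_min[OF cpt this lsc] obtain z where z: "\<forall>x\<in>closure \<Omega>. u z \<le> u x" by blast
      have bdd: "bdd_below (u ` \<Omega>)"
        by (rule bdd_belowI[of _ "u z"]) (use z closure_subset in blast)
      define m where "m = - Inf (u ` \<Omega>)"
      have low: "- m \<le> u x" if "x \<in> \<Omega>" for x
        unfolding m_def using cINF_lower[OF bdd that] by simp
      have m: "0 < m" using low[OF x0(1)] x0(2) by linarith
      have app: "\<exists>y\<in>\<Omega>. u y < - m + e" if "0 < e" for e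
      proof -
        have "Inf (u ` \<Omega>) < - m + e" using that by (simp add: m_def)
        then show ?thesis using cInf_lessD[of "u ` \<Omega>"] x0(1) by blast
      qed
      show False
      proof (cases "\<exists>y\<in>\<Omega>. u y < - m + \<epsilon> * m \<and> ?t y < \<tau>")
        case True
        then obtain y where y: "y \<in> \<Omega>" "u y < - m + \<epsilon> * m" "?t y < \<tau>" by blast
        show False
          by (rule mp[OF bspec[OF spec[OF spec[OF spec[OF spec[OF spec[OF near, of \<mu>], of \<Omega>], of u], of c], of m] y(1)]],
              intro conjI)
            (use om cpt adm lsc odd eq c nonneg m low y tpos in simp_all)
      next
        case False
        \<comment> \<open>A compact set off the leaf that contains all almost minimal points. Its
          minimum point lies in \<open>\<Omega>\<close> because \<open>u\<close> is nonnegative at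
          the remaining points of the half space.\<close>
        define S where "S = closure \<Omega> \<inter> {\<xi>. \<tau> \<le> ?t \<xi>}"
        have "closed {\<xi>. \<tau> \<le> ?t \<xi>}" by (intro closed_Collect_le continuous_intros)
        then have Sc: "compact S" unfolding S_def using cpt by (rule compact_Int_closed[rotated])
        have inS: "y \<in> S" if "y \<in> \<Omega>" "u y < - m + \<epsilon> * m" for y
        proof -
          have "\<not> ?t y < \<tau>" using False that by blast
          then show ?thesis using that closure_subset by (auto simp: S_def)
        qed
        have em: "0 < \<epsilon> * m" using et m by simp
        have ne: "S \<noteq> {}" using app[OF em] inS by blast
        from lsc_attains_min[OF Sc ne lsc_on_subset[OF lsc]] obtain x where x: "x \<in> S" "\<forall>y\<in>S. u x \<le> u y"
          by (auto simp: S_def)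
        have xm: "u x \<le> - m"
        proof (rule field_le_epsilon)
          fix e :: real assume "0 < e"
          then have "0 < min e (\<epsilon> * m)" using em by simp
          then obtain y where y: "y \<in> \<Omega>" "u y < - m + min e (\<epsilon> * m)" using app by blast
          then have "y \<in> S" by (intro inS) auto
          then have "u x \<le> u y" using x(2) by blast
          then show "u x \<le> - m + e" using y(2) by linarith
        qed
        have xh: "x \<in> hyperboloid" and tx: "0 < ?t x" using x(1) csub et by (auto simp: S_def)
        have xO: "x \<in> \<Omega>"
        proof (rule ccontr)
          assume "x \<notin> \<Omega>"
          then have "0 \<le> u x" using nonneg xh tx by blast
          then show False using xm m by linarith
        qed
        have "0 \<le> u x"
        proof (rule attained_minimum_nonneg[OF om xO _ odd tx C])
          show "admissible u x" using adm xO by blast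
          show "0 \<le> C * P + c x * u x" if "(trunc u x \<longlongrightarrow> P) (at_right 0)" for P using eq xO that by blast
          show "c0 \<le> c x" using c xO by blast
          show "u x \<le> u \<xi>" if "\<xi> \<in> hyperboloid" "0 < ?t \<xi>" for \<xi>
          proof (cases "\<xi> \<in> \<Omega>")
            case True then show ?thesis using low[OF True] xm by linarith
          next
            case False
            then have "0 \<le> u \<xi>" using nonneg that by blast
            then show ?thesis using xm m by linarith
          qed
          show "0 \<le> u \<xi>" if "\<xi> \<in> hyperboloid" "\<xi> \<notin> \<Omega>" "0 < ?t \<xi>" for \<xi> using nonneg that by blast
          show "ennreal (cs * l powr - (2 * s)) \<le> (\<integral>\<^sup>+\<xi>. indicator (hyperboloid - \<Omega>) \<xi> * ennreal (kap (mink x \<xi>)) \<partial>hvol)"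
            by (rule mp[OF spec[OF spec[OF spec[OF spec[OF cs(2), of x], of \<omega>], of l], of \<Omega>]], intro conjI)
              (use xO om w l slab in simp_all)
          have "C * M \<le> C * (cs * l powr - (2 * s))" using l(3) C by (intro mult_left_mono) auto
          then show "0 < C * (cs * l powr - (2 * s)) + c0" using M(2) by linarith
        qed
        then show False using xm m by linarith
      qed
    qed
    moreover have "AE \<xi> in hvol. u \<xi> = 0" if x: "x \<in> \<Omega>" "u x = 0" for x
    proof -
      have admx: "admissible u x" and tx: "0 < ?t x" using adm tpos x(1) by auto
      obtain P where P: "(trunc u x \<longlongrightarrow> P) (at_right 0)" by (rule trunc_converges[OF admx])
      have "0 \<le> C * P" using eq x P by force
      then have P0: "0 \<le> P" using C by (simp add: zero_le_mult_iff)
      show ?thesis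
        by (rule zero_minimum_ae[OF admx odd tx P P0 x(2)]) (use nonneg nonnegO in blast)
    qed
    ultimately show ?thesis by blast
  qed
  show ?thesis
    by (rule exI[of _ l], rule conjI[OF l(1)], intro allI impI, elim conjE) (rule main)
qed

end

section \<open>Leaves, strips and the fractional Laplacian\<close>

lemma leaf_iff: "x \<in> leaf t \<longleftrightarrow> x \<in> hyperboloid \<and> mink (leaf_normal t) x = 0"
proof
  assume "x \<in> leaf t"
  then obtain z where z: "z \<in> hyperboloid" "fst (snd z) = 0" "x = boost t z"
    by (auto simp: leaf_def)
  have "mink (leaf_normal t) x = 0" using z(2) by (simp add: z(3) mink_leaf_normal boost_eq)
  moreover have "x \<in> hyperboloid" unfolding z(3) by (rule hyp_iso_in[OF hyp_iso_boost z(1)])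
  ultimately show "x \<in> hyperboloid \<and> mink (leaf_normal t) x = 0" by simp
next
  assume x: "x \<in> hyperboloid \<and> mink (leaf_normal t) x = 0"
  define z where "z = boost (- t) x"
  have "z \<in> hyperboloid" unfolding z_def using x hyp_iso_in[OF hyp_iso_boost] by blast
  moreover have "fst (snd z) = 0" using x by (simp add: z_def boost_eq mink_leaf_normal)
  moreover have "x = boost t z"
  proof -
    have "(a * cosh t - b * sinh t) * cosh t + (b * cosh t - a * sinh t) * sinh t = a"
      "(a * cosh t - b * sinh t) * sinh t + (b * cosh t - a * sinh t) * cosh t = b" for a b
      using cosh_sq[of t] by algebra+
    then show ?thesis by (cases x) (simp add: z_def boost_eq)
  qed
  ultimately show "x \<in> leaf t" unfolding leaf_def by (auto simp: case_prod_beta intro!: image_eqI[of _ _ z])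
qed

text \<open>\<open>(x0, x1) = (a * cosh t, a * sinh t)\<close> places \<open>x\<close> on the leaf
  \<open>t\<close>, and \<open>a\<close> is the hyperbolic cosine of the distance to the axis of the
  boosts. The addition formula gives the product with every leaf normal.\<close>

lemma leaf_parameter:
  assumes x: "x \<in> hyperboloid"
  obtains a t where "0 < a" "a \<le> fst x" "\<And>\<theta>. mink (leaf_normal \<theta>) x = a * sinh (\<theta> - t)"
proof -
  define a where "a = sqrt ((fst x)\<^sup>2 - (fst (snd x))\<^sup>2)"
  have n: "(fst x)\<^sup>2 - (fst (snd x))\<^sup>2 = 1 + (norm (snd (snd x)))\<^sup>2"
    using hyperboloid_fst_sq[OF x] norm_pair_sq[of "fst (snd x)" "snd (snd x)"] by simp
  have a: "0 < a" unfolding a_def n by (simp add: add_pos_nonneg)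
  have a2: "a\<^sup>2 = (fst x)\<^sup>2 - (fst (snd x))\<^sup>2" unfolding a_def n by simp
  have x0: "0 < fst x" using fst_ge_1[OF x] by simp
  have afx: "a \<le> fst x" by (rule power2_le_imp_le) (use a2 x0 in auto)
  define t where "t = arsinh (fst (snd x) / a)"
  have s: "fst (snd x) = a * sinh t" using a by (simp add: t_def)
  have "(a * cosh t)\<^sup>2 = (fst x)\<^sup>2"
  proof -
    have "(a * cosh t)\<^sup>2 = a\<^sup>2 + (a * sinh t)\<^sup>2"
      by (simp add: power_mult_distrib cosh_square_eq algebra_simps)
    then show ?thesis using a2 by (simp add: s[symmetric])
  qed
  then have c: "a * cosh t = fst x" using a x0 by (simp add: power2_eq_iff_nonneg)
  have "mink (leaf_normal \<theta>) x = a * sinh (\<theta> - t)" for \<theta>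
    by (simp add: mink_leaf_normal sinh_diff c[symmetric] s algebra_simps)
  then show ?thesis using that a afx by blast
qed

lemma half_space_iff: "x \<in> half_space \<mu> \<longleftrightarrow> x \<in> hyperboloid \<and> 0 < mink (leaf_normal \<mu>) x"
proof (cases "x \<in> hyperboloid")
  case True
  then obtain a t where "0 < a" "\<And>\<theta>. mink (leaf_normal \<theta>) x = a * sinh (\<theta> - t)"
    using leaf_parameter by metis
  then show ?thesis using True by (simp add: half_space_def leaf_iff zero_less_mult_iff)
next
  case False
  then show ?thesis by (simp add: half_space_def leaf_iff)
qed

text \<open>The thickness of a leaf strip is magnified by \<open>a\<close>, the factor of
  \<open>leaf_parameter\<close>, for which \<open>fst x\<close> is an upper bound.\<close>

lemma leaf_strip_upper:
  assumes "x \<in> leaf_strip \<mu> l"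
  shows "mink (leaf_normal \<mu>) x < fst x * sinh l"
proof -
  obtain \<theta> where th: "\<mu> - l < \<theta>" "\<theta> < \<mu>" "x \<in> hyperboloid" "mink (leaf_normal \<theta>) x = 0"
    using assms by (auto simp: leaf_strip_def leaf_iff)
  obtain a t where at: "0 < a" "a \<le> fst x" "\<And>\<theta>. mink (leaf_normal \<theta>) x = a * sinh (\<theta> - t)"
    using leaf_parameter[OF th(3)] by metis
  have "\<theta> = t" using th(4) at by simp
  then have "mink (leaf_normal \<mu>) x = a * sinh (\<mu> - \<theta>)" using at by simp
  also have "\<dots> < a * sinh l" using at th by simp
  also have "\<dots> \<le> fst x * sinh l" using at th by (intro mult_right_mono) auto
  finally show ?thesis .
qed

lemma sinh_le_double:
  assumes "0 \<le> l" "l \<le> (1::real)"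
  shows "sinh l \<le> 2 * l"
proof -
  have "exp l \<le> 1 + l + l\<^sup>2" using assms by (rule exp_bound)
  moreover have "1 - l \<le> exp (- l)" using exp_ge_add_one_self[of "- l"] by simp
  moreover have "l\<^sup>2 \<le> l" using assms by (simp add: power2_eq_square mult_left_le)
  ultimately have "exp l - exp (- l) \<le> 4 * l" using assms by linarith
  then show ?thesis by (simp add: sinh_field_def)
qed

lemma cosh_le_iff_le_arcosh:
  assumes "0 \<le> \<epsilon>" "1 \<le> (z::real)"
  shows "\<epsilon> \<le> arcosh z \<longleftrightarrow> cosh \<epsilon> \<le> z"
  using cosh_real_nonneg_le_iff[of \<epsilon> "arcosh z"] assms by simp

lemma mink_le_cosh:
  assumes "x \<in> hyperboloid" "p \<in> hyperboloid" "hdist x p \<le> R"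
  shows "mink p x \<le> cosh R"
proof -
  have z: "1 \<le> mink x p" by (rule mink_ge_1[OF assms(1,2)])
  have "cosh (arcosh (mink x p)) \<le> cosh R"
    using z assms(3) by (subst cosh_real_nonneg_le_iff) (auto simp: hdist_eq_mink intro: order_trans[OF arcosh_nonneg_real])
  then show ?thesis using z by (simp add: mink_commute)
qed

lemma hyp_kernel_hkernel:
  assumes s: "0 < s" "s < 1"
  shows "hyp_kernel TYPE('m) (\<lambda>z. hkernel (CARD('m::finite) + 1) s (arcosh z)) s"
proof -
  let ?n = "CARD('m) + 1" and ?k = "\<lambda>z. hkernel (CARD('m) + 1) s (arcosh z)"
  have n: "2 \<le> ?n" using zero_less_card_finite[where 'a = 'm] by linarith
  show ?thesis
  proof unfold_locales
    show "0 < ?k z" if "1 < z" for z using hkernel_pos[OF n s refl refl that] .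
    show "?k z < ?k y" if "1 < y" "y < z" for y z using hkernel_strict_antimono[OF n s refl refl that] .
    show "\<exists>C>0. \<forall>w>0. ?k (1 + w) \<le> C * ?k (1 + 2 * w)"
      using hkernel_doubling[OF n s refl refl] by metis
    show "\<exists>c>0. \<exists>C>0. \<forall>w. 0 < w \<and> w \<le> 1 \<longrightarrow>
      c * w powr - ((CARD('m) + 1) / 2 + s) \<le> ?k (1 + w) \<and> ?k (1 + w) \<le> C * w powr - ((CARD('m) + 1) / 2 + s)"
    proof -
      obtain c C where "0 < c" "0 < C"
        "\<And>w. 0 < w \<Longrightarrow> w \<le> 1 \<Longrightarrow> c * w powr - (real ?n / 2 + s) \<le> ?k (1 + w)"
        "\<And>w. 0 < w \<Longrightarrow> w \<le> 1 \<Longrightarrow> ?k (1 + w) \<le> C * w powr - (real ?n / 2 + s)"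
        using hkernel_near_1[OF n s refl refl] by metis
      then show ?thesis by (intro exI[of _ c] exI[of _ C] conjI allI impI) auto
    qed
    show "summable (\<lambda>k. (2 ^ k) ^ CARD('m) * ?k (1 + 2 ^ k))"
      using hkernel_dyadic_summable[OF n s refl refl] by simp
  qed (use s in auto)
qed

context hyp_kernel
begin

text \<open>The truncations correspond under \<open>\<delta> = cosh \<epsilon> - 1\<close>, which
  tends to \<open>0\<close> from the right with \<open>\<epsilon>\<close>. The value of
  \<open>Lim\<close> is known only because convergence has been established.\<close>

lemma frac_laplacian_eq_trunc_limit:
  assumes K: "\<kappa> = (\<lambda>z. hkernel (CARD('m) + 1) s (arcosh z))" and x: "x \<in> (hyperboloid :: 'm pt set)"
    and P: "(trunc u x \<longlongrightarrow> P) (at_right 0)"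
  shows "frac_laplacian C s u x = C * P"
proof -
  let ?F = "\<lambda>\<epsilon>. LINT \<xi>:{\<xi>\<in>hyperboloid. \<epsilon> \<le> hdist x \<xi>}|hvol. (u x - u \<xi>) * hkernel (CARD('m) + 1) s (hdist x \<xi>)"
  have F: "?F \<epsilon> = trunc u x (cosh \<epsilon> - 1)" if e: "0 < \<epsilon>" for \<epsilon>
    unfolding set_lebesgue_integral_def trunc_def
  proof (rule Bochner_Integration.integral_cong[OF refl])
    fix \<xi> :: "'m pt" assume "\<xi> \<in> space hvol"
    then have xi: "\<xi> \<in> hyperboloid" by simp
    have z: "1 \<le> mink x \<xi>" by (rule mink_ge_1[OF x xi])
    have "1 < cosh \<epsilon>" using cosh_real_nonneg_less_iff[of 0 \<epsilon>] e by simp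
    moreover have "\<epsilon> \<le> hdist x \<xi> \<longleftrightarrow> cosh \<epsilon> \<le> mink x \<xi>"
      unfolding hdist_eq_mink by (rule cosh_le_iff_le_arcosh[OF less_imp_le[OF e] z])
    moreover have "kap (mink x \<xi>) = hkernel (CARD('m) + 1) s (hdist x \<xi>)" if "1 < mink x \<xi>"
      unfolding kap_def hdist_eq_mink by (subst K) (simp add: that)
    ultimately show "indicator {\<xi> \<in> hyperboloid. \<epsilon> \<le> hdist x \<xi>} \<xi> *\<^sub>R ((u x - u \<xi>) * hkernel (CARD('m) + 1) s (hdist x \<xi>))
      = indicator {1 + (cosh \<epsilon> - 1)..} (mink x \<xi>) * ((u x - u \<xi>) * kap (mink x \<xi>))"
      using xi by (auto simp: indicator_def)
  qed
  have "((\<lambda>\<epsilon>::real. cosh \<epsilon> - 1) \<longlongrightarrow> cosh 0 - 1) (at_right 0)" by (intro tendsto_intros)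
  moreover have "\<forall>\<^sub>F \<epsilon> in at_right 0. 0 < cosh \<epsilon> - (1::real)"
    using eventually_at_right_less[of "0::real"]
  proof eventually_elim
    case (elim \<epsilon>) then show ?case using cosh_real_nonneg_less_iff[of 0 \<epsilon>] by simp
  qed
  ultimately have "filterlim (\<lambda>\<epsilon>::real. cosh \<epsilon> - 1) (at_right 0) (at_right 0)"
    by (intro tendsto_imp_filterlim_at_right) auto
  then have "((\<lambda>\<epsilon>. trunc u x (cosh \<epsilon> - 1)) \<longlongrightarrow> P) (at_right 0)" by (rule filterlim_compose[OF P])
  then have "(?F \<longlongrightarrow> P) (at_right 0)"
  proof (rule Lim_transform_eventually)
    show "\<forall>\<^sub>F \<epsilon> in at_right 0. trunc u x (cosh \<epsilon> - 1) = ?F \<epsilon>"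
      using eventually_at_right_less[of "0::real"] by eventually_elim (simp only: F)
  qed
  then have "Lim (at_right 0) ?F = P" by (rule tendsto_Lim[rotated]) simp
  then show ?thesis unfolding frac_laplacian_def by simp
qed

lemma L_space_admissible:
  assumes K: "\<kappa> = (\<lambda>z. hkernel (CARD('m) + 1) s (arcosh z))" and p: "p \<in> (hyperboloid :: 'm pt set)"
    and u: "u \<in> L_space s p" and om: "openin (top_of_set hyperboloid) \<Omega>"
    and C11: "hyp_C11_loc \<Omega> u" and x: "x \<in> \<Omega>"
  shows "admissible u x"
proof -
  have xh: "x \<in> hyperboloid" using openin_imp_subset[OF om] x by blast
  have um [measurable]: "u \<in> borel_measurable hvol"
    and ui: "integrable hvol (\<lambda>\<xi>. \<bar>u \<xi>\<bar> * hkernel (CARD('m) + 1) s (1 + hdist \<xi> p))"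
    using u by (auto simp: L_space_def)
  have "integrable hvol (\<lambda>\<xi>. indicator {1 + e..} (mink x \<xi>) * (\<bar>u \<xi>\<bar> * kap (mink x \<xi>)))" if e: "0 < e" for e
  proof -
    obtain D where D: "D > 0"
      "\<And>\<xi>. \<xi> \<in> hyperboloid \<Longrightarrow> 1 + e \<le> mink x \<xi> \<Longrightarrow> \<kappa> (mink x \<xi>) \<le> D * \<kappa> (cosh (1 + hdist \<xi> p))"
      using kernel_weight_bound[OF xh p e] by blast
    show ?thesis
    proof (rule Bochner_Integration.integrable_bound[OF integrable_mult_right[OF ui, of D]])
      show "(\<lambda>\<xi>. indicator {1 + e..} (mink x \<xi>) * (\<bar>u \<xi>\<bar> * kap (mink x \<xi>))) \<in> borel_measurable hvol"
        by measurable
      show "AE \<xi> in hvol. norm (indicator {1 + e..} (mink x \<xi>) * (\<bar>u \<xi>\<bar> * kap (mink x \<xi>)))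
        \<le> norm (D * (\<bar>u \<xi>\<bar> * hkernel (CARD('m) + 1) s (1 + hdist \<xi> p)))"
      proof (rule AE_I2)
        fix \<xi> :: "'m pt" assume "\<xi> \<in> space hvol"
        then have xi: "\<xi> \<in> hyperboloid" by simp
        have d: "0 \<le> hdist \<xi> p" unfolding hdist_eq_mink using mink_ge_1[OF xi p] by simp
        have k: "\<kappa> (cosh (1 + hdist \<xi> p)) = hkernel (CARD('m) + 1) s (1 + hdist \<xi> p)"
          using d by (simp add: K arcosh_cosh_real)
        show "norm (indicator {1 + e..} (mink x \<xi>) * (\<bar>u \<xi>\<bar> * kap (mink x \<xi>)))
          \<le> norm (D * (\<bar>u \<xi>\<bar> * hkernel (CARD('m) + 1) s (1 + hdist \<xi> p)))"
        proof (cases "1 + e \<le> mink x \<xi>")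
          case True
          have "kap (mink x \<xi>) = \<kappa> (mink x \<xi>)" using True e by (simp add: kap_def)
          also have "\<dots> \<le> D * hkernel (CARD('m) + 1) s (1 + hdist \<xi> p)" using D(2)[OF xi True] by (simp only: k)
          finally have "\<bar>u \<xi>\<bar> * kap (mink x \<xi>) \<le> \<bar>u \<xi>\<bar> * (D * hkernel (CARD('m) + 1) s (1 + hdist \<xi> p))"
            by (rule mult_left_mono) simp
          moreover have "0 \<le> \<bar>u \<xi>\<bar> * kap (mink x \<xi>)" using kap_nonneg by simp
          ultimately show ?thesis using True by (simp add: mult.left_commute)
        qed simp
      qed
    qed
  qed
  then show ?thesis unfolding admissible_def using xh um C11_expansion[OF om C11 x] by simp
qed

end

theorem theorem5p3:
  fixes s \<mu> C c0 :: real and p :: "'m::finite pt"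
  assumes "0 < s" "s < 1" "0 < C" and "p \<in> hyperboloid"
  shows "\<exists>l1>0. \<exists>l2. (\<forall>R. 0 < l2 R) \<and>
    (\<forall>(\<Omega> :: 'm pt set) (u :: 'm pt \<Rightarrow> real) (c :: 'm pt \<Rightarrow> real) (l :: real) (R :: real).
       openin (top_of_set hyperboloid) \<Omega> \<and> \<Omega> \<subseteq> half_space \<mu> \<and> (\<forall>x\<in>\<Omega>. hdist x p \<le> R) \<and>
       0 < l \<and> (l \<le> l1 \<and> \<Omega> \<subseteq> coord_strip \<mu> l \<or> l \<le> l2 R \<and> \<Omega> \<subseteq> leaf_strip \<mu> l) \<and>
       u \<in> L_space s p \<and> hyp_C11_loc \<Omega> u \<and> lsc_on (closure \<Omega>) u \<and>
       (\<forall>x\<in>\<Omega>. frac_laplacian C s u x + c x * u x \<ge> 0) \<and>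
       (\<forall>x\<in>half_space \<mu> - \<Omega>. u x \<ge> 0) \<and>
       (\<forall>x\<in>half_space \<mu>. u (leaf_refl \<mu> x) = - u x) \<and>
       (\<forall>x\<in>\<Omega>. c0 \<le> c x)
       \<longrightarrow> (\<forall>x\<in>\<Omega>. u x \<ge> 0) \<and> ((\<exists>x\<in>\<Omega>. u x = 0) \<longrightarrow> (AE x in hvol. u x = 0)))"
proof -
  define \<kappa> where "\<kappa> = (\<lambda>z. hkernel (CARD('m) + 1) s (arcosh z))"
  interpret hyp_kernel \<kappa> s "TYPE('m)"
    unfolding \<kappa>_def by (rule hyp_kernel_hkernel[OF assms(1,2)])
  obtain l1 where l1: "0 < l1" and narrow: "\<forall>\<mu> \<Omega> u c p B \<omega>.
    openin (top_of_set hyperboloid) (\<Omega> :: 'm pt set) \<and> (\<forall>x\<in>\<Omega>. 0 < mink (leaf_normal \<mu>) x) \<and>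
    p \<in> hyperboloid \<and> (\<forall>x\<in>\<Omega>. mink p x \<le> B) \<and> mink \<omega> \<omega> = -1 \<and>
    (\<forall>x\<in>\<Omega>. \<forall>\<xi>\<in>\<Omega>. \<bar>mink \<omega> x - mink \<omega> \<xi>\<bar> < l1) \<and>
    (\<forall>x\<in>\<Omega>. admissible u x) \<and> lsc_on (closure \<Omega>) u \<and> odd_refl \<mu> u \<and>
    (\<forall>x\<in>\<Omega>. \<forall>P. (trunc u x \<longlongrightarrow> P) (at_right 0) \<longrightarrow> 0 \<le> C * P + c x * u x) \<and> (\<forall>x\<in>\<Omega>. c0 \<le> c x) \<and>
    (\<forall>\<xi>\<in>hyperboloid. 0 < mink (leaf_normal \<mu>) \<xi> \<longrightarrow> \<xi> \<notin> \<Omega> \<longrightarrow> 0 \<le> u \<xi>)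
    \<longrightarrow> (\<forall>x\<in>\<Omega>. 0 \<le> u x) \<and> ((\<exists>x\<in>\<Omega>. u x = 0) \<longrightarrow> (AE \<xi> in hvol. u \<xi> = 0))"
    using narrow_principle[OF assms(3), of c0] by (elim exE conjE)
  define A where "A = fst p + norm (snd p)"
  have A: "0 < A" using fst_ge_1[OF assms(4)] by (simp add: A_def add_pos_nonneg)
  \<comment> \<open>On the region \<open>fst x \<le> A * cosh R\<close>, and
    \<open>sinh l \<le> 2 * l\<close> for \<open>l \<le> 1\<close>; the leaf product there stays
    below \<open>l1\<close>.\<close>
  define l2 where "l2 R = min 1 (l1 / (2 * (A * cosh R)))" for R
  have l2: "0 < l2 R" for R using l1 A by (simp add: l2_def)
  have main: "(\<forall>x\<in>\<Omega>. 0 \<le> u x) \<and> ((\<exists>x\<in>\<Omega>. u x = 0) \<longrightarrow> (AE x in hvol. u x = 0))"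
    if om: "openin (top_of_set hyperboloid) (\<Omega> :: 'm pt set)" and half: "\<Omega> \<subseteq> half_space \<mu>"
      and R: "\<forall>x\<in>\<Omega>. hdist x p \<le> R" and l: "0 < l"
      and strip: "l \<le> l1 \<and> \<Omega> \<subseteq> coord_strip \<mu> l \<or> l \<le> l2 R \<and> \<Omega> \<subseteq> leaf_strip \<mu> l"
      and u: "u \<in> L_space s p" and C11: "hyp_C11_loc \<Omega> u" and lsc: "lsc_on (closure \<Omega>) u"
      and eq: "\<forall>x\<in>\<Omega>. 0 \<le> frac_laplacian C s u x + c x * u x"
      and nonneg: "\<forall>x\<in>half_space \<mu> - \<Omega>. 0 \<le> u x"
      and odd: "\<forall>x\<in>half_space \<mu>. u (leaf_refl \<mu> x) = - u x"
      and c: "\<forall>x\<in>\<Omega>. c0 \<le> c x"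
    for \<Omega> u c l R
  proof -
    have sub: "\<Omega> \<subseteq> hyperboloid" by (rule openin_imp_subset[OF om])
    have tpos: "\<forall>x\<in>\<Omega>. 0 < mink (leaf_normal \<mu>) x" using half by (auto simp: half_space_iff)
    have B: "\<forall>x\<in>\<Omega>. mink p x \<le> cosh R" using mink_le_cosh assms(4) R sub by blast
    have slab: "\<exists>\<omega>. mink \<omega> \<omega> = -1 \<and> (\<forall>x\<in>\<Omega>. \<forall>\<xi>\<in>\<Omega>. \<bar>mink \<omega> x - mink \<omega> \<xi>\<bar> < l1)"
      using strip
    proof (elim disjE conjE)
      assume s: "l \<le> l1" "\<Omega> \<subseteq> coord_strip \<mu> l"
      \<comment> \<open>The product with this vector is \<open>x1\<close> up to sign, so the slab is
        the coordinate strip itself and the size of the region does not enter its width.\<close>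
      define \<omega> :: "'m pt" where "\<omega> = (0, 1, 0)"
      have w: "mink \<omega> x = - fst (snd x)" for x by (cases x) (simp add: \<omega>_def mink_triple)
      have "\<mu> - l < fst (snd x) \<and> fst (snd x) < \<mu>" if "x \<in> \<Omega>" for x
        using s(2) that by (auto simp: coord_strip_def)
      then have "\<bar>mink \<omega> x - mink \<omega> \<xi>\<bar> < l1" if "x \<in> \<Omega>" "\<xi> \<in> \<Omega>" for x \<xi>
        unfolding w using s(1) that by (smt (verit))
      moreover have "mink \<omega> \<omega> = -1" unfolding w by (simp add: \<omega>_def)
      ultimately show ?thesis by blast
    next
      assume s: "l \<le> l2 R" "\<Omega> \<subseteq> leaf_strip \<mu> l"
      have up: "mink (leaf_normal \<mu>) x < l1" if x: "x \<in> \<Omega>" for x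
      proof -
        have AR: "0 < A * cosh R" using A by simp
        have "fst x \<le> A * mink p x" unfolding A_def using x sub by (intro mink_ge_fst[OF assms(4)]) auto
        also have "\<dots> \<le> A * cosh R" using B x A by (intro mult_left_mono) auto
        finally have f: "fst x \<le> A * cosh R" .
        have l': "l \<le> 1" "l \<le> l1 / (2 * (A * cosh R))" using s(1) by (auto simp: l2_def)
        have "mink (leaf_normal \<mu>) x < fst x * sinh l" by (rule leaf_strip_upper) (use s x in blast)
        also have "\<dots> \<le> (A * cosh R) * (2 * l)"
          using f l AR sinh_le_double[OF less_imp_le[OF l] l'(1)] by (intro mult_mono) auto
        also have "\<dots> \<le> l1" using l'(2) AR by (simp add: pos_le_divide_eq mult.commute mult.left_commute)
        finally show ?thesis .
      qed
      have "\<bar>mink (leaf_normal \<mu>) x - mink (leaf_normal \<mu>) \<xi>\<bar> < l1" if "x \<in> \<Omega>" "\<xi> \<in> \<Omega>" for x \<xi>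
        using up[OF that(1)] up[OF that(2)] bspec[OF tpos that(1)] bspec[OF tpos that(2)] by linarith
      then show ?thesis using mink_leaf_normal_self by blast
    qed
    then obtain \<omega> where w: "mink \<omega> \<omega> = -1" "\<forall>x\<in>\<Omega>. \<forall>\<xi>\<in>\<Omega>. \<bar>mink \<omega> x - mink \<omega> \<xi>\<bar> < l1" by blast
    have adm: "\<forall>x\<in>\<Omega>. admissible u x"
      using L_space_admissible[OF \<kappa>_def assms(4) u om C11] by blast
    have eq': "\<forall>x\<in>\<Omega>. \<forall>P. (trunc u x \<longlongrightarrow> P) (at_right 0) \<longrightarrow> 0 \<le> C * P + c x * u x"
    proof (intro ballI allI impI)
      fix x P assume x: "x \<in> \<Omega>" and P: "(trunc u x \<longlongrightarrow> P) (at_right 0)"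
      have "frac_laplacian C s u x = C * P"
        using frac_laplacian_eq_trunc_limit[OF \<kappa>_def _ P] x sub by blast
      then show "0 \<le> C * P + c x * u x" using bspec[OF eq x] by simp
    qed
    have odd': "odd_refl \<mu> u" using odd by (simp add: odd_refl_def half_space_iff)
    have nonneg': "\<forall>\<xi>\<in>hyperboloid. 0 < mink (leaf_normal \<mu>) \<xi> \<longrightarrow> \<xi> \<notin> \<Omega> \<longrightarrow> 0 \<le> u \<xi>"
      using nonneg by (simp add: half_space_iff)
    show ?thesis
      by (rule mp[OF spec[OF spec[OF spec[OF spec[OF spec[OF spec[OF spec[OF narrow, of \<mu>], of \<Omega>], of u], of c], of p], of "cosh R"], of \<omega>]],
          intro conjI)
        (fact om tpos assms(4) B w adm lsc odd' eq' c nonneg')+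
  qed
  show ?thesis
    by (rule exI[of _ l1], rule conjI[OF l1], rule exI[of _ l2], rule conjI, rule allI, rule l2,
        intro allI impI, elim conjE) (rule main)
qed

end
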